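(* Let $0<\beta<\alpha<1$ and $\zeta>0$. Let $(\tilde V,Q)\sim\mathrm{P}^{\frac{\beta}{\alpha}}_\alpha(r^{[1]}_{\beta,\zeta})$ and let $V$ be the ranked masses of the coagulation $F_V=F_{\tilde V}\circ G_Q$, so that $V\overset{d}{=}P^{[1]}_\beta(\zeta)\sim\mathbb{P}^{[1]}_\beta(\zeta):=\mathrm{PK}_\beta(r^{[1]}_{\beta,\zeta}\cdot f_\beta)$. Let $\hat T_1$ be the inverse local time at $1$ of $Q$. Then: (i) $Q\overset{d}{=}P^{[1]}_{\beta/\alpha}(\zeta)\sim\mathbb{P}^{[1]}_{\beta/\alpha}(\zeta)$, with $\hat T_1\overset{d}{=}\hat T^{[1]}_{1,\frac{\beta}{\alpha}}(\zeta)$. (ii) Given $\hat T_1=y$, $\tilde V\sim\mathbb{P}^{[1]}_\alpha(\zeta^{\alpha/\beta}y)$. (iii) $\tilde V\overset{d}{=}P^{[1]}_\alpha\big(\tau_{\frac{\beta}{\alpha}}(\zeta+\gamma_{\frac{\alpha-\beta}{\beta}})\big)$. (iv) $(\tilde V,Q)\overset{d}{=}\Big(P^{[1]}_\alpha\big(\tau_{\frac{\beta}{\alpha}}(\zeta+\gamma_{\frac{\alpha-\beta}{\beta}})\big),\,P^{[1]}_{\frac{\beta}{\alpha}}(\zeta)\Big)$ jointly and component-wise. (v) $P^{[1]}_\alpha\big(\tau_{\frac{\beta}{\alpha}}(\zeta+\gamma_{\frac{\alpha-\beta}{\beta}})\big)\overset{d}{=}\mathrm{FRAG}_{\alpha,-\beta}\big(P^{[1]}_\beta(\zeta)\big)$.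 (vi) $P^{[1]}_\beta(\gamma_{\frac{\theta+\beta}{\beta}})\sim\mathrm{PD}(\beta,\theta)$ for $\theta>-\beta$. (vii) For $\theta>-\beta$, $P^{[1]}_\alpha\big(\tau_{\frac{\beta}{\alpha}}(\gamma_{\frac{\theta+\beta}{\beta}}+\gamma_{\frac{\alpha-\beta}{\beta}})\big)\sim\mathrm{PD}(\alpha,\theta)$, independent of $P^{[1]}_{\frac{\beta}{\alpha}}(\gamma_{\frac{\theta+\beta}{\beta}})\sim\mathrm{PD}\big(\frac{\beta}{\alpha},\frac{\theta}{\alpha}\big)$.
   Context: $\mathcal P_\infty=\{(s_1,s_2,\ldots): s_1\ge s_2\ge\cdots\ge 0,\ \sum_k s_k=1\}$. For $\gamma\in(0,1)$ let $J_1>J_2>\cdots$ be the ranked points of a Poisson process on $(0,\infty)$ with intensity $\frac{\gamma}{\Gamma(1-\gamma)}x^{-\gamma-1}dx$ and $T_\gamma=\sum_i J_i$, a positive $\gamma$-stable variable with $\mathbb{E}[e^{-\lambda T_\gamma}]=e^{-\lambda^\gamma}$ and density $f_\gamma$. $\mathrm{PD}(\gamma,0)$ is the law of $(J_i/T_\gamma)_i$, $\mathrm{PD}(\gamma|t)$ its regular conditional law given $T_\gamma=t$, and for $h\ge0$ with $\mathbb{E}[h(T_\gamma)]=1$, $\mathrm{PK}_\gamma(h\cdot f_\gamma)=\int_0^\infty \mathrm{PD}(\gamma|t)h(t)f_\gamma(t)\,dt$. If $P$ has such a law, its local time at $1$ is the a.s. limit $L=\Gamma(1-\gamma)\lim_{\epsilon\downarrow0}\epsilon^\gamma|\{i:P_i\ge\epsilon\}|$,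 and its inverse local time at $1$ is $L^{-1/\gamma}$. For $\theta>-\gamma$, $\mathrm{PD}(\gamma,\theta)$ is the law of the decreasing rearrangement of $(R_k\prod_{j<k}(1-R_j))_{k\ge1}$ with $R_k\sim\mathrm{Beta}(1-\gamma,\theta+k\gamma)$ independent. For $h\ge0$ with $\mathbb{E}[h(T_\beta)]=1$, $\mathrm{P}^{\frac{\beta}{\alpha}}_{\alpha}(h)$ is the joint law $\int_0^\infty\int_0^\infty \mathrm{PD}(\alpha|s)\,\mathrm{PD}(\beta/\alpha|y)\,h(s y^{1/\alpha})f_{\beta/\alpha}(y)f_\alpha(s)\,dy\,ds$ on $\mathcal P_\infty\times\mathcal P_\infty$. $F_{\tilde V}(y)=\sum_{k}\tilde V_k\mathbb{I}_{\{\tilde U_k\le y\}}$, $G_Q(y)=\sum_\ell Q_\ell\mathbb{I}_{\{U_\ell\le y\}}$, with $(\tilde U_k),(U_\ell)$ iid $\mathrm{Uniform}[0,1]$ independent of $(\tilde V,Q)$. $\mathrm{FRAG}_{\alpha,-\beta}((P_i))$ is the decreasing rearrangement of all masses $P_i\hat Q^{(i)}_\ell$, where $\hat Q^{(i)}$, $i\ge1$, are iid $\mathrm{PD}(\alpha,-\beta)$, independent of $(P_i)$. For $\gamma\in(0,1)$, $\zeta>0$: $r^{[1]}_{\gamma,\zeta}(t)=\frac1\gamma\zeta^{\frac1\gamma-1}t\,e^{-\zeta^{1/\gamma}t}e^{\zeta}$; $\mathbb{P}^{[1]}_\gamma(\zeta)=\mathrm{PK}_\gamma(r^{[1]}_{\gamma,\zeta}\cdot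 f_\gamma)$; and $P^{[1]}_\gamma(\zeta)$ denotes a random mass partition with this law. If $Z$ is a positive random variable, $P^{[1]}_\gamma(Z)$ denotes a mass partition whose conditional law given $Z=z$ is $\mathbb{P}^{[1]}_\gamma(z)$. $\tau_\gamma=(\tau_\gamma(s))_{s\ge0}$ is the generalized gamma subordinator with $\mathbb{E}[e^{-w\tau_\gamma(s)}]=e^{-s[(1+w)^\gamma-1]}$; $\gamma_a\sim\mathrm{Gamma}(a,1)$; subordinators and gamma variables appearing together are independent. $\hat T^{[1]}_{1,\gamma}(\zeta)=\tau_\gamma\big(\zeta+\gamma_{\frac{1-\gamma}{\gamma}}\big)/\zeta^{1/\gamma}$, which has density $r^{[1]}_{\gamma,\zeta}f_\gamma$, represents the inverse local time at $1$ of $P^{[1]}_\gamma(\zeta)$. Coupling in (iv) and (vii): $\tau_{\frac{\beta}{\alpha}}(\zeta+\gamma_{\frac{\alpha-\beta}{\beta}})$ is identified with $\zeta^{\alpha/\beta}$ times the inverse local time at $1$ of $P^{[1]}_{\beta/\alpha}(\zeta)$, and given $P^{[1]}_{\beta/\alpha}(\zeta)$ with $\tau_{\frac{\beta}{\alpha}}(\zeta+\gamma_{\frac{\alpha-\beta}{\beta}})=z$ the first component has law $\mathbb{P}^{[1]}_\alpha(z)$. In (vii) the pair is that of (iv) with $\zeta$ replaced by an independent $\gamma_{\frac{\theta+\beta}{\beta}}$ (the same in both components). *)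

theory Defs
  imports "HOL-Probability.Probability"
begin

text \<open>Sequences are indexed from 0 and \<open>(borel :: (nat \<Rightarrow> real) measure)\<close> carries the product
  \<open>\<sigma>\<close>-algebra. Laws of random mass partitions are measures on this space, carried by the
  set below.\<close>

definition mass_partitions :: "(nat \<Rightarrow> real) set" where
  "mass_partitions = {s. decseq s \<and> (\<forall>k. 0 \<le> s k) \<and> s sums 1}"

text \<open>The decreasing rearrangement of a family of nonnegative masses, over an arbitrary index type:
  the entry with index \<open>k\<close> is the least level exceeded by at most \<open>k\<close> of the masses.\<close>

definition ranked :: "('i \<Rightarrow> real) \<Rightarrow> nat \<Rightarrow> real" where
  "ranked x k = Inf {t. 0 \<le> t \<and> finite {i. t < x i} \<and> card {i. t < x i} \<le> k}"

definition gamma_law :: "real \<Rightarrow> real measure" where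
  "gamma_law a = density lborel
     (\<lambda>x. ennreal (x powr (a - 1) * exp (- x) / Gamma a) * indicator {0<..} x)"

definition beta_law :: "real \<Rightarrow> real \<Rightarrow> real measure" where
  "beta_law a b = density lborel
     (\<lambda>x. ennreal (x powr (a - 1) * (1 - x) powr (b - 1) / Beta a b) * indicator {0<..<1} x)"

text \<open>\<open>K\<close> is a regular conditional law of the random sequence \<open>X\<close> given the (almost surely positive)
  random variable \<open>Z\<close>. Only the values of \<open>K\<close> on \<open>(0,\<infinity>)\<close> are relevant.\<close>

definition has_cond_law ::
  "'w measure \<Rightarrow> ('w \<Rightarrow> nat \<Rightarrow> real) \<Rightarrow> ('w \<Rightarrow> real) \<Rightarrow> (real \<Rightarrow> (nat \<Rightarrow> real) measure) \<Rightarrow> bool" where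
  "has_cond_law M X Z K \<longleftrightarrow>
     X \<in> borel_measurable M \<and> Z \<in> borel_measurable M \<and> (AE \<omega> in M. 0 < Z \<omega>) \<and>
     K \<in> restrict_space borel {0<..} \<rightarrow>\<^sub>M prob_algebra borel \<and>
     (\<forall>A\<in>sets borel. \<forall>B\<in>sets borel. B \<subseteq> {0<..} \<longrightarrow>
        emeasure M {\<omega> \<in> space M. X \<omega> \<in> A \<and> Z \<omega> \<in> B}
          = (\<integral>\<^sup>+z. emeasure (K z) A * indicator B z \<partial>distr M borel Z))"

text \<open>\<open>J \<omega> 0 > J \<omega> 1 > \<dots>\<close> are the points of a Poisson process on \<open>(0,\<infinity>)\<close> with intensity \<open>\<nu>\<close>.
  The Poisson probabilities are spelled out because sets of intensity 0 are allowed.\<close>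

definition ranked_poisson_points ::
  "'w measure \<Rightarrow> real measure \<Rightarrow> ('w \<Rightarrow> nat \<Rightarrow> real) \<Rightarrow> bool" where
  "ranked_poisson_points M \<nu> J \<longleftrightarrow>
     J \<in> borel_measurable M \<and>
     (AE \<omega> in M. (\<forall>i. 0 < J \<omega> i) \<and> (\<forall>i. J \<omega> (Suc i) < J \<omega> i)) \<and>
     (\<forall>A\<in>sets borel. emeasure \<nu> A < \<infinity> \<longrightarrow>
        (AE \<omega> in M. finite {i. J \<omega> i \<in> A}) \<and>
        (\<forall>k. measure M {\<omega> \<in> space M. card {i. J \<omega> i \<in> A} = k}
               = measure \<nu> A ^ k / fact k * exp (- measure \<nu> A))) \<and>
     (\<forall>(A :: nat \<Rightarrow> real set) n.
        (\<forall>m<n. A m \<in> sets borel \<and> emeasure \<nu> (A m) < \<infinity>) \<and> disjoint_family_on A {..<n} \<longrightarrow>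
        prob_space.indep_vars M (\<lambda>_. count_space UNIV) (\<lambda>m \<omega>. card {i. J \<omega> i \<in> A m}) {..<n})"

definition stable_intensity :: "real \<Rightarrow> real measure" where
  "stable_intensity \<gamma> = density lborel
     (\<lambda>x. ennreal (\<gamma> / Gamma (1 - \<gamma>) * x powr (- \<gamma> - 1)) * indicator {0<..} x)"

text \<open>\<open>f\<close> is a density of \<open>T\<^sub>\<gamma> = (\<Sum>i. J\<^sub>i)\<close> and \<open>K\<close> is a version of \<open>t \<mapsto> PD(\<gamma>|t)\<close>, the regular
  conditional law of \<open>(J\<^sub>i / T\<^sub>\<gamma>)\<^sub>i\<close> given \<open>T\<^sub>\<gamma> = t\<close>. Here \<open>D\<close> is the law of \<open>(J\<^sub>i)\<^sub>i\<close>. Both \<open>f\<close> and \<open>K\<close> are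
  determined only up to Lebesgue null sets, so they are characterized rather than chosen.\<close>

definition stable_density_and_PD_cond ::
  "real \<Rightarrow> (real \<Rightarrow> real) \<Rightarrow> (real \<Rightarrow> (nat \<Rightarrow> real) measure) \<Rightarrow> bool" where
  "stable_density_and_PD_cond \<gamma> f K \<longleftrightarrow>
     (\<exists>D :: (nat \<Rightarrow> real) measure.
        prob_space D \<and> sets D = sets borel \<and>
        ranked_poisson_points D (stable_intensity \<gamma>) (\<lambda>j. j) \<and>
        (\<forall>t. 0 \<le> f t) \<and> distributed D lborel (\<lambda>j. \<Sum>i. j i) (\<lambda>t. ennreal (f t)) \<and>
        has_cond_law D (\<lambda>j k. j k / (\<Sum>i. j i)) (\<lambda>j. \<Sum>i. j i) K \<and>
        (\<forall>t>0. AE p in K t. p \<in> mass_partitions))"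

text \<open>In what follows \<open>f \<gamma>\<close> stands for \<open>f\<^sub>\<gamma>\<close> and \<open>K \<gamma> t\<close> for \<open>PD(\<gamma>|t)\<close>. \<open>PK f K \<gamma> h\<close> is the law
  \<open>PK\<^sub>\<gamma>(h \<cdot> f\<^sub>\<gamma>)\<close>.\<close>

definition PK :: "(real \<Rightarrow> real \<Rightarrow> real) \<Rightarrow> (real \<Rightarrow> real \<Rightarrow> (nat \<Rightarrow> real) measure) \<Rightarrow>
    real \<Rightarrow> (real \<Rightarrow> real) \<Rightarrow> (nat \<Rightarrow> real) measure" where
  "PK f K \<gamma> h =
     density (restrict_space lborel {0<..}) (\<lambda>t. ennreal (h t * f \<gamma> t)) \<bind> K \<gamma>"

text \<open>\<open>P\<^sub>\<alpha>\<^bsup>\<beta>/\<alpha>\<^esup>(h)\<close> as a joint law on pairs of sequences.\<close>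

definition joint_PK :: "(real \<Rightarrow> real \<Rightarrow> real) \<Rightarrow> (real \<Rightarrow> real \<Rightarrow> (nat \<Rightarrow> real) measure) \<Rightarrow>
    real \<Rightarrow> real \<Rightarrow> (real \<Rightarrow> real) \<Rightarrow> ((nat \<Rightarrow> real) \<times> (nat \<Rightarrow> real)) measure" where
  "joint_PK f K \<alpha> \<beta> h =
     density (restrict_space lborel {0<..} \<Otimes>\<^sub>M restrict_space lborel {0<..})
       (\<lambda>(s, y). ennreal (h (s * y powr (1 / \<alpha>)) * f (\<beta> / \<alpha>) y * f \<alpha> s))
     \<bind> (\<lambda>(s, y). K \<alpha> s \<Otimes>\<^sub>M K (\<beta> / \<alpha>) y)"

definition r1 :: "real \<Rightarrow> real \<Rightarrow> real \<Rightarrow> real" where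
  "r1 \<gamma> \<zeta> t = 1 / \<gamma> * \<zeta> powr (1 / \<gamma> - 1) * t * exp (- (\<zeta> powr (1 / \<gamma>) * t)) * exp \<zeta>"

definition P1 :: "(real \<Rightarrow> real \<Rightarrow> real) \<Rightarrow> (real \<Rightarrow> real \<Rightarrow> (nat \<Rightarrow> real) measure) \<Rightarrow>
    real \<Rightarrow> real \<Rightarrow> (nat \<Rightarrow> real) measure" where
  "P1 f K \<gamma> \<zeta> = PK f K \<gamma> (r1 \<gamma> \<zeta>)"

text \<open>The law of \<open>P\<^bsup>[1]\<^esup>\<^sub>\<gamma>(Z)\<close> when the positive random variable \<open>Z\<close> has law \<open>\<mu>\<close>.\<close>

definition P1_mix :: "(real \<Rightarrow> real \<Rightarrow> real) \<Rightarrow> (real \<Rightarrow> real \<Rightarrow> (nat \<Rightarrow> real) measure) \<Rightarrow>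
    real \<Rightarrow> real measure \<Rightarrow> (nat \<Rightarrow> real) measure" where
  "P1_mix f K \<gamma> \<mu> = restrict_space \<mu> {0<..} \<bind> P1 f K \<gamma>"

definition PD :: "real \<Rightarrow> real \<Rightarrow> (nat \<Rightarrow> real) measure" where
  "PD \<gamma> \<theta> =
     distr (PiM UNIV (\<lambda>k::nat. beta_law (1 - \<gamma>) (\<theta> + real (Suc k) * \<gamma>))) borel
       (\<lambda>R. ranked (\<lambda>k. R k * (\<Prod>j<k. 1 - R j)))"

text \<open>The law of \<open>FRAG\<^sub>\<gamma>\<^sub>,\<^sub>\<theta>(P)\<close> when the mass partition \<open>P\<close> has law \<open>\<pi>\<close>.\<close>

definition FRAG :: "real \<Rightarrow> real \<Rightarrow> (nat \<Rightarrow> real) measure \<Rightarrow> (nat \<Rightarrow> real) measure" where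
  "FRAG \<gamma> \<theta> \<pi> =
     distr (\<pi> \<Otimes>\<^sub>M PiM UNIV (\<lambda>i::nat. PD \<gamma> \<theta>)) borel
       (\<lambda>(p, q). ranked (\<lambda>(i, l). p i * q i l))"

definition local_time :: "real \<Rightarrow> (nat \<Rightarrow> real) \<Rightarrow> real" where
  "local_time \<gamma> p =
     Gamma (1 - \<gamma>) * Lim (at_right 0) (\<lambda>\<epsilon>. \<epsilon> powr \<gamma> * real (card {i. \<epsilon> \<le> p i}))"

definition inv_local_time :: "real \<Rightarrow> (nat \<Rightarrow> real) \<Rightarrow> real" where
  "inv_local_time \<gamma> p = local_time \<gamma> p powr (- 1 / \<gamma>)"

definition step_cdf :: "(nat \<Rightarrow> real) \<Rightarrow> (nat \<Rightarrow> real) \<Rightarrow> real \<Rightarrow> real" where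
  "step_cdf p u y = (\<Sum>k. p k * indicator {..y} (u k))"

definition jump :: "(real \<Rightarrow> real) \<Rightarrow> real \<Rightarrow> real" where
  "jump F y = F y - Lim (at_left y) F"

text \<open>The ranked masses \<open>V\<close> of the purely atomic distribution function
  \<open>F\<^sub>V = step_cdf v ut \<circ> step_cdf q u\<close>; its masses are its jumps, indexed by their location.\<close>

definition coag :: "(nat \<Rightarrow> real) \<Rightarrow> (nat \<Rightarrow> real) \<Rightarrow> (nat \<Rightarrow> real) \<Rightarrow> (nat \<Rightarrow> real) \<Rightarrow> nat \<Rightarrow> real" where
  "coag v ut q u = ranked (jump (step_cdf v ut \<circ> step_cdf q u))"

text \<open>The generalized gamma subordinator. Paths are required to be nondecreasing and right-continuous
  for every \<open>\<omega>\<close>, so that \<open>\<omega> \<mapsto> \<tau> (S \<omega>) \<omega>\<close> is measurable for random times \<open>S \<ge> 0\<close>.\<close>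

definition gen_gamma_subordinator :: "'w measure \<Rightarrow> real \<Rightarrow> (real \<Rightarrow> 'w \<Rightarrow> real) \<Rightarrow> bool" where
  "gen_gamma_subordinator N \<gamma> \<tau> \<longleftrightarrow>
     (\<forall>s\<ge>0. \<tau> s \<in> borel_measurable N) \<and>
     (\<forall>\<omega>\<in>space N. \<tau> 0 \<omega> = 0 \<and> mono_on {0..} (\<lambda>s. \<tau> s \<omega>) \<and>
        (\<forall>s\<ge>0. continuous (at_right s) (\<lambda>s. \<tau> s \<omega>))) \<and>
     (\<forall>(t :: nat \<Rightarrow> real) n. 0 \<le> t 0 \<and> mono t \<longrightarrow>
        prob_space.indep_vars N (\<lambda>_. borel) (\<lambda>i \<omega>. \<tau> (t (Suc i)) \<omega> - \<tau> (t i) \<omega>) {..<n}) \<and>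
     (\<forall>t\<ge>0. \<forall>s\<ge>0. \<forall>w\<ge>0.
        (\<integral>\<omega>. exp (- w * (\<tau> (t + s) \<omega> - \<tau> t \<omega>)) \<partial>N) = exp (- s * ((1 + w) powr \<gamma> - 1)))"

text \<open>Independence of two random elements. The library's \<open>indep_var\<close> needs both to have values in the
  same type.\<close>

definition indep_elements ::
  "'w measure \<Rightarrow> 'b measure \<Rightarrow> ('w \<Rightarrow> 'b) \<Rightarrow> 'c measure \<Rightarrow> ('w \<Rightarrow> 'c) \<Rightarrow> bool" where
  "indep_elements N A X B Y \<longleftrightarrow>
     X \<in> N \<rightarrow>\<^sub>M A \<and> Y \<in> N \<rightarrow>\<^sub>M B \<and>
     prob_space.indep_set N {X -` S \<inter> space N | S. S \<in> sets A} {Y -` S \<inter> space N | S. S \<in> sets B}"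

definition indep_of_process :: "'w measure \<Rightarrow> (real \<Rightarrow> 'w \<Rightarrow> real) \<Rightarrow> 'b measure \<Rightarrow> ('w \<Rightarrow> 'b) \<Rightarrow> bool" where
  "indep_of_process N \<tau> B X \<longleftrightarrow>
     indep_elements N (PiM {0..} (\<lambda>_. borel)) (\<lambda>\<omega>. \<lambda>s\<in>{0..}. \<tau> s \<omega>) B X"

text \<open>The joint law of \<open>(P\<^bsup>[1]\<^esup>\<^sub>\<alpha>(\<tau>\<^sub>\<beta>\<^sub>/\<^sub>\<alpha>(\<zeta> + \<gamma>\<^bsub>(\<alpha>-\<beta>)/\<beta>\<^esub>)), P\<^bsup>[1]\<^esup>\<^sub>\<beta>\<^sub>/\<^sub>\<alpha>(\<zeta>))\<close> under the coupling in which the value of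
  the subordinator is \<open>\<zeta>\<^bsup>\<alpha>/\<beta>\<^esup>\<close> times the inverse local time at 1 of the second component.\<close>

definition coupled_law :: "(real \<Rightarrow> real \<Rightarrow> real) \<Rightarrow> (real \<Rightarrow> real \<Rightarrow> (nat \<Rightarrow> real) measure) \<Rightarrow>
    real \<Rightarrow> real \<Rightarrow> real \<Rightarrow> ((nat \<Rightarrow> real) \<times> (nat \<Rightarrow> real)) measure" where
  "coupled_law f K \<alpha> \<beta> \<zeta> =
     P1 f K (\<beta> / \<alpha>) \<zeta> \<bind>
       (\<lambda>q. distr (P1 f K \<alpha> (\<zeta> powr (\<alpha> / \<beta>) * inv_local_time (\<beta> / \<alpha>) q))
              (borel \<Otimes>\<^sub>M borel) (\<lambda>v. (v, q)))"

end

theory Submission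
  imports Defs
begin

\<comment> \<open>Since \<open>f\<close> and \<open>K\<close> are only characterized up to null
  sets, they are eliminated early: \<open>nn_integral_PK\<close> and
  \<open>nn_integral_joint_PK\<close> rewrite every law as an integral over independent unnormalized
  stable points. The weight of \<open>joint_PK\<close> depends only on s * y powr (1 / \<alpha>),
  the total mass of the \<alpha>-stable points after scaling by the power 1 / \<alpha> of the
  \<beta>/\<alpha>-stable mass. Coagulation and fragmentation preserve this mass and commute with
  scaling, so each reduces to one identity between unweighted point processes,
  \<open>coag_points\<close> and \<open>frag_points\<close>. Both rest on a substitution in the
  stable intensity whose constant Gamma (1 - \<beta>) / Gamma (1 - \<beta> / \<alpha>) is the
  reciprocal of the \<beta>-th moment of the \<alpha>-stable sum; this singles out -\<beta> as the
  parameter of the fragments. The mass lost by normalization is recovered almost surely as the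
  inverse local time, which makes conditioning on the latter explicit. Functionals take values in
  [0, \<infinity>] and the test functions vanish near 0: infinite exponents then need no separate
  treatment, and the zeros produced by \<open>ranked\<close> are invisible.\<close>
text \<open>The law of a ranked sequence is determined by its Laplace functionals, which are explicit for ranked
  Poisson points, so that Poisson-Kingman laws are those of the normalized stable points, reweighted by a
  function of their total mass. The coupling rests on the factorization
  \<open>r1 \<beta> z (s * y powr (1/\<alpha>)) = r1 (\<beta>/\<alpha>) z y * r1 \<alpha> (z powr (\<alpha>/\<beta>) * y) s\<close>. Coagulation sums
  the \<open>\<alpha>\<close>-stable points over random cells whose lengths are proportional to the \<open>\<beta>/\<alpha>\<close>-stable points:
  these sums are the jumps of a subordinated, hence \<open>\<beta>\<close>-stable, subordinator. Fragmentation reads the same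
  picture backwards: the \<open>\<beta>\<close>-stable masses, together with the way they split, form a marked Poisson process.
  The Poisson-Dirichlet laws with \<open>\<theta> \<noteq> 0\<close> come from mixing over a gamma parameter, and their
  stick-breaking form from the Mecke formula for a size-biased pick.\<close>

syntax "_NN" :: "pttrn \<Rightarrow> 'a measure \<Rightarrow> ennreal \<Rightarrow> ennreal" ("(3NN (_)/|(_)./ _)" [0,0,10] 10)
translations "NN x|M. f" == "CONST nn_integral M (\<lambda>x. f)"

lemmas pair_cong = measurable_cong_sets sets_pair_measure_cong

abbreviation seqs :: "(nat \<Rightarrow> real) measure" where "seqs \<equiv> borel"

lemma nn_integral_cong_on:
  "AE x in M. P x \<Longrightarrow> (\<And>x. P x \<Longrightarrow> f x = g x) \<Longrightarrow> (NN x|M. f x) = (NN x|M. g x)"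
  by (rule nn_integral_cong_AE) (auto elim: eventually_mono)

subsection \<open>Laplace exponentials and infinite products\<close>

text \<open>Exponents are sums over infinitely many points and may be infinite. The value 0 at
  \<open>\<top>\<close> extends exp (- x) continuously, so that sums become products without
  finiteness conditions.\<close>

definition nexp :: "ennreal \<Rightarrow> ennreal" where
  "nexp x = (if x = \<top> then 0 else ennreal (exp (- enn2real x)))"

lemma nexp_0 [simp]: "nexp 0 = 1"
  by (simp add: nexp_def)

lemma nexp_top [simp]: "nexp \<top> = 0"
  by (simp add: nexp_def)

lemma nexp_ennreal: "0 \<le> r \<Longrightarrow> nexp (ennreal r) = ennreal (exp (- r))"
  by (simp add: nexp_def)

lemma nexp_measurable [measurable]: "nexp \<in> borel_measurable borel"
  unfolding nexp_def by measurable

lemma nexp_add: "nexp (x + y) = nexp x * nexp y"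
  by (cases x; cases y) (auto simp: nexp_ennreal exp_diff exp_minus divide_inverse ennreal_mult[symmetric] ennreal_plus[symmetric] simp del: ennreal_plus)

lemma nexp_antimono: "x \<le> y \<Longrightarrow> nexp y \<le> nexp x"
  by (cases x; cases y) (auto simp: nexp_ennreal top_unique intro!: ennreal_leI)

lemma nexp_le_1 [simp]: "nexp x \<le> 1"
  using nexp_antimono[of 0 x] by simp

lemma nexp_not_top [simp]: "nexp x \<noteq> \<top>" "nexp x < \<top>"
  using le_less_trans[OF nexp_le_1[of x], of \<top>] by auto

lemma nexp_sum: "finite I \<Longrightarrow> nexp (\<Sum>i\<in>I. g i) = (\<Prod>i\<in>I. nexp (g i))"
  by (induction I rule: finite_induct) (auto simp: nexp_add)

lemma nexp_tendsto:
  assumes "(f \<longlongrightarrow> x) F" shows "((\<lambda>i. nexp (f i)) \<longlongrightarrow> nexp x) F"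
proof (cases x)
  case (real r)
  have ev: "eventually (\<lambda>i. f i < \<top>) F"
    using assms real by (intro order_tendstoD(2)[of f x]) auto
  have "((\<lambda>i. enn2real (f i)) \<longlongrightarrow> r) F"
    by (rule tendsto_enn2real) (use assms real in auto)
  then have "((\<lambda>i. ennreal (exp (- enn2real (f i)))) \<longlongrightarrow> ennreal (exp (- r))) F"
    by (intro tendsto_ennrealI tendsto_exp tendsto_minus)
  moreover have "eventually (\<lambda>i. ennreal (exp (- enn2real (f i))) = nexp (f i)) F"
    using ev by eventually_elim (auto simp: nexp_def)
  ultimately have "((\<lambda>i. nexp (f i)) \<longlongrightarrow> ennreal (exp (- r))) F"
    by (rule Lim_transform_eventually)
  then show ?thesis using real by (simp add: nexp_ennreal)
next
  case top
  show ?thesis unfolding top nexp_top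
  proof (rule order_tendstoI)
    fix a :: ennreal assume "0 < a"
    then obtain e where e: "0 < e" "ennreal e < a"
      by (metis dense ennreal_cases ennreal_less_zero_iff less_top_ennreal order_less_trans top.not_eq_extremum)
    \<comment> \<open>Every argument above \<open>r\<close> has \<open>nexp\<close> at most
      \<open>e\<close>; the maximum keeps \<open>r\<close> nonnegative as required by
      \<open>nexp_ennreal\<close>.\<close>
    define r where "r = max 0 (- ln e)"
    have "eventually (\<lambda>i. ennreal r < f i) F"
      using assms top by (intro order_tendstoD(1)[of f x]) auto
    then show "eventually (\<lambda>i. nexp (f i) < a) F"
    proof eventually_elim
      case (elim i)
      have "nexp (f i) \<le> nexp (ennreal r)" using elim by (intro nexp_antimono) auto
      also have "\<dots> = ennreal (exp (- r))" by (rule nexp_ennreal) (simp add: r_def)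
      also have "\<dots> \<le> ennreal e" using e
        by (intro ennreal_leI) (auto simp: r_def max_def intro: order.trans[OF _ eq_refl[OF exp_ln]])
      finally show ?case using e by simp
    qed
  qed auto
qed

lemma nexp_SUP:
  assumes "incseq X" shows "nexp (SUP n. X n) = (INF n. nexp (X (n::nat)))"
proof -
  have "(\<lambda>n. nexp (X n)) \<longlonglongrightarrow> nexp (SUP n. X n)"
    by (intro nexp_tendsto LIMSEQ_SUP assms)
  moreover have "decseq (\<lambda>n. nexp (X n))"
    using assms by (auto simp: decseq_def incseq_def intro: nexp_antimono)
  ultimately show ?thesis using LIMSEQ_INF LIMSEQ_unique by blast
qed

text \<open>A right inverse of \<open>nexp\<close> on [0, 1]. It turns a product of factors at most
  1 into the exponential of a sum, to which a Laplace functional applies.\<close>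

definition nlog :: "ennreal \<Rightarrow> ennreal" where
  "nlog y = (if y = 0 then \<top> else ennreal (- ln (enn2real y)))"

lemma nlog_measurable [measurable]: "nlog \<in> borel_measurable borel"
  unfolding nlog_def by measurable

lemma nexp_nlog: "y \<le> 1 \<Longrightarrow> nexp (nlog y) = y"
  by (cases y) (auto simp: nlog_def nexp_ennreal top_unique ennreal_le_1)

text \<open>For factors at most 1 the partial products decrease, so the infimum is their limit; in
  this form measurability and monotone convergence are immediate.\<close>

definition iprod :: "(nat \<Rightarrow> ennreal) \<Rightarrow> ennreal" where
  "iprod \<phi> = (INF n. \<Prod>k<n. \<phi> k)"

lemma iprod_measurable [measurable (raw)]:
  assumes "\<And>k. (\<lambda>x. \<phi> x k) \<in> borel_measurable M"
  shows "(\<lambda>x. iprod (\<phi> x)) \<in> borel_measurable M"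
  unfolding iprod_def using assms by measurable

lemma decseq_prod_le_1:
  fixes \<phi> :: "nat \<Rightarrow> ennreal"
  assumes "\<And>k. \<phi> k \<le> 1" shows "decseq (\<lambda>n. \<Prod>k<n. \<phi> k)"
  by (intro decseq_SucI) (use mult_left_mono[OF assms] in fastforce)

lemma iprod_LIMSEQ:
  assumes "\<And>k. \<phi> k \<le> 1" shows "(\<lambda>n. \<Prod>k<n. \<phi> k) \<longlonglongrightarrow> iprod \<phi>"
  unfolding iprod_def by (intro LIMSEQ_INF decseq_prod_le_1 assms)

lemma iprod_nexp: "iprod (\<lambda>k. nexp (g k)) = nexp (\<Sum>k. g k)"
  by (simp add: iprod_def suminf_eq_SUP nexp_SUP nexp_sum incseq_sumI)

lemma nn_integral_iprod:
  assumes [measurable]: "\<And>k. (\<lambda>x. \<phi> x k) \<in> borel_measurable M"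
    and "finite_measure M" and le: "\<And>x k. \<phi> x k \<le> 1"
  shows "(NN x|M. iprod (\<phi> x)) = (INF n. NN x|M. (\<Prod>k<n. \<phi> x k))"
proof -
  interpret finite_measure M by fact
  show ?thesis unfolding iprod_def
  proof (rule nn_integral_monotone_convergence_INF_decseq[symmetric, THEN sym])
    show "decseq (\<lambda>n x. \<Prod>k<n. \<phi> x k)"
      unfolding monotone_on_def le_fun_def by (auto intro!: decseqD[OF decseq_prod_le_1] le)
    show "(NN x|M. (\<Prod>k<0. \<phi> x k)) < \<infinity>" by (simp add: less_top[symmetric])
  qed measurable
qed

subsection \<open>Families of test functions that determine a measure\<close>

text \<open>The variable exp (- X) lies in [0, 1], and its moments are the Laplace transform at the
  natural numbers. Its characteristic function is a power series in these moments, so Levy's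
  uniqueness theorem applies, and - ln recovers X.\<close>

lemma laplace_unique_prob:
  fixes \<mu> \<nu> :: "real measure"
  assumes "prob_space \<mu>" "prob_space \<nu>" and sets: "sets \<mu> = sets borel" "sets \<nu> = sets borel"
    and pos: "AE x in \<mu>. 0 \<le> x" "AE x in \<nu>. 0 \<le> x"
    and eq: "\<And>c. 0 \<le> c \<Longrightarrow> (NN x|\<mu>. ennreal (exp (- c * x))) = (NN x|\<nu>. ennreal (exp (- c * x)))"
  shows "\<mu> = \<nu>"
proof -
  define Y :: "real measure \<Rightarrow> real measure" where "Y M = distr M borel (\<lambda>x. exp (- x))" for M
  have char: "char (Y M) t = (\<Sum>n. ((\<i> * t) ^ n /\<^sub>R fact n) * of_real (\<integral>x. exp (- real n * x) \<partial>M))"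
    if "prob_space M" and [measurable_cong]: "sets M = sets borel" and pos: "AE x in M. 0 \<le> x" for M t
  proof -
    interpret prob_space M by fact
    have [measurable]: "(\<lambda>x. exp (- x)) \<in> borel_measurable M" by measurable
    have "char (Y M) t = (\<integral>x. iexp (t * exp (- x)) \<partial>M)"
      unfolding char_def Y_def by (subst integral_distr) auto
    also have "\<dots> = (\<integral>x. (\<Sum>n. (\<i> * of_real (t * exp (- x))) ^ n /\<^sub>R fact n) \<partial>M)"
      by (simp add: exp_def)
    also have "\<dots> = (\<Sum>n. \<integral>x. (\<i> * of_real (t * exp (- x))) ^ n /\<^sub>R fact n \<partial>M)"
    proof -
      have bd: "AE x in M. norm ((\<i> * of_real (t * exp (- x))) ^ n /\<^sub>R fact n) \<le> \<bar>t\<bar> ^ n /\<^sub>R fact n" for n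
        using pos
      proof eventually_elim
        case (elim x)
        have "(\<bar>t\<bar> * exp (- x)) ^ n \<le> (\<bar>t\<bar> * 1) ^ n"
          using elim by (intro power_mono mult_left_mono) auto
        then show ?case by (simp add: norm_mult norm_power abs_mult divide_right_mono field_simps)
      qed
      have int: "integrable M (\<lambda>x. (\<i> * of_real (t * exp (- x))) ^ n /\<^sub>R fact n)" for n
        by (intro integrable_const_bound[OF bd]) measurable
      have sm: "summable (\<lambda>n. \<bar>t\<bar> ^ n /\<^sub>R fact n)"
        using summable_norm_exp[of "\<bar>t\<bar>"] by (simp add: summable_exp)
      show ?thesis
      proof (rule integral_suminf[OF int])
        show "AE x in M. summable (\<lambda>n. norm ((\<i> * complex_of_real (t * exp (- x))) ^ n /\<^sub>R fact n))"
          by (intro AE_I2 summable_norm_exp)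
        show "summable (\<lambda>n. \<integral>x. norm ((\<i> * complex_of_real (t * exp (- x))) ^ n /\<^sub>R fact n) \<partial>M)"
        proof (rule summable_comparison_test'[OF sm, of 0])
          fix n :: nat
          have "(\<integral>x. norm ((\<i> * complex_of_real (t * exp (- x))) ^ n /\<^sub>R fact n) \<partial>M) \<le> (\<integral>x. \<bar>t\<bar> ^ n /\<^sub>R fact n \<partial>M)"
            by (intro integral_mono_AE integrable_norm int bd) auto
          then show "norm (\<integral>x. norm ((\<i> * complex_of_real (t * exp (- x))) ^ n /\<^sub>R fact n) \<partial>M) \<le> \<bar>t\<bar> ^ n /\<^sub>R fact n"
            by (simp add: prob_space integral_nonneg)
        qed
      qed
    qed
    also have "\<dots> = (\<Sum>n. ((\<i> * t) ^ n /\<^sub>R fact n) * of_real (\<integral>x. exp (- real n * x) \<partial>M))"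
    proof (rule arg_cong[where f = suminf], rule ext)
      fix n
      have "(\<i> * of_real (t * exp (- x))) ^ n /\<^sub>R fact n = ((\<i> * t) ^ n /\<^sub>R fact n) * complex_of_real (exp (- real n * x))" for x
      proof -
        have "exp (- real n * x) = exp (- x) ^ n" by (simp add: exp_of_nat_mult[symmetric])
        then show ?thesis by (simp add: power_mult_distrib)
      qed
      then show "(\<integral>x. (\<i> * of_real (t * exp (- x))) ^ n /\<^sub>R fact n \<partial>M) = ((\<i> * t) ^ n /\<^sub>R fact n) * of_real (\<integral>x. exp (- real n * x) \<partial>M)"
        by (simp add: integral_complex_of_real del: of_real_exp scaleR_conv_of_real mult_scaleR_left)
    qed
    finally show ?thesis .
  qed
  have "(\<integral>x. exp (- real n * x) \<partial>\<mu>) = (\<integral>x. exp (- real n * x) \<partial>\<nu>)" for n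
    using eq[of "real n"] by (subst (1 2) integral_eq_nn_integral) (auto simp: measurable_cong_sets[OF sets(1) refl] measurable_cong_sets[OF sets(2) refl])
  then have "char (Y \<mu>) = char (Y \<nu>)"
    using char[OF assms(1) sets(1) pos(1)] char[OF assms(2) sets(2) pos(2)] by auto
  moreover have rd: "real_distribution (Y M)" if "prob_space M" "sets M = sets borel" for M
    using that unfolding Y_def real_distribution_def real_distribution_axioms_def
    by (auto intro!: prob_space.prob_space_distr cong: measurable_cong_sets)
  ultimately have Yeq: "Y \<mu> = Y \<nu>"
    using assms by (intro Levy_uniqueness) auto
  have inv: "distr (Y M) borel (\<lambda>y. - ln y) = M" if [measurable_cong]: "sets M = sets borel" for M
    unfolding Y_def using that
    by (subst distr_distr) (auto simp: comp_def distr_id2)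
  have "\<mu> = distr (Y \<nu>) borel (\<lambda>y. - ln y)" using inv[OF sets(1)] unfolding Yeq ..
  also have "\<dots> = \<nu>" by (rule inv[OF sets(2)])
  finally show ?thesis .
qed

text \<open>The transform at 0 is the total mass. If it is positive, both measures are rescaled to
  probability measures by a constant density, which is undone at the end.\<close>

lemma laplace_unique:
  fixes \<mu> \<nu> :: "real measure"
  assumes "finite_measure \<mu>" "finite_measure \<nu>" and sets: "sets \<mu> = sets borel" "sets \<nu> = sets borel"
    and pos: "AE x in \<mu>. 0 \<le> x" "AE x in \<nu>. 0 \<le> x"
    and eq: "\<And>c. 0 \<le> c \<Longrightarrow> (NN x|\<mu>. ennreal (exp (- c * x))) = (NN x|\<nu>. ennreal (exp (- c * x)))"
  shows "\<mu> = \<nu>"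
proof -
  interpret m: finite_measure \<mu> by fact
  interpret n: finite_measure \<nu> by fact
  have sp: "space \<mu> = UNIV" "space \<nu> = UNIV"
    using sets_eq_imp_space_eq[OF sets(1)] sets_eq_imp_space_eq[OF sets(2)] by auto
  define r where "r = emeasure \<mu> UNIV"
  have r: "emeasure \<mu> UNIV = r" "emeasure \<nu> UNIV = r"
    using eq[of 0] by (auto simp: sp r_def)
  show ?thesis
  proof (cases "r = 0")
    case True
    show ?thesis
    proof (rule measure_eqI)
      fix A assume "A \<in> sets \<mu>"
      have "emeasure \<mu> A \<le> r" "emeasure \<nu> A \<le> r" using emeasure_space[of \<mu> A] emeasure_space[of \<nu> A] r sp by auto
      then show "emeasure \<mu> A = emeasure \<nu> A" using True by simp
    qed (simp add: sets)
  next
    case False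
    have rtop: "r \<noteq> \<top>" using m.emeasure_finite[of UNIV] r_def by simp
    define c where "c = inverse r"
    have c: "r * c = 1" using ennreal_divide_self[OF False] rtop unfolding c_def divide_ennreal_def top.not_eq_extremum .
    then have c: "c * r = 1" "r * c = 1" by (auto simp: mult.commute)
    have ps: "prob_space (density M (\<lambda>_. c))" if "emeasure M (space M) = r" for M :: "real measure"
    proof (rule prob_spaceI)
      have "emeasure (density M (\<lambda>_. c)) (space M) = c * emeasure M (space M)"
        by (rule emeasure_density_const) simp
      then show "emeasure (density M (\<lambda>_. c)) (space (density M (\<lambda>_. c))) = 1"
        by (simp add: that c)
    qed
    note [measurable_cong] = sets
    have "density \<mu> (\<lambda>_. c) = density \<nu> (\<lambda>_. c)"
    proof (rule laplace_unique_prob)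
      show "prob_space (density \<mu> (\<lambda>_. c))" "prob_space (density \<nu> (\<lambda>_. c))"
        using ps r sp by auto
      show "sets (density \<mu> (\<lambda>_. c)) = sets borel" "sets (density \<nu> (\<lambda>_. c)) = sets borel"
        by (simp_all add: sets)
      show "AE x in density \<mu> (\<lambda>_. c). 0 \<le> x" "AE x in density \<nu> (\<lambda>_. c). 0 \<le> x"
        using pos by (auto simp: AE_density)
      fix d :: real assume "0 \<le> d"
      then show "(NN x|density \<mu> (\<lambda>_. c). ennreal (exp (- d * x))) = (NN x|density \<nu> (\<lambda>_. c). ennreal (exp (- d * x)))"
        using eq[of d] by (subst (1 2) nn_integral_density) (simp_all add: nn_integral_cmult)
    qed
    moreover have un: "density (density M (\<lambda>_. c)) (\<lambda>_. r) = M" for M :: "real measure"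
      by (subst density_density_eq) (simp_all add: c density_1)
    ultimately show ?thesis by metis
  qed
qed

text \<open>Quantifies over finite measures instead of probability measures because
  \<open>seq_measure_eqI\<close> applies it to laws of one coordinate weighted by test functions of
  the others.\<close>

definition determining :: "(real \<Rightarrow> ennreal) set \<Rightarrow> real set \<Rightarrow> bool" where
  "determining C S \<longleftrightarrow> (\<forall>\<mu> \<nu>. finite_measure \<mu> \<longrightarrow> finite_measure \<nu> \<longrightarrow> sets \<mu> = sets borel \<longrightarrow> sets \<nu> = sets borel \<longrightarrow>
     (AE x in \<mu>. x \<in> S) \<longrightarrow> (AE x in \<nu>. x \<in> S) \<longrightarrow> (\<forall>\<phi>\<in>C. (NN x|\<mu>. \<phi> x) = (NN x|\<nu>. \<phi> x)) \<longrightarrow> \<mu> = \<nu>)"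

lemma determining_laplace: "determining {\<lambda>x. ennreal (exp (- c * x)) |c. 0 \<le> c} {0..}"
  unfolding determining_def by (auto intro!: laplace_unique)

lemma sets_borel_seq: "sets seqs = sets (PiM UNIV (\<lambda>_. borel))"
  by (simp add: sets_PiM_equal_borel)

lemma borel_seq_component_dest [measurable_dest]:
  "f \<in> M \<rightarrow>\<^sub>M (borel :: (nat \<Rightarrow> real) measure) \<Longrightarrow> (\<lambda>x. f x i) \<in> borel_measurable M"
  by (rule measurable_product_then_coordinatewise)

lemma seq_box_eq_prod_indicator:
  "finite J \<Longrightarrow> J \<subseteq> {..<n} \<Longrightarrow>
     indicator {x :: nat \<Rightarrow> 'b. \<forall>i\<in>J. x i \<in> A i} x = (\<Prod>i<n. indicator (if i \<in> J then A i else UNIV) (x i) :: ennreal)"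
proof (cases "\<forall>i\<in>J. x i \<in> A i")
  case True
  then have "(\<Prod>i<n. indicator (if i \<in> J then A i else UNIV) (x i) :: ennreal) = 1"
    by (intro prod.neutral) auto
  then show ?thesis using True by simp
next
  case False
  then obtain i where i: "i \<in> J" "x i \<notin> A i" by auto
  assume "J \<subseteq> {..<n}"
  then have "i \<in> {..<n}" using i by auto
  then have "(\<Prod>i<n. indicator (if i \<in> J then A i else UNIV) (x i) :: ennreal) = 0"
    using i by (intro prod_zero) (auto intro!: bexI[of _ i])
  then show ?thesis using False by simp
qed

text \<open>The test functions are exchanged for indicators one coordinate at a time.\<close>

lemma seq_measure_eqI:
  fixes \<mu> \<nu> :: "(nat \<Rightarrow> real) measure"
  assumes fin: "finite_measure \<mu>" "finite_measure \<nu>"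
    and sets: "sets \<mu> = sets borel" "sets \<nu> = sets borel"
    and S: "AE x in \<mu>. \<forall>i. x i \<in> S" "AE x in \<nu>. \<forall>i. x i \<in> S"
    and Sm: "S \<in> sets borel"
    and det: "determining C S"
    and C: "\<And>\<phi>. \<phi> \<in> C \<Longrightarrow> \<phi> \<in> borel_measurable borel" "\<And>\<phi> x. \<phi> \<in> C \<Longrightarrow> x \<in> S \<Longrightarrow> \<phi> x \<le> 1"
    and eq: "\<And>n \<phi>. (\<And>i. i < n \<Longrightarrow> \<phi> i \<in> C) \<Longrightarrow>
      (NN x|\<mu>. (\<Prod>i<n. \<phi> i (x i))) = (NN x|\<nu>. (\<Prod>i<n. \<phi> i (x i)))"
  shows "\<mu> = \<nu>"
proof -
  define I :: "(real \<Rightarrow> ennreal) set" where "I = indicator ` sets borel"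
  have Im: "\<phi> \<in> borel_measurable borel" "\<phi> x \<le> 1" if "\<phi> \<in> I" for \<phi> x
    using that by (auto simp: I_def indicator_def)
  note [measurable_cong] = sets
  have step: "(NN x|\<mu>. (\<Prod>i<n. \<phi> i (x i))) = (NN x|\<nu>. (\<Prod>i<n. \<phi> i (x i)))"
    if "m \<le> n" "\<And>i. i < m \<Longrightarrow> \<phi> i \<in> I" "\<And>i. m \<le> i \<Longrightarrow> i < n \<Longrightarrow> \<phi> i \<in> C" for m n \<phi>
    using that
  proof (induction m arbitrary: \<phi>)
    case 0
    then show ?case by (intro eq) auto
  next
    case (Suc m)
    have m: "m < n" using Suc.prems by simp
    \<comment> \<open>The factors of the other coordinates act as a weight, and \<open>L M\<close>
      below is the law of coordinate \<open>m\<close> under it. The bound \<open>w1\<close> makes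
      this law finite, so \<open>det\<close> can exchange the test function at
      \<open>m\<close>.\<close>
    define w where "w x = (\<Prod>i\<in>{..<n} - {m}. \<phi> i (x i))" for x :: "nat \<Rightarrow> real"
    have phi: "\<phi> i \<in> I \<union> C" if "i < n" for i
      using that Suc.prems(2)[of i] Suc.prems(3)[of i] by (cases "i < Suc m") auto
    have [measurable]: "\<phi> i \<in> borel_measurable borel" if "i < n" for i
      using phi[OF that] Im C(1) by auto
    have w[measurable]: "w \<in> borel_measurable borel"
      unfolding w_def by measurable
    have w1: "w x \<le> 1" if "\<forall>i. x i \<in> S" for x
      unfolding w_def
    proof (rule prod_le_1)
      fix i assume "i \<in> {..<n} - {m}"
      then show "0 \<le> \<phi> i (x i) \<and> \<phi> i (x i) \<le> 1" using phi[of i] Im C(2) that by auto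
    qed
    define L where "L M = distr (density M w) borel (\<lambda>x. x m)" for M
    have split: "(\<Prod>i<n. (\<phi>(m := \<psi>)) i (x i)) = w x * \<psi> (x m)" for \<psi> x
    proof -
      have "(\<Prod>i<n. (\<phi>(m := \<psi>)) i (x i)) = \<psi> (x m) * (\<Prod>i\<in>{..<n} - {m}. (\<phi>(m := \<psi>)) i (x i))"
        using m by (subst prod.remove[of _ m]) simp_all
      also have "(\<Prod>i\<in>{..<n} - {m}. (\<phi>(m := \<psi>)) i (x i)) = w x"
        unfolding w_def by (intro prod.cong) auto
      finally show ?thesis by (simp only: mult.commute)
    qed
    have L: "(NN x|L M. \<psi> x) = (NN x|M. (\<Prod>i<n. (\<phi>(m := \<psi>)) i (x i)))"
      if [measurable_cong]: "sets M = sets borel" and [measurable]: "\<psi> \<in> borel_measurable borel" for M \<psi>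
    proof -
      have "(NN x|L M. \<psi> x) = (NN x|density M w. \<psi> (x m))"
        unfolding L_def by (rule nn_integral_distr) (auto simp: measurable_cong_sets[OF that(1) refl] that(2))
      also have "\<dots> = (NN x|M. w x * \<psi> (x m))"
        by (rule nn_integral_density) measurable
      finally show ?thesis unfolding split .
    qed
    have finL: "finite_measure (L M)"
      if [measurable_cong]: "sets M = sets borel" and f: "finite_measure M" and S: "AE x in M. \<forall>i. x i \<in> S" for M
    proof -
      interpret finite_measure M by fact
      have "(NN x|M. w x) \<le> (NN x|M. 1)"
        by (rule nn_integral_mono_AE) (use S w1 in auto)
      also have "\<dots> < \<top>" by (simp add: less_top[symmetric])
      finally have "(NN x|M. w x) < \<top>" .
      moreover have "emeasure (L M) (space (L M)) = (NN x|M. w x)"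
        using L[OF that(1), of "\<lambda>_. 1"] unfolding split by simp
      ultimately show ?thesis by (intro finite_measureI) simp
    qed
    have AEL: "AE x in L M. x \<in> S" if [measurable_cong]: "sets M = sets borel" and S: "AE x in M. \<forall>i. x i \<in> S" for M
      unfolding L_def using S Sm by (subst AE_distr_iff) (auto simp: AE_density)
    have "L \<mu> = L \<nu>"
    proof (rule det[unfolded determining_def, rule_format])
      show "finite_measure (L \<mu>)" "finite_measure (L \<nu>)" "AE x in L \<mu>. x \<in> S" "AE x in L \<nu>. x \<in> S"
        by (rule finL AEL sets fin S)+
      show "sets (L \<mu>) = sets borel" "sets (L \<nu>) = sets borel" by (simp_all add: L_def)
      fix \<psi> assume psi: "\<psi> \<in> C"
      have "(NN x|\<mu>. (\<Prod>i<n. (\<phi>(m := \<psi>)) i (x i))) = (NN x|\<nu>. (\<Prod>i<n. (\<phi>(m := \<psi>)) i (x i)))"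
      proof (rule Suc.IH)
        show "m \<le> n" using m by simp
        show "(\<phi>(m := \<psi>)) i \<in> I" if "i < m" for i using that Suc.prems(2)[of i] by auto
        show "(\<phi>(m := \<psi>)) i \<in> C" if "m \<le> i" "i < n" for i using that Suc.prems(3)[of i] psi by auto
      qed
      then show "(NN x|L \<mu>. \<psi> x) = (NN x|L \<nu>. \<psi> x)"
        using C(1)[OF psi] by (simp only: L[OF sets(1)] L[OF sets(2)])
    qed
    then have "(NN x|L \<mu>. \<phi> m x) = (NN x|L \<nu>. \<phi> m x)" by simp
    then show ?case using m by (simp add: L[OF sets(1)] L[OF sets(2)])
  qed
  show ?thesis
  proof (rule measure_eqI_PiM_infinite[where I = UNIV and M = "\<lambda>_. borel"])
    show "sets \<mu> = sets (Pi\<^sub>M UNIV (\<lambda>_. borel))" "sets \<nu> = sets (Pi\<^sub>M UNIV (\<lambda>_. borel))"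
      using sets sets_borel_seq by auto
    show "finite_measure \<mu>" by fact
    fix A :: "nat \<Rightarrow> real set" and J :: "nat set"
    assume J: "finite J" "J \<subseteq> UNIV" and A: "\<And>i. i \<in> J \<Longrightarrow> A i \<in> sets borel"
    obtain n where n: "J \<subseteq> {..<n}" using finite_nat_bounded[OF J(1)] by auto
    have e: "prod_emb UNIV (\<lambda>_. borel :: real measure) J (Pi\<^sub>E J A) = {x. \<forall>i\<in>J. x i \<in> A i}"
      by (auto simp: prod_emb_def PiE_iff)
    have m: "{x. \<forall>i\<in>J. x i \<in> A i} \<in> sets borel"
      unfolding sets_borel_seq e[symmetric] using J A by (intro sets_PiM_I) auto
    have *: "emeasure M {x. \<forall>i\<in>J. x i \<in> A i} = (NN x|M. (\<Prod>i<n. indicator (if i \<in> J then A i else UNIV) (x i)))"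
      if "sets M = sets borel" for M
      unfolding seq_box_eq_prod_indicator[OF J(1) n, symmetric] using that m by simp
    show "emeasure \<mu> (prod_emb UNIV (\<lambda>_. borel) J (Pi\<^sub>E J A)) = emeasure \<nu> (prod_emb UNIV (\<lambda>_. borel) J (Pi\<^sub>E J A))"
      unfolding e *[OF sets(1)] *[OF sets(2)]
      using A by (intro step[of n n]) (auto simp: I_def)
  qed
qed

subsection \<open>Infinite product measures\<close>

text \<open>Resampling one coordinate keeps every cylinder probability. This isolates one coordinate
  of an infinite product by Fubini without decomposing the index set.\<close>

lemma prod_space_PiM_update:
  fixes M :: "'i \<Rightarrow> 'a measure"
  assumes "\<And>i. prob_space (M i)"
  shows "distr (PiM UNIV M \<Otimes>\<^sub>M M n) (PiM UNIV M) (\<lambda>(\<omega>, x). fun_upd \<omega> n x) = PiM UNIV M"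
proof -
  interpret product_prob_space M UNIV using assms by (intro product_prob_spaceI) auto
  interpret P: prob_space "PiM UNIV M" by (rule prob_space_PiM) (rule assms)
  interpret Pn: prob_space "M n" by (rule assms)
  have meas[measurable]: "(\<lambda>(\<omega>, x). fun_upd \<omega> n x) \<in> PiM UNIV M \<Otimes>\<^sub>M M n \<rightarrow>\<^sub>M PiM UNIV M"
    unfolding split_beta by (rule measurable_fun_upd[where J = UNIV]) auto
  show ?thesis
  proof (rule measure_eqI_PiM_infinite[symmetric, where I = UNIV and M = M])
    show "finite_measure (PiM UNIV M)" by (rule P.finite_measure_axioms)
    fix A J assume J: "finite J" "J \<subseteq> UNIV" and A: "\<And>i. i \<in> J \<Longrightarrow> A i \<in> sets (M i)"
    define B where "B = prod_emb UNIV M (J - {n}) (Pi\<^sub>E (J - {n}) A)"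
    define C where "C = (if n \<in> J then A n else space (M n))"
    have m: "B \<in> sets (PiM UNIV M)" "C \<in> sets (M n)"
      unfolding B_def C_def using J A by (auto intro!: sets_PiM_I)
    have emb: "prod_emb UNIV M J (Pi\<^sub>E J A) \<in> sets (PiM UNIV M)" using J A by (auto intro!: sets_PiM_I)
    have AS: "i \<in> J \<Longrightarrow> x \<in> A i \<Longrightarrow> x \<in> space (M i)" for i x using A sets.sets_into_space by blast
    have vim: "(\<lambda>(\<omega>, x). fun_upd \<omega> n x) -` prod_emb UNIV M J (Pi\<^sub>E J A) \<inter> space (PiM UNIV M \<Otimes>\<^sub>M M n) = B \<times> C"
      using AS unfolding B_def C_def by (fastforce simp: prod_emb_def space_pair_measure space_PiM PiE_iff split: if_splits)
    have "emeasure (distr (PiM UNIV M \<Otimes>\<^sub>M M n) (PiM UNIV M) (\<lambda>(\<omega>, x). fun_upd \<omega> n x)) (prod_emb UNIV M J (Pi\<^sub>E J A))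
       = emeasure (PiM UNIV M) B * emeasure (M n) C"
      using emb m by (subst emeasure_distr) (auto simp: vim M.emeasure_pair_measure_Times)
    also have "emeasure (PiM UNIV M) B = (\<Prod>i\<in>J - {n}. emeasure (M i) (A i))"
      unfolding B_def using J A by (intro emeasure_PiM_emb) auto
    also have "(\<Prod>i\<in>J - {n}. emeasure (M i) (A i)) * emeasure (M n) C = (\<Prod>i\<in>J. emeasure (M i) (A i))"
      unfolding C_def using J by (auto simp: prod.remove[of J n] mult.commute M.emeasure_space_1)
    also have "\<dots> = emeasure (PiM UNIV M) (prod_emb UNIV M J (Pi\<^sub>E J A))"
      using J A by (intro emeasure_PiM_emb[symmetric]) auto
    finally show "emeasure (PiM UNIV M) (prod_emb UNIV M J (Pi\<^sub>E J A)) =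
      emeasure (distr (PiM UNIV M \<Otimes>\<^sub>M M n) (PiM UNIV M) (\<lambda>(\<omega>, x). fun_upd \<omega> n x)) (prod_emb UNIV M J (Pi\<^sub>E J A))" ..
  qed auto
qed

lemma nn_integral_PiM_update:
  fixes M :: "'i \<Rightarrow> 'a measure"
  assumes M: "\<And>i. prob_space (M i)" and F[measurable]: "F \<in> borel_measurable (PiM UNIV M)"
  shows "(NN \<omega>|PiM UNIV M. F \<omega>) = (NN \<omega>|PiM UNIV M. NN x|M n. F (fun_upd \<omega> n x))"
proof -
  interpret Pn: prob_space "M n" by (rule M)
  have meas[measurable]: "(\<lambda>(\<omega>, x). fun_upd \<omega> n x) \<in> PiM UNIV M \<Otimes>\<^sub>M M n \<rightarrow>\<^sub>M PiM UNIV M"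
    unfolding split_beta by (rule measurable_fun_upd[where J = UNIV]) auto
  have "(NN \<omega>|PiM UNIV M. F \<omega>) = (NN \<omega>|distr (PiM UNIV M \<Otimes>\<^sub>M M n) (PiM UNIV M) (\<lambda>(\<omega>, x). fun_upd \<omega> n x). F \<omega>)"
    using prod_space_PiM_update[of M n, OF M] by simp
  also have "\<dots> = (NN p|(PiM UNIV M \<Otimes>\<^sub>M M n). F (fun_upd (fst p) n (snd p)))"
    using F by (subst nn_integral_distr[OF meas]) (auto simp: split_beta)
  also have "\<dots> = (NN \<omega>|PiM UNIV M. NN x|M n. F (fun_upd \<omega> n x))"
    using measurable_compose[OF meas F] by (subst Pn.nn_integral_fst[symmetric]) (auto simp: split_beta)
  finally show ?thesis .
qed

lemma nn_integral_PiM_prod: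
  fixes M :: "nat \<Rightarrow> 'a measure"
  assumes M: "\<And>i. prob_space (M i)" and [measurable]: "\<And>k. \<phi> k \<in> borel_measurable (M k)"
  shows "(NN \<omega>|PiM UNIV M. (\<Prod>k<n. \<phi> k (\<omega> k))) = (\<Prod>k<n. NN x|M k. \<phi> k x)"
proof (induction n)
  case 0
  interpret P: prob_space "PiM UNIV M" by (rule prob_space_PiM) (rule M)
  show ?case by (simp add: P.emeasure_space_1)
next
  case (Suc n)
  have "(NN \<omega>|PiM UNIV M. (\<Prod>k<Suc n. \<phi> k (\<omega> k))) =
      (NN \<omega>|PiM UNIV M. NN x|M n. (\<Prod>k<n. \<phi> k (\<omega> k)) * \<phi> n x)"
    by (subst nn_integral_PiM_update[OF M, where n = n]) (auto intro!: nn_integral_cong)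
  also have "\<dots> = (NN \<omega>|PiM UNIV M. (\<Prod>k<n. \<phi> k (\<omega> k))) * (NN x|M n. \<phi> n x)"
    by (simp add: nn_integral_cmult nn_integral_multc)
  finally show ?case by (simp add: Suc)
qed

lemma nn_integral_PiM_iprod:
  fixes M :: "nat \<Rightarrow> 'a measure"
  assumes M: "\<And>i. prob_space (M i)" and [measurable]: "\<And>k. \<phi> k \<in> borel_measurable (M k)"
    and le: "\<And>k x. \<phi> k x \<le> 1"
  shows "(NN \<omega>|PiM UNIV M. iprod (\<lambda>k. \<phi> k (\<omega> k))) = iprod (\<lambda>k. NN x|M k. \<phi> k x)"
proof -
  interpret P: prob_space "PiM UNIV M" by (rule prob_space_PiM) (rule M)
  show ?thesis
    by (subst nn_integral_iprod) (use le in \<open>auto simp: iprod_def nn_integral_PiM_prod[OF M assms(2)] P.finite_measure_axioms\<close>)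
qed

text \<open>Used to split a single independent family, indexed by a sum type, into the two sequences
  of uniform locations of the coagulation.\<close>

lemma PiM_sum_type:
  fixes M :: "'i + 'j \<Rightarrow> 'a measure"
  assumes M: "\<And>i. prob_space (M i)"
  shows "distr (PiM UNIV (\<lambda>i. M (Inl i)) \<Otimes>\<^sub>M PiM UNIV (\<lambda>j. M (Inr j))) (PiM UNIV M) (\<lambda>(a, b). case_sum a b) = PiM UNIV M"
    (is "distr (?L \<Otimes>\<^sub>M ?R) _ ?c = _")
proof -
  interpret product_prob_space M UNIV using assms by (intro product_prob_spaceI) auto
  interpret l: product_prob_space "\<lambda>i. M (Inl i)" UNIV using assms by (intro product_prob_spaceI) auto
  interpret r: product_prob_space "\<lambda>i. M (Inr i)" UNIV using assms by (intro product_prob_spaceI) auto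
  interpret P: prob_space "PiM UNIV M" by (rule prob_space_PiM) (rule assms)
  have Rs: "sigma_finite_measure ?R"
    by (intro prob_space_imp_sigma_finite prob_space_PiM M)
  have [measurable]: "(\<lambda>p. case_sum (fst p) (snd p)) \<in> ?L \<Otimes>\<^sub>M ?R \<rightarrow>\<^sub>M PiM UNIV M"
  proof (rule measurable_PiM_single')
    show "(\<lambda>p. case_sum (fst p) (snd p) i) \<in> ?L \<Otimes>\<^sub>M ?R \<rightarrow>\<^sub>M M i" for i
      by (cases i) auto
    show "(\<lambda>p. case_sum (fst p) (snd p)) \<in> space (?L \<Otimes>\<^sub>M ?R) \<rightarrow> (\<Pi>\<^sub>E i\<in>UNIV. space (M i))"
      by (auto simp: space_pair_measure space_PiM PiE_iff split: sum.split)
  qed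
  then have meas[measurable]: "?c \<in> ?L \<Otimes>\<^sub>M ?R \<rightarrow>\<^sub>M PiM UNIV M" by (simp add: split_beta)
  show ?thesis
  proof (rule measure_eqI_PiM_infinite[symmetric, where I = UNIV and M = M])
    show "finite_measure (PiM UNIV M)" by (rule P.finite_measure_axioms)
    fix A J assume J: "finite J" "J \<subseteq> UNIV" and A: "\<And>i. i \<in> J \<Longrightarrow> A i \<in> sets (M i)"
    define J1 J2 where "J1 = Inl -` J" and "J2 = Inr -` J"
    have J12: "finite J1" "finite J2" "J = Inl ` J1 \<union> Inr ` J2"
    proof -
      show "finite J1" "finite J2" unfolding J1_def J2_def using J by (auto intro!: finite_vimageI)
      show "J = Inl ` J1 \<union> Inr ` J2"
      proof (intro equalityI subsetI)
        fix x assume "x \<in> J" then show "x \<in> Inl ` J1 \<union> Inr ` J2" by (cases x) (auto simp: J1_def J2_def)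
      qed (auto simp: J1_def J2_def)
    qed
    define B where "B = prod_emb UNIV (\<lambda>i. M (Inl i)) J1 (Pi\<^sub>E J1 (\<lambda>i. A (Inl i)))"
    define C where "C = prod_emb UNIV (\<lambda>i. M (Inr i)) J2 (Pi\<^sub>E J2 (\<lambda>i. A (Inr i)))"
    have m: "B \<in> sets ?L" "C \<in> sets ?R"
      unfolding B_def C_def using J12 A by (auto intro!: sets_PiM_I)
    have emb: "prod_emb UNIV M J (Pi\<^sub>E J A) \<in> sets (PiM UNIV M)" using J A by (auto intro!: sets_PiM_I)
    have vim: "?c -` prod_emb UNIV M J (Pi\<^sub>E J A) \<inter> space (?L \<Otimes>\<^sub>M ?R) = B \<times> C"
      unfolding B_def C_def by (auto simp: prod_emb_def space_pair_measure space_PiM PiE_iff J1_def J2_def split: sum.splits)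
    have "emeasure (distr (?L \<Otimes>\<^sub>M ?R) (PiM UNIV M) ?c) (prod_emb UNIV M J (Pi\<^sub>E J A)) = emeasure ?L B * emeasure ?R C"
      using emb m by (subst emeasure_distr) (auto simp: vim sigma_finite_measure.emeasure_pair_measure_Times[OF Rs])
    also have "emeasure ?L B = (\<Prod>i\<in>J1. emeasure (M (Inl i)) (A (Inl i)))"
      unfolding B_def using J12 A by (intro l.emeasure_PiM_emb) auto
    also have "emeasure ?R C = (\<Prod>i\<in>J2. emeasure (M (Inr i)) (A (Inr i)))"
      unfolding C_def using J12 A by (intro r.emeasure_PiM_emb) auto
    also have "(\<Prod>i\<in>J1. emeasure (M (Inl i)) (A (Inl i))) * (\<Prod>i\<in>J2. emeasure (M (Inr i)) (A (Inr i))) = (\<Prod>i\<in>J. emeasure (M i) (A i))"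
      unfolding J12(3) using J12 by (subst prod.union_disjoint) (auto simp: prod.reindex)
    also have "\<dots> = emeasure (PiM UNIV M) (prod_emb UNIV M J (Pi\<^sub>E J A))"
      using J A by (intro emeasure_PiM_emb[symmetric]) auto
    finally show "emeasure (PiM UNIV M) (prod_emb UNIV M J (Pi\<^sub>E J A)) =
      emeasure (distr (?L \<Otimes>\<^sub>M ?R) (PiM UNIV M) ?c) (prod_emb UNIV M J (Pi\<^sub>E J A))" ..
  qed auto
qed

subsection \<open>Decreasing rearrangements\<close>

text \<open>The families for which \<open>ranked\<close> is a genuine rearrangement. Infinitely,
  even uncountably many zeros are allowed, since the jumps of a distribution function are indexed by
  all reals.\<close>

definition vanishing :: "('i \<Rightarrow> real) \<Rightarrow> bool" where
  "vanishing x \<longleftrightarrow> (\<forall>i. 0 \<le> x i) \<and> (\<forall>t>0. finite {i. t < x i})"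

text \<open>Replaces a cardinality bound by a quantifier over finite sets of k + 1 indices. For a
  countable index type there are only countably many of these, which yields measurability.\<close>

lemma finite_card_le_iff:
  "finite S \<and> card S \<le> k \<longleftrightarrow> \<not> (\<exists>F. finite F \<and> card F = Suc k \<and> F \<subseteq> S)"
proof (intro iffI notI)
  assume S: "finite S \<and> card S \<le> k" and "\<exists>F. finite F \<and> card F = Suc k \<and> F \<subseteq> S"
  then obtain F where "card F = Suc k" "F \<subseteq> S" by blast
  then show False using S card_mono[of S F] by simp
next
  assume n: "\<not> (\<exists>F. finite F \<and> card F = Suc k \<and> F \<subseteq> S)"
  have fin: "finite S"
  proof (rule ccontr)
    assume "infinite S"
    then show False using n infinite_arbitrarily_large[of S "Suc k"] by blast
  qed
  have "card S \<le> k"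
  proof (rule ccontr)
    assume "\<not> card S \<le> k"
    then have "Suc k \<le> card S" by simp
    then obtain F where "F \<subseteq> S" "card F = Suc k" "finite F" by (rule obtain_subset_with_card_n)
    then show False using n by blast
  qed
  with fin show "finite S \<and> card S \<le> k" ..
qed

definition rank_levels :: "('i \<Rightarrow> real) \<Rightarrow> nat \<Rightarrow> real set" where
  "rank_levels x k = {t. 0 \<le> t \<and> finite {i. t < x i} \<and> card {i. t < x i} \<le> k}"

lemma ranked_eq_Inf: "ranked x k = Inf (rank_levels x k)"
  by (simp add: ranked_def rank_levels_def)

lemma rank_levels_upward: "t \<in> rank_levels x k \<Longrightarrow> t \<le> s \<Longrightarrow> s \<in> rank_levels x k"
proof -
  assume t: "t \<in> rank_levels x k" "t \<le> s"
  then have "{i. s < x i} \<subseteq> {i. t < x i}" by auto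
  then show "s \<in> rank_levels x k"
    using t finite_subset[of "{i. s < x i}" "{i. t < x i}"] card_mono[of "{i. t < x i}" "{i. s < x i}"]
    unfolding rank_levels_def by auto
qed

lemma rank_levels_nonempty:
  assumes "vanishing x" shows "rank_levels x k \<noteq> {}"
proof -
  have f: "finite {i. 1 < x i}" using assms by (auto simp: vanishing_def)
  define t where "t = Max (insert 1 (x ` {i. 1 < x i}))"
  have le: "x i \<le> t" for i
  proof (cases "1 < x i")
    case True then show ?thesis unfolding t_def using f by (intro Max_ge) auto
  next
    case False
    have "1 \<le> t" unfolding t_def using f by (intro Max_ge) auto
    with False show ?thesis by simp
  qed
  have "1 \<le> t" unfolding t_def using f by (intro Max_ge) auto
  moreover have "{i. t < x i} = {}" using le by (auto simp: not_less)
  ultimately have "t \<in> rank_levels x k" by (simp add: rank_levels_def)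
  then show ?thesis by auto
qed

text \<open>The point is that the infimum is attained: if k + 1 masses exceeded it, so would their
  minimum, and some admissible level below that minimum would still be exceeded by all of
  them.\<close>

lemma less_ranked_iff:
  assumes v: "vanishing x" and t: "0 \<le> t"
  shows "t < ranked x k \<longleftrightarrow> \<not> (finite {i. t < x i} \<and> card {i. t < x i} \<le> k)"
proof -
  let ?A = "rank_levels x k"
  have bdd: "bdd_below ?A" by (auto simp: rank_levels_def bdd_below_def)
  note ne = rank_levels_nonempty[OF v, of k]
  have "Inf ?A \<in> ?A"
  proof (rule ccontr)
    assume n: "Inf ?A \<notin> ?A"
    have "0 \<le> Inf ?A" by (rule cInf_greatest[OF ne]) (auto simp: rank_levels_def)
    then obtain F where F: "finite F" "card F = Suc k" "F \<subseteq> {i. Inf ?A < x i}"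
      using n finite_card_le_iff[of "{i. Inf ?A < x i}" k] unfolding rank_levels_def by auto
    have Fne: "F \<noteq> {}" using F by auto
    have "Inf ?A < Min (x ` F)" using F Fne by auto
    then obtain s where s: "s \<in> ?A" "s < Min (x ` F)" using cInf_less_iff[OF ne bdd] by auto
    have "F \<subseteq> {i. s < x i}" using s F Fne by auto
    then show False using s F finite_card_le_iff[of "{i. s < x i}" k] unfolding rank_levels_def by auto
  qed
  then have "t < Inf ?A \<longleftrightarrow> t \<notin> ?A"
    using rank_levels_upward[of "Inf ?A" x k t] cInf_lower[OF _ bdd, of t] by force
  then show ?thesis using t by (auto simp: ranked_eq_Inf rank_levels_def)
qed

lemma ranked_nonneg: "vanishing x \<Longrightarrow> 0 \<le> ranked x k"
  unfolding ranked_eq_Inf by (rule cInf_greatest[OF rank_levels_nonempty]) (auto simp: rank_levels_def)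

lemma ranked_level_set:
  assumes "vanishing x" "0 \<le> t"
  shows "{k. t < ranked x k} = (if finite {i. t < x i} then {..<card {i. t < x i}} else UNIV)"
  by (auto simp: less_ranked_iff[OF assms])

lemma vanishing_ranked: "vanishing x \<Longrightarrow> vanishing (ranked x)"
  unfolding vanishing_def[of "ranked x"] by (auto simp: ranked_nonneg ranked_level_set vanishing_def)

lemma count_ranked:
  assumes "vanishing x" "0 \<le> t"
  shows "emeasure (count_space UNIV) {k. t < ranked x k} = emeasure (count_space UNIV) {i. t < x i}"
  by (auto simp: ranked_level_set[OF assms] emeasure_count_space)

lemma eq_of_less_iff:
  fixes a b :: real
  assumes "0 \<le> a" "0 \<le> b" "\<And>t. 0 \<le> t \<Longrightarrow> t < a \<longleftrightarrow> t < b"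
  shows "a = b"
  using assms(1,2) assms(3)[of a] assms(3)[of b] by force

lemma decseq_ranked:
  assumes v: "vanishing x" shows "decseq (ranked x)"
proof (rule decseq_SucI, rule ccontr)
  fix n assume "\<not> ranked x (Suc n) \<le> ranked x n"
  then have "ranked x n < ranked x (Suc n)" by simp
  then have "\<not> ranked x n < ranked x n"  "ranked x n < ranked x (Suc n)" by auto
  then show False
    unfolding less_ranked_iff[OF v ranked_nonneg[OF v, of n]] by auto
qed

text \<open>The index types may differ. This is how masses indexed by real locations are exchanged
  for masses indexed by natural numbers.\<close>

lemma ranked_cong_count:
  assumes "\<And>t. 0 \<le> t \<Longrightarrow> emeasure (count_space UNIV) {i. t < x i} = emeasure (count_space UNIV) {j. t < y j}"
  shows "ranked x = ranked y"
proof -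
  have "finite {i. t < x i} \<and> card {i. t < x i} \<le> k \<longleftrightarrow> finite {i. t < y i} \<and> card {i. t < y i} \<le> k" if "0 \<le> t" for t k
    using assms[OF that] by (auto simp: emeasure_count_space split: if_splits)
  then have "rank_levels x k = rank_levels y k" for k unfolding rank_levels_def by blast
  then show ?thesis by (auto simp: ranked_eq_Inf)
qed

lemma ranked_decseq:
  fixes p :: "nat \<Rightarrow> real"
  assumes v: "vanishing p" and d: "decseq p" shows "ranked p = p"
proof
  fix k
  show "ranked p k = p k"
  proof (rule eq_of_less_iff)
    show "0 \<le> ranked p k" "0 \<le> p k" using v ranked_nonneg by (auto simp: vanishing_def)
    fix t :: real assume t: "0 \<le> t"
    show "t < ranked p k \<longleftrightarrow> t < p k"
    proof
      assume "t < p k"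
      then have "{..k} \<subseteq> {i. t < p i}" using d by (auto simp: decseq_def intro: less_le_trans)
      then show "t < ranked p k"
        unfolding less_ranked_iff[OF v t] using card_mono[of "{i. t < p i}" "{..k}"] by auto
    next
      assume r: "t < ranked p k"
      show "t < p k"
      proof (rule ccontr)
        assume "\<not> t < p k"
        then have "{i. t < p i} \<subseteq> {..<k}" using d by (auto simp: decseq_def not_less) (metis leI order.trans not_le)
        then show False using r unfolding less_ranked_iff[OF v t]
          using finite_subset card_mono[of "{..<k}" "{i. t < p i}"] by auto
      qed
    qed
  qed
qed

lemma vanishing_scale:
  assumes v: "vanishing x" and c: "0 \<le> c" shows "vanishing (\<lambda>i. c * x i)"
proof (cases "c = 0")
  case True then show ?thesis by (simp add: vanishing_def)
next
  case False
  then have "{i. t < c * x i} = {i. t / c < x i}" for t using c by (auto simp: field_simps)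
  then show ?thesis using v c False by (auto simp: vanishing_def)
qed

lemma ranked_scale:
  assumes v: "vanishing x" and c: "0 < c" shows "ranked (\<lambda>i. c * x i) = (\<lambda>k. c * ranked x k)"
proof
  fix k
  have e: "{i. t < c * x i} = {i. t / c < x i}" for t using c by (auto simp: field_simps)
  show "ranked (\<lambda>i. c * x i) k = c * ranked x k"
  proof (rule eq_of_less_iff)
    show "0 \<le> ranked (\<lambda>i. c * x i) k" "0 \<le> c * ranked x k"
      using v c vanishing_scale[OF v, of c] by (auto intro!: ranked_nonneg mult_nonneg_nonneg)
    fix t :: real assume t: "0 \<le> t"
    have "t < c * ranked x k \<longleftrightarrow> t / c < ranked x k" using c by (auto simp: field_simps)
    then show "t < ranked (\<lambda>i. c * x i) k \<longleftrightarrow> t < c * ranked x k"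
      using c t less_ranked_iff[OF vanishing_scale[OF v, of c] t] less_ranked_iff[OF v, of "t / c"] by (simp add: e)
  qed
qed

text \<open>Above a level t > 0 both families push the counting measure to measures on the line that
  are finite and agree on half-lines, by \<open>count_ranked\<close>. Letting t tend to 0 leaves out
  only zero entries, on which \<open>g 0 = 0\<close>.\<close>

lemma nn_integral_count_ranked:
  fixes x :: "'i \<Rightarrow> real" and g :: "real \<Rightarrow> ennreal"
  assumes v: "vanishing x" and [measurable]: "g \<in> borel_measurable borel" and g0: "g 0 = 0"
  shows "(\<Sum>k. g (ranked x k)) = (NN i|count_space UNIV. g (x i))"
proof -
  have level: "(NN i|count_space UNIV. g (y i) * indicator {t<..} (y i)) = (NN s|distr (count_space {i. t < y i}) borel y. g s)"
    for y :: "'j \<Rightarrow> real" and t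
  proof -
    have "(NN i|count_space UNIV. g (y i) * indicator {t<..} (y i)) = (NN i|count_space UNIV. g (y i) * indicator {i. t < y i} i)"
      by (intro nn_integral_cong) (auto simp: indicator_def)
    also have "\<dots> = (NN i|count_space {i. t < y i}. g (y i))"
      by (simp add: nn_integral_count_space_indicator)
    finally show ?thesis by (subst nn_integral_distr) auto
  qed
  have em: "emeasure (distr (count_space {i. t < y i}) borel y) {a<..} = emeasure (count_space UNIV) {i. max a t < y i}"
    for y :: "'j \<Rightarrow> real" and t a
  proof -
    have "y -` {a<..} \<inter> {i. t < y i} = {i. max a t < y i}" by auto
    then have "emeasure (distr (count_space {i. t < y i}) borel y) {a<..} = emeasure (count_space {i. t < y i}) {i. max a t < y i}"
      by (subst emeasure_distr) simp_all
    also have "\<dots> = emeasure (count_space UNIV) {i. max a t < y i}"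
      by (subst (1 2) emeasure_count_space) auto
    finally show ?thesis .
  qed
  have eq: "(NN k|count_space UNIV. g (ranked x k) * indicator {t<..} (ranked x k)) = (NN i|count_space UNIV. g (x i) * indicator {t<..} (x i))"
    if t: "0 < t" for t
  proof -
    have "distr (count_space {k. t < ranked x k}) borel (ranked x) = distr (count_space {i. t < x i}) borel x"
    proof (rule measure_eqI_lessThan)
      fix a
      have t': "0 \<le> max a t" "0 < max a t" using t by auto
      show "emeasure (distr (count_space {k. t < ranked x k}) borel (ranked x)) {a<..} = emeasure (distr (count_space {i. t < x i}) borel x) {a<..}"
        unfolding em by (rule count_ranked[OF v t'(1)])
      show "emeasure (distr (count_space {k. t < ranked x k}) borel (ranked x)) {a<..} < \<infinity>"
        unfolding em using vanishing_ranked[OF v] t'(2) unfolding vanishing_def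
        by (subst emeasure_count_space) (auto simp: of_nat_less_top)
    qed auto
    then show ?thesis unfolding level by simp
  qed
  have lim: "(NN i|count_space UNIV. g (y i)) = (SUP n. NN i|count_space UNIV. g (y i) * indicator {inverse (real (Suc n))<..} (y i))"
    if nn: "\<And>i. 0 \<le> y i" for y :: "'j \<Rightarrow> real"
  proof -
    let ?h = "\<lambda>n i. g (y i) * indicator {inverse (real (Suc n))<..} (y i)"
    have *: "g (y i) = (SUP n. ?h n i)" for i
    proof (cases "y i = 0")
      case False
      then have "0 < y i" using nn[of i] by simp
      then obtain n where n: "inverse (real (Suc n)) < y i" using reals_Archimedean by blast
      show ?thesis
      proof (rule antisym)
        show "g (y i) \<le> (SUP n. ?h n i)"
          by (rule SUP_upper2[of n]) (use n in auto)
        show "(SUP n. ?h n i) \<le> g (y i)"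
          by (rule SUP_least) (auto simp: indicator_def)
      qed
    qed (simp add: g0)
    have inc: "incseq ?h"
    proof (intro incseq_SucI le_funI mult_left_mono)
      fix n i
      have "inverse (real (Suc (Suc n))) \<le> inverse (real (Suc n))" by (intro le_imp_inverse_le) auto
      then have sub: "{inverse (real (Suc n))<..} \<subseteq> {inverse (real (Suc (Suc n)))<..}"
        by (rule greaterThan_subset_iff[THEN iffD2])
      then show "indicator {inverse (real (Suc n))<..} (y i) \<le> (indicator {inverse (real (Suc (Suc n)))<..} (y i) :: ennreal)"
        using subsetD[OF sub, of "y i"] by (simp add: indicator_def del: greaterThan_iff of_nat_Suc)
    qed simp
    have "(NN i|count_space UNIV. g (y i)) = (NN i|count_space UNIV. SUP n. ?h n i)"
      by (intro nn_integral_cong *)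
    also have "\<dots> = (SUP n. NN i|count_space UNIV. ?h n i)"
      by (rule nn_integral_monotone_convergence_SUP[OF inc]) auto
    finally show ?thesis .
  qed
  show ?thesis
    unfolding nn_integral_count_space_nat[symmetric]
    using lim[of "ranked x"] lim[of x] v ranked_nonneg[OF v] eq[of "inverse (real (Suc n))" for n]
    by (simp add: vanishing_def del: of_nat_Suc)
qed

lemma measurable_ranked:
  fixes x :: "'a \<Rightarrow> 'i :: countable \<Rightarrow> real"
  assumes [measurable]: "\<And>i. (\<lambda>\<omega>. x \<omega> i) \<in> borel_measurable M"
  shows "(\<lambda>\<omega>. ranked (x \<omega>)) \<in> borel_measurable M"
proof (rule measurable_coordinatewise_then_product)
  fix k
  have cnt: "countable {F :: 'i set. finite F \<and> card F = Suc k}"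
    by (rule countable_subset[OF _ countable_Collect_finite]) auto
  have [measurable]: "Measurable.pred M (\<lambda>\<omega>. t \<in> rank_levels (x \<omega>) k)" for t
  proof -
    have 1: "Measurable.pred M (\<lambda>\<omega>. \<forall>i\<in>F. t < x \<omega> i)" if "finite F" for F
      using that by measurable
    have "Measurable.pred M (\<lambda>\<omega>. \<exists>F\<in>{F. finite F \<and> card F = Suc k}. \<forall>i\<in>F. t < x \<omega> i)"
    proof -
      have "{\<omega> \<in> space M. \<exists>F\<in>{F. finite F \<and> card F = Suc k}. \<forall>i\<in>F. t < x \<omega> i} =
          (\<Union>F\<in>{F. finite F \<and> card F = Suc k}. {\<omega> \<in> space M. \<forall>i\<in>F. t < x \<omega> i})" by auto
      also have "\<dots> \<in> sets M"
        using 1 by (intro sets.countable_UN'' cnt) (auto simp: pred_def)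
      finally show ?thesis by (simp add: pred_def)
    qed
    then have "Measurable.pred M (\<lambda>\<omega>. 0 \<le> t \<and> \<not> (\<exists>F\<in>{F. finite F \<and> card F = Suc k}. \<forall>i\<in>F. t < x \<omega> i))"
      by measurable
    also have "(\<lambda>\<omega>. 0 \<le> t \<and> \<not> (\<exists>F\<in>{F. finite F \<and> card F = Suc k}. \<forall>i\<in>F. t < x \<omega> i)) = (\<lambda>\<omega>. t \<in> rank_levels (x \<omega>) k)"
      by (auto simp: rank_levels_def finite_card_le_iff subset_eq fun_eq_iff)
    finally show ?thesis .
  qed
  \<comment> \<open>Since \<open>rank_levels\<close> is upward closed, rational levels detect the
    strict inequality and a natural number detects nonemptiness. The last branch is the default of
    \<open>Inf\<close> on the empty set, which is constant in \<omega>.\<close>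
  have iff: "ranked (x \<omega>) k < a \<longleftrightarrow>
      (if \<exists>n::nat. real n \<in> rank_levels (x \<omega>) k then \<exists>q. of_rat q \<in> rank_levels (x \<omega>) k \<and> of_rat q < a else Inf ({}::real set) < a)" for a \<omega>
  proof (cases "rank_levels (x \<omega>) k = {}")
    case True then show ?thesis by (simp add: ranked_eq_Inf)
  next
    case False
    then obtain s where s: "s \<in> rank_levels (x \<omega>) k" by auto
    obtain n where "s \<le> real n" using real_arch_simple by blast
    then have n: "\<exists>n::nat. real n \<in> rank_levels (x \<omega>) k" using rank_levels_upward[OF s] by blast
    have bdd: "bdd_below (rank_levels (x \<omega>) k)" by (auto simp: rank_levels_def bdd_below_def)
    have "ranked (x \<omega>) k < a \<longleftrightarrow> (\<exists>t\<in>rank_levels (x \<omega>) k. t < a)"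
      unfolding ranked_eq_Inf by (rule cInf_less_iff[OF False bdd])
    also have "\<dots> \<longleftrightarrow> (\<exists>q. of_rat q \<in> rank_levels (x \<omega>) k \<and> of_rat q < a)"
    proof
      assume "\<exists>t\<in>rank_levels (x \<omega>) k. t < a"
      then obtain t q where "t \<in> rank_levels (x \<omega>) k" "t < of_rat q" "of_rat q < a" using of_rat_dense by blast
      then show "\<exists>q. of_rat q \<in> rank_levels (x \<omega>) k \<and> of_rat q < a"
        using rank_levels_upward[of t "x \<omega>" k "of_rat q"] by (intro exI[of _ q]) auto
    qed auto
    finally show ?thesis using n by simp
  qed
  show "(\<lambda>\<omega>. ranked (x \<omega>) k) \<in> borel_measurable M"
    unfolding borel_measurable_iff_less
  proof
    fix a
    have "Measurable.pred M (\<lambda>\<omega>. ranked (x \<omega>) k < a)"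
      unfolding iff by measurable
    then show "{\<omega> \<in> space M. ranked (x \<omega>) k < a} \<in> sets M" by measurable
  qed
qed

text \<open>Markov's inequality for the counting measure.\<close>

lemma vanishing_if_nn_integral_finite:
  fixes x :: "'i \<Rightarrow> real"
  assumes nn: "\<And>i. 0 \<le> x i" and fin: "(NN i|count_space UNIV. ennreal (x i)) < \<top>"
  shows "vanishing x"
  unfolding vanishing_def
proof (intro conjI allI impI nn)
  fix t :: real assume t: "0 < t"
  have "ennreal t * emeasure (count_space UNIV) {i. t < x i} = (NN i|count_space UNIV. ennreal t * indicator {i. t < x i} i)"
    by (simp add: nn_integral_cmult)
  also have "\<dots> \<le> (NN i|count_space UNIV. ennreal (x i))"
    by (intro nn_integral_mono) (auto simp: indicator_def intro: ennreal_leI)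
  finally have "ennreal t * emeasure (count_space UNIV) {i. t < x i} < \<top>" using fin by (rule le_less_trans)
  then show "finite {i. t < x i}" using t by (auto simp: emeasure_count_space ennreal_mult_top split: if_splits)
qed

lemma vanishing_if_summable:
  fixes x :: "nat \<Rightarrow> real"
  assumes nn: "\<And>i. 0 \<le> x i" and s: "summable x"
  shows "vanishing x"
proof (rule vanishing_if_nn_integral_finite[OF nn])
  show "(NN i|count_space UNIV. ennreal (x i)) < \<top>"
    unfolding nn_integral_count_space_nat suminf_ennreal2[OF nn s] by simp
qed

definition ranked_seqs :: "(nat \<Rightarrow> real) set" where
  "ranked_seqs = {p. decseq p \<and> vanishing p}"

lemma ranked_in_ranked_seqs: "vanishing x \<Longrightarrow> ranked x \<in> ranked_seqs"
  by (simp add: ranked_seqs_def decseq_ranked vanishing_ranked)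

text \<open>No indicator in the class sees the point 0. Its mass is recovered as the difference
  between the total mass, tested by the constant 1, and the mass of the open half-line, a limit of
  the tested ones.\<close>

lemma determining_positive_halflines:
  "determining (insert (\<lambda>_. 1) ((\<lambda>t. indicator {t<..}) ` {0<..})) {0..}"
  unfolding determining_def
proof (intro allI impI)
  fix \<mu> \<nu> :: "real measure"
  assume "finite_measure \<mu>" "finite_measure \<nu>" and sets: "sets \<mu> = sets borel" "sets \<nu> = sets borel"
    and AE: "AE x in \<mu>. x \<in> {0..}" "AE x in \<nu>. x \<in> {0..}"
    and eq: "\<forall>\<phi>\<in>insert (\<lambda>_. 1) ((\<lambda>t. indicator {t<..}) ` {0<..}). (NN x|\<mu>. \<phi> x) = (NN x|\<nu>. \<phi> x)"
  then interpret m: finite_measure \<mu> + n: finite_measure \<nu> by simp_all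
  have sp: "space \<mu> = UNIV" "space \<nu> = UNIV"
    using sets_eq_imp_space_eq[OF sets(1)] sets_eq_imp_space_eq[OF sets(2)] by auto
  have e0: "emeasure \<mu> UNIV = emeasure \<nu> UNIV" using eq by (simp add: sp)
  have e1: "emeasure \<mu> {t<..} = emeasure \<nu> {t<..}" if "0 < t" for t
    using eq[rule_format, of "indicator {t<..}"] that by (simp add: sets)
  have e2: "emeasure \<mu> {0<..} = emeasure \<nu> {0<..}"
  proof -
    have U: "{0<..} = (\<Union>n. {inverse (real (Suc n))<..})"
    proof (intro equalityI subsetI)
      fix x :: real assume "x \<in> {0<..}"
      then obtain n where "inverse (real (Suc n)) < x" using reals_Archimedean by auto
      then show "x \<in> (\<Union>n. {inverse (real (Suc n))<..})" by auto
    next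
      fix x :: real assume "x \<in> (\<Union>n. {inverse (real (Suc n))<..})"
      then obtain n where "inverse (real (Suc n)) < x" by auto
      then show "x \<in> {0<..}" using less_trans[of 0 "inverse (real (Suc n))" x] by simp
    qed
    have inc: "incseq (\<lambda>n. {inverse (real (Suc n))<..})"
      by (intro incseq_SucI) (auto simp: greaterThan_subset_iff intro!: le_imp_inverse_le)
    have "emeasure M {0<..} = (SUP n. emeasure M {inverse (real (Suc n))<..})" if "sets M = sets borel" for M :: "real measure"
      unfolding U by (rule SUP_emeasure_incseq[symmetric]) (use inc in \<open>auto simp: that\<close>)
    then show ?thesis using sets e1 by simp
  qed
  have e3: "emeasure M {t<..} = emeasure M UNIV"
    if [measurable_cong]: "sets M = sets borel" and "AE x in M. x \<in> {0..}" and "t < 0" for M :: "real measure" and t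
  proof (rule emeasure_eq_AE)
    show "AE x in M. x \<in> {t<..} \<longleftrightarrow> x \<in> UNIV"
      using that(2) by eventually_elim (use that(3) in auto)
  qed (simp_all add: that(1))
  show "\<mu> = \<nu>"
  proof (rule measure_eqI_lessThan[OF sets])
    fix x
    show "emeasure \<mu> {x<..} < \<infinity>" by (simp add: m.emeasure_finite less_top[symmetric])
    show "emeasure \<mu> {x<..} = emeasure \<nu> {x<..}"
      using e1[of x] e2 e3[OF sets(1) AE(1), of x] e3[OF sets(2) AE(2), of x] e0
      by (cases x "0::real" rule: linorder_cases) auto
  qed
qed

lemma borel_seq_component: "(\<lambda>p :: nat \<Rightarrow> real. p k) \<in> borel_measurable borel"
  by (rule measurable_product_coordinates)

text \<open>The exponents \<open>\<Sum>i<n. c i * indicator {t i<..}\<close> give the Laplace transforms of the counts above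
  the levels \<open>t i\<close>, and \<open>t < p k\<close> holds iff more than \<open>k\<close> entries exceed \<open>t\<close>.\<close>

lemma ranked_seqs_measure_eqI:
  fixes \<mu> \<nu> :: "(nat \<Rightarrow> real) measure"
  assumes fin: "finite_measure \<mu>" "finite_measure \<nu>"
    and sets: "sets \<mu> = sets borel" "sets \<nu> = sets borel"
    and R: "AE p in \<mu>. p \<in> ranked_seqs" "AE p in \<nu>. p \<in> ranked_seqs"
    and eq: "\<And>(g :: real \<Rightarrow> ennreal) \<delta>. g \<in> borel_measurable borel \<Longrightarrow> 0 < \<delta> \<Longrightarrow> (\<And>x. x \<le> \<delta> \<Longrightarrow> g x = 0) \<Longrightarrow>
       (NN p|\<mu>. nexp (\<Sum>k. g (p k))) = (NN p|\<nu>. nexp (\<Sum>k. g (p k)))"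
  shows "\<mu> = \<nu>"
proof (rule seq_measure_eqI[OF fin sets _ _ _ determining_positive_halflines])
  note [measurable_cong] = sets
  let ?I = "insert (\<lambda>_. 1) ((\<lambda>t. indicator {t<..}) ` {0<..}) :: (real \<Rightarrow> ennreal) set"
  let ?E = "{\<lambda>x. ennreal (exp (- c * x)) |c. 0 \<le> c} :: (real \<Rightarrow> ennreal) set"
  note [measurable] = borel_seq_component
  have nn: "p \<in> ranked_seqs \<Longrightarrow> 0 \<le> p k" for p k by (auto simp: ranked_seqs_def vanishing_def)
  show "AE p in \<mu>. \<forall>i. p i \<in> {0..}" "AE p in \<nu>. \<forall>i. p i \<in> {0..}"
    using R nn by (auto elim!: eventually_mono)
  define N :: "real \<Rightarrow> (nat \<Rightarrow> real) \<Rightarrow> real" where "N t p = enn2real (\<Sum>k. indicator {t<..} (p k))" for t p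
  have Nm[measurable]: "N t \<in> borel_measurable borel" for t unfolding N_def by measurable
  have N: "(\<Sum>k. indicator {t<..} (p k)) = ennreal (N t p)" "N t p = real (card {k. t < p k})" "finite {k. t < p k}"
    if "p \<in> ranked_seqs" "0 < t" for t p
  proof -
    show f: "finite {k. t < p k}" using that by (auto simp: ranked_seqs_def vanishing_def)
    have "(\<Sum>k. indicator {t<..} (p k) :: ennreal) = (NN k|count_space UNIV. indicator {k. t < p k} k)"
      by (subst nn_integral_count_space_nat, intro arg_cong[where f = suminf] ext) (simp add: indicator_def)
    also have "\<dots> = of_nat (card {k. t < p k})" using f by (simp add: emeasure_count_space)
    finally have *: "(\<Sum>k. indicator {t<..} (p k) :: ennreal) = of_nat (card {k. t < p k})" .
    then show "N t p = real (card {k. t < p k})" unfolding N_def by simp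
    with * show "(\<Sum>k. indicator {t<..} (p k)) = ennreal (N t p)" by (simp add: ennreal_of_nat_eq_real_of_nat)
  qed
  have less: "t < p k \<longleftrightarrow> real k < N t p" if p: "p \<in> ranked_seqs" and t: "0 < t" for p t k
  proof -
    have "p = ranked p" "vanishing p" using p ranked_decseq by (auto simp: ranked_seqs_def)
    then have "t < p k \<longleftrightarrow> k < card {i. t < p i}"
      using less_ranked_iff[of p t k] N(3)[OF p t] t by auto
    then show ?thesis by (simp add: N(2)[OF p t])
  qed
  show "{0::real..} \<in> sets borel" by simp
  show "\<phi> \<in> borel_measurable borel" if "\<phi> \<in> ?I" for \<phi>
    using that by auto
  show "\<phi> x \<le> 1" if "\<phi> \<in> ?I" for \<phi> x
    using that by (auto simp: indicator_def)
  fix n and \<phi> :: "nat \<Rightarrow> real \<Rightarrow> ennreal"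
  assume phi: "\<And>i. i < n \<Longrightarrow> \<phi> i \<in> ?I"
  have "\<exists>t>0. \<phi> i = (\<lambda>_. 1) \<or> \<phi> i = indicator {t<..}" if "i < n" for i
    using phi[OF that] by (auto intro: exI[of _ 1])
  then obtain t where "\<forall>i. i < n \<longrightarrow> 0 < t i \<and> (\<phi> i = (\<lambda>_. 1) \<or> \<phi> i = indicator {t i<..})" by metis
  then have t: "\<And>i. i < n \<Longrightarrow> 0 < t i" "\<And>i. i < n \<Longrightarrow> \<phi> i = (\<lambda>_. 1) \<or> \<phi> i = indicator {t i<..}" by auto
  \<comment> \<open>Levels beyond \<open>n\<close> are filled with an arbitrary positive value, so
    that the counts form an infinite sequence and \<open>seq_measure_eqI\<close> applies to their
    law.\<close>
  define s where "s i = (if i < n then t i else 1)" for i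
  have s: "0 < s i" for i using t by (simp add: s_def)
  define L where "L M = distr M borel (\<lambda>p i. N (s i) p)" for M
  have [measurable]: "(\<lambda>p i. N (s i) p) \<in> borel \<rightarrow>\<^sub>M seqs"
    by (intro measurable_coordinatewise_then_product) measurable
  have NL[measurable]: "(\<lambda>p i. N (s i) p) \<in> M \<rightarrow>\<^sub>M seqs" if [measurable_cong]: "sets M = sets borel" for M
    by measurable
  have nnL: "AE x in L M. \<forall>i. x i \<in> {0..}" if [measurable_cong]: "sets M = sets borel" for M
  proof -
    have "0 \<le> N t p" for t p by (simp add: N_def)
    then show ?thesis unfolding L_def by (subst AE_distr_iff[OF NL[OF that]]) auto
  qed
  let ?f = "\<lambda>i y. if \<phi> i = (\<lambda>_. 1) then 1 else indicator {real i<..} (y :: real) :: ennreal"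
  have "L \<mu> = L \<nu>"
  proof (rule seq_measure_eqI[OF _ _ _ _ _ _ _ determining_laplace])
    show "finite_measure (L \<mu>)" "finite_measure (L \<nu>)"
      unfolding L_def using sets fin by (auto intro!: finite_measure.finite_measure_distr)
    show "sets (L \<mu>) = sets borel" "sets (L \<nu>) = sets borel" by (simp_all add: L_def)
    show "AE x in L \<mu>. \<forall>i. x i \<in> {0..}" "AE x in L \<nu>. \<forall>i. x i \<in> {0..}" using nnL sets by auto
    show "{0::real..} \<in> sets borel" by simp
    show "\<psi> \<in> borel_measurable borel" if "\<psi> \<in> ?E" for \<psi> using that by auto
    show "\<psi> x \<le> 1" if "\<psi> \<in> ?E" "x \<in> {0..}" for \<psi> and x :: real using that by auto
    fix m and \<psi> :: "nat \<Rightarrow> real \<Rightarrow> ennreal"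
    assume "\<And>i. i < m \<Longrightarrow> \<psi> i \<in> ?E"
    then have "\<exists>c\<ge>0. \<psi> i = (\<lambda>x. ennreal (exp (- c * x)))" if "i < m" for i using that by blast
    then obtain c where c: "\<And>i. i < m \<Longrightarrow> 0 \<le> c i" "\<And>i. i < m \<Longrightarrow> \<psi> i = (\<lambda>x. ennreal (exp (- c i * x)))" by metis
    have [measurable]: "\<psi> i \<in> borel_measurable borel" if "i < m" for i using c(2)[OF that] by simp
    define g where "g x = (\<Sum>i<m. ennreal (c i) * indicator {s i<..} x)" for x :: real
    have gm: "g \<in> borel_measurable borel" unfolding g_def by measurable
    \<comment> \<open>The smallest level in use, below which \<open>g\<close> vanishes. The inserted
      1 covers the case \<open>m = 0\<close>.\<close>
    define \<delta> where "\<delta> = Min (insert 1 (s ` {..<m}))"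
    have d: "0 < \<delta>" unfolding \<delta>_def using s by auto
    have "\<delta> \<le> s i" if "i < m" for i unfolding \<delta>_def using that by (intro Min_le) auto
    then have g0: "g x = 0" if "x \<le> \<delta>" for x unfolding g_def using that
      by (intro sum.neutral) (force simp: indicator_def not_less)
    have *: "(NN x|L M. (\<Prod>i<m. \<psi> i (x i))) = (NN p|M. nexp (\<Sum>k. g (p k)))"
      if [measurable_cong]: "sets M = sets borel" and R: "AE p in M. p \<in> ranked_seqs" for M
    proof -
      have "(NN x|L M. (\<Prod>i<m. \<psi> i (x i))) = (NN p|M. (\<Prod>i<m. \<psi> i (N (s i) p)))"
        unfolding L_def by (rule nn_integral_distr[OF NL[OF that(1)]]) measurable
      also have "\<dots> = (NN p|M. nexp (\<Sum>k. g (p k)))"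
      proof (rule nn_integral_cong_on[OF R], goal_cases elim)
        case (elim p)
        have "(\<Sum>k. g (p k)) = (\<Sum>i<m. ennreal (c i) * (\<Sum>k. indicator {s i<..} (p k)))"
          unfolding g_def by (subst suminf_sum) auto
        also have "\<dots> = (\<Sum>i<m. ennreal (c i * N (s i) p))"
          using N(1)[OF elim s] c(1) by (intro sum.cong) (auto simp: ennreal_mult')
        also have "nexp \<dots> = (\<Prod>i<m. nexp (ennreal (c i * N (s i) p)))" by (simp add: nexp_sum)
        also have "\<dots> = (\<Prod>i<m. \<psi> i (N (s i) p))"
          using c N(2)[OF elim s] by (intro prod.cong) (auto simp: nexp_ennreal)
        finally show ?case by simp
      qed
      finally show ?thesis .
    qed
    show "(NN x|L \<mu>. (\<Prod>i<m. \<psi> i (x i))) = (NN x|L \<nu>. (\<Prod>i<m. \<psi> i (x i)))"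
      unfolding *[OF sets(1) R(1)] *[OF sets(2) R(2)] by (rule eq[OF gm d g0])
  qed
  moreover have "(NN p|M. (\<Prod>i<n. \<phi> i (p i))) = (NN x|L M. (\<Prod>i<n. ?f i (x i)))"
    if [measurable_cong]: "sets M = sets borel" and R: "AE p in M. p \<in> ranked_seqs" for M
  proof -
    have "(NN x|L M. (\<Prod>i<n. ?f i (x i))) =
       (NN p|M. (\<Prod>i<n. ?f i (N (s i) p)))"
      unfolding L_def by (rule nn_integral_distr[OF NL[OF that(1)]]) measurable
    also have "\<dots> = (NN p|M. (\<Prod>i<n. \<phi> i (p i)))"
    proof (rule nn_integral_cong_on[OF R], goal_cases elim)
      case (elim p)
      show ?case
      proof (rule prod.cong)
        fix i assume "i \<in> {..<n}"
        then have i: "i < n" by simp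
        show "?f i (N (s i) p) = \<phi> i (p i)"
          using t(2)[OF i] less[OF elim s[of i], of i] i by (auto simp: s_def indicator_def)
      qed simp
    qed
    finally show ?thesis ..
  qed
  ultimately show "(NN p|\<mu>. (\<Prod>i<n. \<phi> i (p i))) = (NN p|\<nu>. (\<Prod>i<n. \<phi> i (p i)))"
    using sets R by simp
qed

subsection \<open>The stable intensity\<close>

lemma nn_integral_Gamma:
  fixes a u :: real
  assumes a: "0 < a" and u: "0 < u"
  shows "(NN x|lborel. ennreal (x powr (a - 1) * exp (- (u * x))) * indicator {0<..} x) = ennreal (Gamma a * u powr (- a))" (is "?I = _")
proof -
  have "(NN x|lborel. ennreal (indicator {0..} x * (x powr (a - 1) / exp x))) = ennreal (Gamma a)"
    by (rule nn_integral_has_integral_lebesgue[OF _ Gamma_integral_real[OF a]]) auto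
  moreover have "(NN x|lborel. ennreal (indicator {0..} x * (x powr (a - 1) / exp x))) =
      (NN x|lborel. ennreal (x powr (a - 1) / exp x) * indicator {0<..} x)"
    by (intro nn_integral_cong) (auto simp: indicator_def)
  ultimately have "ennreal (Gamma a) = (NN x|lborel. ennreal (x powr (a - 1) / exp x) * indicator {0<..} x)" by simp
  also have "\<dots> = ennreal u * (NN x|lborel. ennreal ((u * x) powr (a - 1) / exp (u * x)) * indicator {0<..} (u * x))"
    using u by (subst nn_integral_real_affine[where c = u and t = 0]) auto
  also have "(NN x|lborel. ennreal ((u * x) powr (a - 1) / exp (u * x)) * indicator {0<..} (u * x)) =
     (NN x|lborel. ennreal (u powr (a - 1)) * (ennreal (x powr (a - 1) * exp (- (u * x))) * indicator {0<..} x))"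
    using u by (intro nn_integral_cong) (auto simp: indicator_def powr_mult exp_minus field_simps zero_less_mult_iff ennreal_mult[symmetric])
  also have "\<dots> = ennreal (u powr (a - 1)) * (NN x|lborel. (ennreal (x powr (a - 1) * exp (- (u * x))) * indicator {0<..} x))"
    by (rule nn_integral_cmult) measurable
  finally have *: "ennreal (Gamma a) = ennreal (u powr a) * (NN x|lborel. (ennreal (x powr (a - 1) * exp (- (u * x))) * indicator {0<..} x))"
    using u by (simp add: mult.assoc[symmetric] ennreal_mult[symmetric] powr_mult_base)
  have "ennreal (Gamma a * u powr (- a)) = ennreal (u powr (- a)) * ennreal (Gamma a)"
    using Gamma_real_pos[OF a] by (subst ennreal_mult[symmetric]) (auto simp: mult.commute)
  also have "\<dots> = ennreal (u powr (- a) * u powr a) * (NN x|lborel. (ennreal (x powr (a - 1) * exp (- (u * x))) * indicator {0<..} x))"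
    unfolding * by (simp add: mult.assoc[symmetric] ennreal_mult[symmetric])
  also have "u powr (- a) * u powr a = 1" using u by (simp add: powr_minus)
  finally show ?thesis by simp
qed

lemma sets_stable_intensity [measurable_cong, simp]: "sets (stable_intensity \<gamma>) = sets borel"
  by (simp add: stable_intensity_def)

lemma space_stable_intensity [simp]: "space (stable_intensity \<gamma>) = UNIV"
  by (simp add: stable_intensity_def)

lemma nn_integral_stable_intensity:
  assumes [measurable]: "g \<in> borel_measurable borel"
  shows "(NN x|stable_intensity \<gamma>. g x) = (NN x|lborel. ennreal (\<gamma> / Gamma (1 - \<gamma>) * x powr (- \<gamma> - 1)) * indicator {0<..} x * g x)"
  unfolding stable_intensity_def by (subst nn_integral_density) auto

lemma stable_intensity_nonpos: "emeasure (stable_intensity \<gamma>) {..0} = 0"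
proof -
  have "emeasure (stable_intensity \<gamma>) {..0} = (NN x|(lborel :: real measure). 0)"
    unfolding stable_intensity_def
    by (subst emeasure_density, simp, simp, intro nn_integral_cong) (auto simp: indicator_def)
  then show ?thesis by simp
qed

lemma sigma_finite_stable_intensity: "sigma_finite_measure (stable_intensity \<gamma>)"
  unfolding stable_intensity_def by (subst sigma_finite_measure.sigma_finite_iff_density_finite[OF lborel.sigma_finite_measure_axioms]) (auto simp: indicator_def)

context
  fixes \<gamma> :: real assumes \<gamma>: "0 < \<gamma>" "\<gamma> < 1"
begin

lemma Gamma_one_minus_pos: "0 < Gamma (1 - \<gamma>)"
  using \<gamma> by (intro Gamma_real_pos) auto

text \<open>Self-similarity of the stable intensity. It is what trades a rescaling of the points by
  a total mass for a power of that mass.\<close>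

lemma nn_integral_stable_intensity_scale:
  assumes [measurable]: "g \<in> borel_measurable borel" and a: "0 < a"
  shows "(NN x|stable_intensity \<gamma>. g (a * x)) = ennreal (a powr \<gamma>) * (NN x|stable_intensity \<gamma>. g x)"
proof -
  define c where "c = \<gamma> / Gamma (1 - \<gamma>)"
  have c: "0 < c" using \<gamma> Gamma_one_minus_pos by (simp add: c_def)
  have "(NN x|stable_intensity \<gamma>. g x) = (NN x|lborel. ennreal (c * x powr (- \<gamma> - 1)) * indicator {0<..} x * g x)"
    by (simp add: nn_integral_stable_intensity c_def)
  also have "\<dots> = ennreal a * (NN x|lborel. ennreal (c * (a * x) powr (- \<gamma> - 1)) * indicator {0<..} (a * x) * g (a * x))"
    using a by (subst nn_integral_real_affine[where c = a and t = 0]) auto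
  also have "\<dots> = (NN x|lborel. ennreal (a powr (- \<gamma>)) * (ennreal (c * x powr (- \<gamma> - 1)) * indicator {0<..} x * g (a * x)))"
  proof (subst nn_integral_cmult[symmetric], simp, intro nn_integral_cong)
    fix x :: real
    have "a * (a * x) powr (- \<gamma> - 1) = a powr (- \<gamma>) * x powr (- \<gamma> - 1)" if "0 < x"
      using a that by (simp add: powr_mult powr_diff powr_minus field_simps)
    then have "0 < x \<Longrightarrow> ennreal a * ennreal (c * (a * x) powr (- \<gamma> - 1)) = ennreal (a powr (- \<gamma>)) * ennreal (c * x powr (- \<gamma> - 1))"
      using a c by (simp add: ennreal_mult[symmetric] mult.left_commute)
    then show "ennreal a * (ennreal (c * (a * x) powr (- \<gamma> - 1)) * indicator {0<..} (a * x) * g (a * x)) =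
      ennreal (a powr (- \<gamma>)) * (ennreal (c * x powr (- \<gamma> - 1)) * indicator {0<..} x * g (a * x))"
      using a by (auto simp: indicator_def zero_less_mult_iff mult.assoc[symmetric])
  qed
  also have "\<dots> = ennreal (a powr (- \<gamma>)) * (NN x|stable_intensity \<gamma>. g (a * x))"
    by (subst nn_integral_cmult) (auto simp: nn_integral_stable_intensity c_def)
  finally have "ennreal (a powr \<gamma>) * (NN x|stable_intensity \<gamma>. g x) = ennreal (a powr \<gamma> * a powr (- \<gamma>)) * (NN x|stable_intensity \<gamma>. g (a * x))"
    by (simp add: ennreal_mult mult.assoc)
  also have "a powr \<gamma> * a powr (- \<gamma>) = 1" using a by (simp add: powr_minus)
  finally show ?thesis by simp
qed

text \<open>The tail explains the factor Gamma (1 - \<gamma>) in \<open>local_time\<close>: with it,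
  the number of points above a small level is normalized to 1.\<close>

lemma emeasure_stable_intensity_atLeast:
  assumes t: "0 < t"
  shows "emeasure (stable_intensity \<gamma>) {t..} = ennreal (t powr (- \<gamma>) / Gamma (1 - \<gamma>))"
proof -
  have "emeasure (stable_intensity \<gamma>) {t..} = (NN x|lborel. ennreal (\<gamma> / Gamma (1 - \<gamma>) * x powr (- \<gamma> - 1)) * indicator {t..} x)"
    unfolding stable_intensity_def using t by (subst emeasure_density) (auto intro!: nn_integral_cong simp: indicator_def)
  also have "\<dots> = ennreal (0 - (- (t powr (- \<gamma>) / Gamma (1 - \<gamma>))))"
  proof (rule nn_integral_FTC_atLeast)
    fix x assume "t \<le> x"
    then have x: "0 < x" using t by simp
    then show "((\<lambda>x. - (x powr (- \<gamma>) / Gamma (1 - \<gamma>))) has_real_derivative \<gamma> / Gamma (1 - \<gamma>) * x powr (- \<gamma> - 1)) (at x)"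
      using Gamma_one_minus_pos by (auto intro!: derivative_eq_intros simp: powr_diff)
    show "0 \<le> \<gamma> / Gamma (1 - \<gamma>) * x powr (- \<gamma> - 1)" using \<gamma> Gamma_one_minus_pos by simp
  next
    have "((\<lambda>x. x powr (- \<gamma>)) \<longlongrightarrow> 0) at_top"
      using \<gamma> by (intro tendsto_neg_powr filterlim_ident) auto
    from tendsto_minus[OF tendsto_divide[OF this tendsto_const[of "Gamma (1 - \<gamma>)"]]]
    show "((\<lambda>x. - (x powr (- \<gamma>) / Gamma (1 - \<gamma>))) \<longlongrightarrow> 0) at_top"
      using Gamma_one_minus_pos by simp
  qed simp
  finally show ?thesis by simp
qed

lemma emeasure_stable_intensity_greaterThan_finite:
  assumes "0 < t" shows "emeasure (stable_intensity \<gamma>) {t<..} < \<infinity>"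
proof -
  have "emeasure (stable_intensity \<gamma>) {t<..} \<le> emeasure (stable_intensity \<gamma>) {t..}"
    by (rule emeasure_mono) auto
  also have "\<dots> < \<infinity>" by (simp add: emeasure_stable_intensity_atLeast[OF assms])
  finally show ?thesis .
qed

lemma nn_integral_stable_intensity_exp:
  assumes u: "0 < u"
  shows "(NN x|stable_intensity \<gamma>. ennreal (x * exp (- (u * x)))) = ennreal (\<gamma> * u powr (\<gamma> - 1))"
proof -
  have "(NN x|stable_intensity \<gamma>. ennreal (x * exp (- (u * x)))) =
    (NN x|lborel. ennreal (\<gamma> / Gamma (1 - \<gamma>)) * (ennreal (x powr ((1 - \<gamma>) - 1) * exp (- (u * x))) * indicator {0<..} x))"
    using \<gamma> Gamma_one_minus_pos
    by (subst nn_integral_stable_intensity)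
       (auto intro!: nn_integral_cong simp: indicator_def ennreal_mult[symmetric] powr_diff powr_minus field_simps)
  also have "\<dots> = ennreal (\<gamma> / Gamma (1 - \<gamma>)) * ennreal (Gamma (1 - \<gamma>) * u powr (- (1 - \<gamma>)))"
    using nn_integral_Gamma[of "1 - \<gamma>" u] u \<gamma> by (subst nn_integral_cmult) auto
  also have "\<dots> = ennreal (\<gamma> * u powr (\<gamma> - 1))"
    using \<gamma> Gamma_one_minus_pos less_imp_neq[OF Gamma_one_minus_pos] by (subst ennreal_mult[symmetric]) auto
  finally show ?thesis .
qed

text \<open>Write 1 - exp (- l x) as the integral of x exp (- u x) over u in [0, l] and exchange the
  integrals; the inner one is \<open>nn_integral_stable_intensity_exp\<close>, an elementary power
  of u.\<close>

lemma nn_integral_stable_intensity_Laplace: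
  assumes l: "0 \<le> l"
  shows "(NN x|stable_intensity \<gamma>. ennreal (1 - exp (- (l * x)))) = ennreal (l powr \<gamma>)"
proof (cases "l = 0")
  case False
  with l have l: "0 < l" by simp
  let ?\<nu> = "stable_intensity \<gamma>"
  have sf: "sigma_finite_measure ?\<nu>" by (rule sigma_finite_stable_intensity)
  interpret n: sigma_finite_measure ?\<nu> by (rule sf)
  interpret pair_sigma_finite ?\<nu> "lborel :: real measure" ..
  have pos: "AE x in ?\<nu>. 0 < x"
    by (rule AE_I[where N = "{..0}"]) (auto simp: stable_intensity_nonpos)
  have "(NN x|?\<nu>. ennreal (1 - exp (- (l * x)))) = (NN x|?\<nu>. NN u|lborel. ennreal (x * exp (- (u * x))) * indicator {0..l} u * indicator {0<..} x)"
  proof (rule nn_integral_cong_on[OF pos], goal_cases elim)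
    case (elim x)
    have "(NN u|lborel. ennreal (x * exp (- (u * x))) * indicator {0..l} u) = ennreal (- exp (- (l * x)) - (- exp (- (0 * x))))"
      using elim l by (intro nn_integral_FTC_Icc) (auto intro!: derivative_eq_intros)
    then show ?case using elim by simp
  qed
  also have "\<dots> = (NN u|lborel. NN x|?\<nu>. ennreal (x * exp (- (u * x))) * indicator {0..l} u * indicator {0<..} x)"
    by (rule Fubini'[symmetric]) measurable
  also have "\<dots> = (NN u|lborel. ennreal (indicator {0..l} u * (\<gamma> * u powr (\<gamma> - 1))))"
  proof (rule nn_integral_cong_AE, rule AE_mp[OF AE_lborel_singleton[of 0]], rule AE_I2, rule impI)
    fix u :: real assume "u \<noteq> 0"
    show "(NN x|?\<nu>. ennreal (x * exp (- (u * x))) * indicator {0..l} u * indicator {0<..} x) = ennreal (indicator {0..l} u * (\<gamma> * u powr (\<gamma> - 1)))"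
    proof (cases "u \<in> {0..l}")
      case True
      with \<open>u \<noteq> 0\<close> have u: "0 < u" by simp
      have "(NN x|?\<nu>. ennreal (x * exp (- (u * x))) * indicator {0..l} u * indicator {0<..} x) = (NN x|?\<nu>. ennreal (x * exp (- (u * x))))"
        using True by (intro nn_integral_cong_AE AE_mp[OF pos AE_I2]) auto
      also have "\<dots> = ennreal (\<gamma> * u powr (\<gamma> - 1))" by (rule nn_integral_stable_intensity_exp[OF u])
      finally show ?thesis using True by simp
    qed simp
  qed
  also have "\<dots> = ennreal (l powr \<gamma>)"
  proof (rule nn_integral_has_integral_lebesgue)
    have "((\<lambda>x. x powr (\<gamma> - 1)) has_integral l powr (\<gamma> - 1 + 1) / (\<gamma> - 1 + 1)) {0..l}"
      using \<gamma> l by (intro has_integral_powr_from_0) auto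
    from has_integral_mult_right[OF this, of \<gamma>] show "((\<lambda>u. \<gamma> * u powr (\<gamma> - 1)) has_integral l powr \<gamma>) {0..l}"
      using \<gamma> by simp
  qed (use \<gamma> in auto)
  finally show ?thesis .
qed simp

end

subsection \<open>The Laplace functional of a ranked Poisson process\<close>

locale ranked_poisson = prob_space D for D :: "(nat \<Rightarrow> real) measure" +
  fixes \<nu> :: "real measure"
  assumes sets_D [measurable_cong, simp]: "sets D = sets borel"
    and points: "ranked_poisson_points D \<nu> (\<lambda>j. j)"
    and sets_nu [measurable_cong, simp]: "sets \<nu> = sets borel"
    and sigma_finite_nu: "sigma_finite_measure \<nu>"
    and nu_finite: "\<And>t. 0 < t \<Longrightarrow> emeasure \<nu> {t<..} < \<infinity>"
    and nu_nonpos: "emeasure \<nu> {..0} = 0"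
begin

lemma space_D [simp]: "space D = UNIV" "space \<nu> = UNIV"
  using sets_eq_imp_space_eq[OF sets_D] sets_eq_imp_space_eq[OF sets_nu] by auto

lemma AE_nu_pos: "AE x in \<nu>. 0 < x"
  by (rule AE_I[where N = "{..0}"]) (auto simp: nu_nonpos)

lemma AE_points:
  "AE p in D. (\<forall>i. 0 < p i)"  "AE p in D. (\<forall>i. p (Suc i) < p i)"
  using points by (auto simp: ranked_poisson_points_def)

lemma AE_finite_points:
  assumes "A \<in> sets borel" "emeasure \<nu> A < \<infinity>" shows "AE p in D. finite {i. p i \<in> A}"
  using points assms by (auto simp: ranked_poisson_points_def)

lemma AE_ranked_seqs: "AE p in D. p \<in> ranked_seqs"
proof -
  have "AE p in D. \<forall>n::nat. finite {i. p i \<in> {inverse (real (Suc n))<..}}"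
    unfolding AE_all_countable by (rule allI, rule AE_finite_points, simp, rule nu_finite, simp)
  then have fin: "AE p in D. vanishing p"
    using AE_points(1)
  proof eventually_elim
    case (elim p)
    have "finite {i. t < p i}" if t: "0 < t" for t
    proof -
      obtain n where n: "inverse (real (Suc n)) < t" using t reals_Archimedean by blast
      have "{i. t < p i} \<subseteq> {i. p i \<in> {inverse (real (Suc n))<..}}"
      proof
        fix i assume "i \<in> {i. t < p i}"
        then have "t < p i" by simp
        with n have "inverse (real (Suc n)) < p i" by (rule less_trans)
        then show "i \<in> {i. p i \<in> {inverse (real (Suc n))<..}}" by simp
      qed
      then show ?thesis by (rule finite_subset) (rule elim(1)[rule_format])
    qed
    then show ?case using less_imp_le[OF elim(2)[rule_format]] by (simp add: vanishing_def)
  qed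
  then show ?thesis
    using AE_points(2)
  proof eventually_elim
    case (elim p)
    have "decseq p" by (intro decseq_SucI) (rule less_imp_le[OF elim(2)[rule_format]])
    with elim(1) show ?case by (simp add: ranked_seqs_def)
  qed
qed

text \<open>Measurability of a count is extracted from the independence clause, applied to a family
  with one member.\<close>

lemma count_measurable:
  assumes "A \<in> sets borel" "emeasure \<nu> A < \<infinity>"
  shows "(\<lambda>p. card {i. p i \<in> A}) \<in> D \<rightarrow>\<^sub>M count_space UNIV"
proof -
  have "indep_vars (\<lambda>_. count_space UNIV) (\<lambda>m p. card {i. p i \<in> A}) {..<Suc 0}"
    using points assms unfolding ranked_poisson_points_def
    by (elim conjE allE[of _ "\<lambda>_. A"] allE[of _ "Suc 0"]) (auto simp: disjoint_family_on_def)
  then show ?thesis by (auto simp: indep_vars_def2)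
qed

lemma nn_integral_exp_count:
  assumes A: "A \<in> sets borel" "emeasure \<nu> A < \<infinity>" and c: "0 \<le> c"
  shows "(NN p|D. ennreal (exp (- c * real (card {i. p i \<in> A})))) = ennreal (exp (- (measure \<nu> A * (1 - exp (- c)))))"
proof -
  let ?N = "\<lambda>p :: nat \<Rightarrow> real. card {i. p i \<in> A}" and ?m = "measure \<nu> A"
  note [measurable] = count_measurable[OF A]
  have "(NN p|D. ennreal (exp (- c * real (?N p)))) = (NN p|D. (\<Sum>k. ennreal (exp (- c * real k)) * indicator {p. ?N p = k} p))"
  proof (intro nn_integral_cong)
    fix p
    have "(\<Sum>k. ennreal (exp (- c * real k)) * indicator {p. ?N p = k} p) = (\<Sum>k\<in>{?N p}. ennreal (exp (- c * real k)) * indicator {p. ?N p = k} p)"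
      by (rule suminf_finite) auto
    then show "ennreal (exp (- c * real (?N p))) = (\<Sum>k. ennreal (exp (- c * real k)) * indicator {p. ?N p = k} p)"
      by simp
  qed
  also have "\<dots> = (\<Sum>k. NN p|D. ennreal (exp (- c * real k)) * indicator {p\<in>space D. ?N p = k} p)"
    by (subst nn_integral_suminf[symmetric]) auto
  also have "\<dots> = (\<Sum>k. ennreal ((?m * exp (- c)) ^ k /\<^sub>R fact k * exp (- ?m)))"
  proof (intro arg_cong[where f = suminf] ext)
    fix k
    have "measure D {p\<in>space D. ?N p = k} = ?m ^ k / fact k * exp (- ?m)"
      using points A by (auto simp: ranked_poisson_points_def)
    then show "(NN p|D. ennreal (exp (- c * real k)) * indicator {p\<in>space D. ?N p = k} p) = ennreal ((?m * exp (- c)) ^ k /\<^sub>R fact k * exp (- ?m))"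
      by (subst nn_integral_cmult_indicator)
         (simp_all add: emeasure_eq_measure ennreal_mult[symmetric] power_mult_distrib exp_of_nat_mult[symmetric] field_simps)
  qed
  also have "\<dots> = ennreal (exp (?m * exp (- c)) * exp (- ?m))"
    by (intro suminf_ennreal_eq sums_mult2 exp_converges) simp
  also have "exp (?m * exp (- c)) * exp (- ?m) = exp (- (?m * (1 - exp (- c))))" by (simp add: exp_add[symmetric] algebra_simps)
  finally show ?thesis .
qed

text \<open>Over disjoint sets the sum over points is a linear combination of independent Poisson
  counts, so the functional is a product of Poisson generating functions. At each x at most one
  summand is nonzero, which lets the exponents be recombined into one integral.\<close>

lemma laplace_functional_step:
  fixes n :: nat
  assumes A: "\<And>m. m < n \<Longrightarrow> A m \<in> sets borel" "\<And>m. m < n \<Longrightarrow> emeasure \<nu> (A m) < \<infinity>"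
    and disj: "disjoint_family_on A {..<n}" and c: "\<And>m. m < n \<Longrightarrow> 0 \<le> c m"
  shows "(NN p|D. nexp (\<Sum>k. \<Sum>m<n. ennreal (c m) * indicator (A m) (p k))) =
    nexp (NN x|\<nu>. 1 - nexp (\<Sum>m<n. ennreal (c m) * indicator (A m) x))"
proof -
  let ?e = "\<lambda>m p. exp (- c m * real (card {i. p i \<in> A m}))"
  let ?m = "\<lambda>m. ennreal (measure \<nu> (A m) * (1 - exp (- c m)))"
  have fin: "AE p in D. \<forall>m\<in>{..<n}. finite {i. p i \<in> A m}"
    by (subst AE_ball_countable) (auto intro!: AE_finite_points A)
  have "(NN p|D. nexp (\<Sum>k. \<Sum>m<n. ennreal (c m) * indicator (A m) (p k))) =
      (NN p|D. (\<Prod>m<n. ennreal (?e m p)))"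
  proof (rule nn_integral_cong_on[OF fin], goal_cases elim)
    case (elim p)
    have "(\<Sum>k. \<Sum>m<n. ennreal (c m) * indicator (A m) (p k)) = (\<Sum>m<n. ennreal (c m) * (\<Sum>k. indicator (A m) (p k)))"
      by (subst suminf_sum) auto
    also have "\<dots> = (\<Sum>m<n. ennreal (c m * real (card {i. p i \<in> A m})))"
    proof (rule sum.cong)
      fix m assume m: "m \<in> {..<n}"
      have "(\<Sum>k. indicator (A m) (p k) :: ennreal) = (NN k|count_space UNIV. indicator {k. p k \<in> A m} k)"
        by (subst nn_integral_count_space_nat, intro arg_cong[where f = suminf] ext) (simp add: indicator_def)
      also have "\<dots> = of_nat (card {k. p k \<in> A m})" using elim m by (simp add: emeasure_count_space)
      finally show "ennreal (c m) * (\<Sum>k. indicator (A m) (p k)) = ennreal (c m * real (card {i. p i \<in> A m}))"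
        using c m by (simp add: ennreal_mult ennreal_of_nat_eq_real_of_nat)
    qed simp
    also have "nexp \<dots> = (\<Prod>m<n. ennreal (?e m p))"
      using c by (auto simp: nexp_sum nexp_ennreal intro!: prod.cong)
    finally show ?case .
  qed
  also have "\<dots> = (\<Prod>m<n. NN p|D. ennreal (?e m p))"
  proof (rule indep_vars_nn_integral)
    have "indep_vars (\<lambda>_. count_space UNIV) (\<lambda>m p. card {i. p i \<in> A m}) {..<n}"
      using points A disj unfolding ranked_poisson_points_def by blast
    then show "indep_vars (\<lambda>_. borel) (\<lambda>m p. ennreal (?e m p)) {..<n}"
      by (rule indep_vars_compose2[where Y = "\<lambda>m k. ennreal (exp (- c m * real k))"]) auto
  qed auto
  also have "\<dots> = (\<Prod>m<n. nexp (?m m))"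
  proof (rule prod.cong)
    fix m assume "m \<in> {..<n}"
    then show "(NN p|D. ennreal (?e m p)) = nexp (?m m)"
      using A c by (subst nn_integral_exp_count) (auto simp: nexp_ennreal)
  qed simp
  also have "\<dots> = nexp (\<Sum>m<n. ?m m)"
    by (simp add: nexp_sum)
  also have "(\<Sum>m<n. ?m m) = (\<Sum>m<n. NN x|\<nu>. ennreal (1 - exp (- c m)) * indicator (A m) x)"
  proof (rule sum.cong)
    fix m assume "m \<in> {..<n}"
    then have m: "A m \<in> sets \<nu>" "emeasure \<nu> (A m) \<noteq> \<top>" "0 \<le> c m" using A[of m] c by auto
    then show "?m m = (NN x|\<nu>. ennreal (1 - exp (- c m)) * indicator (A m) x)"
      by (subst nn_integral_cmult_indicator) (simp_all add: emeasure_eq_ennreal_measure ennreal_mult[symmetric] mult.commute)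
  qed simp
  also have "\<dots> = (NN x|\<nu>. (\<Sum>m<n. ennreal (1 - exp (- c m)) * indicator (A m) x))"
  proof (rule nn_integral_sum[symmetric])
    fix m assume "m \<in> {..<n}"
    then have [measurable]: "A m \<in> sets borel" using A by auto
    have "(\<lambda>x. ennreal (1 - exp (- c m)) * indicator (A m) x) \<in> borel_measurable borel" by measurable
    then show "(\<lambda>x. ennreal (1 - exp (- c m)) * indicator (A m) x) \<in> borel_measurable \<nu>"
      by (simp cong: measurable_cong_sets)
  qed
  also have "\<dots> = (NN x|\<nu>. 1 - nexp (\<Sum>m<n. ennreal (c m) * indicator (A m) x))"
  proof (intro nn_integral_cong)
    fix x
    show "(\<Sum>m<n. ennreal (1 - exp (- c m)) * indicator (A m) x) = 1 - nexp (\<Sum>m<n. ennreal (c m) * indicator (A m) x)"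
    proof (cases "\<exists>m<n. x \<in> A m")
      case True
      then obtain m where m: "m < n" "x \<in> A m" by auto
      have z: "x \<notin> A i" if "i < n" "i \<noteq> m" for i
        using disj m that unfolding disjoint_family_on_def by (metis disjoint_iff lessThan_iff)
      have s: "(\<Sum>i<n. f i * indicator (A i) x) = f m" for f :: "nat \<Rightarrow> ennreal"
        using m z by (subst sum.remove[of _ m]) (auto intro!: sum.neutral)
      show ?thesis unfolding s using c[OF m(1)] by (simp add: nexp_ennreal ennreal_minus flip: ennreal_1)
    next
      case False
      then show ?thesis by auto
    qed
  qed
  finally show ?thesis .
qed

lemma laplace_functional_simple:
  fixes g :: "real \<Rightarrow> ennreal"
  assumes g: "simple_function borel g" "\<And>x. g x < \<top>" and t: "0 < t" "\<And>x. x \<le> t \<Longrightarrow> g x = 0"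
  shows "(NN p|D. nexp (\<Sum>k. g (p k))) = nexp (NN x|\<nu>. 1 - nexp (g x))"
proof -
  \<comment> \<open>Only nonzero values are enumerated: the level set of 0 contains a neighbourhood
    of 0, where the intensity may be infinite.\<close>
  define n where "n = card (range g - {0})"
  have "finite (range g)" using g(1) by (auto simp: simple_function_def)
  then obtain e where e: "bij_betw e {..<n} (range g - {0})"
    using ex_bij_betw_nat_finite[of "range g - {0}"] by (auto simp: n_def atLeast0LessThan)
  define A where "A m = g -` {e m}" for m
  have em: "e m \<noteq> 0" "e m < \<top>" if "m < n" for m
  proof -
    have "e m \<in> range g - {0}" using bij_betwE[OF e] that by auto
    then show "e m \<noteq> 0" "e m < \<top>" using g(2) by auto
  qed
  have [measurable]: "g \<in> borel_measurable borel" using g(1) by (rule borel_measurable_simple_function)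
  have A: "A m \<in> sets borel" "emeasure \<nu> (A m) < \<infinity>" if "m < n" for m
  proof -
    show "A m \<in> sets borel" using measurable_sets[of g borel borel "{e m}"] by (simp add: A_def)
    have "A m \<subseteq> {t<..}" using t(2) em[OF that] by (force simp: A_def not_le[symmetric])
    then have "emeasure \<nu> (A m) \<le> emeasure \<nu> {t<..}" by (intro emeasure_mono) auto
    then show "emeasure \<nu> (A m) < \<infinity>" using nu_finite[OF t(1)] by (rule le_less_trans)
  qed
  have disj: "disjoint_family_on A {..<n}"
    using bij_betw_imp_inj_on[OF e] by (auto simp: disjoint_family_on_def A_def inj_on_def)
  have "g x = (\<Sum>m<n. ennreal (enn2real (e m)) * indicator (A m) x)" for x
  proof (cases "g x = 0")
    case True
    then show ?thesis using em by (auto simp: A_def indicator_def intro!: sum.neutral[symmetric])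
  next
    case False
    then have "g x \<in> e ` {..<n}" using e by (simp add: bij_betw_def)
    then obtain m where m: "m < n" "e m = g x" by auto
    have z: "x \<notin> A i" if "i < n" "i \<noteq> m" for i
      using m that bij_betw_imp_inj_on[OF e] unfolding A_def inj_on_def by auto
    have "(\<Sum>m<n. ennreal (enn2real (e m)) * indicator (A m) x) = ennreal (enn2real (e m)) * indicator (A m) x"
      using m(1) z by (subst sum.remove[of _ m]) (auto intro!: sum.neutral)
    also have "\<dots> = ennreal (enn2real (e m))" using m(2) by (simp add: A_def)
    finally have "(\<Sum>m<n. ennreal (enn2real (e m)) * indicator (A m) x) = ennreal (enn2real (e m))" .
    then show ?thesis using m g(2)[of x] by simp
  qed
  then have "g = (\<lambda>x. \<Sum>m<n. ennreal (enn2real (e m)) * indicator (A m) x)" by auto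
  with laplace_functional_step[of n A "\<lambda>m. enn2real (e m)", OF A disj] show ?thesis by simp
qed

theorem laplace_functional:
  fixes g :: "real \<Rightarrow> ennreal"
  assumes g[measurable]: "g \<in> borel_measurable borel"
  shows "(NN p|D. nexp (\<Sum>k. g (p k))) = nexp (NN x|\<nu>. 1 - nexp (g x))"
proof -
  obtain f where f: "\<And>i. simple_function borel (f i)" "incseq f" "\<And>i x. f i x < \<top>" "\<And>x. (SUP i. f i x) = g x"
    using borel_measurable_implies_simple_function_sequence'[OF g] by metis
  \<comment> \<open>The cutoff makes each \<open>h i\<close> vanish near 0, as
    \<open>laplace_functional_simple\<close> requires, and disappears in the supremum at every
    positive point. Both sides then pass to the limit monotonically.\<close>
  define h where "h i x = f i x * indicator {inverse (real (Suc i))<..} x" for i x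
  have hs: "simple_function borel (h i)" for i unfolding h_def using f(1) by (intro simple_function_mult) auto
  have [measurable]: "h i \<in> borel_measurable borel" for i using hs by (rule borel_measurable_simple_function)
  have hinc: "incseq h"
  proof (intro incseq_SucI le_funI)
    fix i x
    have "inverse (real (Suc (Suc i))) \<le> inverse (real (Suc i))" by (intro le_imp_inverse_le) auto
    moreover have "f i x \<le> f (Suc i) x" using f(2) by (auto simp: incseq_Suc_iff le_fun_def)
    ultimately show "h i x \<le> h (Suc i) x"
      using le_less_trans[of "inverse (real (Suc (Suc i)))" "inverse (real (Suc i))" x]
      by (cases "inverse (real (Suc i)) < x") (simp_all add: h_def del: of_nat_Suc)
  qed
  have hincx: "incseq (\<lambda>i. h i x)" for x using hinc by (auto simp: incseq_def le_fun_def)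
  have hsup: "(SUP i. h i x) = g x" if x: "0 < x" for x
  proof (rule antisym)
    show "(SUP i. h i x) \<le> g x" unfolding f(4)[symmetric]
      by (intro SUP_mono) (auto simp: h_def indicator_def)
    show "g x \<le> (SUP i. h i x)" unfolding f(4)[symmetric]
    proof (rule SUP_least)
      fix i
      obtain n where n: "inverse (real (Suc n)) < x" using x reals_Archimedean by blast
      have "inverse (real (Suc (max i n))) \<le> inverse (real (Suc n))" by (intro le_imp_inverse_le) auto
      then have "inverse (real (Suc (max i n))) < x" using n by (rule le_less_trans)
      then have "f (max i n) x = h (max i n) x" by (simp add: h_def del: of_nat_Suc)
      moreover have "f i x \<le> f (max i n) x" using f(2) by (auto simp: incseq_def le_fun_def)
      ultimately show "f i x \<le> (SUP i. h i x)" by (intro SUP_upper2[of "max i n"]) auto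
    qed
  qed
  have simp: "(NN p|D. nexp (\<Sum>k. h i (p k))) = nexp (NN x|\<nu>. 1 - nexp (h i x))" for i
    by (rule laplace_functional_simple[OF hs, where t = "inverse (real (Suc i))"])
       (use f(3)[of i] in \<open>auto simp: h_def indicator_def\<close>)
  have "(NN p|D. nexp (\<Sum>k. g (p k))) = (NN p|D. (INF i. nexp (\<Sum>k. h i (p k))))"
  proof (rule nn_integral_cong_on[OF AE_points(1)], goal_cases elim)
    case (elim p)
    have "(\<Sum>k. g (p k)) = (\<Sum>k. SUP i. h i (p k))" using elim by (simp add: hsup)
    also have "\<dots> = (SUP i. \<Sum>k. h i (p k))"
      by (rule ennreal_suminf_SUP_eq) (rule hincx)
    finally show ?case
      using hincx by (subst nexp_SUP[symmetric]) (auto simp: incseq_def intro!: suminf_le)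
  qed
  also have "\<dots> = (INF i. NN p|D. nexp (\<Sum>k. h i (p k)))"
  proof (rule nn_integral_monotone_convergence_INF_decseq)
    show "decseq (\<lambda>i p. nexp (\<Sum>k. h i (p k)))"
      using hincx unfolding monotone_on_def le_fun_def
      by (auto simp: incseq_def intro!: nexp_antimono suminf_le)
    have "(NN p|D. nexp (\<Sum>k. h 0 (p k))) \<le> (NN p|D. 1)" by (intro nn_integral_mono) auto
    then show "(NN p|D. nexp (\<Sum>k. h 0 (p k))) < \<infinity>"
      using emeasure_space_1 by (simp add: le_less_trans)
  qed measurable
  also have "\<dots> = (INF i. nexp (NN x|\<nu>. 1 - nexp (h i x)))" by (simp add: simp)
  also have "\<dots> = nexp (SUP i. NN x|\<nu>. 1 - nexp (h i x))"
    using hincx by (subst nexp_SUP) (auto simp: incseq_def intro!: nn_integral_mono ennreal_minus_mono nexp_antimono)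
  also have "(SUP i. NN x|\<nu>. 1 - nexp (h i x)) = (NN x|\<nu>. (SUP i. 1 - nexp (h i x)))"
  proof (rule nn_integral_monotone_convergence_SUP[symmetric])
    show "incseq (\<lambda>i x. 1 - nexp (h i x))"
      using hincx by (auto simp: incseq_def le_fun_def intro!: ennreal_minus_mono nexp_antimono)
  qed measurable
  also have "\<dots> = (NN x|\<nu>. 1 - nexp (g x))"
    by (rule nn_integral_cong_on[OF AE_nu_pos]) (simp add: SUP_const_minus_ennreal nexp_SUP[OF hincx, symmetric] hsup)
  finally show ?thesis .
qed

corollary product_functional:
  fixes \<Psi> :: "real \<Rightarrow> ennreal"
  assumes [measurable]: "\<Psi> \<in> borel_measurable borel" and le: "\<And>x. \<Psi> x \<le> 1"
  shows "(NN p|D. iprod (\<lambda>k. \<Psi> (p k))) = nexp (NN x|\<nu>. 1 - \<Psi> x)"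
proof -
  have "(NN p|D. iprod (\<lambda>k. \<Psi> (p k))) = (NN p|D. nexp (\<Sum>k. nlog (\<Psi> (p k))))"
    by (simp add: iprod_nexp[symmetric] nexp_nlog le)
  also have "\<dots> = nexp (NN x|\<nu>. 1 - nexp (nlog (\<Psi> x)))" by (rule laplace_functional) measurable
  finally show ?thesis by (simp add: nexp_nlog le)
qed

end

subsection \<open>The Mecke formula\<close>

text \<open>Halving the step replaces 1 - e * e by 2 * (1 - e), and the difference is the square of
  1 - e. Dyadic steps thus make the difference quotients increase, so the derivative can be taken by
  monotone convergence.\<close>

lemma dyadic_quotient_mono:
  "2 ^ j * (1 - nexp (ennreal (1 / 2 ^ j) * N)) \<le> 2 ^ Suc j * (1 - nexp (ennreal (1 / 2 ^ Suc j) * N))"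
proof (cases N)
  case (real r)
  define e where "e = exp (- (1 / 2 ^ Suc j * r))"
  have e: "0 < e" "e \<le> 1" using real by (auto simp: e_def)
  have e2: "exp (- (1 / 2 ^ j * r)) = e * e" by (simp add: e_def exp_add[symmetric] field_simps)
  have n: "nexp (ennreal (1 / 2 ^ i) * N) = ennreal (exp (- (1 / 2 ^ i * r)))" for i
    using real by (simp add: nexp_ennreal ennreal_mult[symmetric] del: times_divide_eq_left)
  have "2 ^ j * (1 - e * e) \<le> 2 ^ Suc j * (1 - e)"
  proof -
    have "0 \<le> (1 - e) * (1 - e)" by (rule zero_le_square)
    then have "1 - e * e \<le> 2 * (1 - e)" by (simp add: algebra_simps)
    then have "2 ^ j * (1 - e * e) \<le> 2 ^ j * (2 * (1 - e))" by (intro mult_left_mono) auto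
    then show ?thesis by simp
  qed
  moreover have "(2::ennreal) ^ i = ennreal (2 ^ i)" for i by (simp add: ennreal_power[symmetric])
  moreover have "1 - ennreal x = ennreal (1 - x)" if "0 \<le> x" for x using that by (simp add: ennreal_minus flip: ennreal_1)
  ultimately show ?thesis
    using e mult_le_one[of e e] unfolding n e2 e_def[symmetric]
    by (auto simp: ennreal_mult[symmetric] simp del: power_Suc intro!: ennreal_leI)
next
  case top
  have "1 / 2 ^ i \<noteq> (0::real)" for i by simp
  then have *: "nexp (ennreal (1 / 2 ^ i) * N) = 0" for i
    unfolding top by (subst ennreal_mult_top) (auto simp: ennreal_eq_0_iff not_le)
  have "(2::ennreal) ^ j \<le> 2 ^ Suc j" by (intro power_increasing) auto
  then show ?thesis unfolding * by simp
qed

text \<open>These are difference quotients at 0 of 1 - exp (- q x * b). A general \<open>q\<close>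
  covers the identity as well as the increment 1 - exp (- e) that occurs in
  \<open>mecke_laplace\<close>.\<close>

lemma dyadic_quotient_LIMSEQ:
  assumes b: "0 \<le> b" and q: "q 0 = 0" "(q has_real_derivative 1) (at 0)" "\<And>x. 0 \<le> x \<Longrightarrow> 0 \<le> q x"
  shows "(\<lambda>j. 2 ^ j * (1 - nexp (ennreal (q (1 / 2 ^ j)) * ennreal b))) \<longlonglongrightarrow> ennreal b"
proof -
  define h where "h x = - exp (- (q x * b))" for x
  have "(h has_real_derivative b) (at 0)"
    unfolding h_def by (rule derivative_eq_intros q(2) refl | simp add: q(1))+
  then have h: "((\<lambda>x. (h x - h 0) / x) \<longlongrightarrow> b) (at 0)"
    by (simp add: has_field_derivative_iff)
  have "filterlim (\<lambda>j. 1 / 2 ^ j :: real) (at 0) sequentially"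
    unfolding filterlim_at using LIMSEQ_divide_realpow_zero[of 2 1] by auto
  from filterlim_compose[OF h this] have "(\<lambda>j. 2 ^ j * (1 - exp (- (q (1 / 2 ^ j) * b)))) \<longlonglongrightarrow> b"
    unfolding h_def q(1) by (simp add: divide_inverse mult.commute)
  then have "(\<lambda>j. ennreal (2 ^ j * (1 - exp (- (q (1 / 2 ^ j) * b))))) \<longlonglongrightarrow> ennreal b" by (rule tendsto_ennrealI)
  moreover have "ennreal (2 ^ j * (1 - exp (- (q (1 / 2 ^ j) * b)))) = 2 ^ j * (1 - nexp (ennreal (q (1 / 2 ^ j)) * ennreal b))" for j
  proof -
    have "ennreal (2 ^ j * z) = 2 ^ j * ennreal z" for z
      by (subst ennreal_mult') (simp_all add: ennreal_power[symmetric])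
    then show ?thesis using b q(3)[of "1 / 2 ^ j"]
      by (simp add: nexp_ennreal ennreal_mult[symmetric] ennreal_minus flip: ennreal_1)
  qed
  ultimately show ?thesis by simp
qed

lemma dyadic_quotient_SUP: "(SUP j. 2 ^ j * (1 - nexp (ennreal (1 / 2 ^ j) * N))) = N"
proof (cases N)
  case (real r)
  have "(\<lambda>j. 2 ^ j * (1 - nexp (ennreal (1 / 2 ^ j) * N))) \<longlonglongrightarrow> N"
    using dyadic_quotient_LIMSEQ[of r "\<lambda>x. x"] real by simp
  moreover have "incseq (\<lambda>j. 2 ^ j * (1 - nexp (ennreal (1 / 2 ^ j) * N)))"
    by (intro incseq_SucI dyadic_quotient_mono)
  ultimately show ?thesis using LIMSEQ_SUP LIMSEQ_unique by blast
next
  case top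
  have "1 / 2 ^ i \<noteq> (0::real)" for i by simp
  then have *: "nexp (ennreal (1 / 2 ^ i) * N) = 0" for i
    unfolding top by (subst ennreal_mult_top) (auto simp: ennreal_eq_0_iff not_le)
  have "(SUP j. ennreal (2 ^ j)) = \<top>"
  proof (rule ennreal_SUP_eq_top)
    fix n :: nat
    have "real n \<le> 2 ^ n" by (simp add: less_imp_le of_nat_less_two_power)
    then show "\<exists>i\<in>UNIV. of_nat n \<le> ennreal (2 ^ i)"
      by (intro bexI[of _ n]) (auto simp: ennreal_of_nat_eq_real_of_nat intro!: ennreal_leI)
  qed
  then show ?thesis unfolding * by (simp add: top ennreal_power[symmetric])
qed

lemma ennreal_one_minus_mult:
  fixes x y :: ennreal
  assumes "x \<le> 1" "y < \<top>" shows "(1 - x) * y = y - y * x"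
proof -
  obtain r s where "x = ennreal r" "0 \<le> r" "r \<le> 1" "y = ennreal s" "0 \<le> s"
    using assms by (cases x; cases y) (auto simp: top_unique)
  then show ?thesis
    by (simp add: ennreal_minus ennreal_mult[symmetric] algebra_simps flip: ennreal_1)
qed

lemma ranked_seqs_measurable [measurable]: "ranked_seqs \<in> sets borel"
proof -
  have "ranked_seqs = {p. (\<forall>k. p (Suc k) \<le> p k) \<and> (\<forall>k. 0 \<le> p k) \<and> (\<forall>n::nat. \<exists>k. p k \<le> inverse (real (Suc n)))}" (is "_ = ?R")
  proof (intro equalityI subsetI)
    fix p assume p: "p \<in> ranked_seqs"
    have "\<exists>k. p k \<le> inverse (real (Suc n))" for n
    proof (rule ccontr)
      assume "\<nexists>k. p k \<le> inverse (real (Suc n))"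
      then have "{k. inverse (real (Suc n)) < p k} = UNIV" by (auto simp: not_le)
      then show False using p by (auto simp: ranked_seqs_def vanishing_def dest: spec[of _ "inverse (real (Suc n))"])
    qed
    then show "p \<in> ?R" using p by (auto simp: ranked_seqs_def vanishing_def decseq_Suc_iff)
  next
    fix p assume p: "p \<in> ?R"
    have d: "decseq p" using p by (auto simp: decseq_Suc_iff)
    have "finite {k. t < p k}" if t: "0 < t" for t
    proof -
      obtain n where n: "inverse (real (Suc n)) < t" using t reals_Archimedean by blast
      obtain k where k: "p k \<le> inverse (real (Suc n))" using p by blast
      have "{i. t < p i} \<subseteq> {..<k}"
      proof
        fix i assume i: "i \<in> {i. t < p i}"
        show "i \<in> {..<k}"
        proof (rule ccontr)
          assume "i \<notin> {..<k}"
          then have "p i \<le> p k" using d by (auto simp: decseq_def)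
          with i k n show False by simp
        qed
      qed
      then show ?thesis using finite_subset by blast
    qed
    then show "p \<in> ranked_seqs" using p d by (auto simp: ranked_seqs_def vanishing_def)
  qed
  also have "?R = (\<Inter>k. {p. p (Suc k) \<le> p k}) \<inter> (\<Inter>k. {p. 0 \<le> p k}) \<inter> (\<Inter>n::nat. \<Union>k. {p. p k \<le> inverse (real (Suc n))})"
    by auto
  also have "\<dots> \<in> sets borel"
  proof -
    have "{p :: nat \<Rightarrow> real. p (Suc k) \<le> p k} \<in> sets borel" "{p :: nat \<Rightarrow> real. 0 \<le> p k} \<in> sets borel"
        "{p. p k \<le> c} \<in> sets borel" for k and c :: real
      using borel_measurable_le[OF borel_seq_component[of "Suc k"] borel_seq_component[of k]]
        borel_measurable_le[OF borel_measurable_const borel_seq_component[of k], of 0]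
        borel_measurable_le[OF borel_seq_component[of k] borel_measurable_const, of c]
      by simp_all
    then show ?thesis by (intro sets.Int sets.countable_INT'' sets.countable_UN'') auto
  qed
  finally show ?thesis .
qed

section \<open>Inserting a point into a ranked sequence\<close>

lemma measurable_insert_point: "(\<lambda>(x, p). ranked (case_nat x p)) \<in> borel \<Otimes>\<^sub>M borel \<rightarrow>\<^sub>M seqs"
  unfolding split_beta
proof (rule measurable_ranked)
  show "(\<lambda>q. case i of 0 \<Rightarrow> fst q | Suc k \<Rightarrow> snd q k) \<in> borel_measurable (borel \<Otimes>\<^sub>M seqs)" for i
    by (cases i) auto
qed

lemma vanishing_case_nat: "0 \<le> x \<Longrightarrow> vanishing p \<Longrightarrow> vanishing (case_nat x p)"
proof -
  assume x: "0 \<le> x" and p: "vanishing p"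
  have "{i. t < case_nat x p i} \<subseteq> insert 0 (Suc ` {i. t < p i})" for t
  proof
    fix i assume "i \<in> {i. t < case_nat x p i}"
    then show "i \<in> insert 0 (Suc ` {i. t < p i})" by (cases i) auto
  qed
  moreover have "finite (insert 0 (Suc ` {i. t < p i}))" if "0 < t" for t
    using p that by (simp add: vanishing_def)
  ultimately have "finite {i. t < case_nat x p i}" if "0 < t" for t
    using that finite_subset by blast
  moreover have "0 \<le> case_nat x p i" for i using x p by (cases i) (auto simp: vanishing_def)
  ultimately show ?thesis by (simp add: vanishing_def)
qed

lemma suminf_insert_point:
  fixes g :: "real \<Rightarrow> ennreal"
  assumes "0 \<le> x" "vanishing p" and [measurable]: "g \<in> borel_measurable borel" and "g 0 = 0"
  shows "(\<Sum>k. g (ranked (case_nat x p) k)) = g x + (\<Sum>k. g (p k))"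
proof -
  have "(\<Sum>k. g (ranked (case_nat x p) k)) = (\<Sum>k. g (case_nat x p k))"
    using nn_integral_count_ranked[OF vanishing_case_nat[OF assms(1,2)], of g] assms(3,4)
    by (simp add: nn_integral_count_space_nat)
  also have "\<dots> = g x + (\<Sum>k. g (p k))"
    by (subst suminf_offset[where i = 1]) auto
  finally show ?thesis .
qed

context ranked_poisson
begin

text \<open>Differentiate the Laplace functional of \<open>g + \<epsilon> * indicator A\<close> at \<open>\<epsilon> = 0\<close>.\<close>

lemma mecke_laplace:
  fixes g :: "real \<Rightarrow> ennreal"
  assumes A[measurable]: "A \<in> sets borel" and finA: "emeasure \<nu> A < \<infinity>" and g[measurable]: "g \<in> borel_measurable borel"
  shows "(NN p|D. (\<Sum>k. indicator A (p k)) * nexp (\<Sum>k. g (p k))) =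
    (NN x|\<nu>. indicator A x * nexp (g x)) * nexp (NN x|\<nu>. 1 - nexp (g x))"
proof -
  define N :: "(nat \<Rightarrow> real) \<Rightarrow> ennreal" where "N p = (\<Sum>k. indicator A (p k))" for p
  define G where "G p = (\<Sum>k. g (p k))" for p :: "nat \<Rightarrow> real"
  have [measurable]: "N \<in> borel_measurable borel" "G \<in> borel_measurable borel"
    unfolding N_def G_def by measurable
  define a where "a = (NN x|\<nu>. 1 - nexp (g x))"
  define b where "b = (NN x|\<nu>. indicator A x * nexp (g x))"
  have bfin: "b < \<top>"
  proof -
    have "b \<le> (NN x|\<nu>. indicator A x * 1)" unfolding b_def by (intro nn_integral_mono mult_left_mono) auto
    also have "\<dots> < \<top>" using finA by simp
    finally show ?thesis .
  qed
  \<comment> \<open>Adding e times the indicator of \<open>A\<close> to \<open>g\<close> raises the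
    Laplace exponent by \<open>q e\<close> times the integral \<open>b\<close>, because exp (- e)
    multiplies \<open>nexp (g x)\<close> exactly on \<open>A\<close>.\<close>
  define q where "q e = 1 - exp (- e)" for e :: real
  let ?e = "\<lambda>j p. 2 ^ j * (1 - nexp (ennreal (1 / 2 ^ j) * N p)) * nexp (G p)"
  let ?d = "\<lambda>j. 2 ^ j * (1 - nexp (ennreal (q (1 / 2 ^ j)) * b))"
  have LF: "(NN p|D. nexp (G p + ennreal e * N p)) = nexp a * nexp (ennreal (q e) * b)" if e: "0 \<le> e" for e
  proof -
    have "(NN p|D. nexp (G p + ennreal e * N p)) = (NN p|D. nexp (\<Sum>k. g (p k) + ennreal e * indicator A (p k)))"
      unfolding G_def N_def by (simp add: suminf_add[symmetric])
    also have "\<dots> = nexp (NN x|\<nu>. 1 - nexp (g x + ennreal e * indicator A x))"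
      by (rule laplace_functional) measurable
    also have "(NN x|\<nu>. 1 - nexp (g x + ennreal e * indicator A x)) = (NN x|\<nu>. (1 - nexp (g x)) + ennreal (q e) * (indicator A x * nexp (g x)))"
    proof (intro nn_integral_cong)
      fix x
      obtain r where r: "nexp (g x) = ennreal r" "0 \<le> r" "r \<le> 1"
        using nexp_le_1[of "g x"] by (cases "nexp (g x)") (auto simp: top_unique)
      have "exp (- e) \<le> 1" using e by simp
      then have "r * exp (- e) \<le> 1" using r by (simp add: mult_le_one)
      have *: "ennreal (1 - r * exp (- e)) = ennreal (1 - r) + ennreal (r - r * exp (- e))"
        using r \<open>exp (- e) \<le> 1\<close> by (subst ennreal_plus[symmetric]) (auto simp: mult_left_le)
      show "1 - nexp (g x + ennreal e * indicator A x) = 1 - nexp (g x) + ennreal (q e) * (indicator A x * nexp (g x))"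
        using r e \<open>exp (- e) \<le> 1\<close> \<open>r * exp (- e) \<le> 1\<close>
        by (cases "x \<in> A") (auto simp: nexp_add nexp_ennreal q_def ennreal_mult[symmetric] ennreal_minus algebra_simps * simp flip: ennreal_1)
    qed
    also have "\<dots> = a + ennreal (q e) * b"
      unfolding a_def b_def by (subst nn_integral_add) (auto simp: nn_integral_cmult)
    finally show ?thesis by (simp add: nexp_add)
  qed
  have fin: "(NN p|D. nexp (G p + ennreal e * N p)) \<noteq> \<top>" for e
  proof -
    have "(NN p|D. nexp (G p + ennreal e * N p)) \<le> (NN p|D. 1)" by (intro nn_integral_mono) auto
    then show ?thesis using emeasure_space_1 by (auto simp: top_unique)
  qed
  have diff: "(NN p|D. ?e j p) =
     nexp a * ?d j" for j
  proof -
    have "(NN p|D. ?e j p) =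
      (NN p|D. 2 ^ j * (nexp (G p + ennreal 0 * N p) - nexp (G p + ennreal (1 / 2 ^ j) * N p)))"
      by (intro nn_integral_cong) (simp add: nexp_add mult.assoc ennreal_one_minus_mult)
    also have "\<dots> = 2 ^ j * ((NN p|D. nexp (G p + ennreal 0 * N p)) - (NN p|D. nexp (G p + ennreal (1 / 2 ^ j) * N p)))"
      by (subst nn_integral_cmult, measurable, subst nn_integral_diff)
         (use fin in \<open>auto intro!: nexp_antimono AE_I2\<close>)
    also have "\<dots> = 2 ^ j * (nexp a - nexp a * nexp (ennreal (q (1 / 2 ^ j)) * b))"
      by (subst (1 2) LF) (auto simp: q_def)
    also have "\<dots> = nexp a * ?d j"
      by (subst ennreal_one_minus_mult[symmetric]) (simp_all add: ac_simps)
    finally show ?thesis .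
  qed
  have "(NN p|D. N p * nexp (G p)) = (NN p|D. SUP j. ?e j p)"
    by (simp add: SUP_mult_right_ennreal[symmetric] dyadic_quotient_SUP)
  also have "\<dots> = (SUP j. NN p|D. ?e j p)"
  proof (rule nn_integral_monotone_convergence_SUP)
    show "incseq ?e"
      by (intro incseq_SucI le_funI mult_right_mono dyadic_quotient_mono) simp
  qed measurable
  also have "\<dots> = (SUP j. nexp a * ?d j)" by (simp add: diff)
  also have "\<dots> = nexp a * b"
  proof -
    have inc: "incseq (\<lambda>j. nexp a * ?d j)"
      unfolding diff[symmetric]
      by (intro incseq_SucI nn_integral_mono mult_right_mono dyadic_quotient_mono) simp
    obtain r where r: "b = ennreal r" "0 \<le> r" using bfin by (cases b) auto
    have "?d \<longlonglongrightarrow> b"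
      unfolding r(1) by (rule dyadic_quotient_LIMSEQ[OF r(2)]) (auto simp: q_def intro!: derivative_eq_intros)
    then have "(\<lambda>j. nexp a * ?d j) \<longlonglongrightarrow> nexp a * b"
      by (intro ennreal_tendsto_cmult) auto
    with LIMSEQ_SUP[OF inc] show ?thesis by (rule LIMSEQ_unique)
  qed
  finally show ?thesis unfolding N_def G_def a_def b_def by (simp add: mult.commute)
qed

text \<open>As functionals of \<Phi> both sides are integrals against finite measures on ranked
  sequences. Their Laplace functionals agree by \<open>mecke_laplace\<close>, since inserting
  \<open>x\<close> multiplies the functional by \<open>nexp (g x)\<close>.\<close>

lemma mecke_indicator:
  fixes \<Phi> :: "(nat \<Rightarrow> real) \<Rightarrow> ennreal"
  assumes A[measurable]: "A \<in> sets borel" and finA: "emeasure \<nu> A < \<infinity>" and Phi[measurable]: "\<Phi> \<in> borel_measurable borel"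
  shows "(NN p|D. (\<Sum>k. indicator A (p k)) * \<Phi> p) = (NN x|\<nu>. indicator A x * (NN p|D. \<Phi> (ranked (case_nat x p))))"
proof -
  interpret n: sigma_finite_measure \<nu> by (rule sigma_finite_nu)
  note [measurable] = measurable_insert_point
  define \<mu>1 where "\<mu>1 = density D (\<lambda>p. \<Sum>k. indicator A (p k))"
  define \<mu>2 where "\<mu>2 = distr (density \<nu> (indicator A) \<Otimes>\<^sub>M D) borel (\<lambda>(x, p). ranked (case_nat x p))"
  have ins[measurable]: "(\<lambda>(x, p). ranked (case_nat x p)) \<in> density \<nu> (indicator A) \<Otimes>\<^sub>M D \<rightarrow>\<^sub>M borel"
    using measurable_insert_point by (subst measurable_cong_sets[OF sets_pair_measure_cong refl]) auto
  have i1: "(NN p|\<mu>1. F p) = (NN p|D. (\<Sum>k. indicator A (p k)) * F p)" if [measurable]: "F \<in> borel_measurable borel" for F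
    unfolding \<mu>1_def by (rule nn_integral_density) measurable
  have i2: "(NN p|\<mu>2. F p) = (NN x|\<nu>. indicator A x * (NN p|D. F (ranked (case_nat x p))))"
    if F[measurable]: "F \<in> borel_measurable borel" for F
  proof -
    have [measurable]: "(\<lambda>q. F (ranked (case_nat (fst q) (snd q)))) \<in> borel_measurable (borel \<Otimes>\<^sub>M borel)"
      using measurable_compose[OF measurable_insert_point F] by (simp add: split_beta)
    have "(NN p|\<mu>2. F p) = (NN q|(density \<nu> (indicator A) \<Otimes>\<^sub>M D). F (ranked (case_nat (fst q) (snd q))))"
      unfolding \<mu>2_def by (subst nn_integral_distr[OF ins]) (auto simp: split_beta)
    also have "\<dots> = (NN x|density \<nu> (indicator A). NN p|D. F (ranked (case_nat x p)))"
      by (subst nn_integral_fst[symmetric]) auto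
    also have "\<dots> = (NN x|\<nu>. indicator A x * (NN p|D. F (ranked (case_nat x p))))"
      by (rule nn_integral_density) measurable
    finally show ?thesis .
  qed
  have "\<mu>1 = \<mu>2"
  proof (rule ranked_seqs_measure_eqI)
    have eq: "(NN p|\<mu>1. nexp (\<Sum>k. g (p k))) = (NN p|\<mu>2. nexp (\<Sum>k. g (p k)))"
      if g[measurable]: "g \<in> borel_measurable borel" and g0: "g 0 = 0" for g
    proof -
      have "(NN p|\<mu>1. nexp (\<Sum>k. g (p k))) = (NN x|\<nu>. indicator A x * nexp (g x)) * (NN p|D. nexp (\<Sum>k. g (p k)))"
        by (subst i1, measurable) (simp add: mecke_laplace[OF A finA g] laplace_functional)
      also have "\<dots> = (NN x|\<nu>. indicator A x * (NN p|D. nexp (g x) * nexp (\<Sum>k. g (p k))))"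
        by (simp add: nn_integral_cmult nn_integral_multc[symmetric] mult.assoc)
      also have "\<dots> = (NN x|\<nu>. indicator A x * (NN p|D. nexp (\<Sum>k. g (ranked (case_nat x p) k))))"
      proof (rule nn_integral_cong_on[OF AE_nu_pos], goal_cases elim)
        case (elim x)
        have "(NN p|D. nexp (g x) * nexp (\<Sum>k. g (p k))) = (NN p|D. nexp (\<Sum>k. g (ranked (case_nat x p) k)))"
          by (rule nn_integral_cong_on[OF AE_ranked_seqs]) (use elim g g0 in \<open>simp add: suminf_insert_point nexp_add ranked_seqs_def\<close>)
        then show ?case by simp
      qed
      also have "\<dots> = (NN p|\<mu>2. nexp (\<Sum>k. g (p k)))" by (rule i2[symmetric]) measurable
      finally show ?thesis .
    qed
    then show "(NN p|\<mu>1. nexp (\<Sum>k. g (p k))) = (NN p|\<mu>2. nexp (\<Sum>k. g (p k)))"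
      if "g \<in> borel_measurable borel" "0 < \<delta>" "\<And>x. x \<le> \<delta> \<Longrightarrow> g x = 0" for g \<delta>
      using that by simp
    have "emeasure \<mu>1 (space \<mu>1) = (NN p|\<mu>1. 1)" by simp
    also have "\<dots> = emeasure \<nu> A"
      using mecke_laplace[OF A finA, of "\<lambda>_. 0"] by (subst i1) auto
    finally show f1: "finite_measure \<mu>1" using finA by (intro finite_measureI) simp
    have "emeasure \<mu>2 (space \<mu>2) = (NN p|\<mu>2. 1)" by simp
    also have "\<dots> = emeasure \<nu> A"
      by (subst i2) (auto simp: emeasure_space_1[simplified])
    finally show "finite_measure \<mu>2" using finA by (intro finite_measureI) simp
    show "sets \<mu>1 = sets borel" "sets \<mu>2 = sets borel" by (simp_all add: \<mu>1_def \<mu>2_def)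
    show "AE p in \<mu>1. p \<in> ranked_seqs" using AE_ranked_seqs unfolding \<mu>1_def by (subst AE_density) (auto elim: eventually_mono)
    interpret n': finite_measure "density \<nu> (indicator A)"
      using finA by (intro finite_measureI) (simp add: emeasure_density)
    interpret pair_sigma_finite "density \<nu> (indicator A)" D ..
    have "AE q in density \<nu> (indicator A) \<Otimes>\<^sub>M D. ranked (case_nat (fst q) (snd q)) \<in> ranked_seqs"
    proof (rule AE_pair_measure)
      show "{q \<in> space (density \<nu> (indicator A) \<Otimes>\<^sub>M D). ranked (case_nat (fst q) (snd q)) \<in> ranked_seqs} \<in> sets (density \<nu> (indicator A) \<Otimes>\<^sub>M D)"
        using measurable_sets[OF ins ranked_seqs_measurable] by (simp add: split_beta vimage_def Int_def conj_commute)
      have "AE x in \<nu>. x \<in> A \<longrightarrow> (AE p in D. ranked (case_nat x p) \<in> ranked_seqs)"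
        using AE_nu_pos
      proof eventually_elim
        case (elim x)
        have "AE p in D. ranked (case_nat x p) \<in> ranked_seqs"
          using AE_ranked_seqs
          by eventually_elim (use elim in \<open>auto simp: ranked_seqs_def intro!: ranked_in_ranked_seqs[unfolded ranked_seqs_def, simplified] vanishing_ranked decseq_ranked vanishing_case_nat\<close>)
        then show ?case by simp
      qed
      then show "AE x in density \<nu> (indicator A). AE p in D. ranked (case_nat (fst (x, p)) (snd (x, p))) \<in> ranked_seqs"
        by (subst AE_density) (auto simp: indicator_def)
    qed
    then show "AE p in \<mu>2. p \<in> ranked_seqs"
      unfolding \<mu>2_def by (subst AE_distr_iff[OF ins]) (auto simp: split_beta)
  qed
  then show ?thesis using i1[OF Phi] i2[OF Phi] by simp
qed

text \<open>For fixed \<Phi> both sides are integrals of \<open>w\<close> against measures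
  \<open>m1\<close> and \<open>m2\<close> on the line. They agree on sets of finite intensity by
  \<open>mecke_indicator\<close>, and the sets \<open>B n\<close> of finite intensity exhaust each
  Borel set up to its nonpositive part, which is null for both.\<close>

theorem mecke:
  fixes w :: "real \<Rightarrow> ennreal" and \<Phi> :: "(nat \<Rightarrow> real) \<Rightarrow> ennreal"
  assumes w: "w \<in> borel_measurable borel" and Phi[measurable]: "\<Phi> \<in> borel_measurable borel"
  shows "(NN p|D. (\<Sum>k. w (p k)) * \<Phi> p) = (NN x|\<nu>. w x * (NN p|D. \<Phi> (ranked (case_nat x p))))"
proof -
  interpret C: sigma_finite_measure "count_space (UNIV :: nat set)" by (rule sigma_finite_measure_count_space)
  define \<Psi> where "\<Psi> x = (NN p|D. \<Phi> (ranked (case_nat x p)))" for x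
  have ins: "(\<lambda>q. \<Phi> (ranked (case_nat (fst q) (snd q)))) \<in> borel_measurable (borel \<Otimes>\<^sub>M borel)"
    using measurable_compose[OF measurable_insert_point Phi] by (simp add: split_beta)
  have [measurable]: "\<Psi> \<in> borel_measurable borel"
    unfolding \<Psi>_def using ins by (intro borel_measurable_nn_integral) (simp add: split_beta cong: pair_cong)
  have pk[measurable]: "(\<lambda>q. fst q (snd q)) \<in> borel_measurable (D \<Otimes>\<^sub>M count_space UNIV)"
    by (rule measurable_compose_countable[where f = "\<lambda>k q. fst q k" and g = snd])
       (rule measurable_compose[OF measurable_fst], simp add: borel_seq_component cong: measurable_cong_sets, rule measurable_snd)
  define m1 where "m1 = distr (density (D \<Otimes>\<^sub>M count_space UNIV) (\<lambda>q. \<Phi> (fst q))) borel (\<lambda>q. fst q (snd q))"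
  define m2 where "m2 = density \<nu> \<Psi>"
  have I1: "(NN x|m1. w x) = (NN p|D. (\<Sum>k. w (p k)) * \<Phi> p)" if w[measurable]: "w \<in> borel_measurable borel" for w
  proof -
    have "(NN x|m1. w x) = (NN q|(D \<Otimes>\<^sub>M count_space UNIV). \<Phi> (fst q) * w (fst q (snd q)))"
      unfolding m1_def by (subst nn_integral_distr) (simp_all add: nn_integral_density)
    also have "\<dots> = (NN p|D. NN k|count_space UNIV. \<Phi> p * w (p k))" by (subst C.nn_integral_fst[symmetric]) auto
    finally show ?thesis by (simp add: nn_integral_count_space_nat mult.commute)
  qed
  have I2: "(NN x|m2. w x) = (NN x|\<nu>. w x * \<Psi> x)" if [measurable]: "w \<in> borel_measurable borel" for w
    unfolding m2_def by (simp add: nn_integral_density mult.commute)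
  have sets: "sets m1 = sets borel" "sets m2 = sets borel" by (simp_all add: m1_def m2_def)
  have "m1 = m2"
  proof (rule measure_eqI)
    fix A assume "A \<in> sets m1"
    then have [measurable]: "A \<in> sets borel" using sets by simp
    define B where "B n = A \<inter> {inverse (real (Suc n))<..}" for n
    have Bm[measurable]: "B n \<in> sets borel" for n unfolding B_def by measurable
    have "inverse (real (Suc (Suc n))) \<le> inverse (real (Suc n))" for n by (rule le_imp_inverse_le) auto
    then have inc: "incseq B" unfolding B_def by (intro incseq_SucI Int_mono greaterThan_subset_iff[THEN iffD2] order_refl)
    have c: "emeasure m A = (SUP n. emeasure m (B n))" if m: "sets m = sets borel" "emeasure m {..0} = 0" for m
    proof -
      have iff: "x \<in> A \<longleftrightarrow> x \<in> (\<Union>n. B n)" if "x \<notin> {..0}" for x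
        using that reals_Archimedean[of x] by (auto simp: B_def simp del: of_nat_Suc)
      have AE0: "AE x in m. x \<notin> {..0}" using m by (intro AE_not_in null_setsI) auto
      have "emeasure m A = emeasure m (\<Union>n. B n)"
        by (rule emeasure_eq_AE[OF eventually_mono[OF AE0 iff]]) (auto simp: m(1))
      also have "\<dots> = (SUP n. emeasure m (B n))" by (rule SUP_emeasure_incseq[OF _ inc, symmetric]) (use Bm m(1) in blast)
      finally show ?thesis .
    qed
    have fin: "emeasure \<nu> (B n) < \<infinity>" for n
      by (rule le_less_trans[OF emeasure_mono nu_finite[of "inverse (real (Suc n))"]]) (auto simp: B_def)
    have e1: "emeasure m1 E = (NN p|D. (\<Sum>k. indicator E (p k)) * \<Phi> p)" if "E \<in> sets borel" for E
      using I1[OF borel_measurable_indicator[OF that]] that sets by simp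
    have e2: "emeasure m2 E = (NN x|\<nu>. indicator E x * \<Psi> x)" if "E \<in> sets borel" for E
      using I2[OF borel_measurable_indicator[OF that]] that sets by simp
    have e: "emeasure m1 (B n) = emeasure m2 (B n)" for n
      unfolding e1[OF Bm] e2[OF Bm] \<Psi>_def by (rule mecke_indicator[OF Bm fin Phi])
    have "emeasure m1 {..0} = (NN p|D. 0)"
      by (subst e1, simp, rule nn_integral_cong_on[OF AE_points(1)]) (simp add: indicator_def not_le[symmetric])
    then have z1: "emeasure m1 {..0} = 0" by simp
    have "emeasure m2 {..0} = (NN x|\<nu>. 0)"
      by (subst e2, simp, rule nn_integral_cong_on[OF AE_nu_pos]) (simp add: indicator_def)
    then have z2: "emeasure m2 {..0} = 0" by simp
    show "emeasure m1 A = emeasure m2 A" unfolding c[OF sets(1) z1] c[OF sets(2) z2] e ..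
  qed (simp add: sets)
  then show ?thesis using I1[OF w] I2[OF w] unfolding \<Psi>_def by simp
qed

end

subsection \<open>Stable Poisson processes, conditional laws and Poisson-Kingman laws\<close>

lemma measure_eqI_nn_integral:
  assumes sets: "sets M = sets N"
    and eq: "\<And>F. F \<in> borel_measurable N \<Longrightarrow> (NN x|M. F x) = (NN x|N. F x)"
  shows "M = N"
proof (rule measure_eqI[OF sets])
  fix A assume A: "A \<in> sets M"
  then show "emeasure M A = emeasure N A"
    using eq[of "indicator A"] sets by simp
qed

definition tsum :: "(nat \<Rightarrow> real) \<Rightarrow> real" where "tsum p = (\<Sum>i. p i)"

definition normed :: "(nat \<Rightarrow> real) \<Rightarrow> nat \<Rightarrow> real" where "normed p = (\<lambda>k. p k / tsum p)"

lemma tsum_measurable [measurable]: "tsum \<in> borel_measurable borel" supply [measurable] = borel_seq_component unfolding tsum_def by measurable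

lemma normed_measurable [measurable]: "normed \<in> borel \<rightarrow>\<^sub>M borel"
proof (rule measurable_coordinatewise_then_product)
  fix k
  note [measurable] = borel_seq_component
  show "(\<lambda>p. normed p k) \<in> borel_measurable borel" unfolding normed_def by measurable
qed

locale stable_points = prob_space D for D :: "(nat \<Rightarrow> real) measure" +
  fixes \<gamma> :: real
  assumes gamma: "0 < \<gamma>" "\<gamma> < 1"
    and sets_D [measurable_cong, simp]: "sets D = sets borel"
    and points: "ranked_poisson_points D (stable_intensity \<gamma>) (\<lambda>j. j)"
begin

sublocale ranked_poisson D "stable_intensity \<gamma>"
proof (intro ranked_poisson.intro ranked_poisson_axioms.intro)
  show "prob_space D" by (rule prob_space_axioms)
qed (use emeasure_stable_intensity_greaterThan_finite gamma in
    \<open>auto simp: points stable_intensity_nonpos sigma_finite_stable_intensity\<close>)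

lemma laplace_sum:
  assumes l: "0 \<le> l"
  shows "(NN p|D. nexp (\<Sum>k. ennreal (l * p k))) = ennreal (exp (- (l powr \<gamma>)))"
proof -
  have "(NN p|D. nexp (\<Sum>k. ennreal (l * p k))) = nexp (NN x|stable_intensity \<gamma>. 1 - nexp (ennreal (l * x)))"
    by (rule laplace_functional) measurable
  also have "(NN x|stable_intensity \<gamma>. 1 - nexp (ennreal (l * x))) = (NN x|stable_intensity \<gamma>. ennreal (1 - exp (- (l * x))))"
    by (rule nn_integral_cong_on[OF AE_nu_pos]) (use l in \<open>simp add: nexp_ennreal ennreal_minus flip: ennreal_1\<close>)
  finally show ?thesis using gamma l by (simp add: nn_integral_stable_intensity_Laplace nexp_ennreal)
qed

text \<open>The integrand in \<open>laplace_sum\<close> vanishes where the sum is infinite. Hence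
  the probability of a finite sum is at least exp (- (l powr \<gamma>)), which tends to 1 as l tends
  to 0.\<close>

lemma AE_summable: "AE p in D. summable p"
proof -
  define S where "S p = (\<Sum>k. ennreal (p k))" for p :: "nat \<Rightarrow> real"
  have [measurable]: "S \<in> borel_measurable borel" supply [measurable] = borel_seq_component unfolding S_def by measurable
  let ?E = "{p \<in> space D. S p < \<top>}"
  have le: "ennreal (exp (- (l powr \<gamma>))) \<le> emeasure D ?E" if l: "0 < l" for l
  proof -
    have "ennreal (exp (- (l powr \<gamma>))) = (NN p|D. nexp (ennreal l * S p))"
      unfolding S_def using l laplace_sum[of l] by (simp add: ennreal_mult')
    also have "\<dots> \<le> (NN p|D. indicator ?E p)"
    proof (intro nn_integral_mono)
      fix p assume "p \<in> space D"
      show "nexp (ennreal l * S p) \<le> indicator ?E p"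
        using l by (cases "S p < \<top>") (auto simp: ennreal_mult_top not_less top_unique indicator_def)
    qed
    also have "\<dots> = emeasure D ?E" by simp
    finally show ?thesis .
  qed
  have "(\<lambda>n. ennreal (exp (- (inverse (real (Suc n)) powr \<gamma>)))) \<longlonglongrightarrow> ennreal (exp (- (0 powr \<gamma>)))"
    using gamma LIMSEQ_inverse_real_of_nat
    by (intro tendsto_ennrealI tendsto_exp tendsto_minus tendsto_powr') auto
  then have "ennreal (exp (- (0 powr \<gamma>))) \<le> emeasure D ?E"
  proof (rule LIMSEQ_le_const2, intro exI allI impI)
    fix n show "ennreal (exp (- (inverse (real (Suc n)) powr \<gamma>))) \<le> emeasure D ?E" by (rule le) simp
  qed
  then have "emeasure D ?E = 1" using emeasure_le_1[of ?E] by (intro antisym) auto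
  then have "AE p in D. S p < \<top>"
    by (intro AE_I_eq_1[unfolded mem_Collect_eq]) (auto simp: emeasure_eq_measure)
  with AE_points(1) show ?thesis
  proof eventually_elim
    case (elim p)
    then show ?case unfolding S_def by (intro summable_suminf_not_top) (auto intro: less_imp_le)
  qed
qed

lemma suminf_eq_tsum:
  "(\<And>i. 0 \<le> p i) \<Longrightarrow> summable p \<Longrightarrow> 0 \<le> l \<Longrightarrow> (\<Sum>k. ennreal (l * p k)) = ennreal (l * tsum p)"
  unfolding tsum_def by (subst suminf_ennreal2) (auto simp: suminf_mult summable_mult)

lemma AE_tsum:
  "AE p in D. (\<forall>i. 0 < p i) \<and> p \<in> ranked_seqs \<and> summable p \<and> 0 < tsum p"
  using AE_points(1) AE_ranked_seqs AE_summable
  by eventually_elim (auto simp: tsum_def intro!: suminf_pos)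

lemma laplace_tsum:
  assumes l: "0 \<le> l"
  shows "(NN p|D. ennreal (exp (- (l * tsum p)))) = ennreal (exp (- (l powr \<gamma>)))"
proof -
  have "(NN p|D. ennreal (exp (- (l * tsum p)))) = (NN p|D. nexp (\<Sum>k. ennreal (l * p k)))"
  proof (rule nn_integral_cong_on[OF AE_tsum], goal_cases elim)
    case (elim p)
    then have "(\<Sum>k. ennreal (l * p k)) = ennreal (l * tsum p)"
      using l by (intro suminf_eq_tsum) (auto intro: less_imp_le)
    then show ?case using l elim by (simp add: nexp_ennreal)
  qed
  then show ?thesis by (simp add: laplace_sum[OF l])
qed

text \<open>The factor \<open>tsum p\<close> is a sum over points, so the Mecke formula with weight
  x singles out one point and leaves an unchanged process. This replaces differentiating the Laplace
  transform under the integral.\<close>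

lemma laplace_tsum_weighted:
  assumes l: "0 < l"
  shows "(NN p|D. ennreal (tsum p * exp (- (l * tsum p)))) = ennreal (\<gamma> * l powr (\<gamma> - 1) * exp (- (l powr \<gamma>)))"
proof -
  let ?\<nu> = "stable_intensity \<gamma>"
  define \<Phi> where "\<Phi> p = nexp (\<Sum>k. ennreal (l * p k))" for p :: "nat \<Rightarrow> real"
  have [measurable]: "\<Phi> \<in> borel_measurable borel" supply [measurable] = borel_seq_component unfolding \<Phi>_def by measurable
  have "(NN p|D. ennreal (tsum p * exp (- (l * tsum p)))) = (NN p|D. (\<Sum>k. ennreal (p k)) * \<Phi> p)"
  proof (rule nn_integral_cong_on[OF AE_tsum], goal_cases elim)
    case (elim p)
    then have e: "(\<Sum>k. ennreal (l * p k)) = ennreal (l * tsum p)" "(\<Sum>k. ennreal (1 * p k)) = ennreal (1 * tsum p)"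
      using l by (intro suminf_eq_tsum; auto intro: less_imp_le)+
    have "nexp (ennreal (l * tsum p)) = ennreal (exp (- (l * tsum p)))" by (rule nexp_ennreal) (use l elim in simp)
    then have "(\<Sum>k. ennreal (p k)) * \<Phi> p = ennreal (tsum p) * ennreal (exp (- (l * tsum p)))"
      using e unfolding \<Phi>_def by simp
    then show ?case using elim by (simp add: ennreal_mult)
  qed
  also have "\<dots> = (NN x|?\<nu>. ennreal x * (NN p|D. \<Phi> (ranked (case_nat x p))))"
    by (rule mecke) measurable
  also have "\<dots> = (NN x|?\<nu>. ennreal (x * exp (- (l * x))) * (NN p|D. \<Phi> p))"
  proof (rule nn_integral_cong_on[OF AE_nu_pos], goal_cases elim)
    case (elim x)
    have "(NN p|D. \<Phi> (ranked (case_nat x p))) = (NN p|D. ennreal (exp (- (l * x))) * \<Phi> p)"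
    proof (rule nn_integral_cong_on[OF AE_ranked_seqs], goal_cases elim)
      case (elim p)
      have "(\<Sum>k. ennreal (l * ranked (case_nat x p) k)) = ennreal (l * x) + (\<Sum>k. ennreal (l * p k))"
        using elim \<open>0 < x\<close> by (intro suminf_insert_point[where g = "\<lambda>x. ennreal (l * x)"]) (auto simp: ranked_seqs_def)
      then show ?case using l \<open>0 < x\<close> by (simp add: \<Phi>_def nexp_add nexp_ennreal)
    qed
    also have "\<dots> = ennreal (exp (- (l * x))) * (NN p|D. \<Phi> p)" by (rule nn_integral_cmult) measurable
    finally show ?case using elim by (simp add: ennreal_mult mult.assoc)
  qed
  also have "\<dots> = (NN x|?\<nu>. ennreal (x * exp (- (l * x)))) * (NN p|D. \<Phi> p)"
    by (rule nn_integral_multc) measurable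
  also have "(NN p|D. \<Phi> p) = ennreal (exp (- (l powr \<gamma>)))"
    unfolding \<Phi>_def using l by (intro laplace_sum) simp
  also have "(NN x|?\<nu>. ennreal (x * exp (- (l * x)))) = ennreal (\<gamma> * l powr (\<gamma> - 1))"
    using nn_integral_stable_intensity_exp[OF gamma l] .
  finally show ?thesis using gamma by (simp add: ennreal_mult[symmetric])
qed

end

locale stable_pd = stable_points +
  fixes f :: "real \<Rightarrow> real \<Rightarrow> real" and K :: "real \<Rightarrow> real \<Rightarrow> (nat \<Rightarrow> real) measure"
  assumes f_nonneg: "\<And>t. 0 \<le> f \<gamma> t"
    and f_density: "distributed D lborel (\<lambda>j. \<Sum>i. j i) (\<lambda>t. ennreal (f \<gamma> t))"
    and cond_law: "has_cond_law D (\<lambda>j k. j k / (\<Sum>i. j i)) (\<lambda>j. \<Sum>i. j i) (K \<gamma>)"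
    and K_mass_partitions: "\<And>t. 0 < t \<Longrightarrow> AE p in K \<gamma> t. p \<in> mass_partitions"
begin

lemma f_measurable [measurable]: "f \<gamma> \<in> borel_measurable borel"
proof -
  have "(\<lambda>t. enn2real (ennreal (f \<gamma> t))) \<in> borel_measurable borel"
    using distributed_borel_measurable[OF f_density] by measurable
  then show ?thesis by (simp add: f_nonneg)
qed

lemma K_measurable [measurable]: "K \<gamma> \<in> restrict_space borel {0<..} \<rightarrow>\<^sub>M prob_algebra borel"
  using cond_law by (simp add: has_cond_law_def)

text \<open>A total version of the conditional law. Its value off the positive half-line is an
  arbitrary probability measure, so that it is a measurable kernel on all of
  \<open>borel\<close>.\<close>

definition kernel :: "real \<Rightarrow> (nat \<Rightarrow> real) measure" where
  "kernel t = (if t \<in> {0<..} then K \<gamma> t else return borel (\<lambda>_. 0))"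

lemma kernel_eq [simp]: "0 < t \<Longrightarrow> kernel t = K \<gamma> t"
  by (simp add: kernel_def)

lemma kernel_measurable_prob: "kernel \<in> borel \<rightarrow>\<^sub>M prob_algebra borel"
  unfolding kernel_def
  using K_measurable
  by (subst measurable_If_restrict_space_iff) (auto intro!: measurable_const simp: space_prob_algebra prob_space_return greaterThan_def)

lemma kernel_measurable [measurable]: "kernel \<in> borel \<rightarrow>\<^sub>M subprob_algebra borel"
  by (rule measurable_prob_algebraD) (rule kernel_measurable_prob)

lemma prob_space_kernel: "prob_space (kernel t)" and sets_kernel [simp, measurable_cong]: "sets (kernel t) = sets borel"
  using measurable_space[OF kernel_measurable_prob, of t] by (auto simp: space_prob_algebra)

lemma distr_tsum: "distr D borel tsum = density lborel (\<lambda>t. ennreal (f \<gamma> t))"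
proof -
  have "distr D borel tsum = distr D lborel tsum" by (rule distr_cong) auto
  then show ?thesis using distributed_distr_eq_density[OF f_density] by (simp add: tsum_def[abs_def])
qed

lemma nn_integral_tsum:
  assumes [measurable]: "g \<in> borel_measurable borel"
  shows "(NN t|restrict_space lborel {0<..}. ennreal (f \<gamma> t) * g t) = (NN p|D. g (tsum p))"
proof -
  have "(NN t|restrict_space lborel {0<..}. ennreal (f \<gamma> t) * g t) = (NN t|distr D borel tsum. g t * indicator {0<..} t)"
    unfolding distr_tsum by (simp add: nn_integral_restrict_space nn_integral_density mult.assoc)
  also have "\<dots> = (NN p|D. g (tsum p) * indicator {0<..} (tsum p))" by (rule nn_integral_distr) simp_all
  also have "\<dots> = (NN p|D. g (tsum p))" by (rule nn_integral_cong_on[OF AE_tsum]) simp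
  finally show ?thesis .
qed

text \<open>The definition of \<open>has_cond_law\<close> is the case of rectangles, with the second
  side inside the positive half-line; there lies almost surely \<open>tsum\<close>. Rectangles are
  stable under intersection and generate, so the two joint laws coincide.\<close>

theorem disintegration:
  fixes F :: "(nat \<Rightarrow> real) \<times> real \<Rightarrow> ennreal"
  assumes F: "F \<in> borel_measurable (borel \<Otimes>\<^sub>M borel)"
  shows "(NN p|D. F (normed p, tsum p)) = (NN p|D. NN q|kernel (tsum p). F (q, tsum p))"
proof -
  define m1 where "m1 = distr D (borel \<Otimes>\<^sub>M borel) (\<lambda>p. (normed p, tsum p))"
  define L where "L p = distr (kernel (tsum p)) (borel \<Otimes>\<^sub>M borel) (\<lambda>q. (q, tsum p))" for p
  define m2 where "m2 = D \<bind> L"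
  have Lm[measurable]: "L \<in> D \<rightarrow>\<^sub>M subprob_algebra (borel \<Otimes>\<^sub>M borel)"
    unfolding L_def by (rule measurable_distr2[where M = borel]) auto
  have s2: "sets m2 = sets (borel \<Otimes>\<^sub>M borel)"
    unfolding m2_def by (subst sets_bind[where N = "borel \<Otimes>\<^sub>M borel"]) (auto simp: L_def)
  have i2: "(NN x|m2. F x) = (NN p|D. NN q|kernel (tsum p). F (q, tsum p))" if F: "F \<in> borel_measurable (borel \<Otimes>\<^sub>M borel)" for F
    unfolding m2_def nn_integral_bind[OF F Lm] unfolding L_def using F by (intro nn_integral_cong nn_integral_distr) auto
  let ?E = "{A \<times> B | A B. A \<in> sets seqs \<and> B \<in> sets (borel :: real measure)}"
  have "m1 = m2"
  proof (rule measure_eqI_generator_eq[where E = ?E and \<Omega> = UNIV and A = "\<lambda>_. UNIV"])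
    show "Int_stable ?E" using Int_stable_pair_measure_generator[of seqs "borel :: real measure"] by simp
    show "sets m1 = sigma_sets UNIV ?E" unfolding m1_def by (simp add: sets_pair_measure)
    show "sets m2 = sigma_sets UNIV ?E" unfolding s2 by (simp add: sets_pair_measure)
    show "range (\<lambda>_. UNIV) \<subseteq> ?E" by (intro image_subsetI CollectI exI[of _ UNIV]) simp
    interpret m1: prob_space m1 unfolding m1_def by (rule prob_space_distr) simp
    show "emeasure m1 UNIV \<noteq> \<infinity>" by simp
    fix X assume "X \<in> ?E"
    then obtain A and B :: "real set" where X: "X = A \<times> B" and AB[measurable]: "A \<in> sets borel" "B \<in> sets borel" by auto
    have mX[measurable]: "A \<times> B \<in> sets (borel \<Otimes>\<^sub>M borel)" by (rule pair_measureI) measurable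
    let ?B = "B \<inter> {0<..}"
    have "emeasure m1 X = emeasure D {p \<in> space D. normed p \<in> A \<and> tsum p \<in> B}"
      unfolding m1_def X by (subst emeasure_distr) (auto intro!: arg_cong[where f = "emeasure D"])
    also have "\<dots> = emeasure D {p \<in> space D. normed p \<in> A \<and> tsum p \<in> ?B}"
      using AE_tsum by (intro emeasure_eq_AE) (auto elim: eventually_mono)
    also have "\<dots> = (NN t|distr D borel tsum. emeasure (K \<gamma> t) A * indicator ?B t)"
    proof -
      have "(\<lambda>j. \<Sum>i. j i) = tsum" "(\<lambda>j k. j k / (\<Sum>i. j i)) = normed"
        by (auto simp: fun_eq_iff tsum_def normed_def)
      with cond_law have "has_cond_law D normed tsum (K \<gamma>)" by simp
      then show ?thesis
        by (rule has_cond_law_def[THEN iffD1, THEN conjunct2, THEN conjunct2, THEN conjunct2, THEN conjunct2, rule_format]) auto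
    qed
    also have "\<dots> = (NN t|distr D borel tsum. emeasure (kernel t) A * indicator ?B t)"
      by (intro nn_integral_cong) (auto simp: indicator_def)
    also have "\<dots> = (NN p|D. emeasure (kernel (tsum p)) A * indicator ?B (tsum p))" by (rule nn_integral_distr) simp_all
    also have "\<dots> = (NN p|D. NN q|kernel (tsum p). indicator X (q, tsum p))"
    proof (rule nn_integral_cong_on[OF AE_tsum])
      fix p assume p: "(\<forall>i. 0 < p i) \<and> p \<in> ranked_seqs \<and> summable p \<and> 0 < tsum p"
      have "indicator X (q, tsum p) = indicator B (tsum p) * (indicator A q :: ennreal)" for q by (auto simp: X indicator_def)
      then show "emeasure (kernel (tsum p)) A * indicator ?B (tsum p) = (NN q|kernel (tsum p). indicator X (q, tsum p))"
        using p AB sets_kernel[of "tsum p"] by (simp only:, subst nn_integral_cmult_indicator) (auto simp: indicator_def)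
    qed
    also have "\<dots> = emeasure m2 X" unfolding X by (subst i2[symmetric]) (simp_all add: s2)
    finally show "emeasure m1 X = emeasure m2 X" .
  qed auto
  then show ?thesis
    unfolding i2[OF F, symmetric] using F by (simp add: nn_integral_distr flip: \<open>m1 = m2\<close>) (simp add: m1_def nn_integral_distr)
qed

lemma sets_PK [simp, measurable_cong]: "sets (PK f K \<gamma> h) = sets borel"
proof -
  have "sets (K \<gamma> t) = sets borel" if "0 < t" for t
    using sets_kernel[of t] that by simp
  then show ?thesis unfolding PK_def by (subst sets_bind[where N = borel]) (auto simp: space_restrict_space)
qed

text \<open>Here \<open>f\<close> and \<open>K\<close> disappear: the density
  \<open>f \<gamma>\<close> is absorbed into the law of \<open>tsum\<close>, and
  \<open>disintegration\<close> replaces the kernel by the normalized points.\<close>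

lemma nn_integral_PK:
  assumes h[measurable]: "h \<in> borel_measurable borel" and F[measurable]: "F \<in> borel_measurable borel"
  shows "(NN p|PK f K \<gamma> h. F p) = (NN p|D. ennreal (h (tsum p)) * F (normed p))"
proof -
  let ?R = "restrict_space lborel {0<..} :: real measure"
  have hR[measurable]: "h \<in> borel_measurable ?R" "f \<gamma> \<in> borel_measurable ?R"
    by (auto intro!: measurable_restrict_space1)
  have Km[measurable]: "K \<gamma> \<in> ?R \<rightarrow>\<^sub>M subprob_algebra borel"
    using measurable_prob_algebraD[OF K_measurable] by (simp cong: measurable_cong_sets sets_restrict_space_cong)
  have kF[measurable]: "(\<lambda>t. NN p|kernel t. F p) \<in> borel_measurable borel" by measurable
  have "(NN p|PK f K \<gamma> h. F p) = (NN t|density ?R (\<lambda>t. ennreal (h t * f \<gamma> t)). (NN p|K \<gamma> t. F p))"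
    unfolding PK_def by (rule nn_integral_bind[OF F]) (use Km in simp)
  also have "\<dots> = (NN t|density ?R (\<lambda>t. ennreal (h t * f \<gamma> t)). (NN p|kernel t. F p))"
    by (intro nn_integral_cong) (simp add: space_restrict_space)
  also have "\<dots> = (NN t|?R. ennreal (h t * f \<gamma> t) * (NN p|kernel t. F p))"
    by (rule nn_integral_density, measurable) (rule measurable_restrict_space1, use kF in simp)
  also have "\<dots> = (NN t|?R. ennreal (f \<gamma> t) * (NN p|kernel t. ennreal (h t) * F p))"
    by (intro nn_integral_cong, subst nn_integral_cmult, measurable) (simp only: ennreal_mult''[OF f_nonneg] ac_simps)
  also have "\<dots> = (NN p|D. NN q|kernel (tsum p). ennreal (h (tsum p)) * F q)"
    by (rule nn_integral_tsum) (rule nn_integral_measurable_subprob_algebra2[where N = borel], measurable)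
  also have "\<dots> = (NN p|D. ennreal (h (tsum p)) * F (normed p))"
    using disintegration[of "\<lambda>(p, t). ennreal (h t) * F p"] by (simp add: split_beta)
  finally show ?thesis .
qed

end

subsection \<open>Changes of variables on open intervals\<close>

text \<open>Substitution on each compact interval, where the derivative is continuous; both sides
  increase to the integrals over the unions \<open>S\<close> and \<open>X\<close>. This admits
  substitutions that are singular at the ends.\<close>

lemma nn_integral_substitution_exhaustion:
  fixes f :: "real \<Rightarrow> ennreal" and a b :: "nat \<Rightarrow> real"
  assumes f[measurable]: "f \<in> borel_measurable borel"
    and deriv: "\<And>n x. x \<in> {a n..b n} \<Longrightarrow> (g has_real_derivative g' x) (at x)"
    and cont: "\<And>n. continuous_on {a n..b n} g'" and nonneg: "\<And>n x. x \<in> {a n..b n} \<Longrightarrow> 0 \<le> g' x"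
    and [measurable]: "g \<in> borel_measurable borel" "g' \<in> borel_measurable borel"
    and ab: "\<And>n. a n < b n" "decseq a" "incseq b"
    and S: "S = (\<Union>n. {g (a n)..g (b n)})" and X: "X = (\<Union>n. {a n..b n})"
  shows "(NN x|lborel. f x * indicator S x) = (NN x|lborel. f (g x) * ennreal (g' x) * indicator X x)"
proof -
  have mono: "g x \<le> g y" if "x \<in> {a n..b n}" "y \<in> {a n..b n}" "x \<le> y" for x y n
  proof (rule DERIV_nonneg_imp_nondecreasing[OF that(3)])
    fix z assume "x \<le> z" "z \<le> y"
    then show "\<exists>d. (g has_real_derivative d) (at z) \<and> 0 \<le> d"
      using that deriv[of z n] nonneg[of z n] by auto
  qed
  have I1: "incseq (\<lambda>n. {a n..b n})"
    using ab(2,3) by (intro incseq_SucI) (auto simp: decseq_Suc_iff incseq_Suc_iff intro: order.trans)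
  have I2: "incseq (\<lambda>n. {g (a n)..g (b n)})"
  proof (intro incseq_SucI)
    fix n
    have "a (Suc n) \<le> a n" "b n \<le> b (Suc n)" using ab(2,3) by (auto simp: decseq_Suc_iff incseq_Suc_iff)
    then have "g (a (Suc n)) \<le> g (a n)" "g (b n) \<le> g (b (Suc n))"
      using ab(1)[of n] by (intro mono[of _ "Suc n"]; simp)+
    then show "{g (a n)..g (b n)} \<subseteq> {g (a (Suc n))..g (b (Suc n))}" by auto
  qed
  have SUPind: "(NN x|lborel. h x * indicator (\<Union>n. I n) x) = (SUP n. NN x|lborel. h x * indicator (I n) x)"
    if [measurable]: "h \<in> borel_measurable borel" "\<And>n. I n \<in> sets borel" and inc: "incseq I" for h and I :: "nat \<Rightarrow> real set"
  proof -
    have "(NN x|lborel. h x * indicator (\<Union>n. I n) x) = (NN x|lborel. (SUP n. h x * indicator (I n) x))"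
    proof (intro nn_integral_cong antisym)
      fix x
      show "h x * indicator (\<Union>n. I n) x \<le> (SUP n. h x * indicator (I n) x)"
      proof (cases "x \<in> (\<Union>n. I n)")
        case True
        then obtain n where "x \<in> I n" by auto
        then show ?thesis by (intro SUP_upper2[of n]) (auto simp: indicator_def)
      qed simp
      show "(SUP n. h x * indicator (I n) x) \<le> h x * indicator (\<Union>n. I n) x"
        by (rule SUP_least) (auto simp: indicator_def)
    qed
    also have "\<dots> = (SUP n. NN x|lborel. h x * indicator (I n) x)"
    proof (rule nn_integral_monotone_convergence_SUP)
      show "incseq (\<lambda>n x. h x * indicator (I n) x)"
        using inc by (auto simp: incseq_def le_fun_def indicator_def)
    qed measurable
    finally show ?thesis .
  qed
  have "(NN x|lborel. f x * indicator S x) = (SUP n. NN x|lborel. f x * indicator {g (a n)..g (b n)} x)"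
    unfolding S by (rule SUPind[OF _ _ I2]) auto
  also have "\<dots> = (SUP n. NN x|lborel. f (g x) * ennreal (g' x) * indicator {a n..b n} x)"
    by (intro SUP_cong refl nn_integral_substitution_aux) (use deriv cont nonneg ab(1) in auto)
  also have "\<dots> = (NN x|lborel. f (g x) * ennreal (g' x) * indicator X x)"
    unfolding X by (rule SUPind[OF _ _ I1, symmetric]) auto
  finally show ?thesis .
qed

text \<open>The shift by 2 makes already the first interval, from 1/2 to 1, nondegenerate.\<close>

lemma Union_cball_0_infty: "(\<Union>n::nat. {1 / (real n + 2)..real n + 1}) = {0<..}"
proof (intro equalityI subsetI)
  fix x :: real assume "x \<in> {0<..}"
  then have x: "0 < x" by simp
  obtain m :: nat where m: "1 / x < real m" using reals_Archimedean2 by blast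
  obtain k :: nat where k: "x < real k" using reals_Archimedean2 by blast
  define n where "n = max m k"
  have "1 / x < real n + 2" "x \<le> real n + 1" using m k by (auto simp: n_def)
  then have "1 / (real n + 2) \<le> x" using x by (simp add: field_simps)
  with \<open>x \<le> real n + 1\<close> show "x \<in> (\<Union>n::nat. {1 / (real n + 2)..real n + 1})" by auto
next
  fix x :: real assume "x \<in> (\<Union>n::nat. {1 / (real n + 2)..real n + 1})"
  then obtain n :: nat where "1 / (real n + 2) \<le> x" by auto
  moreover have "0 < 1 / (real n + 2)" by simp
  ultimately show "x \<in> {0<..}" by (metis greaterThan_iff less_le_trans)
qed

lemma nn_integral_powr_substitution:
  fixes f :: "real \<Rightarrow> ennreal"
  assumes f[measurable]: "f \<in> borel_measurable borel" and c: "0 < c"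
  shows "(NN x|lborel. f x * indicator {0<..} x) = (NN x|lborel. f (x powr c) * ennreal (c * x powr (c - 1)) * indicator {0<..} x)"
proof (rule nn_integral_substitution_exhaustion[where a = "\<lambda>n. 1 / (real n + 2)" and b = "\<lambda>n. real n + 1" and g = "\<lambda>x. x powr c"])
  show "{0<..} = (\<Union>n::nat. {1 / (real n + 2)..real n + 1})" by (rule Union_cball_0_infty[symmetric])
  have pos: "0 < x" if "x \<in> {1 / (real n + 2)..real n + 1}" for x and n :: nat
    using that Union_cball_0_infty by auto
  fix n
  show "((\<lambda>x. x powr c) has_real_derivative c * x powr (c - 1)) (at x)" if "x \<in> {1 / (real n + 2)..real n + 1}" for x
    using pos[OF that] by (auto intro!: derivative_eq_intros)
  show "continuous_on {1 / (real n + 2)..real n + 1} (\<lambda>x. c * x powr (c - 1))"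
    using pos[of _ n] by (intro continuous_intros) force
  show "1 / (real n + 2) < real n + 1"
    by (simp add: field_simps) (smt (verit) mult_nonneg_nonneg of_nat_0_le_iff)
  show "decseq (\<lambda>n. 1 / (real n + 2))" by (intro decseq_SucI) (simp add: frac_le)
  show "incseq (\<lambda>n. real n + 1)" by (intro incseq_SucI) simp
next
  show "{0<..} = (\<Union>n::nat. {(1 / (real n + 2)) powr c..(real n + 1) powr c})"
  proof (intro equalityI subsetI)
    fix x :: real assume "x \<in> {0<..}"
    then have x: "0 < x" by simp
    then have "x powr (1 / c) \<in> (\<Union>n::nat. {1 / (real n + 2)..real n + 1})" unfolding Union_cball_0_infty by simp
    then obtain n :: nat where n: "1 / (real n + 2) \<le> x powr (1 / c)" "x powr (1 / c) \<le> real n + 1" by auto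
    have "(1 / (real n + 2)) powr c \<le> (x powr (1 / c)) powr c" "(x powr (1 / c)) powr c \<le> (real n + 1) powr c"
      using n c by (intro powr_mono2; simp)+
    moreover have "(x powr (1 / c)) powr c = x" using x c by (simp add: powr_powr)
    ultimately show "x \<in> (\<Union>n::nat. {(1 / (real n + 2)) powr c..(real n + 1) powr c})" by auto
  next
    fix x :: real assume "x \<in> (\<Union>n::nat. {(1 / (real n + 2)) powr c..(real n + 1) powr c})"
    then obtain n :: nat where "(1 / (real n + 2)) powr c \<le> x" by auto
    moreover have "0 < (1 / (real n + 2)) powr c" by simp
    ultimately show "x \<in> {0<..}" by (metis greaterThan_iff less_le_trans)
  qed
qed (use c in auto)

subsection \<open>The laws \<open>P\<^bsup>[1]\<^esup>\<close>\<close>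

text \<open>The reciprocal of the moment of order -\<theta> of the \<gamma>-stable sum, see
  \<open>nn_integral_tsum_powr\<close>.\<close>

abbreviation pd_const :: "real \<Rightarrow> real \<Rightarrow> real"
  where "pd_const \<gamma> \<theta> \<equiv> Gamma (\<theta> + 1) / Gamma (\<theta> / \<gamma> + 1)"

lemma r1_measurable_pair [measurable]: "(\<lambda>(z, t). r1 \<gamma> z t) \<in> borel_measurable (borel \<Otimes>\<^sub>M borel)"
  unfolding r1_def by measurable

lemma r1_measurable [measurable]: "r1 \<gamma> z \<in> borel_measurable borel"
  unfolding r1_def by measurable

lemma r1_nonneg: "0 < \<gamma> \<Longrightarrow> 0 \<le> t \<Longrightarrow> 0 \<le> r1 \<gamma> z t"
  by (simp add: r1_def)

lemma r1_0: "r1 \<gamma> 0 t = 0"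
  by (simp add: r1_def)

lemma prob_space_gamma_law:
  assumes a: "0 < a" shows "prob_space (gamma_law a)"
proof (rule prob_spaceI)
  have "emeasure (gamma_law a) (space (gamma_law a)) = (NN x|lborel. ennreal (1 / Gamma a) * (ennreal (x powr (a - 1) * exp (- (1 * x))) * indicator {0<..} x))"
    unfolding gamma_law_def
    by (subst emeasure_density) (auto intro!: nn_integral_cong simp: mult.assoc[symmetric] ennreal_mult''[symmetric])
  also have "\<dots> = ennreal (1 / Gamma a) * ennreal (Gamma a * 1 powr (- a))"
    by (subst nn_integral_cmult, measurable) (simp only: nn_integral_Gamma[OF a zero_less_one])
  also have "\<dots> = 1" using Gamma_real_pos[OF a] by (simp add: ennreal_mult[symmetric])
  finally show "emeasure (gamma_law a) (space (gamma_law a)) = 1" .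
qed

lemma sets_gamma_law [simp, measurable_cong]: "sets (gamma_law a) = sets borel"
  by (simp add: gamma_law_def)

lemma nn_integral_gamma_law:
  assumes [measurable]: "F \<in> borel_measurable borel"
  shows "(NN x|gamma_law a. F x) = (NN x|lborel. ennreal (x powr (a - 1) * exp (- x) / Gamma a) * indicator {0<..} x * F x)"
  unfolding gamma_law_def by (rule nn_integral_density) auto

lemma AE_gamma_law_pos: "AE x in gamma_law a. 0 < x"
  unfolding gamma_law_def by (subst AE_density) (auto simp: indicator_def)

text \<open>The factor exp z of \<open>r1\<close> cancels the exponential of the gamma density. With
  u = z powr (1 / \<gamma>) the rest is a gamma integral of order \<theta> + 1, whose value produces
  the power of t.\<close>

lemma gamma_mixture_r1:
  assumes g: "0 < \<gamma>" and th: "- \<gamma> < \<theta>" "\<gamma> < 1" and t: "0 < t"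
  shows "(NN z|gamma_law ((\<theta> + \<gamma>) / \<gamma>). ennreal (r1 \<gamma> z t)) =
    ennreal (pd_const \<gamma> \<theta> * t powr (- \<theta>))"
proof -
  let ?w = "\<lambda>z. ennreal ((z powr (1 / \<gamma>)) powr \<theta> * exp (- (t * z powr (1 / \<gamma>)))) * ennreal (1 / \<gamma> * z powr (1 / \<gamma> - 1)) * indicator {0<..} z"
  let ?d = "\<lambda>z. z powr ((\<theta> + \<gamma>) / \<gamma> - 1) * exp (- z) / Gamma ((\<theta> + \<gamma>) / \<gamma>)"
  have G: "0 < Gamma ((\<theta> + \<gamma>) / \<gamma>)" using g th by (intro Gamma_real_pos) (auto simp: field_simps)
  have G': "0 < Gamma (\<theta> + 1)" using g th by (intro Gamma_real_pos) auto
  have e: "(\<theta> + \<gamma>) / \<gamma> = \<theta> / \<gamma> + 1" using g by (simp add: field_simps)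
  define C where "C = t / Gamma ((\<theta> + \<gamma>) / \<gamma>)"
  have C: "0 \<le> C" using G t by (simp add: C_def)
  have "(NN z|gamma_law ((\<theta> + \<gamma>) / \<gamma>). ennreal (r1 \<gamma> z t)) =
     (NN z|lborel. ennreal (?d z) * indicator {0<..} z * ennreal (r1 \<gamma> z t))"
    by (rule nn_integral_gamma_law) (simp add: r1_def)
  also have "\<dots> = (NN z|lborel. ennreal C * ?w z)"
  proof (intro nn_integral_cong)
    fix z :: real
    show "ennreal (?d z) * indicator {0<..} z * ennreal (r1 \<gamma> z t) =
      ennreal C * ?w z"
    proof (cases "0 < z")
      case True
      have 1: "(z powr (1 / \<gamma>)) powr \<theta> = z powr ((\<theta> + \<gamma>) / \<gamma> - 1)"
        unfolding e using g by (simp add: powr_powr)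
      have "(?d z) * r1 \<gamma> z t
         = C * (z powr ((\<theta> + \<gamma>) / \<gamma> - 1) * exp (- (t * z powr (1 / \<gamma>))) * (1 / \<gamma> * z powr (1 / \<gamma> - 1))) * (exp (- z) * exp z)"
        unfolding r1_def C_def by (simp add: ac_simps)
      also have "exp (- z) * exp z = 1" by (simp add: exp_minus)
      finally show ?thesis
        unfolding 1 using True g C G r1_nonneg[OF g less_imp_le[OF t]] by (simp add: ennreal_mult[symmetric] ac_simps)
    qed simp
  qed
  also have "\<dots> = ennreal C * (NN z|lborel. ?w z)"
    by (rule nn_integral_cmult) measurable
  also have "(NN z|lborel. ?w z)
    = (NN u|lborel. ennreal (u powr \<theta> * exp (- (t * u))) * indicator {0<..} u)"
    using g by (intro nn_integral_powr_substitution[symmetric]) auto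
  also have "\<dots> = ennreal (Gamma (\<theta> + 1) * t powr (- (\<theta> + 1)))"
    using nn_integral_Gamma[of "\<theta> + 1" t] t g th by simp
  also have "ennreal C * \<dots> = ennreal (C * (Gamma (\<theta> + 1) * t powr (- (\<theta> + 1))))"
    using C G' by (simp add: ennreal_mult)
  also have "C * (Gamma (\<theta> + 1) * t powr (- (\<theta> + 1))) = pd_const \<gamma> \<theta> * t powr (- \<theta>)"
    unfolding C_def e using t by (simp add: powr_diff powr_minus field_simps)
  finally show ?thesis .
qed

section \<open>Exponential and power moments under the tilt\<close>

context stable_points
begin

text \<open>The two exponentials combine into a shifted Laplace variable, so
  \<open>laplace_tsum_weighted\<close> applies. The case \<open>c = 0\<close> is the normalization
  of \<open>r1\<close>; \<open>c = w * z powr (1 / \<gamma>)\<close> is used in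
  \<open>subordinated_law\<close>.\<close>

lemma nn_integral_r1_exp:
  assumes z: "0 < z" and c: "0 \<le> c"
  shows "(NN p|D. ennreal (r1 \<gamma> z (tsum p) * exp (- (c * tsum p)))) =
    ennreal (exp z * z powr (1 / \<gamma> - 1) * (z powr (1 / \<gamma>) + c) powr (\<gamma> - 1) * exp (- ((z powr (1 / \<gamma>) + c) powr \<gamma>)))"
proof -
  define u where "u = z powr (1 / \<gamma>) + c"
  have u: "0 < u" using z c by (auto simp: u_def intro: add_pos_nonneg)
  define A where "A = 1 / \<gamma> * z powr (1 / \<gamma> - 1) * exp z"
  have A: "0 \<le> A" using gamma by (simp add: A_def)
  have "(NN p|D. ennreal (r1 \<gamma> z (tsum p) * exp (- (c * tsum p)))) = (NN p|D. ennreal A * ennreal (tsum p * exp (- (u * tsum p))))"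
  proof (intro nn_integral_cong)
    fix p
    have "exp (- (z powr (1 / \<gamma>) * tsum p)) * exp (- (c * tsum p)) = exp (- (u * tsum p))"
      by (simp add: exp_add[symmetric] u_def algebra_simps)
    then have "r1 \<gamma> z (tsum p) * exp (- (c * tsum p)) = A * (tsum p * exp (- (u * tsum p)))"
      unfolding r1_def A_def by (simp add: ac_simps)
    then show "ennreal (r1 \<gamma> z (tsum p) * exp (- (c * tsum p))) = ennreal A * ennreal (tsum p * exp (- (u * tsum p)))"
      using A by (simp add: ennreal_mult')
  qed
  also have "\<dots> = ennreal A * ennreal (\<gamma> * u powr (\<gamma> - 1) * exp (- (u powr \<gamma>)))"
    by (subst nn_integral_cmult) (auto simp: laplace_tsum_weighted[OF u])
  also have "\<dots> = ennreal (A * (\<gamma> * u powr (\<gamma> - 1) * exp (- (u powr \<gamma>))))"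
    using A by (simp add: ennreal_mult')
  also have "A * (\<gamma> * u powr (\<gamma> - 1) * exp (- (u powr \<gamma>))) = exp z * z powr (1 / \<gamma> - 1) * u powr (\<gamma> - 1) * exp (- (u powr \<gamma>))"
    unfolding A_def using gamma by simp
  finally show ?thesis unfolding u_def .
qed

lemma nn_integral_r1:
  assumes z: "0 < z" shows "(NN p|D. ennreal (r1 \<gamma> z (tsum p))) = 1"
proof -
  have 1: "(z powr (1 / \<gamma>)) powr \<gamma> = z" using z gamma by (simp add: powr_powr)
  have "z powr (1 / \<gamma> - 1) * (z powr (1 / \<gamma>)) powr (\<gamma> - 1) = z powr (1 / \<gamma> - 1 + 1 / \<gamma> * (\<gamma> - 1))"
    using z by (simp add: powr_powr powr_add[symmetric])
  also have "1 / \<gamma> - 1 + 1 / \<gamma> * (\<gamma> - 1) = 0" using gamma by (simp add: field_simps)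
  finally have 2: "z powr (1 / \<gamma> - 1) * (z powr (1 / \<gamma>)) powr (\<gamma> - 1) = 1" using z by simp
  have "(NN p|D. ennreal (r1 \<gamma> z (tsum p))) = ennreal (exp z * (z powr (1 / \<gamma> - 1) * (z powr (1 / \<gamma>)) powr (\<gamma> - 1)) * exp (- ((z powr (1 / \<gamma>)) powr \<gamma>)))"
    using nn_integral_r1_exp[OF z, of 0] by (simp add: mult.assoc)
  then show ?thesis unfolding 1 2 by (simp add: exp_minus)
qed

text \<open>Mixing \<open>nn_integral_r1\<close> over a gamma law gives the negative moments of the stable law.\<close>

lemma nn_integral_tsum_powr:
  assumes th: "- \<gamma> < \<theta>"
  shows "(NN p|D. ennreal (pd_const \<gamma> \<theta> * tsum p powr (- \<theta>))) = 1"
proof -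
  let ?G = "gamma_law ((\<theta> + \<gamma>) / \<gamma>)"
  have a: "0 < (\<theta> + \<gamma>) / \<gamma>" using gamma th by simp
  interpret G: prob_space ?G by (rule prob_space_gamma_law[OF a])
  interpret pair_sigma_finite ?G D ..
  have "(NN p|D. ennreal (pd_const \<gamma> \<theta> * tsum p powr (- \<theta>))) = (NN p|D. NN z|?G. ennreal (r1 \<gamma> z (tsum p)))"
    by (rule nn_integral_cong_on[OF AE_tsum]) (use gamma th in \<open>simp add: gamma_mixture_r1\<close>)
  also have "\<dots> = (NN z|?G. NN p|D. ennreal (r1 \<gamma> z (tsum p)))"
    by (rule Fubini') measurable
  also have "\<dots> = (NN z|?G. 1)"
    by (rule nn_integral_cong_on[OF AE_gamma_law_pos]) (rule nn_integral_r1)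
  finally show ?thesis by (simp add: G.emeasure_space_1)
qed

end

section \<open>Kernels and mixtures of tilted Poisson-Kingman laws\<close>

context stable_pd
begin

lemma sets_P1 [simp, measurable_cong]: "sets (P1 f K \<gamma> z) = sets borel"
  by (simp add: P1_def)

lemma nn_integral_P1:
  assumes [measurable]: "F \<in> borel_measurable borel"
  shows "(NN p|P1 f K \<gamma> z. F p) = (NN p|D. ennreal (r1 \<gamma> z (tsum p)) * F (normed p))"
  unfolding P1_def by (rule nn_integral_PK) measurable

lemma space_P1 [simp]: "space (P1 f K \<gamma> z) = UNIV"
  using sets_eq_imp_space_eq[OF sets_P1] by simp

lemma prob_space_P1: assumes "0 < z" shows "prob_space (P1 f K \<gamma> z)"
proof (rule prob_spaceI)
  have "emeasure (P1 f K \<gamma> z) (space (P1 f K \<gamma> z)) = (NN p|P1 f K \<gamma> z. 1)" by simp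
  also have "\<dots> = 1" by (subst nn_integral_P1) (auto simp: nn_integral_r1[OF assms])
  finally show "emeasure (P1 f K \<gamma> z) (space (P1 f K \<gamma> z)) = 1" .
qed

text \<open>At 0 the density \<open>r1\<close> vanishes and \<open>P1\<close> is the zero measure.
  Including this value gives a measurable kernel on the closed half-line, needed because an inverse
  local time may be 0 on exceptional sequences.\<close>

lemma subprob_space_P1: assumes "0 \<le> z" shows "subprob_space (P1 f K \<gamma> z)"
proof (cases "z = 0")
  case True
  have "emeasure (P1 f K \<gamma> z) (space (P1 f K \<gamma> z)) = (NN p|P1 f K \<gamma> z. 1)" by simp
  also have "\<dots> = 0" by (subst nn_integral_P1) (auto simp: True r1_0)
  finally show ?thesis by (intro subprob_spaceI) auto
next
  case False
  then show ?thesis using assms by (intro prob_space_imp_subprob_space prob_space_P1) simp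
qed

lemma emeasure_P1_measurable:
  assumes [measurable]: "A \<in> sets borel"
  shows "(\<lambda>z. emeasure (P1 f K \<gamma> z) A) \<in> borel_measurable borel"
proof -
  have "emeasure (P1 f K \<gamma> z) A = (NN p|D. ennreal (r1 \<gamma> z (tsum p)) * indicator A (normed p))" for z
    using nn_integral_P1[of "indicator A" z] by simp
  then show ?thesis by simp
qed

lemma P1_measurable: "P1 f K \<gamma> \<in> restrict_space borel {0..} \<rightarrow>\<^sub>M subprob_algebra borel"
proof (rule measurable_subprob_algebra)
  show "subprob_space (P1 f K \<gamma> z)" if "z \<in> space (restrict_space borel {0..})" for z
    using that by (intro subprob_space_P1) (auto simp: space_restrict_space)
qed (auto intro!: measurable_restrict_space1 emeasure_P1_measurable)

lemma P1_measurable_prob: "P1 f K \<gamma> \<in> restrict_space borel {0<..} \<rightarrow>\<^sub>M prob_algebra borel"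
proof (rule measurable_prob_algebraI)
  show "prob_space (P1 f K \<gamma> z)" if "z \<in> space (restrict_space borel {0<..})" for z
    using that by (intro prob_space_P1) (auto simp: space_restrict_space)
  show "P1 f K \<gamma> \<in> restrict_space borel {0<..} \<rightarrow>\<^sub>M subprob_algebra borel"
    by (rule measurable_subprob_algebra)
       (auto intro!: measurable_restrict_space1 emeasure_P1_measurable subprob_space_P1 simp: space_restrict_space)
qed

lemma sets_P1_mix [simp, measurable_cong]:
  assumes "sets \<mu> = sets borel" shows "sets (P1_mix f K \<gamma> \<mu>) = sets borel"
  unfolding P1_mix_def using sets_eq_imp_space_eq[OF assms]
  by (subst sets_bind[where N = borel]) (auto simp: space_restrict_space)

lemma nn_integral_P1_mix:
  assumes mu[measurable_cong]: "sets \<mu> = sets borel" and F[measurable]: "F \<in> borel_measurable borel"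
  shows "(NN p|P1_mix f K \<gamma> \<mu>. F p) = (NN z|\<mu>. (NN p|P1 f K \<gamma> z. F p) * indicator {0<..} z)"
proof -
  have Km[measurable]: "P1 f K \<gamma> \<in> restrict_space \<mu> {0<..} \<rightarrow>\<^sub>M subprob_algebra borel"
    using measurable_prob_algebraD[OF P1_measurable_prob]
    by (simp add: measurable_cong_sets[OF sets_restrict_space_cong[OF mu] refl])
  have "(NN p|P1_mix f K \<gamma> \<mu>. F p) = (NN z|restrict_space \<mu> {0<..}. (NN p|P1 f K \<gamma> z. F p))"
    unfolding P1_mix_def by (rule nn_integral_bind[OF F Km])
  also have "\<dots> = (NN z|\<mu>. (NN p|P1 f K \<gamma> z. F p) * indicator {0<..} z)"
    using mu by (subst nn_integral_restrict_space) (auto simp: sets_eq_imp_space_eq[OF mu])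
  finally show ?thesis .
qed

text \<open>The Poisson-Kingman form of the two-parameter law, obtained by a polynomial tilt of the
  total mass. It is identified with the stick-breaking form in \<open>PD_eq_pd_law\<close>.\<close>

definition pd_law :: "real \<Rightarrow> (nat \<Rightarrow> real) measure" where
  "pd_law \<theta> = PK f K \<gamma> (\<lambda>t. pd_const \<gamma> \<theta> * t powr (- \<theta>))"

lemma sets_pd_law [simp, measurable_cong]: "sets (pd_law \<theta>) = sets borel"
  by (simp add: pd_law_def)

lemma nn_integral_pd_law:
  assumes [measurable]: "F \<in> borel_measurable borel"
  shows "(NN p|pd_law \<theta>. F p) = (NN p|D. ennreal (pd_const \<gamma> \<theta> * tsum p powr (- \<theta>)) * F (normed p))"
  unfolding pd_law_def by (rule nn_integral_PK) measurable

lemma prob_space_pd_law: assumes "- \<gamma> < \<theta>" shows "prob_space (pd_law \<theta>)"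
proof (rule prob_spaceI)
  have "emeasure (pd_law \<theta>) (space (pd_law \<theta>)) = (NN p|pd_law \<theta>. 1)" by simp
  also have "\<dots> = 1" using nn_integral_pd_law[of "\<lambda>_. 1" \<theta>] nn_integral_tsum_powr[OF assms] by simp
  finally show "emeasure (pd_law \<theta>) (space (pd_law \<theta>)) = 1" .
qed

lemma P1_mix_gamma_law:
  assumes th: "- \<gamma> < \<theta>"
  shows "P1_mix f K \<gamma> (gamma_law ((\<theta> + \<gamma>) / \<gamma>)) = pd_law \<theta>"
proof (rule measure_eqI_nn_integral)
  let ?G = "gamma_law ((\<theta> + \<gamma>) / \<gamma>)"
  have a: "0 < (\<theta> + \<gamma>) / \<gamma>" using gamma th by simp
  interpret G: prob_space ?G by (rule prob_space_gamma_law[OF a])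
  interpret pair_sigma_finite ?G D ..
  fix F :: "(nat \<Rightarrow> real) \<Rightarrow> ennreal" assume "F \<in> borel_measurable (pd_law \<theta>)"
  then have [measurable]: "F \<in> borel_measurable borel" by (simp cong: measurable_cong_sets)
  have "(NN p|P1_mix f K \<gamma> ?G. F p) = (NN z|?G. (NN p|P1 f K \<gamma> z. F p) * indicator {0<..} z)"
    by (rule nn_integral_P1_mix) auto
  also have "\<dots> = (NN z|?G. (NN p|D. ennreal (r1 \<gamma> z (tsum p)) * F (normed p)))"
    by (rule nn_integral_cong_AE, use AE_gamma_law_pos in eventually_elim) (simp add: nn_integral_P1)
  also have "\<dots> = (NN p|D. (NN z|?G. ennreal (r1 \<gamma> z (tsum p)) * F (normed p)))"
    by (rule Fubini'[symmetric]) measurable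
  also have "\<dots> = (NN p|D. ennreal (pd_const \<gamma> \<theta> * tsum p powr (- \<theta>)) * F (normed p))"
    by (rule nn_integral_cong_AE, use AE_tsum in eventually_elim)
       (use gamma th in \<open>simp add: nn_integral_multc gamma_mixture_r1\<close>)
  also have "\<dots> = (NN p|pd_law \<theta>. F p)" by (rule nn_integral_pd_law[symmetric]) measurable
  finally show "(NN p|P1_mix f K \<gamma> ?G. F p) = (NN p|pd_law \<theta>. F p)" .
qed simp

end

subsection \<open>Local times\<close>

text \<open>For an infinite index set both sides are 0, by the conventions of \<open>card\<close>
  and of \<open>enn2real\<close> at \<open>\<top>\<close>. The right-hand side shows that the count
  is measurable in \<open>p\<close>.\<close>

lemma card_level_eq_enn2real:
  fixes p :: "nat \<Rightarrow> real"
  shows "real (card {i. p i \<in> A}) = enn2real (\<Sum>i. indicator A (p i))"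
proof -
  have "(\<Sum>i. indicator A (p i) :: ennreal) = (NN i|count_space UNIV. indicator {i. p i \<in> A} i)"
    by (subst nn_integral_count_space_nat, intro arg_cong[where f = suminf] ext) (simp add: indicator_def)
  also have "\<dots> = emeasure (count_space UNIV) {i. p i \<in> A}" by simp
  finally show ?thesis by (simp add: emeasure_count_space)
qed

lemma decseq_locate:
  fixes a :: "nat \<Rightarrow> real"
  assumes dec: "decseq a" and lim: "a \<longlonglongrightarrow> 0" and e: "0 < e" "e < a n0"
  obtains n where "n0 \<le> n" "a (Suc n) \<le> e" "e < a n"
proof -
  have "eventually (\<lambda>m. a m < e) sequentially" using lim e by (intro order_tendstoD(2)[of a 0]) auto
  then have ex: "\<exists>m. a m \<le> e" by (auto simp: eventually_sequentially intro: less_imp_le)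
  define m where "m = (LEAST m. a m \<le> e)"
  have m: "a m \<le> e" unfolding m_def by (rule LeastI_ex[OF ex])
  have "n0 < m"
  proof (rule ccontr)
    assume "\<not> n0 < m"
    then have "a n0 \<le> a m" using dec by (auto simp: decseq_def)
    with m e show False by simp
  qed
  then obtain n where n: "m = Suc n" "n0 \<le> n" by (cases m) auto
  have "\<not> a n \<le> e" using not_less_Least[of n "\<lambda>m. a m \<le> e"] n by (simp add: m_def)
  with n m show thesis by (intro that[of n]) auto
qed

text \<open>The count is monotone in the level. Between consecutive levels of \<open>a\<close> the
  normalized count is therefore squeezed between \<open>L n\<close> and \<open>U n\<close>, which
  share a limit because the ratios of consecutive levels tend to 1.\<close>

lemma level_count_limit:
  fixes p a :: "nat \<Rightarrow> real"
  assumes fin: "\<And>e. 0 < e \<Longrightarrow> finite {i. e \<le> p i}" and g: "0 < \<gamma>"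
    and a: "\<And>n. 0 < a n" "decseq a" "a \<longlonglongrightarrow> 0" "(\<lambda>n. a n / a (Suc n)) \<longlonglongrightarrow> 1"
    and lim: "(\<lambda>n. a n powr \<gamma> * real (card {i. a n \<le> p i})) \<longlonglongrightarrow> l"
  shows "((\<lambda>e. e powr \<gamma> * real (card {i. e \<le> p i})) \<longlongrightarrow> l) (at_right 0)"
proof -
  define N where "N e = real (card {i. e \<le> p i})" for e
  have N: "N e \<le> N d" if "0 < d" "d \<le> e" for d e
    unfolding N_def using fin[OF that(1)] that(2) by (intro of_nat_mono card_mono) auto
  define U where "U n = (a n / a (Suc n)) powr \<gamma> * (a (Suc n) powr \<gamma> * N (a (Suc n)))" for n
  define L where "L n = (a n / a (Suc n)) powr (- \<gamma>) * (a n powr \<gamma> * N (a n))" for n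
  have "U \<longlonglongrightarrow> 1 powr \<gamma> * l"
    unfolding U_def N_def by (intro tendsto_mult tendsto_powr a(4) tendsto_const LIMSEQ_Suc[OF lim]) auto
  then have U: "U \<longlonglongrightarrow> l" by simp
  have "L \<longlonglongrightarrow> 1 powr (- \<gamma>) * l"
    unfolding L_def N_def by (intro tendsto_mult tendsto_powr a(4) tendsto_const lim) auto
  then have L: "L \<longlonglongrightarrow> l" by simp
  have bounds: "L n \<le> e powr \<gamma> * N e" "e powr \<gamma> * N e \<le> U n" if "a (Suc n) \<le> e" "e < a n" for n e
  proof -
    have e: "0 < e" using that(1) a(1)[of "Suc n"] by simp
    have "L n = a (Suc n) powr \<gamma> * N (a n)"
      unfolding L_def using a(1)[of n] a(1)[of "Suc n"] by (simp add: powr_divide powr_minus field_simps)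
    also have "\<dots> \<le> e powr \<gamma> * N e"
      using that e a(1)[of "Suc n"] g by (intro mult_mono N powr_mono2) (auto simp: N_def)
    finally show "L n \<le> e powr \<gamma> * N e" .
    have "e powr \<gamma> * N e \<le> a n powr \<gamma> * N (a (Suc n))"
      using that e a(1)[of "Suc n"] g by (intro mult_mono N powr_mono2) (auto simp: N_def)
    also have "\<dots> = U n"
      unfolding U_def using a(1)[of n] a(1)[of "Suc n"] by (simp add: powr_divide)
    finally show "e powr \<gamma> * N e \<le> U n" .
  qed
  have ev: "eventually P (at_right 0)" if P: "\<And>n e. n0 \<le> n \<Longrightarrow> a (Suc n) \<le> e \<Longrightarrow> e < a n \<Longrightarrow> P e" for P :: "real \<Rightarrow> bool" and n0
    unfolding eventually_at_right_field
  proof (intro exI[of _ "a n0"] conjI allI impI)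
    fix y assume y: "0 < y" "y < a n0"
    from decseq_locate[OF a(2,3) y] P show "P y" by metis
  qed (rule a(1))
  have "((\<lambda>e. e powr \<gamma> * N e) \<longlongrightarrow> l) (at_right 0)"
  proof (rule order_tendstoI)
    fix x assume "x < l"
    then obtain n0 where n0: "\<And>n. n0 \<le> n \<Longrightarrow> x < L n"
      using order_tendstoD(1)[OF L] by (auto simp: eventually_sequentially)
    show "eventually (\<lambda>e. x < e powr \<gamma> * N e) (at_right 0)"
      by (rule ev[of n0]) (use n0 bounds(1) less_le_trans in blast)
  next
    fix x assume "l < x"
    then obtain n0 where n0: "\<And>n. n0 \<le> n \<Longrightarrow> U n < x"
      using order_tendstoD(2)[OF U] by (auto simp: eventually_sequentially)
    show "eventually (\<lambda>e. e powr \<gamma> * N e < x) (at_right 0)"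
      by (rule ev[of n0]) (use n0 bounds(2) le_less_trans in blast)
  qed
  then show ?thesis unfolding N_def .
qed

lemma inverse_Suc_ratio: "(\<lambda>n. inverse (real (Suc n)) / inverse (real (Suc (Suc n)))) \<longlonglongrightarrow> 1"
proof -
  have "(\<lambda>n. 1 + inverse (real (Suc n))) \<longlonglongrightarrow> 1 + 0"
    by (intro tendsto_add tendsto_const LIMSEQ_inverse_real_of_nat)
  moreover have "1 + inverse (real (Suc n)) = inverse (real (Suc n)) / inverse (real (Suc (Suc n)))" for n
    by (simp add: field_simps)
  ultimately show ?thesis by simp
qed

text \<open>Replaces the continuous limit in \<open>local_time\<close> by a sequential one, which is
  measurable in \<open>p\<close>. The two notions of convergence agree for every \<open>p\<close>:
  if some level is exceeded infinitely often, \<open>card\<close> is 0 at all smaller levels and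
  both limits are 0.\<close>

lemma Lim_level_count:
  fixes p :: "nat \<Rightarrow> real"
  assumes g: "0 < \<gamma>"
  shows "Lim (at_right 0) (\<lambda>e. e powr \<gamma> * real (card {i. e \<le> p i})) =
    lim (\<lambda>n. inverse (real (Suc n)) powr \<gamma> * real (card {i. inverse (real (Suc n)) \<le> p i}))"
proof -
  let ?F = "\<lambda>e. e powr \<gamma> * real (card {i. e \<le> p i})"
  have at: "filterlim (\<lambda>n. inverse (real (Suc n))) (at_right 0) sequentially"
    unfolding filterlim_at using LIMSEQ_inverse_real_of_nat by auto
  have "(?F \<longlongrightarrow> l) (at_right 0) \<longleftrightarrow> (\<lambda>n. ?F (inverse (real (Suc n)))) \<longlonglongrightarrow> l" for l
  proof (cases "\<forall>e>0. finite {i. e \<le> p i}")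
    case True
    show ?thesis
    proof
      assume "(\<lambda>n. ?F (inverse (real (Suc n)))) \<longlonglongrightarrow> l"
      then show "(?F \<longlongrightarrow> l) (at_right 0)"
      proof (rule level_count_limit[rotated -1])
        show "decseq (\<lambda>n. inverse (real (Suc n)))" by (intro decseq_SucI le_imp_inverse_le) auto
      qed (use True g LIMSEQ_inverse_real_of_nat inverse_Suc_ratio in auto)
    qed (rule filterlim_compose[OF _ at])
  next
    case False
    then obtain d where d: "0 < d" "infinite {i. d \<le> p i}" by auto
    have "card {i. e \<le> p i} = 0" if "e < d" for e
    proof -
      have "{i. d \<le> p i} \<subseteq> {i. e \<le> p i}" using that by auto
      then show ?thesis using d(2) finite_subset by (metis card.infinite)
    qed
    then have z: "eventually (\<lambda>e. ?F e = 0) (at_right 0)"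
      unfolding eventually_at_right_field using d(1) by (intro exI[of _ d]) auto
    have "(?F \<longlongrightarrow> l) (at_right 0) \<longleftrightarrow> l = 0"
      using tendsto_cong[OF z, of l] by (auto simp: tendsto_const_iff)
    moreover have "(\<lambda>n. ?F (inverse (real (Suc n)))) \<longlonglongrightarrow> l \<longleftrightarrow> l = 0"
      using tendsto_cong[OF eventually_compose_filterlim[OF z at], of l] by (auto simp: tendsto_const_iff)
    ultimately show ?thesis by simp
  qed
  then show ?thesis unfolding t2_space_class.Lim_def by simp
qed

lemma inv_local_time_measurable:
  assumes g: "0 < \<gamma>" shows "inv_local_time \<gamma> \<in> borel_measurable borel"
proof -
  note [measurable] = borel_seq_component
  have "(\<lambda>p :: nat \<Rightarrow> real. real (card {i. e \<le> p i})) \<in> borel_measurable borel" for e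
    using card_level_eq_enn2real[of _ "{e..}"] by simp
  then have [measurable]: "local_time \<gamma> \<in> borel_measurable borel"
    unfolding local_time_def Lim_level_count[OF g]
    by (intro borel_measurable_times borel_measurable_const borel_measurable_lim_metric)
  show ?thesis unfolding inv_local_time_def by measurable
qed

lemma inv_local_time_nonneg: "0 \<le> inv_local_time \<gamma> p"
  by (simp add: inv_local_time_def)

section \<open>Variance of the Poisson counts\<close>

context ranked_poisson
begin

text \<open>The Mecke formula applied to the square: a point of \<open>A\<close> inserted into the
  process raises the count by 1, so the second moment is (1 + m) * m. That 0 is outside
  \<open>A\<close> keeps zero entries from being counted.\<close>

lemma second_moment_count:
  assumes A[measurable]: "A \<in> sets borel" and finA: "emeasure \<nu> A < \<infinity>" and A0: "0 \<notin> A"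
  shows "(NN p|D. ennreal ((real (card {i. p i \<in> A}) - measure \<nu> A)\<^sup>2)) = ennreal (measure \<nu> A)"
proof -
  note [measurable] = borel_seq_component
  define N where "N p = (\<Sum>k. indicator A (p k) :: ennreal)" for p :: "nat \<Rightarrow> real"
  have [measurable]: "N \<in> borel_measurable borel" unfolding N_def by measurable
  define m where "m = measure \<nu> A"
  have m: "emeasure \<nu> A = ennreal m" "0 \<le> m" using finA by (auto simp: m_def emeasure_eq_ennreal_measure less_top)
  have 1: "(NN p|D. N p) = ennreal m"
    using mecke[of "indicator A" "\<lambda>_. 1"] m by (simp add: N_def emeasure_space_1[simplified])
  have "(NN p|D. N p * N p) = (NN x|\<nu>. indicator A x * (NN p|D. N (ranked (case_nat x p))))"
    using mecke[of "indicator A" N] by (simp add: N_def)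
  also have "\<dots> = (NN x|\<nu>. ennreal (1 + m) * indicator A x)"
  proof (rule nn_integral_cong_on[OF AE_nu_pos], goal_cases elim)
    case (elim x)
    have "(NN p|D. N (ranked (case_nat x p))) = (NN p|D. indicator A x + N p)"
      unfolding N_def
      by (rule nn_integral_cong_AE, use AE_ranked_seqs in eventually_elim)
         (use elim A0 in \<open>simp add: suminf_insert_point ranked_seqs_def\<close>)
    also have "\<dots> = indicator A x + ennreal m"
      by (subst nn_integral_add) (auto simp: 1 emeasure_space_1[simplified])
    finally show ?case using m(2) by (auto simp: indicator_def mult.commute)
  qed
  also have "\<dots> = ennreal ((1 + m) * m)" using m by (simp add: nn_integral_cmult_indicator ennreal_mult)
  finally have 2: "(NN p|D. N p * N p) = ennreal ((1 + m) * m)" .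
  define n where "n p = enn2real (N p)" for p
  have [measurable]: "n \<in> borel_measurable borel" unfolding n_def by measurable
  have "AE p in D. N p \<noteq> \<infinity>" by (rule nn_integral_PInf_AE) (auto simp: 1)
  then have AEn: "AE p in D. N p = ennreal (n p)"
    by eventually_elim (auto simp: n_def less_top)
  have n1: "(NN p|D. ennreal (n p)) = ennreal m"
    unfolding 1[symmetric] by (rule nn_integral_cong_AE, use AEn in eventually_elim) simp
  have n2: "(NN p|D. ennreal ((n p)\<^sup>2)) = ennreal ((1 + m) * m)"
    unfolding 2[symmetric]
    by (rule nn_integral_cong_AE, use AEn in eventually_elim) (simp add: power2_eq_square ennreal_mult n_def)
  have i1: "has_bochner_integral D n m"
    by (rule has_bochner_integral_nn_integral) (use n1 m in \<open>auto simp: n_def\<close>)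
  have i2: "has_bochner_integral D (\<lambda>p. (n p)\<^sup>2) ((1 + m) * m)"
    by (rule has_bochner_integral_nn_integral) (use n2 m in auto)
  have "has_bochner_integral D (\<lambda>p. (n p)\<^sup>2 - 2 * m * n p + m\<^sup>2) ((1 + m) * m - 2 * m * m + m\<^sup>2)"
    using has_bochner_integral_add[OF has_bochner_integral_diff[OF i2 has_bochner_integral_mult_right[OF i1, of "2 * m"]], of "\<lambda>_. m\<^sup>2" "m\<^sup>2"]
      prob_space by (auto simp: has_bochner_integral_iff)
  moreover have "(\<lambda>p. (n p)\<^sup>2 - 2 * m * n p + m\<^sup>2) = (\<lambda>p. (n p - m)\<^sup>2)" "(1 + m) * m - 2 * m * m + m\<^sup>2 = m"
    by (auto simp: power2_eq_square algebra_simps fun_eq_iff)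
  ultimately have "has_bochner_integral D (\<lambda>p. (n p - m)\<^sup>2) m" by simp
  then have "(NN p|D. ennreal ((n p - m)\<^sup>2)) = ennreal m"
    by (subst nn_integral_eq_integral) (auto simp: has_bochner_integral_iff)
  then show ?thesis unfolding n_def N_def card_level_eq_enn2real m_def .
qed

end

section \<open>Almost sure asymptotics of small points\<close>

context stable_points
begin

text \<open>Chebyshev's inequality and Borel-Cantelli along the levels \<open>n powr (- 2 / \<gamma>)\<close>, followed by
  monotone interpolation.\<close>

lemma AE_level_count:
  "AE p in D. ((\<lambda>e. e powr \<gamma> * real (card {i. e \<le> p i})) \<longlongrightarrow> 1 / Gamma (1 - \<gamma>)) (at_right 0)"
proof -
  define G where "G = Gamma (1 - \<gamma>)"
  have G: "0 < G" using Gamma_one_minus_pos[OF gamma] by (simp add: G_def)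
  \<comment> \<open>The level \<open>a n\<close> has intensity b n / G above it, so the normalized
    count has variance 1 / (G * b n). The square makes these variances summable while consecutive
    levels still have ratio tending to 1.\<close>
  define b where "b n = (real (Suc n))\<^sup>2" for n
  have b: "0 < b n" for n by (simp add: b_def)
  define a where "a n = b n powr (- (1 / \<gamma>))" for n
  have a: "0 < a n" for n using b[of n] by (simp add: a_def)
  have ag: "a n powr \<gamma> = 1 / b n" for n
  proof -
    have "a n powr \<gamma> = b n powr (- (1 / \<gamma>) * \<gamma>)" unfolding a_def by (rule powr_powr)
    also have "- (1 / \<gamma>) * \<gamma> = - 1" using gamma by simp
    finally show ?thesis using b[of n] by (simp add: powr_minus_divide)
  qed
  have ag': "a n powr (- \<gamma>) = b n" for n using gamma b[of n] by (simp add: a_def powr_powr)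
  define N where "N n p = real (card {i. p i \<in> {a n..}})" for n and p :: "nat \<Rightarrow> real"
  have [measurable]: "N n \<in> borel_measurable borel" for n supply [measurable] = borel_seq_component unfolding N_def card_level_eq_enn2real by measurable
  have em: "emeasure (stable_intensity \<gamma>) {a n..} = ennreal (b n / G)" for n
    using emeasure_stable_intensity_atLeast[OF gamma a[of n]] by (simp add: ag' G_def)
  have me: "measure (stable_intensity \<gamma>) {a n..} = b n / G" for n
    using em[of n] G b[of n] by (simp add: measure_def)
  have "(NN p|D. ennreal ((N n p / b n - 1 / G)\<^sup>2)) = ennreal (1 / G * inverse (b n))" for n
  proof -
    have "(NN p|D. ennreal ((N n p / b n - 1 / G)\<^sup>2)) = (NN p|D. ennreal (inverse ((b n)\<^sup>2)) * ennreal ((N n p - b n / G)\<^sup>2))"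
    proof (intro nn_integral_cong)
      fix p
      have "N n p / b n - 1 / G = inverse (b n) * (N n p - b n / G)" using b[of n] by (simp add: field_simps)
      then have "(N n p / b n - 1 / G)\<^sup>2 = inverse ((b n)\<^sup>2) * (N n p - b n / G)\<^sup>2"
        by (simp add: power_mult_distrib power_inverse)
      then show "ennreal ((N n p / b n - 1 / G)\<^sup>2) = ennreal (inverse ((b n)\<^sup>2)) * ennreal ((N n p - b n / G)\<^sup>2)"
        by (simp add: ennreal_mult)
    qed
    also have "\<dots> = ennreal (inverse ((b n)\<^sup>2)) * (NN p|D. ennreal ((N n p - b n / G)\<^sup>2))"
      by (rule nn_integral_cmult) measurable
    also have "(NN p|D. ennreal ((N n p - b n / G)\<^sup>2)) = ennreal (b n / G)"
      using second_moment_count[of "{a n..}"] a[of n] by (simp add: N_def me em)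
    also have "ennreal (inverse ((b n)\<^sup>2)) * ennreal (b n / G) = ennreal (1 / G * inverse (b n))"
      using b[of n] G by (simp add: ennreal_mult[symmetric] power2_eq_square field_simps)
    finally show ?thesis .
  qed
  then have "(NN p|D. (\<Sum>n. ennreal ((N n p / b n - 1 / G)\<^sup>2))) = (\<Sum>n. ennreal (1 / G * inverse (b n)))"
    by (subst nn_integral_suminf) auto
  also have "\<dots> \<noteq> \<top>"
  proof -
    have "summable (\<lambda>n. inverse (b n))"
      using summable_Suc_iff[of "\<lambda>n. inverse ((real n)\<^sup>2)"] inverse_power_summable[of 2] by (simp add: b_def power_inverse del: of_nat_Suc)
    then have "summable (\<lambda>n. 1 / G * inverse (b n))" by (rule summable_mult)
    then show ?thesis using G b by (subst suminf_ennreal2) (auto simp: less_imp_le)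
  qed
  finally have "AE p in D. (\<Sum>n. ennreal ((N n p / b n - 1 / G)\<^sup>2)) \<noteq> \<infinity>"
    by (intro nn_integral_PInf_AE) auto
  with AE_tsum show ?thesis
  proof eventually_elim
    case (elim p)
    have "summable (\<lambda>n. (N n p / b n - 1 / G)\<^sup>2)"
      using elim(2) by (intro summable_suminf_not_top) (auto simp: infinity_ennreal_def)
    then have "(\<lambda>n. (N n p / b n - 1 / G)\<^sup>2) \<longlonglongrightarrow> 0" by (rule summable_LIMSEQ_zero)
    then have "(\<lambda>n. sqrt ((N n p / b n - 1 / G)\<^sup>2)) \<longlonglongrightarrow> sqrt 0" by (rule tendsto_real_sqrt)
    then have "(\<lambda>n. N n p / b n - 1 / G) \<longlonglongrightarrow> 0" by (simp add: tendsto_rabs_zero_iff)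
    then have lim: "(\<lambda>n. N n p / b n) \<longlonglongrightarrow> 1 / G" by (rule LIM_zero_cancel)
    show ?case unfolding G_def[symmetric]
    proof (rule level_count_limit[where a = a])
      show "(\<lambda>n. a n powr \<gamma> * real (card {i. a n \<le> p i})) \<longlonglongrightarrow> 1 / G"
        using lim by (simp add: ag N_def)
      show "finite {i. e \<le> p i}" if "0 < e" for e
      proof (rule finite_subset)
        show "{i. e \<le> p i} \<subseteq> {i. e / 2 < p i}" using that by auto
        have "vanishing p" using elim(1) by (simp add: ranked_seqs_def)
        moreover have "0 < e / 2" using that by simp
        ultimately show "finite {i. e / 2 < p i}" unfolding vanishing_def by blast
      qed
      show "decseq a"
        unfolding a_def b_def using gamma by (intro decseq_SucI powr_mono2') (auto intro!: power_mono)
      have b': "a n = inverse (real (Suc n)) powr (2 / \<gamma>)" for n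
      proof -
        have "(x\<^sup>2) powr c = inverse x powr (- 2 * c)" if "0 < x" for x c :: real
          using that by (simp add: powr_def ln_realpow ln_inverse)
        from this[of "real (Suc n)" "- (1 / \<gamma>)"] show ?thesis by (simp add: a_def b_def)
      qed
      have "(\<lambda>n. inverse (real (Suc n)) powr (2 / \<gamma>)) \<longlonglongrightarrow> 0 powr (2 / \<gamma>)"
        using gamma by (intro tendsto_powr' LIMSEQ_inverse_real_of_nat tendsto_const) auto
      then show "a \<longlonglongrightarrow> 0" by (simp add: b'[abs_def])
      have "(\<lambda>n. (inverse (real (Suc n)) / inverse (real (Suc (Suc n)))) powr (2 / \<gamma>)) \<longlonglongrightarrow> 1 powr (2 / \<gamma>)"
        by (intro tendsto_powr inverse_Suc_ratio tendsto_const) auto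
      then show "(\<lambda>n. a n / a (Suc n)) \<longlonglongrightarrow> 1" by (simp add: b'[abs_def] powr_divide del: of_nat_Suc)
    qed (use gamma a in auto)
  qed
qed

text \<open>Normalization turns level e into level e * t of the original points, with t the total
  mass. The deterministic limit of \<open>AE_level_count\<close> thus becomes t powr (- \<gamma>),
  and t is read off from it.\<close>

lemma AE_inv_local_time: "AE p in D. inv_local_time \<gamma> (normed p) = tsum p"
  using AE_level_count AE_tsum
proof eventually_elim
  case (elim p)
  define G where "G = Gamma (1 - \<gamma>)"
  have G: "0 < G" using Gamma_one_minus_pos[OF gamma] by (simp add: G_def)
  define t where "t = tsum p"
  have t: "0 < t" using elim(2) by (simp add: t_def)
  have "filterlim (\<lambda>e. e * t) (at_right 0) (at_right 0)"
    unfolding filterlim_at using t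
    by (auto simp: eventually_at_filter intro!: tendsto_eq_intros)
  from filterlim_compose[OF elim(1) this]
  have "((\<lambda>e. t powr (- \<gamma>) * ((e * t) powr \<gamma> * real (card {i. e * t \<le> p i}))) \<longlongrightarrow> t powr (- \<gamma>) * (1 / G)) (at_right 0)"
    unfolding G_def by (intro tendsto_mult tendsto_const)
  moreover have "eventually (\<lambda>e. t powr (- \<gamma>) * ((e * t) powr \<gamma> * real (card {i. e * t \<le> p i})) = e powr \<gamma> * real (card {i. e \<le> normed p i})) (at_right 0)"
    using eventually_at_right_less[of 0]
  proof eventually_elim
    case (elim e)
    have "(e * t) powr \<gamma> = e powr \<gamma> * t powr \<gamma>" using elim t by (simp add: powr_mult)
    moreover have "{i. e * t \<le> p i} = {i. e \<le> normed p i}"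
      using t by (auto simp: normed_def t_def[symmetric] field_simps)
    ultimately show ?case using t by (simp add: powr_minus field_simps)
  qed
  ultimately have "((\<lambda>e. e powr \<gamma> * real (card {i. e \<le> normed p i})) \<longlongrightarrow> t powr (- \<gamma>) * (1 / G)) (at_right 0)"
    by (rule Lim_transform_eventually)
  then have "Lim (at_right 0) (\<lambda>e. e powr \<gamma> * real (card {i. e \<le> normed p i})) = t powr (- \<gamma>) * (1 / G)"
    by (intro tendsto_Lim) auto
  then have "local_time \<gamma> (normed p) = t powr (- \<gamma>)"
    unfolding local_time_def G_def[symmetric] using G by simp
  then show ?case using gamma t by (simp add: inv_local_time_def powr_powr t_def[symmetric])
qed

end

subsection \<open>Stick breaking\<close>

text \<open>The shift by 3 starts the exhaustion with the interval from 1/3 to 2/3; a shift by 2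
  would start with a single point.\<close>

lemma Union_cball_0_1: "(\<Union>n::nat. {1 / (real n + 3)..1 - 1 / (real n + 3)}) = {0<..<1}"
proof (intro equalityI subsetI)
  fix x :: real assume "x \<in> {0<..<1}"
  then have x: "0 < x" "x < 1" by auto
  obtain m :: nat where m: "1 / x < real m" using reals_Archimedean2 by blast
  obtain k :: nat where k: "1 / (1 - x) < real k" using reals_Archimedean2 by blast
  define n where "n = max m k"
  have "1 / x < real n + 3" "1 / (1 - x) < real n + 3" using m k by (auto simp: n_def)
  then have "1 / (real n + 3) \<le> x" "1 / (real n + 3) \<le> 1 - x" using x by (simp_all add: field_simps)
  then have "1 / (real n + 3) \<le> x \<and> x \<le> 1 - 1 / (real n + 3)" by simp
  then show "x \<in> (\<Union>n::nat. {1 / (real n + 3)..1 - 1 / (real n + 3)})" by auto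
next
  fix x :: real assume "x \<in> (\<Union>n::nat. {1 / (real n + 3)..1 - 1 / (real n + 3)})"
  then obtain n :: nat where "1 / (real n + 3) \<le> x" "x \<le> 1 - 1 / (real n + 3)" by auto
  moreover have "0 < 1 / (real n + 3)" by simp
  ultimately show "x \<in> {0<..<1}" unfolding greaterThanLessThan_iff by linarith
qed

lemma nn_integral_odds_substitution:
  fixes f :: "real \<Rightarrow> ennreal"
  assumes f[measurable]: "f \<in> borel_measurable borel" and T: "0 < T"
  shows "(NN x|lborel. f x * indicator {0<..} x) = (NN R|lborel. f (T * R / (1 - R)) * ennreal (T / (1 - R)\<^sup>2) * indicator {0<..<1} R)"
proof (rule nn_integral_substitution_exhaustion[where a = "\<lambda>n. 1 / (real n + 3)" and b = "\<lambda>n. 1 - 1 / (real n + 3)" and g = "\<lambda>R. T * R / (1 - R)"])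
  show "{0<..<1} = (\<Union>n::nat. {1 / (real n + 3)..1 - 1 / (real n + 3)})" by (rule Union_cball_0_1[symmetric])
  have pos: "0 < x" "x < 1" if "x \<in> {1 / (real n + 3)..1 - 1 / (real n + 3)}" for x and n :: nat
    using that Union_cball_0_1 by auto
  fix n
  show "((\<lambda>R. T * R / (1 - R)) has_real_derivative T / (1 - x)\<^sup>2) (at x)" if "x \<in> {1 / (real n + 3)..1 - 1 / (real n + 3)}" for x
    using pos[OF that] by (auto intro!: derivative_eq_intros simp: power2_eq_square field_simps)
  show "continuous_on {1 / (real n + 3)..1 - 1 / (real n + 3)} (\<lambda>x. T / (1 - x)\<^sup>2)"
    using pos[of _ n] by (intro continuous_intros) force
  have "1 / (real n + 3) \<le> 1 / 3" by (rule frac_le) auto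
  then show "1 / (real n + 3) < 1 - 1 / (real n + 3)" by linarith
  show "decseq (\<lambda>n. 1 / (real n + 3))" by (intro decseq_SucI) (simp add: frac_le)
  show "incseq (\<lambda>n. 1 - 1 / (real n + 3))" by (intro incseq_SucI) (simp add: frac_le)
next
  let ?g = "\<lambda>R. T * R / (1 - R)"
  show "{0<..} = (\<Union>n::nat. {?g (1 / (real n + 3))..?g (1 - 1 / (real n + 3))})"
  proof (intro equalityI subsetI)
    fix x :: real assume "x \<in> {0<..}"
    then have x: "0 < x" by simp
    have "x / (x + T) \<in> {0<..<1}" using x T by simp
    then obtain n :: nat where n: "1 / (real n + 3) \<le> x / (x + T)" "x / (x + T) \<le> 1 - 1 / (real n + 3)"
      unfolding Union_cball_0_1[symmetric] by auto
    have mono: "?g a \<le> ?g b" if "0 < a" "a \<le> b" "b < 1" for a b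
      using that T by (intro frac_le mult_left_mono mult_nonneg_nonneg) auto
    have "1 - x / (x + T) = T / (x + T)" using x T by (simp add: field_simps)
    then have gx: "?g (x / (x + T)) = x" using x T by simp
    have "?g (1 / (real n + 3)) \<le> ?g (x / (x + T))" "?g (x / (x + T)) \<le> ?g (1 - 1 / (real n + 3))"
      using n x T by (intro mono; simp)+
    then show "x \<in> (\<Union>n::nat. {?g (1 / (real n + 3))..?g (1 - 1 / (real n + 3))})" unfolding gx by auto
  next
    fix x :: real assume "x \<in> (\<Union>n::nat. {?g (1 / (real n + 3))..?g (1 - 1 / (real n + 3))})"
    then obtain n :: nat where "?g (1 / (real n + 3)) \<le> x" by auto
    moreover have "0 < ?g (1 / (real n + 3))" using T by (auto intro!: divide_pos_pos mult_pos_pos)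
    ultimately show "x \<in> {0<..}" unfolding greaterThan_iff by linarith
  qed
qed (use T in auto)

lemma suminf_eq_of_ennreal:
  fixes q :: "nat \<Rightarrow> real"
  assumes "\<And>k. 0 \<le> q k" "(\<Sum>k. ennreal (q k)) = ennreal r" "0 \<le> r"
  shows "summable q" "suminf q = r"
proof -
  show s: "summable q"
    by (rule summable_suminf_not_top) (simp_all add: assms(1,2))
  have "ennreal (suminf q) = ennreal r"
    by (rule trans[OF suminf_ennreal2[symmetric] assms(2)]) (rule assms(1), rule s)
  moreover have "0 \<le> suminf q" by (rule suminf_nonneg[OF s assms(1)])
  ultimately show "suminf q = r" using assms(3) by simp
qed

lemma sets_beta_law [simp, measurable_cong]: "sets (beta_law a b) = sets borel"
  by (simp add: beta_law_def)

lemma nn_integral_beta_law: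
  assumes [measurable]: "F \<in> borel_measurable borel"
  shows "(NN x|beta_law a b. F x) = (NN x|lborel. ennreal (x powr (a - 1) * (1 - x) powr (b - 1) / Beta a b) * indicator {0<..<1} x * F x)"
  unfolding beta_law_def by (rule nn_integral_density) auto

lemma AE_beta_law: "AE x in beta_law a b. 0 < x \<and> x < 1"
  unfolding beta_law_def by (subst AE_density) (auto simp: indicator_def)

lemma snd_seq_measurable: "(\<lambda>q. snd q k) \<in> borel_measurable (M \<Otimes>\<^sub>M seqs)"
  by (rule measurable_compose[OF measurable_snd borel_seq_component])

lemma snd_tsum_measurable: "(\<lambda>q. tsum (snd q)) \<in> borel_measurable (M \<Otimes>\<^sub>M borel)"
  by (rule measurable_compose[OF measurable_snd tsum_measurable])

section \<open>Size-biased recursion for the polynomially tilted law\<close>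

context stable_pd
begin

lemma AE_PK:
  assumes S[measurable]: "S \<in> sets borel" and h[measurable]: "h \<in> borel_measurable borel" and AE: "AE p in D. normed p \<in> S"
  shows "AE p in PK f K \<gamma> h. p \<in> S"
proof -
  have "emeasure (PK f K \<gamma> h) (- S) = (NN p|PK f K \<gamma> h. indicator (- S) p)" by simp
  also have "\<dots> = (NN p|D. ennreal (h (tsum p)) * indicator (- S) (normed p))" by (rule nn_integral_PK) measurable
  also have "\<dots> = (NN p|D. 0)" by (rule nn_integral_cong_AE, use AE in eventually_elim) simp
  finally have "emeasure (PK f K \<gamma> h) (- S) = 0" by simp
  then show ?thesis by (intro AE_I[where N = "- S"]) auto
qed

lemma AE_normed: "AE p in D. normed p \<in> ranked_seqs \<and> (\<forall>k. 0 \<le> normed p k \<and> normed p k \<le> 1) \<and> (\<Sum>k. ennreal (normed p k)) = 1"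
  using AE_tsum
proof eventually_elim
  case (elim p)
  have n: "normed p = (\<lambda>k. inverse (tsum p) * p k)" by (simp add: normed_def divide_inverse mult.commute fun_eq_iff)
  have "vanishing (normed p)" unfolding n using elim by (intro vanishing_scale) (auto simp: ranked_seqs_def)
  moreover have "decseq (normed p)" unfolding n using elim
    by (auto simp: ranked_seqs_def decseq_def intro!: mult_left_mono)
  moreover have "p k \<le> tsum p" for k
    unfolding tsum_def using elim sum_le_suminf[of p "{k}"] by (auto intro: less_imp_le)
  moreover have "(\<Sum>k. ennreal (normed p k)) = 1"
  proof -
    have "(\<Sum>k. ennreal (inverse (tsum p) * p k)) = ennreal (inverse (tsum p) * tsum p)"
      using elim by (intro suminf_eq_tsum) (auto intro: less_imp_le)
    then show ?thesis unfolding n using elim by simp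
  qed
  ultimately show ?case using elim by (auto simp: ranked_seqs_def normed_def less_imp_le)
qed

lemma AE_pd_law_ranked_seqs: "AE p in pd_law \<theta>. p \<in> ranked_seqs"
  unfolding pd_law_def by (rule AE_PK) (use AE_normed in \<open>auto elim: eventually_mono\<close>)

lemma tsum_insert_point:
  assumes "0 < x" "\<forall>i. 0 < p i" "p \<in> ranked_seqs" "summable p"
  shows "tsum (ranked (case_nat x p)) = x + tsum p"
proof -
  have v: "vanishing p" using assms(3) by (simp add: ranked_seqs_def)
  have nn: "0 \<le> p i" for i by (rule less_imp_le[OF assms(2)[rule_format]])
  have s: "(\<Sum>k. ennreal (p k)) = ennreal (tsum p)"
    using suminf_eq_tsum[of p 1, OF nn assms(4)] by simp
  have t: "0 \<le> tsum p" unfolding tsum_def by (rule suminf_nonneg[OF assms(4) nn])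
  have "(\<Sum>k. ennreal (ranked (case_nat x p) k)) = ennreal x + (\<Sum>k. ennreal (p k))"
    using assms by (intro suminf_insert_point v) auto
  also have "\<dots> = ennreal (x + tsum p)" unfolding s using assms t by simp
  finally show ?thesis unfolding tsum_def[of "ranked _"]
    using assms t v by (intro suminf_eq_of_ennreal(2)) (auto intro!: ranked_nonneg vanishing_case_nat)
qed

text \<open>The Laplace functional of a partition rescaled to total mass \<open>m\<close>. In the
  stick-breaking recursion \<open>m\<close> is the length that remains to be broken.\<close>

definition pd_functional :: "(real \<Rightarrow> ennreal) \<Rightarrow> real \<Rightarrow> real \<Rightarrow> ennreal" where
  "pd_functional g \<theta> m = (NN p|pd_law \<theta>. nexp (\<Sum>k. g (m * p k)))"

lemma pd_functional_eq:
  assumes [measurable]: "g \<in> borel_measurable borel"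
  shows "pd_functional g \<theta> m = (NN p|D. ennreal (pd_const \<gamma> \<theta> * tsum p powr (- \<theta>)) * nexp (\<Sum>k. g (m * (p k / tsum p))))"
proof -
  note [measurable] = borel_seq_component
  show ?thesis unfolding pd_functional_def
    by (subst nn_integral_pd_law) (auto simp: normed_def)
qed

lemma pd_functional_measurable [measurable]:
  assumes [measurable]: "g \<in> borel_measurable borel"
  shows "pd_functional g \<theta> \<in> borel_measurable borel"
proof -
  have "(\<lambda>q. ennreal (pd_const \<gamma> \<theta> * tsum (snd q) powr (- \<theta>)) * nexp (\<Sum>k. g (fst q * (snd q k / tsum (snd q)))))
    \<in> borel_measurable (borel \<Otimes>\<^sub>M borel)"
  proof -
    note [measurable] = snd_seq_measurable[of _ borel] snd_tsum_measurable[of borel]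
    show ?thesis by measurable
  qed
  then show ?thesis
    unfolding pd_functional_eq[OF assms, abs_def]
    by (intro borel_measurable_nn_integral) (simp add: split_beta cong: pair_cong)
qed

lemma pd_functional_step_measurable:
  assumes [measurable_cong]: "sets M = sets borel" and g[measurable]: "g \<in> borel_measurable borel"
  shows "(\<lambda>x. nexp (g (c * x)) * pd_functional g \<theta> (c * (1 - x))) \<in> borel_measurable M"
proof -
  have "(\<lambda>x. c * (1 - x)) \<in> borel_measurable M" by measurable
  note [measurable] = measurable_compose[OF this pd_functional_measurable[OF g], of \<theta>]
  show ?thesis by measurable
qed

text \<open>A size-biased pick: \<open>mecke\<close> with weight \<open>x\<close>, followed by \<open>x = T * R / (1 - R)\<close> for fixed remaining sum \<open>T\<close>.\<close>

lemma pd_functional_step: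
  assumes g[measurable]: "g \<in> borel_measurable borel" and g0: "g 0 = 0" and th: "- \<gamma> < \<theta>"
  shows "pd_functional g \<theta> m = (NN R|beta_law (1 - \<gamma>) (\<theta> + \<gamma>). nexp (g (m * R)) * pd_functional g (\<theta> + \<gamma>) (m * (1 - R)))"
proof -
  let ?\<nu> = "stable_intensity \<gamma>"
  interpret n: sigma_finite_measure ?\<nu> by (rule sigma_finite_nu)
  interpret nD: pair_sigma_finite ?\<nu> D ..
  interpret lD: pair_sigma_finite "lborel :: real measure" D ..
  define c where "c \<theta> = pd_const \<gamma> \<theta>" for \<theta>
  define C where "C = \<gamma> / Gamma (1 - \<gamma>)"
  define B where "B = Beta (1 - \<gamma>) (\<theta> + \<gamma>)"
  have pos: "0 < Gamma (1 - \<gamma>)" "0 < Gamma (\<theta> + \<gamma>)" "0 < Gamma (\<theta> + 1)" "0 < Gamma (\<theta> / \<gamma> + 1)"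
  proof -
    have "0 < \<theta> / \<gamma> + 1" using th gamma by (simp add: field_simps)
    then show "0 < Gamma (1 - \<gamma>)" "0 < Gamma (\<theta> + \<gamma>)" "0 < Gamma (\<theta> + 1)" "0 < Gamma (\<theta> / \<gamma> + 1)"
      using th gamma by (auto intro!: Gamma_real_pos)
  qed
  have cpos: "0 < c \<theta>" "0 < C" "0 < B"
    using pos pos(3)[unfolded add.commute[of \<theta>]] gamma by (auto simp: c_def C_def B_def Beta_def)
  \<comment> \<open>The functional equation of Gamma, at \<theta> + \<gamma> and at \<theta> /
    \<gamma> + 1, makes the stable constant times the old normalization split into the new
    normalization and that of the beta density.\<close>
  have const: "C * c \<theta> = c (\<theta> + \<gamma>) / B"
  proof -
    have G1: "Gamma (z + 1) = z * Gamma z" if "0 < z" for z :: real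
      using that by (intro Gamma_plus1) (auto dest: nonpos_Ints_nonpos)
    have "Gamma (\<theta> + \<gamma> + 1) = (\<theta> + \<gamma>) * Gamma (\<theta> + \<gamma>)"
      using th by (intro G1) simp
    moreover have "Gamma ((\<theta> + \<gamma>) / \<gamma> + 1) = (\<theta> / \<gamma> + 1) * Gamma (\<theta> / \<gamma> + 1)"
    proof -
      have "(\<theta> + \<gamma>) / \<gamma> = \<theta> / \<gamma> + 1" "0 < \<theta> / \<gamma> + 1" using gamma th by (auto simp: field_simps)
      then show ?thesis using G1[of "\<theta> / \<gamma> + 1"] by simp
    qed
    moreover have "B = Gamma (1 - \<gamma>) * Gamma (\<theta> + \<gamma>) / Gamma (\<theta> + 1)" by (simp add: B_def Beta_def add.commute)
    moreover have k: "\<theta> + \<gamma> = \<gamma> * (\<theta> / \<gamma> + 1)" "0 < \<theta> / \<gamma> + 1" using gamma th by (simp_all add: field_simps)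
    ultimately have "c (\<theta> + \<gamma>) = \<gamma> * (\<theta> / \<gamma> + 1) * Gamma (\<theta> + \<gamma>) / ((\<theta> / \<gamma> + 1) * Gamma (\<theta> / \<gamma> + 1))"
      and B: "B = Gamma (1 - \<gamma>) * Gamma (\<theta> + \<gamma>) / Gamma (\<theta> + 1)"
      unfolding c_def by simp_all
    then have "c (\<theta> + \<gamma>) = \<gamma> * Gamma (\<theta> + \<gamma>) / Gamma (\<theta> / \<gamma> + 1)" using k(2) by simp
    then show ?thesis unfolding B c_def[of \<theta>] C_def using pos by simp
  qed
  \<comment> \<open>One power of \<open>tsum p\<close> is removed from the weight; it reappears as
    the sum over the points, which is the form required by \<open>mecke\<close>.\<close>
  define \<Psi> where "\<Psi> p = ennreal (c \<theta> * tsum p powr (- \<theta> - 1)) * nexp (\<Sum>k. g (m * (p k / tsum p)))" for p :: "nat \<Rightarrow> real"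
  have [measurable]: "\<Psi> \<in> borel_measurable borel" supply [measurable] = borel_seq_component unfolding \<Psi>_def by measurable
  define H where "H x p = ennreal (x * c \<theta> * (x + tsum p) powr (- \<theta> - 1)) * (nexp (g (m * (x / (x + tsum p)))) * nexp (\<Sum>k. g (m * (p k / (x + tsum p)))))" for x p
  have Hm[measurable]: "(\<lambda>q. H (fst q) (snd q)) \<in> borel_measurable (borel \<Otimes>\<^sub>M borel)"
    supply [measurable] = snd_seq_measurable[of _ borel] snd_tsum_measurable[of borel] unfolding H_def by measurable
  have H1[measurable]: "(\<lambda>x. H x p) \<in> borel_measurable borel" for p
    unfolding H_def by measurable
  define b where "b R = ennreal (R powr (1 - \<gamma> - 1) * (1 - R) powr (\<theta> + \<gamma> - 1) / B) * indicator {0<..<1} R" for R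
  define J where "J R p = nexp (g (m * R)) * (ennreal (c (\<theta> + \<gamma>) * tsum p powr (- (\<theta> + \<gamma>))) * nexp (\<Sum>k. g (m * (1 - R) * (p k / tsum p))))" for R p
  have Jm: "(\<lambda>q. b (fst q) * J (fst q) (snd q)) \<in> borel_measurable (borel \<Otimes>\<^sub>M borel)"
    supply [measurable] = snd_seq_measurable[of _ borel] snd_tsum_measurable[of borel] unfolding b_def J_def by measurable
  have "pd_functional g \<theta> m = (NN p|D. (\<Sum>k. ennreal (p k)) * \<Psi> p)"
    unfolding pd_functional_eq[OF g]
  proof (rule nn_integral_cong_on[OF AE_tsum], goal_cases elim)
    case (elim p)
    have "(\<Sum>k. ennreal (1 * p k)) = ennreal (1 * tsum p)"
      using elim by (intro suminf_eq_tsum) (auto intro: less_imp_le)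
    moreover have "c \<theta> * tsum p powr (- \<theta>) = tsum p * (c \<theta> * tsum p powr (- \<theta> - 1))"
      using elim by (simp add: powr_diff)
    ultimately show ?case unfolding \<Psi>_def c_def[symmetric] using elim cpos
      by (simp add: ennreal_mult ac_simps)
  qed
  also have "\<dots> = (NN x|?\<nu>. ennreal x * (NN p|D. \<Psi> (ranked (case_nat x p))))"
    by (rule mecke) measurable
  also have "\<dots> = (NN x|?\<nu>. (NN p|D. H x p))"
  proof (rule nn_integral_cong_on[OF AE_nu_pos], goal_cases elim)
    case (elim x)
    have "ennreal x * (NN p|D. \<Psi> (ranked (case_nat x p))) = (NN p|D. ennreal x * \<Psi> (ranked (case_nat x p)))"
    proof (rule nn_integral_cmult[symmetric])
      show "(\<lambda>p. \<Psi> (ranked (case_nat x p))) \<in> borel_measurable D"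
      proof -
        have "(\<lambda>p. ranked (case_nat x p)) \<in> borel \<rightarrow>\<^sub>M borel"
          using measurable_Pair2[OF measurable_insert_point, of x] by simp
        then have "(\<lambda>p. \<Psi> (ranked (case_nat x p))) \<in> borel_measurable borel"
          by (rule measurable_compose) measurable
        then show ?thesis by (simp cong: measurable_cong_sets)
      qed
    qed
    also have "\<dots> = (NN p|D. H x p)"
    proof (rule nn_integral_cong_on[OF AE_tsum], goal_cases elim)
      case (elim p)
      have t: "tsum (ranked (case_nat x p)) = x + tsum p" using elim \<open>0 < x\<close> by (intro tsum_insert_point) auto
      have "(\<Sum>k. g (m * (ranked (case_nat x p) k / (x + tsum p)))) = g (m * (x / (x + tsum p))) + (\<Sum>k. g (m * (p k / (x + tsum p))))"
        using elim \<open>0 < x\<close> g0 by (intro suminf_insert_point[where g = "\<lambda>y. g (m * (y / (x + tsum p)))"]) (auto simp: ranked_seqs_def)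
      then show ?case unfolding \<Psi>_def H_def t using \<open>0 < x\<close> cpos by (simp add: nexp_add ennreal_mult mult.assoc)
    qed
    finally show ?case .
  qed
  also have "\<dots> = (NN p|D. (NN x|?\<nu>. H x p))"
    by (rule nD.Fubini'[symmetric]) (simp add: split_beta cong: pair_cong)
  also have "\<dots> = (NN p|D. (NN R|lborel. b R * J R p))"
  proof (rule nn_integral_cong_on[OF AE_tsum], goal_cases elim)
    case (elim p)
    define T where "T = tsum p"
    have T: "0 < T" using elim by (simp add: T_def)
    have "(NN x|?\<nu>. H x p) = (NN x|lborel. ennreal (C * x powr (- \<gamma> - 1)) * H x p * indicator {0<..} x)"
      unfolding C_def by (subst nn_integral_stable_intensity) (auto simp: ac_simps)
    also have "\<dots> = (NN R|lborel. ennreal (C * (T * R / (1 - R)) powr (- \<gamma> - 1)) * H (T * R / (1 - R)) p * ennreal (T / (1 - R)\<^sup>2) * indicator {0<..<1} R)"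
      by (rule nn_integral_odds_substitution[OF _ T]) measurable
    also have "\<dots> = (NN R|lborel. b R * J R p)"
    proof (intro nn_integral_cong)
      fix R :: real
      show "ennreal (C * (T * R / (1 - R)) powr (- \<gamma> - 1)) * H (T * R / (1 - R)) p * ennreal (T / (1 - R)\<^sup>2) * indicator {0<..<1} R = b R * J R p"
      proof (cases "0 < R \<and> R < 1")
        case True
        then have R: "0 < R" "R < 1" by auto
        define x where "x = T * R / (1 - R)"
        have x: "0 < x" using R T by (simp add: x_def)
        have xT: "x + T = T / (1 - R)" using R by (simp add: x_def field_simps)
        have e1: "x / (x + T) = R" unfolding xT using R T by (simp add: x_def)
        have e2: "m * (p k / (x + T)) = m * (1 - R) * (p k / T)" for k unfolding xT by simp
        define S where "S = nexp (g (m * R)) * nexp (\<Sum>k. g (m * (1 - R) * (p k / T)))"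
        have Hx: "H x p = ennreal (x * c \<theta> * (x + T) powr (- \<theta> - 1)) * S"
          unfolding H_def T_def[symmetric] e1 e2 S_def ..
        have lnx: "ln x = ln T + ln R - ln (1 - R)" using R T by (simp add: x_def ln_div ln_mult)
        have lnxT: "ln (x + T) = ln T - ln (1 - R)" unfolding xT using R T by (simp add: ln_div)
        have "C * x powr (- \<gamma> - 1) * (x * c \<theta> * (x + T) powr (- \<theta> - 1)) * (T / (1 - R)\<^sup>2) =
          (C * c \<theta>) * (x powr (- \<gamma>) * (x + T) powr (- \<theta> - 1) * (T / (1 - R)\<^sup>2))"
          using x by (simp add: powr_diff field_simps)
        \<comment> \<open>Collecting exponents: R has -\<gamma>, 1 - R has \<gamma> + (\<theta> + 1)
          - 2, and T has -\<gamma> - (\<theta> + 1) + 1. The density in R is a beta density, and the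
          power of T is the tilt with parameter \<theta> + \<gamma>.\<close>
        also have "x powr (- \<gamma>) * (x + T) powr (- \<theta> - 1) * (T / (1 - R)\<^sup>2) =
           R powr (1 - \<gamma> - 1) * (1 - R) powr (\<theta> + \<gamma> - 1) * T powr (- (\<theta> + \<gamma>))"
        proof -
          have a1: "T / (1 - R)\<^sup>2 = exp (ln T - 2 * ln (1 - R))"
          proof -
            have "exp (2 * ln (1 - R)) = (1 - R)\<^sup>2" using R by (simp add: exp_double)
            then show ?thesis using T by (simp add: exp_diff)
          qed
          have "x + T \<noteq> 0" using x T by simp
          then show ?thesis unfolding a1 powr_def using x R T
            by (simp add: exp_add[symmetric] lnx lnxT) (simp add: algebra_simps)
        qed
        finally have eq: "C * x powr (- \<gamma> - 1) * (x * c \<theta> * (x + T) powr (- \<theta> - 1)) * (T / (1 - R)\<^sup>2) =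
           (R powr (1 - \<gamma> - 1) * (1 - R) powr (\<theta> + \<gamma> - 1) / B) * (c (\<theta> + \<gamma>) * T powr (- (\<theta> + \<gamma>)))"
          unfolding const by (simp add: ac_simps)
        have "ennreal (C * x powr (- \<gamma> - 1)) * H x p * ennreal (T / (1 - R)\<^sup>2) =
           ennreal (C * x powr (- \<gamma> - 1) * (x * c \<theta> * (x + T) powr (- \<theta> - 1)) * (T / (1 - R)\<^sup>2)) * S"
          unfolding Hx using cpos x T by (subst ennreal_mult, simp, simp, subst ennreal_mult, simp, simp) (simp add: ac_simps)
        also have "\<dots> = ennreal (R powr (1 - \<gamma> - 1) * (1 - R) powr (\<theta> + \<gamma> - 1) / B) * ennreal (c (\<theta> + \<gamma>) * T powr (- (\<theta> + \<gamma>))) * S"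
          unfolding eq using cpos R by (subst ennreal_mult') auto
        finally show ?thesis using True unfolding x_def[symmetric] S_def b_def J_def T_def[symmetric] by (simp add: ac_simps)
      qed (auto simp: indicator_def b_def)
    qed
    finally show ?case .
  qed
  also have "\<dots> = (NN R|lborel. (NN p|D. b R * J R p))"
    by (rule lD.Fubini') (use Jm in \<open>simp add: split_beta cong: pair_cong\<close>)
  also have "\<dots> = (NN R|lborel. b R * (nexp (g (m * R)) * pd_functional g (\<theta> + \<gamma>) (m * (1 - R))))"
  proof (intro nn_integral_cong)
    fix R :: real
    have [measurable]: "(\<lambda>p. ennreal (c (\<theta> + \<gamma>) * tsum p powr (- (\<theta> + \<gamma>))) * nexp (\<Sum>k. g (m * (1 - R) * (p k / tsum p)))) \<in> borel_measurable D"
      by measurable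
    show "(NN p|D. b R * J R p) = b R * (nexp (g (m * R)) * pd_functional g (\<theta> + \<gamma>) (m * (1 - R)))"
      unfolding pd_functional_eq[OF g] c_def[symmetric] J_def by (subst nn_integral_cmult, measurable, subst nn_integral_cmult, measurable)
  qed
  also have "\<dots> = (NN R|beta_law (1 - \<gamma>) (\<theta> + \<gamma>). nexp (g (m * R)) * pd_functional g (\<theta> + \<gamma>) (m * (1 - R)))"
    unfolding b_def B_def by (rule nn_integral_beta_law[symmetric]) measurable
  finally show ?thesis .
qed

lemma pd_functional_le_1: "- \<gamma> < \<theta> \<Longrightarrow> pd_functional g \<theta> m \<le> 1"
proof -
  assume "- \<gamma> < \<theta>"
  then interpret P: prob_space "pd_law \<theta>" by (rule prob_space_pd_law)
  have "pd_functional g \<theta> m \<le> (NN p|pd_law \<theta>. 1)" unfolding pd_functional_def by (intro nn_integral_mono) simp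
  then show ?thesis by (simp add: P.emeasure_space_1)
qed

text \<open>Entries of a partition are at most 1, so after scaling by \<open>m\<close> none of them
  reaches the region where \<open>g\<close> is nonzero. This closes the recursion once the remaining
  length is small.\<close>

lemma pd_functional_eq_1:
  assumes th: "- \<gamma> < \<theta>" and g[measurable]: "g \<in> borel_measurable borel" and d: "\<And>x. x \<le> \<delta> \<Longrightarrow> g x = 0" and m: "0 \<le> m" "m \<le> \<delta>"
  shows "pd_functional g \<theta> m = 1"
proof -
  have "pd_functional g \<theta> m = (NN p|D. ennreal (pd_const \<gamma> \<theta> * tsum p powr (- \<theta>)))"
    unfolding pd_functional_eq[OF g]
  proof (rule nn_integral_cong_on[OF AE_normed], goal_cases elim)
    case (elim p)
    have "m * (p k / tsum p) \<le> \<delta>" for k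
    proof -
      have "m * (p k / tsum p) \<le> m * 1" using elim m by (intro mult_left_mono) (auto simp: normed_def)
      then show ?thesis using m by simp
    qed
    then show ?case by (simp add: d)
  qed
  then show ?thesis using nn_integral_tsum_powr[OF th] by simp
qed

text \<open>For \<open>g = 0\<close> both functionals in \<open>pd_functional_step\<close> equal 1,
  so the recursion itself says that the beta density integrates to 1.\<close>

lemma prob_space_beta_law:
  assumes th: "- \<gamma> < \<theta>" shows "prob_space (beta_law (1 - \<gamma>) (\<theta> + \<gamma>))"
proof (rule prob_spaceI)
  have th': "- \<gamma> < \<theta> + \<gamma>" using th gamma by simp
  have "1 = pd_functional (\<lambda>_. 0) \<theta> 0" by (rule pd_functional_eq_1[OF th, symmetric, where \<delta> = 0]) auto
  also have "\<dots> = (NN R|beta_law (1 - \<gamma>) (\<theta> + \<gamma>). 1)"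
    by (subst pd_functional_step[OF _ _ th]) (auto simp: pd_functional_eq_1[OF th', where \<delta> = 0])
  finally show "emeasure (beta_law (1 - \<gamma>) (\<theta> + \<gamma>)) (space (beta_law (1 - \<gamma>) (\<theta> + \<gamma>))) = 1" by simp
qed

section \<open>Decay of the remaining stick\<close>

lemma beta_law_mean_complement:
  assumes th: "- \<gamma> < \<theta>"
  shows "(NN R|beta_law (1 - \<gamma>) (\<theta> + \<gamma>). ennreal (1 - R)) = ennreal (1 - (1 - \<gamma>) / (1 + \<theta>))"
proof -
  define a b where "a = 1 - \<gamma>" and "b = \<theta> + \<gamma>"
  have ab: "0 < a" "0 < b" using th gamma by (auto simp: a_def b_def)
  have B: "0 < Beta a b" "0 < Beta a (b + 1)" using ab by (auto simp: Beta_def intro!: divide_pos_pos mult_pos_pos Gamma_real_pos)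
  have th': "- \<gamma> < \<theta> + 1" using th by simp
  have Beta: "(a + b) * Beta a (b + 1) = b * Beta a b"
    using ab by (intro Beta_plus1_right) (auto dest: nonpos_Ints_nonpos)
  interpret P: prob_space "beta_law a (b + 1)" using prob_space_beta_law[OF th'] by (simp add: a_def b_def add_ac)
  have "(NN R|beta_law a b. ennreal (1 - R)) = (NN R|lborel. ennreal (R powr (a - 1) * (1 - R) powr (b - 1) / Beta a b) * indicator {0<..<1} R * ennreal (1 - R))"
    by (rule nn_integral_beta_law) measurable
  also have "\<dots> = (NN R|lborel. ennreal (Beta a (b + 1) / Beta a b) * (ennreal (R powr (a - 1) * (1 - R) powr (b + 1 - 1) / Beta a (b + 1)) * indicator {0<..<1} R * 1))"
  proof (intro nn_integral_cong)
    fix R :: real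
    have "(1 - R) powr b = (1 - R) powr (b - 1) * (1 - R)" if "R < 1" using that by (simp add: powr_diff)
    then show "ennreal (R powr (a - 1) * (1 - R) powr (b - 1) / Beta a b) * indicator {0<..<1} R * ennreal (1 - R) =
      ennreal (Beta a (b + 1) / Beta a b) * (ennreal (R powr (a - 1) * (1 - R) powr (b + 1 - 1) / Beta a (b + 1)) * indicator {0<..<1} R * 1)"
      using B by (auto simp: indicator_def ennreal_mult[symmetric])
  qed
  also have "\<dots> = ennreal (Beta a (b + 1) / Beta a b) * (NN R|beta_law a (b + 1). 1)"
    by (subst nn_integral_cmult, measurable) (subst nn_integral_beta_law, auto)
  also have "(NN R|beta_law a (b + 1). 1) = 1" by (simp add: P.emeasure_space_1)
  also have "Beta a (b + 1) / Beta a b = b / (a + b)" using Beta B ab by (simp add: field_simps)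
  also have "b / (a + b) = 1 - (1 - \<gamma>) / (1 + \<theta>)" using th gamma by (simp add: a_def b_def field_simps)
  finally show ?thesis by (simp add: a_def b_def)
qed

text \<open>With c = (1 - \<gamma>) / (1 + |\<theta>|) the subtracted terms are at least c / (j +
  1), because 1 + \<theta> + j * \<gamma> is at most (1 + |\<theta>|) * (j + 1). As 1 - d is at most
  exp (- d), the product is bounded by exp of minus c times a harmonic number.\<close>

lemma prod_mean_complement_tendsto_0:
  assumes th: "- \<gamma> < \<theta>"
  shows "0 \<le> 1 - (1 - \<gamma>) / (1 + (\<theta> + real j * \<gamma>))"
    and "(\<lambda>n. \<Prod>j<n. 1 - (1 - \<gamma>) / (1 + (\<theta> + real j * \<gamma>))) \<longlonglongrightarrow> 0"
proof -
  define c where "c = (1 - \<gamma>) / (1 + \<bar>\<theta>\<bar>)"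
  define d where "d j = (1 - \<gamma>) / (1 + (\<theta> + real j * \<gamma>))" for j
  have c: "0 < c" using gamma by (simp add: c_def add_pos_nonneg)
  have j: "0 \<le> real j * \<gamma>" "real j * \<gamma> \<le> real j" "0 \<le> \<bar>\<theta>\<bar> * real j" for j
    using gamma by (auto simp: mult_le_cancel_left2)
  have pos: "0 < 1 + (\<theta> + real j * \<gamma>)" for j using j(1)[of j] th gamma by linarith
  have le: "c * inverse (real (Suc j)) \<le> d j" for j
  proof -
    have "1 + (\<theta> + real j * \<gamma>) \<le> (1 + \<bar>\<theta>\<bar>) * real (Suc j)"
      using j[of j] abs_ge_self[of \<theta>] by (simp only: of_nat_Suc distrib_left distrib_right mult_1 mult_1_right)
    then have "(1 - \<gamma>) / ((1 + \<bar>\<theta>\<bar>) * real (Suc j)) \<le> d j"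
      using gamma pos[of j] unfolding d_def by (intro divide_left_mono) auto
    then show ?thesis by (simp add: c_def divide_inverse ac_simps)
  qed
  have nn: "0 \<le> 1 - d j" for j using pos[of j] j(1)[of j] th by (simp add: d_def divide_le_eq)
  then show "0 \<le> 1 - (1 - \<gamma>) / (1 + (\<theta> + real j * \<gamma>))" by (simp add: d_def)
  have bound: "(\<Prod>j<n. 1 - d j) \<le> exp (- (c * harm n))" for n
  proof -
    have "(\<Prod>j<n. 1 - d j) \<le> (\<Prod>j<n. exp (- (c * inverse (real (Suc j)))))"
      by (intro prod_mono conjI nn order_trans[OF _ exp_ge_add_one_self]) (use le in auto)
    also have "\<dots> = exp (- (c * harm n))"
      unfolding exp_sum[symmetric, OF finite_lessThan] by (simp add: harm_def sum.atLeast1_atMost_eq sum_negf sum_distrib_left)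
    finally show ?thesis .
  qed
  have "filterlim (\<lambda>n. c * harm n) at_top sequentially"
    using c harm_at_top by (intro filterlim_tendsto_pos_mult_at_top[OF tendsto_const]) auto
  then have "filterlim (\<lambda>n. - (c * harm n)) at_bot sequentially" by (simp add: filterlim_uminus_at_top)
  then have "(\<lambda>n. exp (- (c * harm n))) \<longlonglongrightarrow> 0" by (rule filterlim_compose[OF exp_at_bot])
  then have "(\<lambda>n. \<Prod>j<n. 1 - d j) \<longlonglongrightarrow> 0"
    by (rule tendsto_sandwich[OF _ _ tendsto_const, rotated 2]) (auto intro!: always_eventually prod_nonneg nn bound)
  then show "(\<lambda>n. \<Prod>j<n. 1 - (1 - \<gamma>) / (1 + (\<theta> + real j * \<gamma>))) \<longlonglongrightarrow> 0" by (simp add: d_def)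
qed

text \<open>Each application of \<open>pd_functional_step\<close> breaks off one stick, so
  \<open>X n\<close>, the functional after n sticks, has a mean independent of n. Once the remaining
  length is below \<delta> its last factor is 1, and dominated convergence yields the functional of
  all sticks.\<close>

theorem PD_eq_pd_law:
  assumes th: "- \<gamma> < \<theta>" shows "PD \<gamma> \<theta> = pd_law \<theta>"
proof -
  define B where "B k = beta_law (1 - \<gamma>) (\<theta> + real (Suc k) * \<gamma>)" for k
  have Bk: "B k = beta_law (1 - \<gamma>) ((\<theta> + real k * \<gamma>) + \<gamma>)" for k by (simp add: B_def algebra_simps)
  have thk: "- \<gamma> < \<theta> + real k * \<gamma>" for k
    using th gamma mult_nonneg_nonneg[of "real k" \<gamma>] by linarith
  have B: "prob_space (B k)" for k unfolding Bk by (rule prob_space_beta_law[OF thk])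
  have setsB[measurable_cong]: "sets (B k) = sets borel" for k by (simp add: B_def)
  define \<Omega> where "\<Omega> = PiM UNIV B"
  interpret \<Omega>: prob_space \<Omega> unfolding \<Omega>_def by (rule prob_space_PiM) (rule B)
  have comp[measurable]: "(\<lambda>R. R k) \<in> borel_measurable \<Omega>" for k
    unfolding \<Omega>_def using measurable_component_singleton[of k UNIV B] by (simp cong: measurable_cong_sets)
  define rem where "rem R n = (\<Prod>j<n. 1 - R j)" for R :: "nat \<Rightarrow> real" and n
  define stick where "stick R k = R k * rem R k" for R :: "nat \<Rightarrow> real" and k
  have [measurable]: "(\<lambda>R. rem R k) \<in> borel_measurable \<Omega>" "(\<lambda>R. stick R k) \<in> borel_measurable \<Omega>" for k
    unfolding stick_def rem_def by measurable
  have AE01: "AE R in \<Omega>. \<forall>k. 0 < R k \<and> R k < 1"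
  proof -
    have "AE R in \<Omega>. 0 < R k \<and> R k < 1" for k
      unfolding \<Omega>_def
    proof (rule AE_PiM_component[of UNIV B k "\<lambda>x. 0 < x \<and> x < 1"])
      show "AE x in B k. 0 < x \<and> x < 1" unfolding B_def by (rule AE_beta_law)
    qed (use B in auto)
    then show ?thesis by (simp add: AE_all_countable)
  qed
  have rem_pos: "0 < rem R n" "rem R n \<le> 1" if "\<forall>k. 0 < R k \<and> R k < 1" for R n
  proof -
    show "0 < rem R n" unfolding rem_def using that by (auto intro!: prod_pos)
    show "rem R n \<le> 1" unfolding rem_def
    proof (rule prod_le_1)
      fix k show "0 \<le> 1 - R k \<and> 1 - R k \<le> 1" using that[rule_format, of k] by linarith
    qed
  qed
  have stick_sum: "(\<Sum>k<n. stick R k) = 1 - rem R n" for R n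
    by (induction n) (auto simp: stick_def rem_def algebra_simps)
  have stick_van: "vanishing (stick R)" if R: "\<forall>k. 0 < R k \<and> R k < 1" for R
  proof (rule vanishing_if_summable)
    show nn: "0 \<le> stick R k" for k using rem_pos(1)[OF R, of k] R by (auto simp: stick_def intro!: mult_nonneg_nonneg less_imp_le)
    show "summable (stick R)"
    proof (rule summableI_nonneg_bounded[OF nn])
      show "(\<Sum>k<n. stick R k) \<le> 1" for n unfolding stick_sum using rem_pos(1)[OF R, of n] by simp
    qed
  qed
  have upd: "rem (fun_upd R n x) k = rem R k" if "k \<le> n" for R n x k
    unfolding rem_def using that by (intro prod.cong) auto
  \<comment> \<open>The means of the remaining lengths are products of beta means and tend to 0,
    hence their infimum vanishes almost surely; by monotonicity the infimum is the limit.\<close>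
  have rem0: "AE R in \<Omega>. (\<lambda>n. rem R n) \<longlonglongrightarrow> 0"
  proof -
    have mean: "(NN R|\<Omega>. ennreal (rem R n)) = ennreal (\<Prod>j<n. 1 - (1 - \<gamma>) / (1 + (\<theta> + real j * \<gamma>)))" for n
    proof -
      have "(NN R|\<Omega>. ennreal (rem R n)) = (NN R|\<Omega>. (\<Prod>j<n. ennreal (1 - R j)))"
        by (rule nn_integral_cong_AE, use AE01 in eventually_elim) (auto simp: rem_def prod_ennreal less_imp_le)
      also have "\<dots> = (\<Prod>j<n. NN x|B j. ennreal (1 - x))"
        unfolding \<Omega>_def using setsB by (intro nn_integral_PiM_prod[OF B]) (simp cong: measurable_cong_sets)
      also have "\<dots> = (\<Prod>j<n. ennreal (1 - (1 - \<gamma>) / (1 + (\<theta> + real j * \<gamma>))))"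
        unfolding Bk by (simp add: beta_law_mean_complement[OF thk])
      also have "\<dots> = ennreal (\<Prod>j<n. 1 - (1 - \<gamma>) / (1 + (\<theta> + real j * \<gamma>)))"
        by (intro prod_ennreal prod_mean_complement_tendsto_0(1) th)
      finally show ?thesis .
    qed
    have "(NN R|\<Omega>. (INF n. ennreal (rem R n))) \<le> ennreal (\<Prod>j<n. 1 - (1 - \<gamma>) / (1 + (\<theta> + real j * \<gamma>)))" for n
      unfolding mean[symmetric] by (intro nn_integral_mono INF_lower) simp
    moreover have "(\<lambda>n. ennreal (\<Prod>j<n. 1 - (1 - \<gamma>) / (1 + (\<theta> + real j * \<gamma>)))) \<longlonglongrightarrow> ennreal 0"
      by (intro tendsto_ennrealI prod_mean_complement_tendsto_0(2) th)
    ultimately have "(NN R|\<Omega>. (INF n. ennreal (rem R n))) \<le> ennreal 0"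
      by (intro LIMSEQ_le_const) auto
    then have "AE R in \<Omega>. (INF n. ennreal (rem R n)) = 0"
      by (subst (asm) ennreal_0, subst (asm) le_zero_eq, subst (asm) nn_integral_0_iff_AE) auto
    with AE01 show ?thesis
    proof eventually_elim
      case (elim R)
      have "decseq (\<lambda>n. ennreal (rem R n))"
      proof (intro decseq_SucI ennreal_leI)
        fix n show "rem R (Suc n) \<le> rem R n"
          using rem_pos(1)[OF elim(1), of n] elim(1) by (auto simp: rem_def mult_le_cancel_left2 less_imp_le)
      qed
      then have "(\<lambda>n. ennreal (rem R n)) \<longlonglongrightarrow> ennreal 0" using LIMSEQ_INF[of "\<lambda>n. ennreal (rem R n)"] elim(2) by simp
      then show ?case using rem_pos(1)[OF elim(1)] by (subst (asm) tendsto_ennreal_iff) (auto simp: less_imp_le)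
    qed
  qed
  have rm: "(\<lambda>R. ranked (stick R)) \<in> \<Omega> \<rightarrow>\<^sub>M borel" by (rule measurable_ranked) measurable
  have PD: "PD \<gamma> \<theta> = distr \<Omega> borel (\<lambda>R. ranked (stick R))"
    unfolding PD_def \<Omega>_def B_def stick_def rem_def by simp
  show ?thesis unfolding PD
  proof (rule ranked_seqs_measure_eqI)
    interpret pdl: prob_space "pd_law \<theta>" by (rule prob_space_pd_law[OF th])
    show "finite_measure (pd_law \<theta>)" by (rule pdl.finite_measure_axioms)
    show "finite_measure (distr \<Omega> borel (\<lambda>R. ranked (stick R)))" by (intro \<Omega>.finite_measure_distr rm)
    show "AE p in pd_law \<theta>. p \<in> ranked_seqs" by (rule AE_pd_law_ranked_seqs)
    show "AE p in distr \<Omega> borel (\<lambda>R. ranked (stick R)). p \<in> ranked_seqs"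
      by (subst AE_distr_iff[OF rm]) (simp, use AE01 in eventually_elim, auto intro!: ranked_in_ranked_seqs stick_van)
    fix g :: "real \<Rightarrow> ennreal" and \<delta>
    assume g[measurable]: "g \<in> borel_measurable borel" and d: "0 < \<delta>" "\<And>x. x \<le> \<delta> \<Longrightarrow> g x = 0"
    then have g0: "g 0 = 0" by simp
    have step_m: "(\<lambda>x. nexp (g (c * x)) * pd_functional g \<theta>' (c * (1 - x))) \<in> borel_measurable (B n)" for c \<theta>' n
      by (rule pd_functional_step_measurable[OF setsB g])
    define X where "X n R = (\<Prod>k<n. nexp (g (stick R k))) * pd_functional g (\<theta> + real n * \<gamma>) (rem R n)" for n and R :: "nat \<Rightarrow> real"
    have [measurable]: "X n \<in> borel_measurable \<Omega>" for n unfolding X_def by measurable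
    have iter: "(NN R|\<Omega>. X n R) = pd_functional g \<theta> 1" for n
    proof (induction n)
      case 0
      then show ?case by (simp add: X_def rem_def \<Omega>.emeasure_space_1)
    next
      case (Suc n)
      have "(NN R|\<Omega>. X (Suc n) R) = (NN R|\<Omega>. NN x|B n. X (Suc n) (fun_upd R n x))"
        unfolding \<Omega>_def by (rule nn_integral_PiM_update[OF B]) (simp add: \<Omega>_def[symmetric])
      also have "\<dots> = (NN R|\<Omega>. X n R)"
      proof (rule nn_integral_cong)
        fix R
        have "X (Suc n) (fun_upd R n x) = (\<Prod>k<n. nexp (g (stick R k))) *
          (nexp (g (rem R n * x)) * pd_functional g ((\<theta> + real n * \<gamma>) + \<gamma>) (rem R n * (1 - x)))" for x
        proof -
          have "stick (fun_upd R n x) k = stick R k" if "k < n" for k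
            using that by (simp add: stick_def upd)
          moreover have "stick (fun_upd R n x) n = rem R n * x" by (simp add: stick_def upd)
          moreover have "rem (fun_upd R n x) (Suc n) = rem R n * (1 - x)"
            using upd[of n n R x] by (simp add: rem_def)
          moreover have "\<theta> + real (Suc n) * \<gamma> = (\<theta> + real n * \<gamma>) + \<gamma>" by (simp add: algebra_simps)
          ultimately show ?thesis unfolding X_def by (simp add: mult.assoc add.assoc)
        qed
        then have "(NN x|B n. X (Suc n) (fun_upd R n x)) =
          (\<Prod>k<n. nexp (g (stick R k))) * (NN x|B n. nexp (g (rem R n * x)) * pd_functional g ((\<theta> + real n * \<gamma>) + \<gamma>) (rem R n * (1 - x)))"
          using step_m by (simp add: nn_integral_cmult)
        also have "\<dots> = X n R" unfolding Bk X_def by (simp add: pd_functional_step[OF g g0 thk, symmetric])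
        finally show "(NN x|B n. X (Suc n) (fun_upd R n x)) = X n R" .
      qed
      finally show ?case using Suc by simp
    qed
    have "(\<lambda>n. NN R|\<Omega>. X n R) \<longlonglongrightarrow> (NN R|\<Omega>. nexp (\<Sum>k. g (stick R k)))"
    proof (rule nn_integral_dominated_convergence[where w = "\<lambda>_. 1"])
      show "AE R in \<Omega>. X n R \<le> 1" for n
      proof (rule AE_I2)
        fix R
        have "(\<Prod>k<n. nexp (g (stick R k))) \<le> 1" by (intro prod_le_1) auto
        then have "X n R \<le> 1 * 1" unfolding X_def by (intro mult_mono pd_functional_le_1 thk) auto
        then show "X n R \<le> 1" by simp
      qed
      show "AE R in \<Omega>. (\<lambda>n. X n R) \<longlonglongrightarrow> nexp (\<Sum>k. g (stick R k))"
        using AE01 rem0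
      proof eventually_elim
        case (elim R)
        have "eventually (\<lambda>n. rem R n < \<delta>) sequentially" using elim(2) d(1) by (rule order_tendstoD(2))
        then have ev: "eventually (\<lambda>n. (\<Prod>k<n. nexp (g (stick R k))) = X n R) sequentially"
        proof eventually_elim
          case (elim n)
          have "pd_functional g (\<theta> + real n * \<gamma>) (rem R n) = 1"
            using elim rem_pos(1)[OF \<open>\<forall>k. 0 < R k \<and> R k < 1\<close>, of n] by (intro pd_functional_eq_1[OF thk g d(2)]) auto
          then show ?case by (simp add: X_def)
        qed
        have "(\<lambda>n. \<Prod>k<n. nexp (g (stick R k))) \<longlonglongrightarrow> nexp (\<Sum>k. g (stick R k))"
          unfolding iprod_nexp[symmetric] by (rule iprod_LIMSEQ) simp
        then show ?case using ev by (rule Lim_transform_eventually)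
      qed
    qed (auto simp: \<Omega>.emeasure_space_1)
    then have lim: "pd_functional g \<theta> 1 = (NN R|\<Omega>. nexp (\<Sum>k. g (stick R k)))"
      unfolding iter by (rule LIMSEQ_unique[OF tendsto_const])
    note [measurable] = borel_seq_component
    have "(NN p|distr \<Omega> borel (\<lambda>R. ranked (stick R)). nexp (\<Sum>k. g (p k))) = (NN R|\<Omega>. nexp (\<Sum>k. g (ranked (stick R) k)))"
      by (rule nn_integral_distr[OF rm]) measurable
    also have "\<dots> = (NN R|\<Omega>. nexp (\<Sum>k. g (stick R k)))"
      by (rule nn_integral_cong_AE, use AE01 in eventually_elim)
         (simp add: nn_integral_count_ranked[OF stick_van g g0] nn_integral_count_space_nat)
    also have "\<dots> = (NN p|pd_law \<theta>. nexp (\<Sum>k. g (p k)))"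
      unfolding lim[symmetric] pd_functional_def by simp
    finally show "(NN p|distr \<Omega> borel (\<lambda>R. ranked (stick R)). nexp (\<Sum>k. g (p k))) = (NN p|pd_law \<theta>. nexp (\<Sum>k. g (p k)))" .
  qed simp_all
qed

end

subsection \<open>The coupled Poisson-Kingman laws\<close>

text \<open>The normalizing factor exp (k * y) of the second density, with k = z powr (\<alpha> /
  \<beta>), cancels the exponential tilt of the first. What survives is exp z and the tilt in s * y
  powr (1 / \<alpha>).\<close>

lemma r1_factorization:
  assumes "0 < \<beta>" "0 < \<alpha>" "0 < z" "0 < s" "0 < y"
  shows "r1 \<beta> z (s * y powr (1 / \<alpha>)) = r1 (\<beta> / \<alpha>) z y * r1 \<alpha> (z powr (\<alpha> / \<beta>) * y) s"
proof -
  define k where "k = z powr (\<alpha> / \<beta>)"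
  have k: "0 < k" using assms by (simp add: k_def)
  have 1: "(k * y) powr (1 / \<alpha>) = z powr (1 / \<beta>) * y powr (1 / \<alpha>)"
    using assms by (simp add: k_def powr_mult powr_powr)
  have 2: "(k * y) powr (1 / \<alpha> - 1) = (z powr (1 / \<beta>) * y powr (1 / \<alpha>)) / (k * y)"
    using 1 k assms by (simp add: powr_diff)
  have 3: "z powr (1 / (\<beta> / \<alpha>) - 1) = k / z" "z powr (1 / (\<beta> / \<alpha>)) = k" "z powr (1 / \<beta> - 1) = z powr (1 / \<beta>) / z"
    using assms by (simp_all add: k_def powr_diff)
  have "r1 (\<beta> / \<alpha>) z y * r1 \<alpha> (k * y) s =
    (\<alpha> / \<beta> * (k / z) * y * (1 / \<alpha>) * ((z powr (1 / \<beta>) * y powr (1 / \<alpha>)) / (k * y)) * s * exp z) *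
    (exp (- (k * y)) * exp (k * y)) * exp (- (z powr (1 / \<beta>) * y powr (1 / \<alpha>) * s))"
    unfolding r1_def 1 2 3 using assms by (simp add: ac_simps)
  also have "exp (- (k * y)) * exp (k * y) = 1" by (simp add: exp_minus)
  also have "\<alpha> / \<beta> * (k / z) * y * (1 / \<alpha>) * ((z powr (1 / \<beta>) * y powr (1 / \<alpha>)) / (k * y)) * s * exp z =
      1 / \<beta> * (z powr (1 / \<beta>) / z) * (s * y powr (1 / \<alpha>)) * exp z"
    using assms k by (simp add: field_simps)
  finally show ?thesis unfolding k_def[symmetric] r1_def 3 by (simp add: ac_simps)
qed

locale stable_pd_pair =
  a: stable_pd Da \<alpha> f K + b: stable_pd Db "\<beta> / \<alpha>" f K for Da Db \<alpha> \<beta> f K +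
  assumes beta: "0 < \<beta>" "\<beta> < \<alpha>"
begin

lemma joint_kernel_measurable:
  "(\<lambda>q. a.kernel (fst q) \<Otimes>\<^sub>M b.kernel (snd q)) \<in> borel \<Otimes>\<^sub>M borel \<rightarrow>\<^sub>M subprob_algebra (borel \<Otimes>\<^sub>M borel)"
  by (rule measurable_pair_measure)
     (rule measurable_compose[OF measurable_fst a.kernel_measurable] measurable_compose[OF measurable_snd b.kernel_measurable])+

text \<open>The joint version of \<open>nn_integral_PK\<close>: the weight couples the two
  independent point processes only through their total masses, so each kernel can be removed by its
  own disintegration.\<close>

theorem nn_integral_joint_PK:
  assumes h[measurable]: "h \<in> borel_measurable borel" and F[measurable]: "F \<in> borel_measurable (borel \<Otimes>\<^sub>M borel)"
  shows "(NN x|joint_PK f K \<alpha> \<beta> h. F x) =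
    (NN p'|Db. NN p|Da. ennreal (h (tsum p * tsum p' powr (1 / \<alpha>))) * F (normed p, normed p'))"
proof -
  let ?R = "restrict_space lborel {0<..} :: real measure"
  let ?fa = "f \<alpha>" and ?fb = "f (\<beta> / \<alpha>)"
  interpret R: sigma_finite_measure ?R by (rule sigma_finite_measure_restrict_space) (auto simp: lborel.sigma_finite_measure_axioms)
  interpret ab: pair_sigma_finite Da Db ..
  let ?h = "\<lambda>s p'. ennreal (h (s * tsum p' powr (1 / \<alpha>)))"
  have idR: "(\<lambda>x. x) \<in> ?R \<rightarrow>\<^sub>M borel" by (rule measurable_restrict_space1) simp
  have toR: "g \<in> ?R \<Otimes>\<^sub>M ?R \<rightarrow>\<^sub>M N" if g: "g \<in> borel \<Otimes>\<^sub>M borel \<rightarrow>\<^sub>M N" for g and N :: "'z measure"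
  proof -
    have "(\<lambda>q. (fst q, snd q)) \<in> ?R \<Otimes>\<^sub>M ?R \<rightarrow>\<^sub>M borel \<Otimes>\<^sub>M borel"
      by (intro measurable_Pair measurable_compose[OF measurable_fst idR] measurable_compose[OF measurable_snd idR])
    from measurable_compose[OF this g] show ?thesis by simp
  qed
  define w where "w q = ennreal (h (fst q * snd q powr (1 / \<alpha>)) * ?fb (snd q) * ?fa (fst q))" for q
  define \<kappa> where "\<kappa> q = a.kernel (fst q) \<Otimes>\<^sub>M b.kernel (snd q)" for q
  have wm[measurable]: "w \<in> borel_measurable (borel \<Otimes>\<^sub>M borel)" unfolding w_def by measurable
  have km: "\<kappa> \<in> borel \<Otimes>\<^sub>M borel \<rightarrow>\<^sub>M subprob_algebra (borel \<Otimes>\<^sub>M borel)"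
    unfolding \<kappa>_def by (rule joint_kernel_measurable)
  \<comment> \<open>Keeps the kernel of the first component packed while the second is disintegrated
    with \<open>s\<close> fixed; it is unpacked by the last disintegration.\<close>
  define Fa where "Fa s q = (NN p|a.kernel s. F (p, q))" for s q
  have Fam[measurable]: "(\<lambda>x. Fa (fst x) (snd x)) \<in> borel_measurable (borel \<Otimes>\<^sub>M borel)"
    unfolding Fa_def
    by (rule nn_integral_measurable_subprob_algebra2[where N = borel, OF _ measurable_compose[OF measurable_fst a.kernel_measurable]])
       measurable
  have m0: "(\<lambda>x. ?h (fst x) (snd x) * Fa (fst x) (normed (snd x))) \<in> borel_measurable (borel \<Otimes>\<^sub>M Db)"
  proof -
    note [measurable] = snd_tsum_measurable[of borel]
    have "(\<lambda>x. Fa (fst x) (normed (snd x))) \<in> borel_measurable (borel \<Otimes>\<^sub>M borel)"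
      using measurable_compose[OF _ Fam, of "\<lambda>x. (fst x, normed (snd x))"] by simp
    then have "(\<lambda>x. ?h (fst x) (snd x) * Fa (fst x) (normed (snd x))) \<in> borel_measurable (borel \<Otimes>\<^sub>M borel)" by measurable
    then show ?thesis by (simp cong: pair_cong)
  qed
  have Fs: "(\<lambda>q. Fa s q) \<in> borel_measurable borel" for s
    using measurable_compose[OF measurable_Pair1' Fam, of s] by simp
  have kF: "(NN x|\<kappa> (s, y). F x) = (NN q|b.kernel y. Fa s q)" for s y
  proof -
    interpret ka: prob_space "a.kernel s" by (rule a.prob_space_kernel)
    interpret kb: prob_space "b.kernel y" by (rule b.prob_space_kernel)
    interpret pair_sigma_finite "a.kernel s" "b.kernel y" ..
    show ?thesis unfolding \<kappa>_def Fa_def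
      using nn_integral_snd[of F] F by (simp add: split_beta cong: pair_cong)
  qed
  have kFm: "(\<lambda>q. NN x|\<kappa> q. F x) \<in> borel_measurable (borel \<Otimes>\<^sub>M borel)"
    by (rule measurable_compose[OF km nn_integral_measurable_subprob_algebra[OF F]])
  have Kab: "(\<lambda>(s, y). K \<alpha> s \<Otimes>\<^sub>M K (\<beta> / \<alpha>) y) q = \<kappa> q" if "q \<in> space (?R \<Otimes>\<^sub>M ?R)" for q
    using that by (auto simp: \<kappa>_def space_pair_measure space_restrict_space)
  have Km: "(\<lambda>(s, y). K \<alpha> s \<Otimes>\<^sub>M K (\<beta> / \<alpha>) y) \<in> ?R \<Otimes>\<^sub>M ?R \<rightarrow>\<^sub>M subprob_algebra (borel \<Otimes>\<^sub>M borel)"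
    by (subst measurable_cong[OF Kab]) (assumption, rule toR[OF km])
  have "(NN x|joint_PK f K \<alpha> \<beta> h. F x) = (NN q|density (?R \<Otimes>\<^sub>M ?R) w. (NN x|(\<lambda>(s, y). K \<alpha> s \<Otimes>\<^sub>M K (\<beta> / \<alpha>) y) q. F x))"
  proof -
    have "(\<lambda>(s, y). ennreal (h (s * y powr (1 / \<alpha>)) * ?fb y * ?fa s)) = w" by (auto simp: w_def fun_eq_iff)
    then show ?thesis
      unfolding joint_PK_def using Km by (subst nn_integral_bind[OF F]) simp_all
  qed
  also have "\<dots> = (NN q|density (?R \<Otimes>\<^sub>M ?R) w. (NN x|\<kappa> q. F x))"
    by (intro nn_integral_cong) (simp only: space_density Kab)
  also have "\<dots> = (NN q|(?R \<Otimes>\<^sub>M ?R). w q * (NN x|\<kappa> q. F x))"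
    by (rule nn_integral_density[OF toR[OF wm] toR[OF kFm]])
  also have "\<dots> = (NN s|?R. NN y|?R. w (s, y) * (NN x|\<kappa> (s, y). F x))"
    by (rule R.nn_integral_fst[OF toR[OF borel_measurable_times_ennreal[OF wm kFm]], symmetric])
  also have "\<dots> = (NN s|?R. ennreal (?fa s) * (NN p'|Db. ?h s p' * Fa s (normed p')))"
  proof (intro nn_integral_cong)
    fix s
    have [measurable]: "Fa s \<in> borel_measurable borel" by (rule Fs)
    have m: "(\<lambda>y. NN q|b.kernel y. ennreal (h (s * y powr (1 / \<alpha>))) * Fa s q) \<in> borel_measurable borel"
      by (rule nn_integral_measurable_subprob_algebra2[where N = borel]) measurable
    have "w (s, y) * (NN x|\<kappa> (s, y). F x) = ennreal (?fa s) * (ennreal (?fb y) * (NN q|b.kernel y. ennreal (h (s * y powr (1 / \<alpha>))) * Fa s q))" for y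
      unfolding w_def kF fst_conv snd_conv ennreal_mult''[OF a.f_nonneg] ennreal_mult''[OF b.f_nonneg]
      by (subst nn_integral_cmult, measurable) (simp only: ac_simps)
    then have "(NN y|?R. w (s, y) * (NN x|\<kappa> (s, y). F x)) = ennreal (?fa s) * (NN y|?R. ennreal (?fb y) * (NN q|b.kernel y. ennreal (h (s * y powr (1 / \<alpha>))) * Fa s q))"
      using m by (simp, intro nn_integral_cmult measurable_restrict_space1) measurable
    also have "(NN y|?R. ennreal (?fb y) * (NN q|b.kernel y. ennreal (h (s * y powr (1 / \<alpha>))) * Fa s q)) = (NN p'|Db. NN q|b.kernel (tsum p'). ?h s p' * Fa s q)"
      by (rule b.nn_integral_tsum[OF m])
    also have "\<dots> = (NN p'|Db. ?h s p' * Fa s (normed p'))"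
      using b.disintegration[of "\<lambda>(q, y). ennreal (h (s * y powr (1 / \<alpha>))) * Fa s q"] by (simp add: split_beta)
    finally show "(NN y|?R. w (s, y) * (NN x|\<kappa> (s, y). F x)) = ennreal (?fa s) * (NN p'|Db. ?h s p' * Fa s (normed p'))" .
  qed
  also have "\<dots> = (NN p|Da. NN p'|Db. ?h (tsum p) p' * Fa (tsum p) (normed p'))"
    using b.borel_measurable_nn_integral_fst[OF m0] by (intro a.nn_integral_tsum) simp
  also have "\<dots> = (NN p'|Db. NN p|Da. ?h (tsum p) p' * Fa (tsum p) (normed p'))"
  proof (rule ab.Fubini'[symmetric])
    have "(\<lambda>x. (tsum (fst x), snd x)) \<in> Da \<Otimes>\<^sub>M Db \<rightarrow>\<^sub>M borel \<Otimes>\<^sub>M Db" by measurable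
    from measurable_compose[OF this m0] show "(\<lambda>(p, p'). ?h (tsum p) p' * Fa (tsum p) (normed p')) \<in> borel_measurable (Da \<Otimes>\<^sub>M Db)"
      by (simp add: split_beta)
  qed
  also have "\<dots> = (NN p'|Db. NN p|Da. ?h (tsum p) p' * F (normed p, normed p'))"
  proof (rule nn_integral_cong)
    fix p'
    have "(\<lambda>x. F (fst x, normed p')) \<in> borel_measurable (borel \<Otimes>\<^sub>M (borel :: real measure))" by measurable
    then have "(\<lambda>(p, t). ?h t p' * F (p, normed p')) \<in> borel_measurable (borel \<Otimes>\<^sub>M borel)"
      by (simp add: split_beta)
    from a.disintegration[OF this] show "(NN p|Da. ?h (tsum p) p' * Fa (tsum p) (normed p')) = (NN p|Da. ?h (tsum p) p' * F (normed p, normed p'))"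
      by (simp add: Fa_def nn_integral_cmult)
  qed
  finally show ?thesis .
qed

lemma sets_joint_PK [simp, measurable_cong]: "sets (joint_PK f K \<alpha> \<beta> h) = sets (borel \<Otimes>\<^sub>M borel)"
proof -
  have "sets (K \<alpha> s \<Otimes>\<^sub>M K (\<beta> / \<alpha>) y) = sets (borel \<Otimes>\<^sub>M borel)" if "0 < s" "0 < y" for s y
    using a.sets_kernel[of s] b.sets_kernel[of y] that by (intro sets_pair_measure_cong) auto
  moreover have "1 \<in> space (restrict_space lborel {0<..} :: real measure)" by (simp add: space_restrict_space)
  ultimately show ?thesis unfolding joint_PK_def
    by (intro sets_bind) (auto simp: space_pair_measure space_restrict_space intro!: exI[of _ "1::real"])
qed

text \<open>The first factor of \<open>r1_factorization\<close> tilts the \<beta>/\<alpha>-stable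
  points, the second one tilts the \<alpha>-stable points given \<open>tsum p'\<close>. This is the
  common source of the marginal law of the second component, the conditional law of the first, and
  the coupling.\<close>

lemma nn_integral_joint_P1:
  assumes z: "0 < z" and F[measurable]: "F \<in> borel_measurable (borel \<Otimes>\<^sub>M borel)"
  shows "(NN x|joint_PK f K \<alpha> \<beta> (r1 \<beta> z). F x) =
    (NN p'|Db. ennreal (r1 (\<beta> / \<alpha>) z (tsum p')) *
       (NN v|P1 f K \<alpha> (z powr (\<alpha> / \<beta>) * tsum p'). F (v, normed p')))"
proof -
  have "(NN x|joint_PK f K \<alpha> \<beta> (r1 \<beta> z). F x) =
    (NN p'|Db. NN p|Da. ennreal (r1 \<beta> z (tsum p * tsum p' powr (1 / \<alpha>))) * F (normed p, normed p'))"
    by (rule nn_integral_joint_PK) measurable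
  also have "\<dots> = (NN p'|Db. ennreal (r1 (\<beta> / \<alpha>) z (tsum p')) *
       (NN v|P1 f K \<alpha> (z powr (\<alpha> / \<beta>) * tsum p'). F (v, normed p')))"
  proof (rule nn_integral_cong_on[OF b.AE_tsum], goal_cases elim)
    case (elim p')
    let ?z = "z powr (\<alpha> / \<beta>) * tsum p'"
    have rb: "0 \<le> r1 (\<beta> / \<alpha>) z (tsum p')" using b.gamma elim by (intro r1_nonneg) auto
    have [measurable]: "(\<lambda>v. F (v, normed p')) \<in> borel_measurable borel" by measurable
    have "(NN p|Da. ennreal (r1 \<beta> z (tsum p * tsum p' powr (1 / \<alpha>))) * F (normed p, normed p')) =
      (NN p|Da. ennreal (r1 (\<beta> / \<alpha>) z (tsum p')) * (ennreal (r1 \<alpha> ?z (tsum p)) * F (normed p, normed p')))"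
    proof (rule nn_integral_cong_on[OF a.AE_tsum], goal_cases elim)
      case (elim p)
      have "r1 \<beta> z (tsum p * tsum p' powr (1 / \<alpha>)) = r1 (\<beta> / \<alpha>) z (tsum p') * r1 \<alpha> ?z (tsum p)"
        using beta a.gamma z elim \<open>(\<forall>i. 0 < p' i) \<and> p' \<in> ranked_seqs \<and> summable p' \<and> 0 < tsum p'\<close>
        by (intro r1_factorization) auto
      then show ?case using rb by (simp add: ennreal_mult' mult.assoc)
    qed
    also have "\<dots> = ennreal (r1 (\<beta> / \<alpha>) z (tsum p')) * (NN p|Da. ennreal (r1 \<alpha> ?z (tsum p)) * F (normed p, normed p'))"
      by (rule nn_integral_cmult) measurable
    also have "(NN p|Da. ennreal (r1 \<alpha> ?z (tsum p)) * F (normed p, normed p')) = (NN v|P1 f K \<alpha> ?z. F (v, normed p'))"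
      by (rule a.nn_integral_P1[symmetric]) measurable
    finally show ?case .
  qed
  finally show ?thesis .
qed

end

subsection \<open>Fragmentation\<close>

text \<open>The substitution x = y powr (1 / \<alpha>) carries one intensity to a multiple of the
  other. The multiple is \<open>pd_const \<alpha> (- \<beta>)\<close>, which later cancels against
  the \<beta>-th moment of the \<alpha>-stable sum.\<close>

lemma nn_integral_stable_intensity_powr:
  assumes ab: "0 < \<beta>" "\<beta> < \<alpha>" "\<alpha> < 1" and G[measurable]: "G \<in> borel_measurable borel"
  shows "(NN y|stable_intensity (\<beta> / \<alpha>). G (y powr (1 / \<alpha>))) =
    ennreal (Gamma (- \<beta> + 1) / Gamma (- \<beta> / \<alpha> + 1)) * (NN x|stable_intensity \<beta>. G x)"
proof -
  have g: "0 < Gamma (1 - \<beta>)" "0 < Gamma (1 - \<beta> / \<alpha>)" using ab by (auto intro!: Gamma_real_pos)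
  define k where "k = \<beta> / Gamma (1 - \<beta>)"
  define C where "C = Gamma (1 - \<beta>) / Gamma (1 - \<beta> / \<alpha>)"
  have k: "0 < k" "0 < C" using g ab by (auto simp: k_def C_def)
  have Ck: "C * k / \<alpha> = \<beta> / \<alpha> / Gamma (1 - \<beta> / \<alpha>)" using g by (simp add: C_def k_def)
  let ?k = "\<lambda>y. ennreal (k * (y powr (1 / \<alpha>)) powr (- \<beta> - 1))"
  let ?v = "\<lambda>y. ennreal (1 / \<alpha> * y powr (1 / \<alpha> - 1))"
  let ?w = "\<lambda>y. ennreal (\<beta> / \<alpha> / Gamma (1 - \<beta> / \<alpha>) * y powr (- (\<beta> / \<alpha>) - 1))"
  have "ennreal C * (NN x|stable_intensity \<beta>. G x) = ennreal C * (NN x|lborel. (ennreal (k * x powr (- \<beta> - 1)) * G x) * indicator {0<..} x)"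
    unfolding k_def by (subst nn_integral_stable_intensity) (auto simp: ac_simps)
  also have "\<dots> = ennreal C * (NN y|lborel. (?k y * G (y powr (1 / \<alpha>))) * ?v y * indicator {0<..} y)"
    using ab by (subst nn_integral_powr_substitution[of _ "1 / \<alpha>"]) auto
  also have "\<dots> = (NN y|lborel. ennreal C * ((?k y * G (y powr (1 / \<alpha>))) * ?v y * indicator {0<..} y))"
    by (rule nn_integral_cmult[symmetric]) measurable
  also have "\<dots> = (NN y|lborel. ?w y * indicator {0<..} y * G (y powr (1 / \<alpha>)))"
  proof (intro nn_integral_cong)
    fix y :: real
    show "ennreal C * ((?k y * G (y powr (1 / \<alpha>))) * ?v y * indicator {0<..} y) =
      ?w y * indicator {0<..} y * G (y powr (1 / \<alpha>))"
    proof (cases "0 < y")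
      case True
      have "(y powr (1 / \<alpha>)) powr (- \<beta> - 1) * y powr (1 / \<alpha> - 1) = y powr (1 / \<alpha> * (- \<beta> - 1) + (1 / \<alpha> - 1))"
        by (simp add: powr_powr powr_add[symmetric])
      also have "1 / \<alpha> * (- \<beta> - 1) + (1 / \<alpha> - 1) = - (\<beta> / \<alpha>) - 1" using ab by (simp add: field_simps)
      finally have e: "(y powr (1 / \<alpha>)) powr (- \<beta> - 1) * y powr (1 / \<alpha> - 1) = y powr (- (\<beta> / \<alpha>) - 1)" .
      have "C * (k * (y powr (1 / \<alpha>)) powr (- \<beta> - 1)) * (1 / \<alpha> * y powr (1 / \<alpha> - 1)) =
        C * k / \<alpha> * ((y powr (1 / \<alpha>)) powr (- \<beta> - 1) * y powr (1 / \<alpha> - 1))" by simp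
      also have "\<dots> = \<beta> / \<alpha> / Gamma (1 - \<beta> / \<alpha>) * y powr (- (\<beta> / \<alpha>) - 1)" unfolding Ck e ..
      finally have "ennreal C * ?k y * ?v y = ?w y"
        using k ab by (simp only: ennreal_mult[symmetric] mult_nonneg_nonneg less_imp_le powr_ge_zero divide_nonneg_nonneg zero_le_one)
      moreover have "ennreal C * ((?k y * G (y powr (1 / \<alpha>))) * ?v y * 1) =
        ennreal C * ?k y * ?v y * G (y powr (1 / \<alpha>))"
        by (simp only: ac_simps mult_1_right mult_1_left)
      ultimately show ?thesis using True by (simp only: indicator_simps greaterThan_iff mult_1_right)
    qed simp
  qed
  also have "\<dots> = (NN y|stable_intensity (\<beta> / \<alpha>). G (y powr (1 / \<alpha>)))"
    by (rule nn_integral_stable_intensity[symmetric]) measurable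
  finally show ?thesis by (simp add: C_def add.commute)
qed

lemma nn_integral_count_space_nat_prod:
  "(NN x|count_space (UNIV :: (nat \<times> nat) set). h x) = (\<Sum>i. \<Sum>l. h (i, l))"
  by (simp add: nn_integral_fst_count_space[symmetric] nn_integral_count_space_nat)

lemma AE_pair_fst:
  assumes "prob_space M" "prob_space N" "AE x in M. P x" shows "AE x in M \<Otimes>\<^sub>M N. P (fst x)"
proof -
  interpret N: prob_space N by fact
  have "AE x in distr (M \<Otimes>\<^sub>M N) M fst. P x" unfolding N.distr_pair_fst by fact
  then show ?thesis by (rule AE_distrD[OF measurable_fst])
qed

lemma AE_pair_snd:
  assumes "prob_space M" "prob_space N" "AE x in N. P x" shows "AE x in M \<Otimes>\<^sub>M N. P (snd x)"
proof -
  interpret M: prob_space M by fact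
  interpret N: prob_space N by fact
  have d: "distr (M \<Otimes>\<^sub>M N) N snd = N"
  proof (rule measure_eqI)
    fix A assume "A \<in> sets (distr (M \<Otimes>\<^sub>M N) N snd)"
    then have A: "A \<in> sets N" by simp
    have "snd -` A \<inter> space (M \<Otimes>\<^sub>M N) = space M \<times> A"
      using sets.sets_into_space[OF A] by (auto simp: space_pair_measure)
    then show "emeasure (distr (M \<Otimes>\<^sub>M N) N snd) A = emeasure N A"
      using A by (simp add: emeasure_distr N.emeasure_pair_measure_Times M.emeasure_space_1)
  qed simp
  have "AE x in distr (M \<Otimes>\<^sub>M N) N snd. P x" unfolding d by fact
  then show ?thesis by (rule AE_distrD[OF measurable_snd])
qed

lemma normed_scale: "c \<noteq> 0 \<Longrightarrow> summable p \<Longrightarrow> normed (\<lambda>k. c * p k) = normed p"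
  by (simp add: normed_def tsum_def suminf_mult fun_eq_iff)

lemma tsum_scale: "summable p \<Longrightarrow> tsum (\<lambda>k. c * p k) = c * tsum p"
  by (simp add: tsum_def suminf_mult)

section \<open>Laplace exponents for fragmentation\<close>

context stable_pd_pair
begin

lemma one_minus_pd_functional:
  assumes g[measurable]: "g \<in> borel_measurable borel"
  shows "1 - a.pd_functional g (- \<beta>) x = (NN p|Da. (1 - nexp (\<Sum>k. g (x * (p k / tsum p)))) *
     ennreal (Gamma (- \<beta> + 1) / Gamma (- \<beta> / \<alpha> + 1) * tsum p powr \<beta>))"
proof -
  have th: "- \<alpha> < - \<beta>" using beta by simp
  define w where "w p = ennreal (Gamma (- \<beta> + 1) / Gamma (- \<beta> / \<alpha> + 1) * tsum p powr \<beta>)" for p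
  define e where "e p = nexp (\<Sum>k. g (x * (p k / tsum p)))" for p :: "nat \<Rightarrow> real"
  have [measurable]: "w \<in> borel_measurable Da" unfolding w_def by measurable
  have [measurable]: "e \<in> borel_measurable Da"
  proof -
    note [measurable] = borel_seq_component
    have "e \<in> borel_measurable borel" unfolding e_def by measurable
    then show ?thesis by (simp cong: measurable_cong_sets)
  qed
  have w1: "(NN p|Da. w p) = 1" using a.nn_integral_tsum_powr[OF th] by (simp add: w_def)
  have "a.pd_functional g (- \<beta>) x = (NN p|Da. w p * e p)"
    using a.pd_functional_eq[OF g, of "- \<beta>" x] by (simp add: w_def e_def)
  then have "1 - a.pd_functional g (- \<beta>) x = (NN p|Da. w p) - (NN p|Da. w p * e p)" by (simp add: w1)
  also have "\<dots> = (NN p|Da. w p - w p * e p)"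
  proof (rule nn_integral_diff[symmetric])
    have le: "w p * e p \<le> w p * 1" for p unfolding e_def by (intro mult_left_mono) auto
    then show "AE p in Da. w p * e p \<le> w p" by simp
    have "(NN p|Da. w p * e p) \<le> (NN p|Da. w p)" using le by (intro nn_integral_mono) simp
    then show "(NN p|Da. w p * e p) \<noteq> \<infinity>" using w1 by (auto simp: top_unique)
  qed measurable
  also have "\<dots> = (NN p|Da. (1 - e p) * w p)"
    by (intro nn_integral_cong) (simp add: ennreal_one_minus_mult e_def w_def)
  finally show ?thesis unfolding w_def e_def .
qed

text \<open>Under the \<beta>-stable intensity, rescaling x by the total mass of the fragments
  absorbs exactly the weight \<open>tsum p powr \<beta>\<close> of the law with parameter -\<beta>.
  The fragments become unnormalized \<alpha>-stable points, whose functional is explicit, and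
  \<open>nn_integral_stable_intensity_powr\<close> absorbs the constant.\<close>

lemma frag_exponent:
  fixes g :: "real \<Rightarrow> ennreal"
  assumes g[measurable]: "g \<in> borel_measurable borel"
  defines "A \<equiv> (NN v|stable_intensity \<alpha>. 1 - nexp (g v))"
  shows "(NN x|stable_intensity \<beta>. 1 - a.pd_functional g (- \<beta>) x) = (NN y|stable_intensity (\<beta> / \<alpha>). 1 - nexp (ennreal y * A))"
proof -
  let ?\<nu> = "stable_intensity \<beta>"
  have b1: "0 < \<beta>" "\<beta> < 1" using beta a.gamma by auto
  define C where "C = Gamma (- \<beta> + 1) / Gamma (- \<beta> / \<alpha> + 1)"
  have C: "0 \<le> C"
  proof -
    have "0 < Gamma (- \<beta> + 1)" "0 < Gamma (- \<beta> / \<alpha> + 1)" using beta a.gamma by (auto intro!: Gamma_real_pos)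
    then show ?thesis by (simp add: C_def)
  qed
  interpret n: sigma_finite_measure ?\<nu> by (rule sigma_finite_stable_intensity)
  interpret nD: pair_sigma_finite ?\<nu> Da ..
  define G where "G p x = 1 - nexp (\<Sum>k. g (x * p k))" for p :: "nat \<Rightarrow> real" and x
  have Gm: "(\<lambda>q. G (snd q) (fst q)) \<in> borel_measurable (borel \<Otimes>\<^sub>M borel)"
  proof -
    note [measurable] = snd_seq_measurable[of _ borel]
    show ?thesis unfolding G_def by measurable
  qed
  have Gp[measurable]: "G p \<in> borel_measurable borel" for p unfolding G_def by measurable
  have "(NN x|?\<nu>. 1 - a.pd_functional g (- \<beta>) x) = (NN x|?\<nu>. NN p|Da. G (normed p) x * ennreal (C * tsum p powr \<beta>))"
    by (simp add: one_minus_pd_functional[OF g] G_def C_def normed_def)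
  also have "\<dots> = (NN p|Da. NN x|?\<nu>. G (normed p) x * ennreal (C * tsum p powr \<beta>))"
  proof (rule nD.Fubini'[symmetric])
    have "(\<lambda>q. G (normed (snd q)) (fst q)) \<in> borel_measurable (borel \<Otimes>\<^sub>M borel)"
      using measurable_compose[OF _ Gm, of "\<lambda>q. (fst q, normed (snd q))"] by simp
    then show "(\<lambda>(x, p). G (normed p) x * ennreal (C * tsum p powr \<beta>)) \<in> borel_measurable (?\<nu> \<Otimes>\<^sub>M Da)"
      using snd_tsum_measurable[of borel] by (simp add: split_beta cong: pair_cong)
  qed
  also have "\<dots> = (NN p|Da. NN x|?\<nu>. ennreal C * G p x)"
  proof (rule nn_integral_cong_on[OF a.AE_tsum], goal_cases elim)
    case (elim p)
    define T where "T = tsum p"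
    have T: "0 < T" using elim by (simp add: T_def)
    have "(NN x|?\<nu>. G (normed p) x * ennreal (C * T powr \<beta>)) = (NN x|?\<nu>. G p (1 / T * x)) * ennreal (C * T powr \<beta>)"
      by (subst nn_integral_multc[symmetric]) (auto simp: G_def normed_def T_def)
    also have "(NN x|?\<nu>. G p (1 / T * x)) = ennreal ((1 / T) powr \<beta>) * (NN x|?\<nu>. G p x)"
      using T by (intro nn_integral_stable_intensity_scale[OF b1]) auto
    also have "ennreal ((1 / T) powr \<beta>) * (NN x|?\<nu>. G p x) * ennreal (C * T powr \<beta>) = ennreal ((1 / T) powr \<beta> * (C * T powr \<beta>)) * (NN x|?\<nu>. G p x)"
      using C by (simp add: ennreal_mult ac_simps)
    also have "(1 / T) powr \<beta> * (C * T powr \<beta>) = C" using T by (simp add: powr_divide)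
    finally show ?case unfolding T_def by (simp add: nn_integral_cmult)
  qed
  also have "\<dots> = (NN x|?\<nu>. NN p|Da. ennreal C * G p x)"
    by (rule nD.Fubini') (use Gm in \<open>simp add: split_beta cong: pair_cong\<close>)
  also have "\<dots> = (NN x|?\<nu>. ennreal C * (1 - nexp (ennreal (x powr \<alpha>) * A)))"
  proof (rule nn_integral_cong_AE)
    have "AE x in ?\<nu>. 0 < x" by (rule AE_I[where N = "{..0}"]) (auto simp: stable_intensity_nonpos)
    then show "AE x in ?\<nu>. (NN p|Da. ennreal C * G p x) = ennreal C * (1 - nexp (ennreal (x powr \<alpha>) * A))"
    proof eventually_elim
      case (elim x)
      define e where "e p = nexp (\<Sum>k. g (x * p k))" for p :: "nat \<Rightarrow> real"
      have [measurable]: "e \<in> borel_measurable Da"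
      proof -
        note [measurable] = borel_seq_component
        have "e \<in> borel_measurable borel" unfolding e_def by measurable
        then show ?thesis by (simp cong: measurable_cong_sets)
      qed
      have "(NN p|Da. e p) = nexp (NN v|stable_intensity \<alpha>. 1 - nexp (g (x * v)))"
        unfolding e_def by (rule a.laplace_functional) measurable
      also have "(NN v|stable_intensity \<alpha>. 1 - nexp (g (x * v))) = ennreal (x powr \<alpha>) * A"
        unfolding A_def using elim by (intro nn_integral_stable_intensity_scale[OF a.gamma, of "\<lambda>v. 1 - nexp (g v)"]) auto
      finally have ie: "(NN p|Da. e p) = nexp (ennreal (x powr \<alpha>) * A)" .
      have e1: "e p \<le> 1" for p by (simp add: e_def)
      have "(NN p|Da. ennreal C * G p x) = ennreal C * (NN p|Da. 1 - e p)"
        unfolding G_def e_def[symmetric] by (rule nn_integral_cmult) measurable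
      also have "(NN p|Da. 1 - e p) = (NN p|Da. 1) - (NN p|Da. e p)"
        by (rule nn_integral_diff) (simp_all add: ie e1)
      finally show ?case by (simp add: ie a.emeasure_space_1[simplified])
    qed
  qed
  also have "\<dots> = ennreal C * (NN x|?\<nu>. 1 - nexp (ennreal (x powr \<alpha>) * A))"
    by (rule nn_integral_cmult) measurable
  also have "\<dots> = (NN y|stable_intensity (\<beta> / \<alpha>). 1 - nexp (ennreal ((y powr (1 / \<alpha>)) powr \<alpha>) * A))"
    unfolding C_def using beta a.gamma by (intro nn_integral_stable_intensity_powr[symmetric]) auto
  also have "\<dots> = (NN y|stable_intensity (\<beta> / \<alpha>). 1 - nexp (ennreal y * A))"
  proof (rule nn_integral_cong_AE)
    have "AE y in stable_intensity (\<beta> / \<alpha>). 0 < y" by (rule AE_I[where N = "{..0}"]) (auto simp: stable_intensity_nonpos)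
    then show "AE y in stable_intensity (\<beta> / \<alpha>). 1 - nexp (ennreal ((y powr (1 / \<alpha>)) powr \<alpha>) * A) = 1 - nexp (ennreal y * A)"
      by eventually_elim (use a.gamma in \<open>simp add: powr_powr\<close>)
  qed
  finally show ?thesis .
qed

text \<open>Given \<open>p'\<close>, scaling the \<alpha>-stable points by the power 1 / \<alpha> of
  \<open>tsum p'\<close> multiplies their exponent by \<open>tsum p'\<close>, a sum over the points
  of \<open>p'\<close>; then the functional of \<open>Db\<close> applies.\<close>

lemma laplace_subordinated:
  fixes g :: "real \<Rightarrow> ennreal"
  assumes g[measurable]: "g \<in> borel_measurable borel"
  shows "(NN p'|Db. NN p|Da. nexp (\<Sum>k. g (tsum p' powr (1 / \<alpha>) * p k))) =
    nexp (NN y|stable_intensity (\<beta> / \<alpha>). 1 - nexp (ennreal y * (NN v|stable_intensity \<alpha>. 1 - nexp (g v))))"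
proof -
  define A where "A = (NN v|stable_intensity \<alpha>. 1 - nexp (g v))"
  have "(NN p'|Db. NN p|Da. nexp (\<Sum>k. g (tsum p' powr (1 / \<alpha>) * p k))) = (NN p'|Db. nexp (\<Sum>k. ennreal (p' k) * A))"
  proof (rule nn_integral_cong_on[OF b.AE_tsum], goal_cases elim)
    case (elim p')
    define t where "t = tsum p' powr (1 / \<alpha>)"
    have t: "0 < t" "t powr \<alpha> = tsum p'" using elim a.gamma by (auto simp: t_def powr_powr)
    have "(NN p|Da. nexp (\<Sum>k. g (t * p k))) = nexp (NN v|stable_intensity \<alpha>. 1 - nexp (g (t * v)))"
      by (rule a.laplace_functional) measurable
    also have "(NN v|stable_intensity \<alpha>. 1 - nexp (g (t * v))) = ennreal (t powr \<alpha>) * A"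
      unfolding A_def using t by (intro nn_integral_stable_intensity_scale[OF a.gamma, of "\<lambda>v. 1 - nexp (g v)"]) auto
    also have "ennreal (t powr \<alpha>) = (\<Sum>k. ennreal (p' k))"
    proof -
      have pn: "0 \<le> p' i" and ps: "summable p'" for i using elim by (auto intro: less_imp_le)
      show ?thesis unfolding t(2) using b.suminf_eq_tsum[of p' 1, OF pn ps] by simp
    qed
    finally show ?case by (simp add: t_def)
  qed
  also have "\<dots> = nexp (NN y|stable_intensity (\<beta> / \<alpha>). 1 - nexp (ennreal y * A))"
    by (rule b.laplace_functional) measurable
  finally show ?thesis unfolding A_def .
qed

end

section \<open>Fragmented stable points\<close>

locale stable_pd_triple = stable_pd_pair Da Db \<alpha> \<beta> f K + c: stable_pd Dc \<beta> f K for Da Db \<alpha> \<beta> f K Dc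
begin

abbreviation pd_frag :: "(nat \<Rightarrow> nat \<Rightarrow> real) measure" where
  "pd_frag \<equiv> PiM UNIV (\<lambda>i::nat. PD \<alpha> (- \<beta>))"

lemma PD_frag: "PD \<alpha> (- \<beta>) = a.pd_law (- \<beta>)" "prob_space (PD \<alpha> (- \<beta>))"
  using beta a.PD_eq_pd_law[of "- \<beta>"] a.prob_space_pd_law[of "- \<beta>"] by auto

lemma prob_space_pd_frag: "prob_space pd_frag"
  by (rule prob_space_PiM) (rule PD_frag(2))

lemma sets_PD_frag: "sets (PD \<alpha> (- \<beta>)) = sets borel"
  by (simp add: PD_frag)

lemma frag_measurable:
  "(\<lambda>x. ranked (\<lambda>(i, l). fst x i * snd x i l)) \<in> borel \<Otimes>\<^sub>M pd_frag \<rightarrow>\<^sub>M seqs"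
proof (rule measurable_ranked)
  fix i :: "nat \<times> nat"
  obtain j l where i: "i = (j, l)" by (cases i)
  have "(\<lambda>x. snd x j) \<in> borel \<Otimes>\<^sub>M pd_frag \<rightarrow>\<^sub>M seqs"
  proof -
    have "(\<lambda>q. q j) \<in> pd_frag \<rightarrow>\<^sub>M PD \<alpha> (- \<beta>)" by (rule measurable_component_singleton) simp
    then have "(\<lambda>q. q j) \<in> pd_frag \<rightarrow>\<^sub>M borel" by (simp cong: measurable_cong_sets add: sets_PD_frag)
    then show ?thesis by (rule measurable_compose[OF measurable_snd])
  qed
  from measurable_compose[OF this borel_seq_component[of l]] have 1: "(\<lambda>x. snd x j l) \<in> borel_measurable (borel \<Otimes>\<^sub>M pd_frag)" .
  have 2: "(\<lambda>x. fst x j) \<in> borel_measurable (seqs \<Otimes>\<^sub>M pd_frag)"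
    by (rule measurable_compose[OF measurable_fst borel_seq_component])
  show "(\<lambda>x. case i of (i, l) \<Rightarrow> fst x i * snd x i l) \<in> borel_measurable (seqs \<Otimes>\<^sub>M pd_frag)"
    unfolding i prod.case by (rule borel_measurable_times[OF 2 1])
qed

lemma AE_pd_frag: "AE q in pd_frag. \<forall>i. q i \<in> ranked_seqs \<and> (\<Sum>l. ennreal (q i l)) = 1"
proof -
  have S: "{v \<in> ranked_seqs. (\<Sum>l. ennreal (v l)) = 1} \<in> sets borel"
  proof -
    have "(\<lambda>v :: nat \<Rightarrow> real. \<Sum>l. ennreal (v l)) \<in> borel_measurable borel" supply [measurable] = borel_seq_component by measurable
    then have m: "{v \<in> space seqs. (\<Sum>l. ennreal (v l)) = 1} \<in> sets borel"
      by (intro borel_measurable_eq) auto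
    have "{v \<in> ranked_seqs. (\<Sum>l. ennreal (v l)) = 1} = ranked_seqs \<inter> {v \<in> space borel. (\<Sum>l. ennreal (v l)) = 1}"
      by auto
    then show ?thesis using sets.Int[OF ranked_seqs_measurable m] by simp
  qed
  have "AE v in PD \<alpha> (- \<beta>). v \<in> {v \<in> ranked_seqs. (\<Sum>l. ennreal (v l)) = 1}"
    unfolding PD_frag a.pd_law_def by (rule a.AE_PK[OF S]) (use a.AE_normed in \<open>auto elim: eventually_mono\<close>)
  then have "AE q in pd_frag. q i \<in> ranked_seqs \<and> (\<Sum>l. ennreal (q i l)) = 1" for i
    by (intro AE_PiM_component[of UNIV "\<lambda>_. PD \<alpha> (- \<beta>)" i "\<lambda>v. v \<in> ranked_seqs \<and> (\<Sum>l. ennreal (v l)) = 1"]) (auto simp: PD_frag(2))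
  then show ?thesis by (simp add: AE_all_countable)
qed

lemma frag_sums:
  assumes p: "\<forall>i. 0 < p i" "summable p" and q: "\<forall>i. q i \<in> ranked_seqs \<and> (\<Sum>l. ennreal (q i l)) = 1"
  defines "X \<equiv> \<lambda>(i, l). p i * q i l"
  shows "vanishing X" "(NN x|count_space UNIV. ennreal (X x)) = ennreal (tsum p)"
proof -
  have qn: "0 \<le> q i l" for i l using q by (auto simp: ranked_seqs_def vanishing_def)
  have pn: "0 \<le> p i" for i by (rule less_imp_le[OF p(1)[rule_format]])
  have "(NN x|count_space UNIV. ennreal (X x)) = (\<Sum>i. \<Sum>l. ennreal (p i) * ennreal (q i l))"
    unfolding nn_integral_count_space_nat_prod X_def using pn qn by (simp add: ennreal_mult)
  also have "\<dots> = (\<Sum>i. ennreal (p i))" using q by simp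
  also have "\<dots> = ennreal (tsum p)" using c.suminf_eq_tsum[of p 1, OF pn p(2)] by simp
  finally show s: "(NN x|count_space UNIV. ennreal (X x)) = ennreal (tsum p)" .
  show "vanishing X"
  proof (rule vanishing_if_nn_integral_finite)
    show "0 \<le> X i" for i using pn qn by (auto simp: X_def split: prod.split)
    show "(NN x|count_space UNIV. ennreal (X x)) < \<top>" unfolding s by simp
  qed
qed

text \<open>Independent fragmentation turns the Laplace functional into a product over the
  \<beta>-stable points with factor \<open>pd_functional\<close> at each of them. By
  \<open>product_functional\<close> its exponent is the one in \<open>frag_exponent\<close>, the
  same as in \<open>laplace_subordinated\<close>.\<close>

theorem frag_points:
  "distr (Dc \<Otimes>\<^sub>M pd_frag) borel (\<lambda>x. ranked (\<lambda>(i, l). fst x i * snd x i l)) =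
   distr (Db \<Otimes>\<^sub>M Da) borel (\<lambda>x k. tsum (fst x) powr (1 / \<alpha>) * snd x k)" (is "?L = ?R")
proof (rule ranked_seqs_measure_eqI)
  interpret F: prob_space pd_frag by (rule prob_space_pd_frag)
  interpret cF: pair_prob_space Dc pd_frag ..
  interpret ba: pair_prob_space Db Da ..
  have m1: "(\<lambda>x. ranked (\<lambda>(i, l). fst x i * snd x i l)) \<in> Dc \<Otimes>\<^sub>M pd_frag \<rightarrow>\<^sub>M seqs"
    using frag_measurable by (simp cong: pair_cong)
  have m2: "(\<lambda>x k. tsum (fst x) powr (1 / \<alpha>) * snd x k) \<in> Db \<Otimes>\<^sub>M Da \<rightarrow>\<^sub>M seqs"
  proof (rule measurable_coordinatewise_then_product)
    fix k :: nat
    have "(\<lambda>x. tsum (fst x) powr (1 / \<alpha>) * snd x k) \<in> borel_measurable (borel \<Otimes>\<^sub>M borel)"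
      using snd_seq_measurable[of k borel] by measurable
    then show "(\<lambda>x. tsum (fst x) powr (1 / \<alpha>) * snd x k) \<in> borel_measurable (Db \<Otimes>\<^sub>M Da)"
      by (simp cong: pair_cong)
  qed
  show "finite_measure ?L" by (intro cF.P.finite_measure_distr m1)
  show "finite_measure ?R" by (intro ba.P.finite_measure_distr m2)
  show "sets ?L = sets borel" "sets ?R = sets borel" by simp_all
  have AE1: "AE x in Dc \<Otimes>\<^sub>M pd_frag. (\<forall>i. 0 < fst x i) \<and> summable (fst x) \<and> (\<forall>i. snd x i \<in> ranked_seqs \<and> (\<Sum>l. ennreal (snd x i l)) = 1)"
    using AE_pair_fst[OF c.prob_space_axioms prob_space_pd_frag c.AE_tsum] AE_pair_snd[OF c.prob_space_axioms prob_space_pd_frag AE_pd_frag]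
    by eventually_elim auto
  show "AE p in ?L. p \<in> ranked_seqs"
    by (subst AE_distr_iff[OF m1]) (simp, use AE1 in eventually_elim, auto intro!: ranked_in_ranked_seqs frag_sums(1))
  show "AE p in ?R. p \<in> ranked_seqs"
  proof (subst AE_distr_iff[OF m2])
    show "AE x in Db \<Otimes>\<^sub>M Da. (\<lambda>k. tsum (fst x) powr (1 / \<alpha>) * snd x k) \<in> ranked_seqs"
      using AE_pair_snd[OF b.prob_space_axioms a.prob_space_axioms a.AE_tsum]
    proof eventually_elim
      case (elim x)
      have "vanishing (\<lambda>k. tsum (fst x) powr (1 / \<alpha>) * snd x k)"
        using elim by (intro vanishing_scale) (auto simp: ranked_seqs_def)
      moreover have "decseq (\<lambda>k. tsum (fst x) powr (1 / \<alpha>) * snd x k)"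
        using elim by (auto simp: ranked_seqs_def decseq_def intro!: mult_left_mono)
      ultimately show ?case by (simp add: ranked_seqs_def)
    qed
  qed simp
  fix g :: "real \<Rightarrow> ennreal" and \<delta>
  assume g[measurable]: "g \<in> borel_measurable borel" and d: "0 < \<delta>" "\<And>x. x \<le> \<delta> \<Longrightarrow> g x = 0"
  then have g0: "g 0 = 0" by simp
  have sm: "(\<lambda>p. nexp (\<Sum>k. g (p k))) \<in> borel_measurable seqs" supply [measurable] = borel_seq_component by measurable
  have "(NN p|?L. nexp (\<Sum>k. g (p k))) = (NN x|(Dc \<Otimes>\<^sub>M pd_frag). nexp (\<Sum>k. g (ranked (\<lambda>(i, l). fst x i * snd x i l) k)))"
    by (rule nn_integral_distr[OF m1]) (use sm in simp)
  also have "\<dots> = (NN p|Dc. NN q|pd_frag. nexp (\<Sum>k. g (ranked (\<lambda>(i, l). p i * q i l) k)))"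
    using measurable_compose[OF m1 sm] by (subst F.nn_integral_fst[symmetric]) auto
  also have "\<dots> = (NN p|Dc. iprod (\<lambda>i. a.pd_functional g (- \<beta>) (p i)))"
  proof (rule nn_integral_cong_on[OF c.AE_tsum], goal_cases elim)
    case (elim p)
    have "(NN q|pd_frag. nexp (\<Sum>k. g (ranked (\<lambda>(i, l). p i * q i l) k))) = (NN q|pd_frag. iprod (\<lambda>i. nexp (\<Sum>l. g (p i * q i l))))"
    proof (rule nn_integral_cong_on[OF AE_pd_frag], goal_cases elim)
      case (elim q)
      have "vanishing (\<lambda>(i, l). p i * q i l)"
        using elim \<open>(\<forall>i. 0 < p i) \<and> p \<in> ranked_seqs \<and> summable p \<and> 0 < tsum p\<close> by (intro frag_sums(1)) auto
      from nn_integral_count_ranked[OF this g g0] show ?case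
        by (simp add: iprod_nexp nn_integral_count_space_nat_prod)
    qed
    also have "\<dots> = iprod (\<lambda>i. NN v|PD \<alpha> (- \<beta>). nexp (\<Sum>l. g (p i * v l)))"
    proof (rule nn_integral_PiM_iprod)
      fix i
      have "(\<lambda>v. nexp (\<Sum>l. g (p i * v l))) \<in> borel_measurable seqs" supply [measurable] = borel_seq_component by measurable
      then show "(\<lambda>v. nexp (\<Sum>l. g (p i * v l))) \<in> borel_measurable (PD \<alpha> (- \<beta>))"
        by (simp cong: measurable_cong_sets add: sets_PD_frag)
    qed (auto simp: PD_frag(2))
    finally show ?case by (simp add: a.pd_functional_def PD_frag(1))
  qed
  also have "\<dots> = nexp (NN x|stable_intensity \<beta>. 1 - a.pd_functional g (- \<beta>) x)"
    using a.pd_functional_measurable[OF g] beta by (intro c.product_functional a.pd_functional_le_1) auto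
  also have "\<dots> = (NN p'|Db. NN p|Da. nexp (\<Sum>k. g (tsum p' powr (1 / \<alpha>) * p k)))"
    unfolding frag_exponent[OF g] laplace_subordinated[OF g] ..
  also have "\<dots> = (NN x|(Db \<Otimes>\<^sub>M Da). nexp (\<Sum>k. g (tsum (fst x) powr (1 / \<alpha>) * snd x k)))"
    using measurable_compose[OF m2 sm] by (subst a.nn_integral_fst[symmetric]) auto
  also have "\<dots> = (NN p|?R. nexp (\<Sum>k. g (p k)))"
    by (rule nn_integral_distr[OF m2, symmetric]) (use sm in simp)
  finally show "(NN p|?L. nexp (\<Sum>k. g (p k))) = (NN p|?R. nexp (\<Sum>k. g (p k)))" .
qed

lemma nn_integral_frag_points:
  assumes G[measurable]: "G \<in> borel_measurable seqs"
  shows "(NN p|Dc. NN q|pd_frag. G (ranked (\<lambda>(i, l). p i * q i l))) =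
    (NN p'|Db. NN p|Da. G (\<lambda>k. tsum p' powr (1 / \<alpha>) * p k))"
proof -
  interpret F: prob_space pd_frag by (rule prob_space_pd_frag)
  have m1: "(\<lambda>x. ranked (\<lambda>(i, l). fst x i * snd x i l)) \<in> Dc \<Otimes>\<^sub>M pd_frag \<rightarrow>\<^sub>M seqs"
    using frag_measurable by (simp cong: pair_cong)
  have m2: "(\<lambda>x k. tsum (fst x) powr (1 / \<alpha>) * snd x k) \<in> Db \<Otimes>\<^sub>M Da \<rightarrow>\<^sub>M seqs"
  proof (rule measurable_coordinatewise_then_product)
    fix k :: nat
    have "(\<lambda>x. tsum (fst x) powr (1 / \<alpha>) * snd x k) \<in> borel_measurable (borel \<Otimes>\<^sub>M borel)"
      using snd_seq_measurable[of k borel] by measurable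
    then show "(\<lambda>x. tsum (fst x) powr (1 / \<alpha>) * snd x k) \<in> borel_measurable (Db \<Otimes>\<^sub>M Da)"
      by (simp cong: pair_cong)
  qed
  have "(NN p|Dc. NN q|pd_frag. G (ranked (\<lambda>(i, l). p i * q i l))) = (NN x|(Dc \<Otimes>\<^sub>M pd_frag). G (ranked (\<lambda>(i, l). fst x i * snd x i l)))"
    using measurable_compose[OF m1 G] by (subst F.nn_integral_fst[symmetric]) auto
  also have "\<dots> = (NN p|distr (Dc \<Otimes>\<^sub>M pd_frag) borel (\<lambda>x. ranked (\<lambda>(i, l). fst x i * snd x i l)). G p)"
    by (rule nn_integral_distr[OF m1, symmetric]) simp
  also have "\<dots> = (NN x|(Db \<Otimes>\<^sub>M Da). G (\<lambda>k. tsum (fst x) powr (1 / \<alpha>) * snd x k))"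
    unfolding frag_points by (rule nn_integral_distr[OF m2]) simp
  also have "\<dots> = (NN p'|Db. NN p|Da. G (\<lambda>k. tsum p' powr (1 / \<alpha>) * p k))"
    using measurable_compose[OF m2 G] by (subst a.nn_integral_fst[symmetric]) auto
  finally show ?thesis .
qed

text \<open>Splitting masses keeps the total, so the weight \<open>r1\<close> can be moved across
  the fragmentation, and normalization commutes with ranking. The claim then becomes
  \<open>frag_points\<close>, tested with the weighted functional \<open>G\<close>.\<close>

theorem nn_integral_FRAG_P1:
  assumes F[measurable]: "F \<in> borel_measurable seqs"
  shows "(NN p|FRAG \<alpha> (- \<beta>) (P1 f K \<beta> z). F p) =
    (NN x|joint_PK f K \<alpha> \<beta> (r1 \<beta> z). F (fst x))"
proof -
  interpret F: prob_space pd_frag by (rule prob_space_pd_frag)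
  have m: "(\<lambda>(p, q). ranked (\<lambda>(i, l). p i * q i l)) \<in> P1 f K \<beta> z \<Otimes>\<^sub>M pd_frag \<rightarrow>\<^sub>M seqs"
    using frag_measurable by (simp add: split_beta cong: pair_cong)
  have Fm: "(\<lambda>x. F (ranked (\<lambda>(i, l). fst x i * snd x i l))) \<in> borel_measurable (borel \<Otimes>\<^sub>M pd_frag)"
    by (rule measurable_compose[OF frag_measurable F])
  define \<Phi> where "\<Phi> p = (NN q|pd_frag. F (ranked (\<lambda>(i, l). p i * q i l)))" for p :: "nat \<Rightarrow> real"
  have [measurable]: "\<Phi> \<in> borel_measurable borel"
    unfolding \<Phi>_def using Fm by (intro F.borel_measurable_nn_integral) (simp add: split_beta)
  define G where "G w = ennreal (r1 \<beta> z (tsum w)) * F (normed w)" for w :: "nat \<Rightarrow> real"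
  have [measurable]: "G \<in> borel_measurable borel" unfolding G_def by measurable
  have "(NN p|FRAG \<alpha> (- \<beta>) (P1 f K \<beta> z). F p) = (NN x|(P1 f K \<beta> z \<Otimes>\<^sub>M pd_frag). F (ranked (\<lambda>(i, l). fst x i * snd x i l)))"
    unfolding FRAG_def by (subst nn_integral_distr[OF m]) (auto simp: split_beta)
  also have "\<dots> = (NN p|P1 f K \<beta> z. \<Phi> p)"
    unfolding \<Phi>_def using Fm
    by (subst F.nn_integral_fst[symmetric]) (auto cong: pair_cong)
  also have "\<dots> = (NN p|Dc. ennreal (r1 \<beta> z (tsum p)) * \<Phi> (normed p))"
    by (rule c.nn_integral_P1) measurable
  also have "\<dots> = (NN p|Dc. NN q|pd_frag. G (ranked (\<lambda>(i, l). p i * q i l)))"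
  proof (rule nn_integral_cong_on[OF c.AE_tsum], goal_cases elim)
    case (elim p)
    have Fq: "(\<lambda>q. F (ranked (\<lambda>(i, l). normed p i * q i l))) \<in> borel_measurable pd_frag"
      using measurable_compose[OF measurable_Pair1' Fm, of "normed p"] by simp
    have "ennreal (r1 \<beta> z (tsum p)) * \<Phi> (normed p) = (NN q|pd_frag. ennreal (r1 \<beta> z (tsum p)) * F (ranked (\<lambda>(i, l). normed p i * q i l)))"
      unfolding \<Phi>_def by (rule nn_integral_cmult[OF Fq, symmetric])
    also have "\<dots> = (NN q|pd_frag. G (ranked (\<lambda>(i, l). p i * q i l)))"
    proof (rule nn_integral_cong_on[OF AE_pd_frag], goal_cases elim)
      case (elim q)
      let ?X = "\<lambda>(i, l). p i * q i l"
      have p: "\<forall>i. 0 < p i" "summable p" "0 < tsum p" using \<open>(\<forall>i. 0 < p i) \<and> p \<in> ranked_seqs \<and> summable p \<and> 0 < tsum p\<close> by auto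
      note X = frag_sums[OF p(1,2) elim]
      have "(\<Sum>k. ennreal (ranked ?X k)) = (NN x|count_space UNIV. ennreal (?X x))"
        by (rule nn_integral_count_ranked[OF X(1)]) auto
      then have "(\<Sum>k. ennreal (ranked ?X k)) = ennreal (tsum p)" unfolding X(2) .
      then have t: "tsum (ranked ?X) = tsum p"
        unfolding tsum_def[of "ranked _"] using p by (intro suminf_eq_of_ennreal(2) ranked_nonneg X(1)) auto
      have "(\<lambda>(i, l). normed p i * q i l) = (\<lambda>x. 1 / tsum p * ?X x)"
        by (auto simp: normed_def fun_eq_iff)
      then have "ranked (\<lambda>(i, l). normed p i * q i l) = normed (ranked ?X)"
        using ranked_scale[OF X(1), of "1 / tsum p"] p t by (simp add: normed_def split_beta)
      then show ?case unfolding G_def t by simp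
    qed
    finally show ?case .
  qed
  also have "\<dots> = (NN p'|Db. NN p|Da. G (\<lambda>k. tsum p' powr (1 / \<alpha>) * p k))"
    by (rule nn_integral_frag_points) measurable
  also have "\<dots> = (NN p'|Db. NN p|Da. ennreal (r1 \<beta> z (tsum p * tsum p' powr (1 / \<alpha>))) * F (fst (normed p, normed p')))"
  proof (rule nn_integral_cong_on[OF b.AE_tsum], goal_cases elim)
    case (elim p')
    then have "tsum p' powr (1 / \<alpha>) \<noteq> 0" by simp
    then show ?case
      by (intro nn_integral_cong_AE, use a.AE_tsum in eventually_elim)
         (simp add: G_def normed_scale tsum_scale mult.commute[of "tsum _" "tsum p' powr (1 / \<alpha>)"])
  qed
  also have "\<dots> = (NN x|joint_PK f K \<alpha> \<beta> (r1 \<beta> z). F (fst x))"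
    by (rule nn_integral_joint_PK[symmetric]) measurable
  finally show ?thesis .
qed

end

subsection \<open>Coagulation\<close>

text \<open>The index of the interval of lengths \<open>q l\<close>, placed in the order of the locations \<open>u l\<close>, that
  contains \<open>w\<close>.\<close>

definition cell :: "(nat \<Rightarrow> real) \<Rightarrow> (nat \<Rightarrow> real) \<Rightarrow> real \<Rightarrow> nat" where
  "cell q u w = (LEAST l. step_cdf q u (u l) - q l < w \<and> w < step_cdf q u (u l))"

section \<open>Gaps and jumps of step functions\<close>

lemma step_cdf_mono:
  assumes "\<And>k. 0 \<le> q k" "summable q" "x \<le> y"
  shows "step_cdf q u x \<le> step_cdf q u y"
  unfolding step_cdf_def using assms
  by (intro suminf_le summable_comparison_test'[OF assms(2)]) (auto simp: indicator_def)

lemma step_cdf_summable: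
  fixes q :: "nat \<Rightarrow> real"
  assumes "\<And>k. 0 \<le> q k" "summable q"
  shows "summable (\<lambda>k. q k * indicator (A k) (u k))"
  using assms by (intro summable_comparison_test'[OF assms(2)]) (auto simp: indicator_def)

text \<open>The function jumps by at least \<open>q l\<close> at \<open>u l\<close>. Hence it takes
  no value inside the gap belonging to \<open>l\<close>, and gaps of distinct locations are
  disjoint.\<close>

lemma step_cdf_gap:
  assumes q: "\<And>k. 0 \<le> q k" "summable q" and yl: "y < u l"
  shows "step_cdf q u y \<le> step_cdf q u (u l) - q l"
proof -
  have "step_cdf q u y + q l \<le> step_cdf q u (u l)"
  proof -
    have s': "(\<lambda>k. if k = l then q k else 0) sums q l" by (rule sums_single)
    have s: "summable (\<lambda>k. q k * indicator {..y} (u k) + (if k = l then q k else 0))"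
      by (intro summable_add step_cdf_summable q sums_summable[OF s'])
    have "step_cdf q u y + q l = (\<Sum>k. q k * indicator {..y} (u k)) + (\<Sum>k. if k = l then q k else 0)"
      using sums_unique[OF s'] by (simp add: step_cdf_def)
    also have "\<dots> = (\<Sum>k. q k * indicator {..y} (u k) + (if k = l then q k else 0))"
      by (intro suminf_add step_cdf_summable q sums_summable[OF s'])
    also have "\<dots> \<le> (\<Sum>k. q k * indicator {..u l} (u k))"
      using yl q by (intro suminf_le s step_cdf_summable) (auto simp: indicator_def)
    finally show ?thesis by (simp add: step_cdf_def)
  qed
  then show ?thesis by simp
qed

lemma cell_eqI:
  assumes q: "\<And>k. 0 \<le> q k" "summable q" and u: "inj u"
    and w: "step_cdf q u (u l) - q l < w" "w < step_cdf q u (u l)"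
  shows "cell q u w = l"
  unfolding cell_def
proof (rule Least_equality)
  fix m assume m: "step_cdf q u (u m) - q m < w \<and> w < step_cdf q u (u m)"
  show "l \<le> m"
  proof (rule ccontr)
    assume "\<not> l \<le> m"
    then have "u l \<noteq> u m" using u by (auto dest: injD)
    then show False
      using step_cdf_gap[OF q, of "u l" u m] step_cdf_gap[OF q, of "u m" u l] m w by (cases "u l < u m") auto
  qed
qed (use w in auto)

text \<open>A point \<open>ut k\<close> in the gap of \<open>l\<close> is below \<open>step_cdf q u y\<close> exactly when \<open>u l \<le> y\<close>.\<close>

lemma step_cdf_comp:
  assumes q: "\<And>k. 0 \<le> q k" "summable q" and u: "inj u"
    and ut: "\<And>k. \<exists>l. step_cdf q u (u l) - q l < ut k \<and> ut k < step_cdf q u (u l)"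
  shows "step_cdf v ut (step_cdf q u y) = (\<Sum>k. v k * indicator {..y} (u (cell q u (ut k))))"
  unfolding step_cdf_def[of v]
proof (rule arg_cong[where f = suminf], rule ext)
  fix k
  obtain l where l: "step_cdf q u (u l) - q l < ut k" "ut k < step_cdf q u (u l)" using ut by blast
  have c: "cell q u (ut k) = l" by (rule cell_eqI[OF q u l])
  have "ut k \<le> step_cdf q u y \<longleftrightarrow> u l \<le> y"
  proof
    assume "u l \<le> y"
    then show "ut k \<le> step_cdf q u y" using step_cdf_mono[OF q, of "u l" y u] l by simp
  next
    assume "ut k \<le> step_cdf q u y"
    then show "u l \<le> y" using step_cdf_gap[OF q, of y u l] l by (cases "u l \<le> y") auto
  qed
  then show "v k * indicator {..step_cdf q u y} (ut k) = v k * indicator {..y} (u (cell q u (ut k)))"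
    unfolding c by (simp add: indicator_def)
qed

text \<open>The left limit may be taken inside the series by Tannery's theorem, with
  \<open>v\<close> as the dominating series; it drops exactly the terms located at y.\<close>

lemma jump_step_cdf:
  assumes v: "\<And>k. 0 \<le> v k" "summable v"
  shows "jump (\<lambda>y. \<Sum>k. v k * indicator {..y} (x k :: real)) y = (\<Sum>k. v k * indicator {y} (x k))"
proof -
  have lim: "((\<lambda>z. \<Sum>k. v k * indicator {..z} (x k)) \<longlongrightarrow> (\<Sum>k. v k * indicator {..<y} (x k))) (at_left y)"
  proof (rule conjunct2[OF conjunct2[OF tannerys_theorem]])
    show "((\<lambda>z. v k * indicator {..z} (x k)) \<longlongrightarrow> v k * indicator {..<y} (x k)) (at_left y)" for k
    proof (rule tendsto_eventually)
      have "\<forall>\<^sub>F z in at_left y. z < y \<and> (x k < y \<longrightarrow> x k < z)"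
      proof (cases "x k < y")
        case True
        show ?thesis using eventually_at_left_real[OF True] by eventually_elim auto
      next
        case False
        show ?thesis using eventually_at_left_real[of "y - 1" y] by (auto elim!: eventually_mono simp: False)
      qed
      then show "\<forall>\<^sub>F z in at_left y. v k * indicator {..z} (x k) = v k * indicator {..<y} (x k)"
        by eventually_elim (auto simp: indicator_def)
    qed
    show "\<forall>\<^sub>F (k, z) in at_top \<times>\<^sub>F at_left y. norm (v k * indicator {..z} (x k)) \<le> v k"
      using v by (intro always_eventually) (auto simp: indicator_def)
  qed (use v in auto)
  have "jump (\<lambda>y. \<Sum>k. v k * indicator {..y} (x k)) y = (\<Sum>k. v k * indicator {..y} (x k)) - (\<Sum>k. v k * indicator {..<y} (x k))"
    unfolding jump_def by (subst tendsto_Lim[OF _ lim]) (auto simp: trivial_limit_at_left_real)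
  also have "\<dots> = (\<Sum>k. v k * indicator {..y} (x k) - v k * indicator {..<y} (x k))"
    by (intro suminf_diff step_cdf_summable v)
  also have "\<dots> = (\<Sum>k. v k * indicator {y} (x k))"
    by (intro arg_cong[where f = suminf] ext) (auto simp: indicator_def)
  finally show ?thesis .
qed

text \<open>All nonzero jumps of the composition sit at points of the range of the injective
  \<open>u\<close>. Hence \<open>ranked_cong_count\<close> lets the uncountable family of jumps be
  replaced by the masses collected in each cell.\<close>

lemma coag_eq:
  assumes v: "\<And>k. 0 \<le> v k" "summable v" and q: "\<And>k. 0 \<le> q k" "summable q" and u: "inj u"
    and ut: "\<And>k. \<exists>l. step_cdf q u (u l) - q l < ut k \<and> ut k < step_cdf q u (u l)"
  shows "coag v ut q u = ranked (\<lambda>l. \<Sum>k. v k * indicator {l} (cell q u (ut k)))"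
  unfolding coag_def
proof (rule ranked_cong_count)
  fix t :: real assume t: "0 \<le> t"
  let ?X = "\<lambda>l. \<Sum>k. v k * indicator {l} (cell q u (ut k))"
  have J: "jump (step_cdf v ut \<circ> step_cdf q u) y = (\<Sum>k. v k * indicator {y} (u (cell q u (ut k))))" for y
    unfolding comp_def step_cdf_comp[OF q u ut] by (rule jump_step_cdf[OF v])
  have "{y. t < jump (step_cdf v ut \<circ> step_cdf q u) y} = u ` {l. t < ?X l}"
  proof (intro set_eqI iffI)
    fix y assume y: "y \<in> {y. t < jump (step_cdf v ut \<circ> step_cdf q u) y}"
    have "\<exists>l. y = u l"
    proof (rule ccontr)
      assume "\<nexists>l. y = u l"
      then have "indicator {y} (u (cell q u (ut k))) = (0 :: real)" for k by (auto simp: indicator_def)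
      then show False using y t unfolding J by simp
    qed
    then obtain l where "y = u l" ..
    then show "y \<in> u ` {l. t < ?X l}" using y u by (auto simp: J indicator_def inj_eq)
  qed (use u in \<open>auto simp: J indicator_def inj_eq\<close>)
  then show "emeasure (count_space UNIV) {y. t < jump (step_cdf v ut \<circ> step_cdf q u) y} = emeasure (count_space UNIV) {l. t < ?X l}"
    using u by (simp add: emeasure_count_space finite_image_iff card_image inj_on_subset[OF u])
qed

section \<open>Uniform locations and cell masses\<close>

abbreviation unif :: "real measure" where "unif \<equiv> uniform_measure lborel {0..1}"

abbreviation unifs :: "(nat \<Rightarrow> real) measure" where "unifs \<equiv> PiM UNIV (\<lambda>_. unif)"

lemma prob_space_unif: "prob_space unif"
  by (rule prob_space_uniform_measure) auto

lemma prob_space_unifs: "prob_space unifs"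
  by (rule prob_space_PiM) (rule prob_space_unif)

lemma sets_unifs [measurable_cong, simp]: "sets unifs = sets borel"
  unfolding sets_borel_seq by (intro sets_PiM_cong) auto

lemma sums_ennreal_ge: "(\<And>k. 0 \<le> q k) \<Longrightarrow> q sums r \<Longrightarrow> (\<Sum>k. ennreal (q k)) = ennreal r"
  by (subst suminf_ennreal2) (auto simp: sums_iff)

text \<open>The gaps are disjoint subintervals of [0, 1] with lengths \<open>q l\<close> summing to
  1. A uniform point thus lies almost surely in one of them and selects \<open>l\<close> with
  probability \<open>q l\<close>, whatever the order of the locations.\<close>

lemma uniform_cell:
  assumes q: "\<And>k. 0 \<le> q k" "q sums 1" and u: "inj u"
  shows "AE w in unif. \<exists>l. step_cdf q u (u l) - q l < w \<and> w < step_cdf q u (u l)"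
    and "(NN w|unif. \<phi> (cell q u w)) = (\<Sum>l. ennreal (q l) * \<phi> l)"
proof -
  interpret prob_space unif by (rule prob_space_unif)
  have qs: "summable q" "suminf q = 1" using q(2) by (auto simp: sums_iff)
  define F where "F l = step_cdf q u (u l)" for l
  define I where "I l = {F l - q l <..< F l}" for l
  have cell: "cell q u w = l" if "w \<in> I l" for w l
    using that by (intro cell_eqI q qs u) (auto simp: I_def F_def)
  have F: "q l \<le> F l" "F l \<le> 1" for l
  proof -
    have "(\<Sum>k\<in>{l}. q k * indicator {..u l} (u k)) \<le> F l"
      unfolding F_def step_cdf_def using q by (intro sum_le_suminf step_cdf_summable qs) auto
    then show "q l \<le> F l" by simp
    have "F l \<le> suminf q"
      unfolding F_def step_cdf_def using q by (intro suminf_le step_cdf_summable qs) (auto simp: indicator_def)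
    then show "F l \<le> 1" using qs by simp
  qed
  have eI: "emeasure unif (I l) = ennreal (q l)" for l
  proof -
    have "{0..1} \<inter> I l = I l" unfolding I_def using F[of l] by (auto simp: less_imp_le)
    then show ?thesis using q(1)[of l] divide_ennreal[of "q l" 1] by (simp add: I_def)
  qed
  have disj: "disjoint_family I" by (auto simp: disjoint_family_on_def dest: cell)
  have Im: "range I \<subseteq> sets unif" by (auto simp: I_def)
  have "emeasure unif (\<Union>l. I l) = 1"
    using suminf_emeasure[OF Im disj] sums_ennreal_ge[OF q] by (simp add: eI)
  then have AE: "AE w in unif. w \<in> (\<Union>l. I l)"
    using Im by (intro AE_in_set_eq_1[THEN iffD2]) (auto simp: emeasure_eq_measure)
  then show "AE w in unif. \<exists>l. step_cdf q u (u l) - q l < w \<and> w < step_cdf q u (u l)"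
    by eventually_elim (auto simp: I_def F_def)
  have "(NN w|unif. \<phi> (cell q u w)) = (NN w|unif. (\<Sum>l. \<phi> l * indicator (I l) w))"
  proof (rule nn_integral_cong_on[OF AE], goal_cases elim)
    case (elim w)
    then obtain l where l: "w \<in> I l" by auto
    have "(\<Sum>m. \<phi> m * indicator (I m) w) = (\<Sum>m\<in>{l}. \<phi> m * indicator (I m) w)"
      using cell[OF l] cell by (intro suminf_finite) (auto simp: indicator_def)
    then show ?case using l cell[OF l] by simp
  qed
  also have "\<dots> = (\<Sum>l. ennreal (q l) * \<phi> l)"
    using Im by (subst nn_integral_suminf) (auto simp: nn_integral_cmult_indicator eI mult.commute)
  finally show "(NN w|unif. \<phi> (cell q u w)) = (\<Sum>l. ennreal (q l) * \<phi> l)" .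
qed

lemma AE_unifs_inj: "AE u in unifs. inj u"
proof -
  have ne: "AE u in unifs. u i \<noteq> u j" if "i \<noteq> j" for i j :: nat
  proof -
    have [measurable]: "(\<lambda>u. u i) \<in> borel_measurable unifs" for i
      using borel_seq_component[of i] by (simp cong: measurable_cong_sets)
    have "{u \<in> space unifs. u i = u j} \<in> sets unifs" by measurable
    then have m: "{u. u i = u j} \<in> sets unifs" by (simp add: space_PiM)
    have "emeasure unifs {u. u i = u j} = (NN u|unifs. indicator {u. u i = u j} u)"
      using m by (rule nn_integral_indicator[symmetric])
    \<comment> \<open>With coordinate j resampled, a coincidence requires a uniform variable to hit
      the fixed number \<open>u i\<close>.\<close>
    also have "\<dots> = (NN u|unifs. NN x|unif. indicator {u. u i = u j} (u(j := x)))"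
      by (rule nn_integral_PiM_update[OF prob_space_unif borel_measurable_indicator[OF m]])
    also have "\<dots> = (NN u|unifs. NN x|unif. indicator {u i} x)"
      using that by (intro nn_integral_cong) (auto simp: indicator_def)
    also have "\<dots> = 0"
    proof -
      have "emeasure unif {x} = 0" for x
        using emeasure_mono[of "{0..1} \<inter> {x}" "{x}" lborel] by simp
      then show ?thesis by simp
    qed
    finally show ?thesis using m by (intro AE_I[of _ _ "{u. u i = u j}"]) auto
  qed
  then have "AE u in unifs. \<forall>i j. i \<noteq> j \<longrightarrow> u i \<noteq> u j"
    by (simp add: AE_all_countable)
  then show ?thesis by eventually_elim (auto simp: inj_def)
qed

lemma AE_unifs_cell:
  assumes q: "\<And>k. 0 \<le> q k" "q sums 1" and u: "inj u"
  shows "AE w in unifs. \<forall>k. \<exists>l. step_cdf q u (u l) - q l < w k \<and> w k < step_cdf q u (u l)"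
  using uniform_cell(1)[OF q u]
  by (auto simp: AE_all_countable intro!: AE_PiM_component[where P = "\<lambda>w. \<exists>l. step_cdf q u (u l) - q l < w \<and> w < step_cdf q u (u l)"] prob_space_unif)

text \<open>The masses of the coagulation, not yet ranked.\<close>

definition cell_mass :: "(nat \<Rightarrow> real) \<Rightarrow> (nat \<Rightarrow> real) \<Rightarrow> (nat \<Rightarrow> real) \<Rightarrow> (nat \<Rightarrow> real) \<Rightarrow> nat \<Rightarrow> real" where
  "cell_mass v q u w l = (\<Sum>k. v k * indicator {l} (cell q u (w k)))"

lemma cell_mass_nonneg: "(\<And>k. 0 \<le> v k) \<Longrightarrow> summable v \<Longrightarrow> 0 \<le> cell_mass v q u w l"
  unfolding cell_mass_def by (intro suminf_nonneg step_cdf_summable mult_nonneg_nonneg) auto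

lemma cell_mass_ennreal:
  assumes v: "\<And>k. 0 \<le> v k" "summable v"
  shows "ennreal (cell_mass v q u w l) = (\<Sum>k. ennreal (v k) * indicator {l} (cell q u (w k)))"
proof -
  have "ennreal (v k) * indicator {l} (cell q u (w k)) = ennreal (v k * indicator {l} (cell q u (w k)))" for k
    by (simp add: indicator_def)
  then show ?thesis
    unfolding cell_mass_def using v by (simp add: suminf_ennreal2 step_cdf_summable)
qed

lemma suminf_cell_mass:
  assumes v: "\<And>k. 0 \<le> v k" "summable v"
  shows "(\<Sum>l. ennreal (cell_mass v q u w l)) = ennreal (suminf v)"
proof -
  have "(\<Sum>l. ennreal (cell_mass v q u w l)) = (\<Sum>l. NN k|count_space UNIV. ennreal (v k) * indicator {l} (cell q u (w k)))"
    by (simp add: cell_mass_ennreal[OF v] nn_integral_count_space_nat)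
  also have "\<dots> = (NN k|count_space UNIV. (\<Sum>l. ennreal (v k) * indicator {l} (cell q u (w k))))"
    by (rule nn_integral_suminf[symmetric]) simp
  also have "\<dots> = (NN k|count_space UNIV. ennreal (v k))"
  proof (intro nn_integral_cong)
    fix k
    have "(\<Sum>l. ennreal (v k) * indicator {l} (cell q u (w k))) = (\<Sum>l\<in>{cell q u (w k)}. ennreal (v k) * indicator {l} (cell q u (w k)))"
      by (intro suminf_finite) (auto simp: indicator_def)
    then show "(\<Sum>l. ennreal (v k) * indicator {l} (cell q u (w k))) = ennreal (v k)" by simp
  qed
  also have "\<dots> = ennreal (suminf v)" using v by (simp add: nn_integral_count_space_nat suminf_ennreal2)
  finally show ?thesis .
qed

lemma cell_mass_vanishing:
  assumes v: "\<And>k. 0 \<le> v k" "summable v" shows "vanishing (cell_mass v q u w)"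
  using suminf_eq_of_ennreal(1)[OF cell_mass_nonneg[OF v] suminf_cell_mass[OF v] suminf_nonneg[OF v(2,1)]] cell_mass_nonneg[OF v]
  by (intro vanishing_if_summable)

lemma tsum_ranked_cell_mass:
  assumes v: "\<And>k. 0 \<le> v k" "summable v" shows "tsum (ranked (cell_mass v q u w)) = tsum v"
  unfolding tsum_def
proof (rule suminf_eq_of_ennreal(2))
  note van = cell_mass_vanishing[OF v, of q u w]
  show "0 \<le> ranked (cell_mass v q u w) k" for k by (rule ranked_nonneg[OF van])
  show "(\<Sum>k. ennreal (ranked (cell_mass v q u w) k)) = ennreal (suminf v)"
    using nn_integral_count_ranked[OF van, of ennreal] suminf_cell_mass[OF v, of q u w] by (simp add: nn_integral_count_space_nat)
qed (intro suminf_nonneg v)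

lemma cell_mass_scale: "summable v \<Longrightarrow> (\<And>k. 0 \<le> v k) \<Longrightarrow> cell_mass (\<lambda>k. c * v k) q u w = (\<lambda>l. c * cell_mass v q u w l)"
  unfolding cell_mass_def mult.assoc
  by (intro ext suminf_mult step_cdf_summable) auto

lemma cell_mass_measurable:
  assumes v: "\<And>k. (\<lambda>x. v x k) \<in> borel_measurable N" and q: "\<And>k. (\<lambda>x. q x k) \<in> borel_measurable N"
    and u: "\<And>k. (\<lambda>x. u x k) \<in> borel_measurable N" and w: "\<And>k. (\<lambda>x. w x k) \<in> borel_measurable N"
  shows "(\<lambda>x. cell_mass (v x) (q x) (u x) (w x) l) \<in> borel_measurable N"
proof -
  note [measurable] = v q u w
  have e: "step_cdf (q x) (u x) (u x l) = (\<Sum>k. if u x k \<le> u x l then q x k else 0)" for x l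
    unfolding step_cdf_def by (intro arg_cong[where f = suminf] ext) (auto simp: indicator_def)
  have "(\<lambda>x. cell (q x) (u x) (w x k)) \<in> N \<rightarrow>\<^sub>M count_space UNIV" for k
    unfolding cell_def e by measurable
  from measurable_compose[OF this, of "indicator {l} :: _ \<Rightarrow> real" borel]
  have [measurable]: "(\<lambda>x. indicator {l} (cell (q x) (u x) (w x k)) :: real) \<in> borel_measurable N" for k by simp
  show ?thesis unfolding cell_mass_def by measurable
qed

section \<open>Cell masses as stable increments\<close>

context stable_pd_pair
begin

lemma cell_mass_measurable_pair:
  assumes "sets A = sets seqs" "sets B = sets seqs"
  shows "(\<lambda>x. cell_mass (\<lambda>k. t * fst x k) q u (snd x)) \<in> A \<Otimes>\<^sub>M B \<rightarrow>\<^sub>M seqs"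
proof -
  have "(\<lambda>x. cell_mass (\<lambda>k. t * fst x k) q u (snd x)) \<in> borel \<Otimes>\<^sub>M borel \<rightarrow>\<^sub>M borel"
    by (intro measurable_coordinatewise_then_product cell_mass_measurable borel_measurable_times borel_measurable_const
      measurable_compose[OF measurable_fst borel_seq_component] measurable_compose[OF measurable_snd borel_seq_component])
  then show ?thesis using assms by (simp cong: pair_cong)
qed

text \<open>The cells label the \<alpha>-stable points independently with law \<open>q\<close>, so
  the Poisson process splits into independent thinned ones. The scale \<open>t\<close> is chosen so
  that t powr \<alpha> * q l = p' l.\<close>

lemma laplace_cell_mass:
  assumes p': "\<And>i. 0 < p' i" "summable p'" and u: "inj u" and c: "\<And>l. 0 \<le> c l"
  defines "q \<equiv> normed p'" and "t \<equiv> tsum p' powr (1 / \<alpha>)"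
  shows "(NN p|Da. NN w|unifs. nexp (\<Sum>l<n. ennreal (c l * cell_mass (\<lambda>k. t * p k) q u w l))) =
    (\<Prod>l<n. ennreal (exp (- (p' l * c l powr \<alpha>))))"
proof -
  have T: "0 < tsum p'" unfolding tsum_def using p' by (intro suminf_pos) auto
  then have t: "0 < t" "t powr \<alpha> = tsum p'" using a.gamma by (auto simp: t_def powr_powr)
  have pn: "0 \<le> p' l" for l by (rule less_imp_le[OF p'(1)])
  have qn: "0 \<le> q l" for l using T pn by (simp add: q_def normed_def)
  have q1: "q sums 1"
    using T sums_divide[OF summable_sums[OF p'(2)], of "tsum p'"] by (simp add: q_def normed_def tsum_def[symmetric])
  have qe: "(\<Sum>l. ennreal (q l)) = 1" using sums_ennreal_ge[OF qn q1] by simp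
  define C where "C l = (if l < n then ennreal (c l) else 0)" for l
  let ?m = "\<lambda>p w. \<Sum>l<n. ennreal (c l * cell_mass (\<lambda>k. t * p k) q u w l)"
  let ?q = "\<lambda>x. \<Sum>l. ennreal (q l) * (1 - nexp (ennreal (t * x) * C l))"
  \<comment> \<open>The average over the random label of a single point of size x. Independence of
    the labels makes the conditional functional the product of these averages over the
    points.\<close>
  define \<Theta> where "\<Theta> x = (\<Sum>l. ennreal (q l) * nexp (ennreal (t * x) * C l))" for x
  have \<Theta>m: "\<Theta> \<in> borel_measurable borel" unfolding \<Theta>_def by measurable
  have \<Theta>1: "\<Theta> x \<le> 1" for x
  proof -
    have "\<Theta> x \<le> (\<Sum>l. ennreal (q l) * 1)" unfolding \<Theta>_def by (intro suminf_le mult_left_mono) auto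
    then show ?thesis using qe by simp
  qed
  have "(NN p|Da. NN w|unifs. nexp (?m p w)) = (NN p|Da. iprod (\<lambda>k. \<Theta> (p k)))"
  proof (rule nn_integral_cong_on[OF a.AE_tsum], goal_cases elim)
    case (elim p)
    have v: "0 \<le> t * p k" "summable (\<lambda>k. t * p k)" for k
      using elim t by (auto intro: summable_mult) (metis less_imp_le mult_nonneg_nonneg)
    have "?m p w = (\<Sum>k. ennreal (t * p k) * C (cell q u (w k)))" for w
    proof -
      have "?m p w =
          (\<Sum>l<n. \<Sum>k. ennreal (c l) * (ennreal (t * p k) * indicator {l} (cell q u (w k))))"
        using c by (intro sum.cong refl) (simp add: ennreal_mult' cell_mass_ennreal[OF v])
      also have "\<dots> = (\<Sum>k. \<Sum>l<n. ennreal (c l) * (ennreal (t * p k) * indicator {l} (cell q u (w k))))"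
        by (rule suminf_sum[symmetric]) simp
      also have "\<dots> = (\<Sum>k. ennreal (t * p k) * C (cell q u (w k)))"
      proof (intro arg_cong[where f = suminf] ext)
        fix k
        have "(\<Sum>l<n. ennreal (c l) * (ennreal (t * p k) * indicator {l} (cell q u (w k)))) = (\<Sum>l<n. if cell q u (w k) = l then ennreal (t * p k) * ennreal (c l) else 0)"
          by (intro sum.cong) (auto simp: indicator_def mult.commute)
        then show "(\<Sum>l<n. ennreal (c l) * (ennreal (t * p k) * indicator {l} (cell q u (w k)))) = ennreal (t * p k) * C (cell q u (w k))"
          by (simp add: C_def)
      qed
      finally show ?thesis .
    qed
    then have "(NN w|unifs. nexp (?m p w)) =
        (NN w|unifs. iprod (\<lambda>k. nexp (ennreal (t * p k) * C (cell q u (w k)))))"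
      by (simp add: iprod_nexp)
    also have "\<dots> = iprod (\<lambda>k. NN w|unif. nexp (ennreal (t * p k) * C (cell q u w)))"
    proof (rule nn_integral_PiM_iprod[OF prob_space_unif, of "\<lambda>k w. nexp (ennreal (t * p k) * C (cell q u w))"])
      have "cell q u \<in> unif \<rightarrow>\<^sub>M count_space UNIV" unfolding cell_def by measurable
      from measurable_compose[OF this, of "\<lambda>l. nexp (ennreal (t * p k) * C l)" borel for k]
      show "(\<lambda>w. nexp (ennreal (t * p k) * C (cell q u w))) \<in> borel_measurable unif" for k by simp
    qed simp
    also have "\<dots> = iprod (\<lambda>k. \<Theta> (p k))"
      unfolding \<Theta>_def by (subst uniform_cell(2)[OF qn q1 u, of "\<lambda>l. nexp (_ * C l)"]) (rule refl)
    finally show ?case .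
  qed
  also have "\<dots> = nexp (NN x|stable_intensity \<alpha>. 1 - \<Theta> x)"
    by (rule a.product_functional[OF \<Theta>m \<Theta>1])
  also have "(NN x|stable_intensity \<alpha>. 1 - \<Theta> x) = (NN x|stable_intensity \<alpha>. ?q x)"
  proof (intro nn_integral_cong)
    fix x
    have "?q x + \<Theta> x = (\<Sum>l. ennreal (q l) * (1 - nexp (ennreal (t * x) * C l)) + ennreal (q l) * nexp (ennreal (t * x) * C l))"
      unfolding \<Theta>_def by (rule suminf_add) auto
    also have "\<dots> = 1" by (simp add: distrib_left[symmetric] diff_add_cancel_ennreal qe)
    finally have "?q x + \<Theta> x = 1" .
    moreover have "\<Theta> x < \<top>" using \<Theta>1[of x] by (rule le_less_trans) simp
    ultimately show "1 - \<Theta> x = ?q x"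
      using ennreal_add_diff_cancel_right[of "\<Theta> x"] by (metis infinity_ennreal_def less_irrefl)
  qed
  also have "\<dots> = (\<Sum>l. ennreal (q l) * (NN x|stable_intensity \<alpha>. 1 - nexp (ennreal (t * x) * C l)))"
    by (subst nn_integral_suminf) (simp_all add: nn_integral_cmult stable_intensity_def)
  also have "\<dots> = (\<Sum>l. if l < n then ennreal (p' l * c l powr \<alpha>) else 0)"
  proof (intro arg_cong[where f = suminf] ext)
    fix l
    have "(NN x|stable_intensity \<alpha>. 1 - nexp (ennreal (t * x) * ennreal (c l))) = (NN x|stable_intensity \<alpha>. ennreal (1 - exp (- ((t * c l) * x))))"
    proof (rule nn_integral_cong_on[OF a.AE_nu_pos], goal_cases elim)
      case (elim x)
      have "ennreal (t * x) * ennreal (c l) = ennreal (t * c l * x)"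
        using c[of l] t elim by (simp add: ennreal_mult'[symmetric] ac_simps)
      then show ?case using c[of l] t elim by (simp add: nexp_ennreal ennreal_minus flip: ennreal_1)
    qed
    also have "\<dots> = ennreal (tsum p' * c l powr \<alpha>)"
      using a.gamma t c[of l] by (simp add: nn_integral_stable_intensity_Laplace powr_mult)
    finally have "ennreal (q l) * (NN x|stable_intensity \<alpha>. 1 - nexp (ennreal (t * x) * ennreal (c l))) = ennreal (p' l * c l powr \<alpha>)"
      using T qn[of l] by (simp add: ennreal_mult'[symmetric] q_def normed_def)
    then show "ennreal (q l) * (NN x|stable_intensity \<alpha>. 1 - nexp (ennreal (t * x) * C l)) = (if l < n then ennreal (p' l * c l powr \<alpha>) else 0)"
      by (simp add: C_def)
  qed
  also have "\<dots> = (\<Sum>l<n. ennreal (p' l * c l powr \<alpha>))"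
    by (subst suminf_finite[of "{..<n}"]) auto
  also have "nexp \<dots> = (\<Prod>l<n. ennreal (exp (- (p' l * c l powr \<alpha>))))"
    using pn by (simp add: nexp_sum nexp_ennreal del: sum_ennreal)
  finally show ?thesis .
qed

text \<open>Given the points \<open>p'\<close>, the masses of the coagulation are the increments over intervals of lengths
  \<open>p' l\<close> of an \<open>\<alpha>\<close>-stable subordinator.\<close>

lemma cell_mass_law:
  assumes p': "\<And>i. 0 < p' i" "summable p'" and u: "inj u"
  shows "distr (Da \<Otimes>\<^sub>M unifs) borel (\<lambda>x. cell_mass (\<lambda>k. tsum p' powr (1 / \<alpha>) * fst x k) (normed p') u (snd x)) =
    distr (PiM UNIV (\<lambda>_::nat. Da)) borel (\<lambda>\<omega> l. p' l powr (1 / \<alpha>) * tsum (\<omega> l))" (is "distr ?D borel ?Y = distr ?E borel ?Z")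
proof (rule seq_measure_eqI[OF _ _ _ _ _ _ _ determining_laplace])
  interpret U: prob_space unifs by (rule prob_space_unifs)
  interpret aU: pair_prob_space Da unifs ..
  interpret E: prob_space ?E by (rule prob_space_PiM) (rule a.prob_space_axioms)
  have m1[measurable]: "?Y \<in> ?D \<rightarrow>\<^sub>M seqs" by (rule cell_mass_measurable_pair) simp_all
  have Dm: "(\<lambda>\<omega>. tsum (\<omega> l)) \<in> borel_measurable ?E" for l
  proof -
    have "(\<lambda>\<omega>. \<omega> l) \<in> ?E \<rightarrow>\<^sub>M Da" by (rule measurable_component_singleton) simp
    from measurable_compose[OF this, of tsum borel] show ?thesis by simp
  qed
  have m2[measurable]: "?Z \<in> ?E \<rightarrow>\<^sub>M seqs"
    using Dm by (intro measurable_coordinatewise_then_product borel_measurable_times borel_measurable_const)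
  show "finite_measure (distr ?D borel ?Y)" by (rule aU.P.finite_measure_distr[OF m1])
  show "finite_measure (distr ?E borel ?Z)" by (rule E.finite_measure_distr[OF m2])
  show "sets (distr ?D borel ?Y) = sets borel" "sets (distr ?E borel ?Z) = sets borel" by simp_all
  have S: "{v :: nat \<Rightarrow> real. \<forall>i. v i \<in> {0..}} \<in> sets borel"
  proof -
    note [measurable] = borel_seq_component
    have "{v \<in> space borel. \<forall>i::nat. (0::real) \<le> v i} \<in> sets borel" by measurable
    then show ?thesis by simp
  qed
  have nn: "AE x in ?D. (\<forall>i. 0 \<le> fst x i) \<and> summable (fst x)"
    using AE_pair_fst[OF a.prob_space_axioms prob_space_unifs a.AE_tsum]
    by eventually_elim (metis less_imp_le)
  have Yn: "AE x in ?D. \<forall>l. 0 \<le> ?Y x l"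
    using nn by eventually_elim (auto intro!: cell_mass_nonneg summable_mult)
  show "AE x in distr ?D borel ?Y. \<forall>i. x i \<in> {0..}"
    using Yn S by (subst AE_distr_iff[OF m1]) auto
  have Zn: "AE \<omega> in ?E. \<forall>l. 0 \<le> ?Z \<omega> l"
  proof -
    have "AE \<omega> in ?E. 0 < tsum (\<omega> l)" for l
      using a.AE_tsum by (intro AE_PiM_component[where P = "\<lambda>p. 0 < tsum p"] a.prob_space_axioms) auto
    then have "AE \<omega> in ?E. \<forall>l. 0 < tsum (\<omega> l)" by (simp add: AE_all_countable)
    then show ?thesis by eventually_elim (metis less_imp_le mult_nonneg_nonneg powr_ge_zero)
  qed
  show "AE x in distr ?E borel ?Z. \<forall>i. x i \<in> {0..}"
    using Zn S by (subst AE_distr_iff[OF m2]) auto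
  show "{0::real..} \<in> sets borel" by simp
  show "\<psi> \<in> borel_measurable borel" if "\<psi> \<in> {\<lambda>x. ennreal (exp (- c * x)) |c. 0 \<le> c}" for \<psi> using that by auto
  show "\<psi> x \<le> 1" if "\<psi> \<in> {\<lambda>x. ennreal (exp (- c * x)) |c. 0 \<le> c}" "x \<in> {0..}" for \<psi> and x :: real using that by auto
  fix n and \<phi> :: "nat \<Rightarrow> real \<Rightarrow> ennreal"
  assume "\<And>i. i < n \<Longrightarrow> \<phi> i \<in> {\<lambda>x. ennreal (exp (- c * x)) |c. 0 \<le> c}"
  then have "\<exists>c\<ge>0. i < n \<longrightarrow> \<phi> i = (\<lambda>x. ennreal (exp (- c * x)))" for i by (cases "i < n") auto
  then obtain c where c: "\<And>i. 0 \<le> c i" "\<And>i. i < n \<Longrightarrow> \<phi> i = (\<lambda>x. ennreal (exp (- c i * x)))" by metis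
  let ?\<Phi> = "\<lambda>x. \<Prod>i<n. ennreal (exp (- c i * x i)) :: ennreal"
  have \<Phi>: "?\<Phi> \<in> borel_measurable seqs" supply [measurable] = borel_seq_component by measurable
  have "(NN x|distr ?D borel ?Y. ?\<Phi> x) = (NN x|?D. ?\<Phi> (?Y x))"
    by (rule nn_integral_distr[OF m1]) (use \<Phi> in simp)
  also have "\<dots> = (NN x|?D. nexp (\<Sum>l<n. ennreal (c l * ?Y x l)))"
    using Yn by (intro nn_integral_cong_AE, eventually_elim) (simp add: nexp_sum nexp_ennreal c del: sum_ennreal)
  also have "\<dots> = (NN p|Da. NN w|unifs. nexp (\<Sum>l<n. ennreal (c l * cell_mass (\<lambda>k. tsum p' powr (1 / \<alpha>) * p k) (normed p') u w l)))"
  proof -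
    have "(\<lambda>x. nexp (\<Sum>l<n. ennreal (c l * ?Y x l))) \<in> borel_measurable ?D"
      using measurable_compose[OF m1 borel_seq_component] by measurable
    then show ?thesis by (subst U.nn_integral_fst[symmetric]) auto
  qed
  also have "\<dots> = (\<Prod>l<n. ennreal (exp (- (p' l * c l powr \<alpha>))))"
    by (rule laplace_cell_mass[OF p' u c(1)])
  also have "\<dots> = (\<Prod>l<n. NN p|Da. ennreal (exp (- c l * (p' l powr (1 / \<alpha>) * tsum p))))"
  proof (intro prod.cong refl)
    fix l
    have "(c l * p' l powr (1 / \<alpha>)) powr \<alpha> = p' l * c l powr \<alpha>"
      using c(1)[of l] p'(1)[of l] a.gamma by (simp add: powr_mult powr_powr)
    then show "ennreal (exp (- (p' l * c l powr \<alpha>))) = (NN p|Da. ennreal (exp (- c l * (p' l powr (1 / \<alpha>) * tsum p))))"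
      using a.laplace_tsum[of "c l * p' l powr (1 / \<alpha>)"] c(1)[of l] by (simp add: mult.assoc)
  qed
  also have "\<dots> = (NN \<omega>|?E. ?\<Phi> (?Z \<omega>))"
    by (rule nn_integral_PiM_prod[OF a.prob_space_axioms, symmetric]) measurable
  also have "\<dots> = (NN x|distr ?E borel ?Z. ?\<Phi> x)"
    by (rule nn_integral_distr[OF m2, symmetric]) (use \<Phi> in simp)
  finally show "(NN x|distr ?D borel ?Y. (\<Prod>i<n. \<phi> i (x i))) = (NN x|distr ?E borel ?Z. (\<Prod>i<n. \<phi> i (x i)))"
    using c(2) by simp
qed

end

lemma ranked_cell_mass_measurable:
  assumes "v \<in> N \<rightarrow>\<^sub>M borel" "q \<in> N \<rightarrow>\<^sub>M borel" "u \<in> N \<rightarrow>\<^sub>M borel" "w \<in> N \<rightarrow>\<^sub>M borel"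
  shows "(\<lambda>x. ranked (cell_mass (v x) (q x) (u x) (w x))) \<in> N \<rightarrow>\<^sub>M seqs"
  by (intro measurable_ranked cell_mass_measurable; rule measurable_compose[OF assms(1) borel_seq_component]
    measurable_compose[OF assms(2) borel_seq_component] measurable_compose[OF assms(3) borel_seq_component] measurable_compose[OF assms(4) borel_seq_component])

lemma seq_scale_measurable:
  assumes "a \<in> borel_measurable N" "v \<in> N \<rightarrow>\<^sub>M borel"
  shows "(\<lambda>x k. a x * v x k) \<in> N \<rightarrow>\<^sub>M seqs"
  by (rule measurable_coordinatewise_then_product)
     (rule borel_measurable_times[OF assms(1) measurable_compose[OF assms(2) borel_seq_component]])

section \<open>The functional of the coagulated points\<close>

context stable_pd_pair
begin

text \<open>The locations \<open>u\<close> are fixed first. By \<open>cell_mass_law\<close> the cell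
  masses are then independent scaled stable totals, with a law free of \<open>u\<close>, so the
  functional is a product and the integral over \<open>u\<close> is trivial.\<close>

lemma laplace_coag_cond:
  assumes p': "\<And>i. 0 < p' i" "summable p'" and g[measurable]: "g \<in> borel_measurable borel" and g0: "g 0 = 0"
  shows "(NN p|Da. NN u|unifs. NN w|unifs. nexp (\<Sum>k. g (ranked (cell_mass (\<lambda>k. tsum p' powr (1 / \<alpha>) * p k) (normed p') u w) k))) =
    iprod (\<lambda>l. NN p|Da. nexp (g (p' l powr (1 / \<alpha>) * tsum p)))" (is "_ = ?R")
proof -
  interpret U: prob_space unifs by (rule prob_space_unifs)
  interpret aU: pair_prob_space Da unifs ..
  let ?E = "PiM UNIV (\<lambda>_::nat. Da)"
  let ?Y = "\<lambda>u x. cell_mass (\<lambda>k. tsum p' powr (1 / \<alpha>) * fst x k) (normed p') u (snd x)"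
  have sm: "(\<lambda>p. nexp (\<Sum>k. g (p k))) \<in> borel_measurable seqs" supply [measurable] = borel_seq_component by measurable
  define H where "H p u w = nexp (\<Sum>k. g (ranked (?Y u (p, w)) k))" for p u w
  have Hm: "(\<lambda>x. H (fst (fst x)) (snd (fst x)) (snd x)) \<in> borel_measurable ((Da \<Otimes>\<^sub>M unifs) \<Otimes>\<^sub>M unifs)"
  proof -
    have "(\<lambda>x. ranked (?Y (snd (fst x)) (fst (fst x), snd x))) \<in> (borel \<Otimes>\<^sub>M borel) \<Otimes>\<^sub>M borel \<rightarrow>\<^sub>M borel"
      unfolding fst_conv snd_conv by (intro ranked_cell_mass_measurable seq_scale_measurable) measurable
    from measurable_compose[OF this sm] show ?thesis
      unfolding H_def by (simp cong: pair_cong)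
  qed
  have Hu: "(\<lambda>x. H (fst x) u (snd x)) \<in> borel_measurable (Da \<Otimes>\<^sub>M unifs)" for u
  proof -
    have "(\<lambda>x. ranked (?Y u (fst x, snd x))) \<in> borel \<Otimes>\<^sub>M borel \<rightarrow>\<^sub>M borel"
      unfolding fst_conv snd_conv by (intro ranked_cell_mass_measurable seq_scale_measurable) measurable
    from measurable_compose[OF this sm] show ?thesis
      unfolding H_def by (simp cong: pair_cong)
  qed
  have "(NN p|Da. NN u|unifs. NN w|unifs. H p u w) = (NN u|unifs. NN p|Da. NN w|unifs. H p u w)"
    by (rule aU.Fubini'[symmetric]) (use U.borel_measurable_nn_integral_fst[OF Hm] in \<open>simp add: split_beta\<close>)
  also have "\<dots> = (NN u|unifs. ?R)"
  proof (rule nn_integral_cong_on[OF AE_unifs_inj], goal_cases elim)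
    case (elim u)
    have m1: "?Y u \<in> Da \<Otimes>\<^sub>M unifs \<rightarrow>\<^sub>M seqs" by (rule cell_mass_measurable_pair) simp_all
    have m2: "(\<lambda>\<omega> l. p' l powr (1 / \<alpha>) * tsum (\<omega> l)) \<in> ?E \<rightarrow>\<^sub>M seqs"
    proof (intro measurable_coordinatewise_then_product borel_measurable_times borel_measurable_const)
      fix l :: nat
      have "(\<lambda>\<omega>. \<omega> l) \<in> ?E \<rightarrow>\<^sub>M Da" by (rule measurable_component_singleton) simp
      from measurable_compose[OF this, of tsum borel] show "(\<lambda>\<omega>. tsum (\<omega> l)) \<in> borel_measurable ?E" by simp
    qed
    have "(NN p|Da. NN w|unifs. H p u w) = (NN x|(Da \<Otimes>\<^sub>M unifs). H (fst x) u (snd x))"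
      using Hu[of u] by (subst U.nn_integral_fst[symmetric]) auto
    also have "\<dots> = (NN x|(Da \<Otimes>\<^sub>M unifs). nexp (\<Sum>l. g (?Y u x l)))"
    proof (rule nn_integral_cong_on[OF AE_pair_fst[OF a.prob_space_axioms prob_space_unifs a.AE_tsum]], goal_cases elim)
      case (elim x)
      have "vanishing (?Y u x)"
      proof (rule cell_mass_vanishing)
        show "0 \<le> tsum p' powr (1 / \<alpha>) * fst x k" for k using elim by (metis less_imp_le mult_nonneg_nonneg powr_ge_zero)
      qed (use elim in \<open>auto intro: summable_mult\<close>)
      from nn_integral_count_ranked[OF this g g0] show ?case
        by (simp add: H_def nn_integral_count_space_nat)
    qed
    also have "\<dots> = (NN v|distr (Da \<Otimes>\<^sub>M unifs) borel (?Y u). nexp (\<Sum>l. g (v l)))"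
      by (rule nn_integral_distr[OF m1, symmetric]) (use sm in simp)
    also have "\<dots> = (NN \<omega>|?E. nexp (\<Sum>l. g (p' l powr (1 / \<alpha>) * tsum (\<omega> l))))"
      unfolding cell_mass_law[OF p' elim] by (rule nn_integral_distr[OF m2]) (use sm in simp)
    also have "\<dots> = ?R"
      unfolding iprod_nexp[symmetric]
      by (rule nn_integral_PiM_iprod[OF a.prob_space_axioms, of "\<lambda>l p. nexp (g (p' l powr (1 / \<alpha>) * tsum p))"]) simp_all
    finally show ?case .
  qed
  also have "\<dots> = ?R" by (simp add: U.emeasure_space_1)
  finally show ?thesis unfolding H_def by simp
qed

text \<open>The substitution of \<open>nn_integral_stable_intensity_powr\<close> followed by scaling
  with \<open>tsum p\<close> leaves the \<beta>-stable exponent times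
  \<open>pd_const \<alpha> (- \<beta>) * tsum p powr \<beta>\<close>. The mean of this factor is 1,
  by \<open>nn_integral_tsum_powr\<close> at -\<beta>.\<close>

lemma coag_exponent:
  assumes g[measurable]: "g \<in> borel_measurable borel"
  shows "(NN y|stable_intensity (\<beta> / \<alpha>). 1 - (NN p|Da. nexp (g (y powr (1 / \<alpha>) * tsum p)))) = (NN x|stable_intensity \<beta>. 1 - nexp (g x))"
    (is "_ = ?A")
proof -
  let ?\<nu> = "stable_intensity (\<beta> / \<alpha>)"
  let ?C = "Gamma (- \<beta> + 1) / Gamma (- \<beta> / \<alpha> + 1)"
  interpret S: sigma_finite_measure ?\<nu> by (rule sigma_finite_stable_intensity)
  interpret pair_sigma_finite ?\<nu> Da ..
  have sets_nu: "sets ?\<nu> = sets borel" by (simp add: stable_intensity_def)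
  have m: "(\<lambda>x. 1 - nexp (g (fst x powr (1 / \<alpha>) * tsum (snd x)))) \<in> borel_measurable (?\<nu> \<Otimes>\<^sub>M Da)"
  proof -
    have "(\<lambda>x. 1 - nexp (g (fst x powr (1 / \<alpha>) * tsum (snd x)))) \<in> borel_measurable (borel \<Otimes>\<^sub>M borel)" by measurable
    then show ?thesis using sets_nu by (simp cong: pair_cong)
  qed
  have "(NN y|?\<nu>. 1 - (NN p|Da. nexp (g (y powr (1 / \<alpha>) * tsum p)))) = (NN y|?\<nu>. NN p|Da. 1 - nexp (g (y powr (1 / \<alpha>) * tsum p)))"
  proof (intro nn_integral_cong)
    fix y
    have "(NN p|Da. nexp (g (y powr (1 / \<alpha>) * tsum p))) \<le> (NN p|Da. 1)" by (intro nn_integral_mono) simp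
    also have "\<dots> = 1" using a.emeasure_space_1 by simp
    finally have "(NN p|Da. nexp (g (y powr (1 / \<alpha>) * tsum p))) \<noteq> \<infinity>" by (auto simp: top_unique)
    then show "1 - (NN p|Da. nexp (g (y powr (1 / \<alpha>) * tsum p))) = (NN p|Da. 1 - nexp (g (y powr (1 / \<alpha>) * tsum p)))"
      using a.emeasure_space_1 by (subst nn_integral_diff) auto
  qed
  also have "\<dots> = (NN p|Da. NN y|?\<nu>. 1 - nexp (g (y powr (1 / \<alpha>) * tsum p)))"
    by (rule Fubini'[symmetric]) (use m in \<open>simp add: split_beta\<close>)
  also have "\<dots> = (NN p|Da. ennreal (?C * tsum p powr (- (- \<beta>))) * ?A)"
  proof (rule nn_integral_cong_on[OF a.AE_tsum], goal_cases elim)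
    case (elim p)
    have C: "0 \<le> ?C" using beta a.gamma by (intro divide_nonneg_nonneg less_imp_le[OF Gamma_real_pos]) auto
    have "(NN y|?\<nu>. 1 - nexp (g (y powr (1 / \<alpha>) * tsum p))) = ennreal ?C * (NN x|stable_intensity \<beta>. 1 - nexp (g (x * tsum p)))"
      using beta a.gamma by (intro nn_integral_stable_intensity_powr[of _ _ "\<lambda>x. 1 - nexp (g (x * tsum p))"]) auto
    also have "(NN x|stable_intensity \<beta>. 1 - nexp (g (x * tsum p))) = ennreal (tsum p powr \<beta>) * ?A"
      using nn_integral_stable_intensity_scale[of \<beta> "\<lambda>x. 1 - nexp (g x)" "tsum p"] elim beta a.gamma by (simp add: mult.commute)
    finally show ?case using C by (simp only: ennreal_mult' mult.assoc minus_minus)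
  qed
  also have "\<dots> = (NN p|Da. ennreal (?C * tsum p powr (- (- \<beta>)))) * ?A"
    by (rule nn_integral_multc) measurable
  also have "\<dots> = ?A" using a.nn_integral_tsum_powr[of "- \<beta>"] beta by simp
  finally show ?thesis .
qed

end

lemma nn_integral_fst4:
  assumes "prob_space B" "prob_space C" "prob_space D" and F: "F \<in> borel_measurable (A \<Otimes>\<^sub>M (B \<Otimes>\<^sub>M (C \<Otimes>\<^sub>M D)))"
  shows "(NN x|(A \<Otimes>\<^sub>M (B \<Otimes>\<^sub>M (C \<Otimes>\<^sub>M D))). F x) = (NN a|A. NN b|B. NN c|C. NN d|D. F (a, b, c, d))"
proof -
  interpret B: prob_space B by fact
  interpret C: prob_space C by fact
  interpret D: prob_space D by fact
  interpret CD: pair_prob_space C D ..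
  interpret BCD: pair_prob_space B "C \<Otimes>\<^sub>M D" ..
  have "(NN x|(A \<Otimes>\<^sub>M (B \<Otimes>\<^sub>M (C \<Otimes>\<^sub>M D))). F x) = (NN a|A. NN y|(B \<Otimes>\<^sub>M (C \<Otimes>\<^sub>M D)). F (a, y))"
    by (rule BCD.nn_integral_fst[OF F, symmetric])
  also have "\<dots> = (NN a|A. NN b|B. NN c|C. NN d|D. F (a, b, c, d))"
  proof (rule nn_integral_cong)
    fix a assume a: "a \<in> space A"
    have Fa: "(\<lambda>y. F (a, y)) \<in> borel_measurable (B \<Otimes>\<^sub>M (C \<Otimes>\<^sub>M D))"
      by (rule measurable_compose[OF measurable_Pair1'[OF a] F])
    have "(NN y|(B \<Otimes>\<^sub>M (C \<Otimes>\<^sub>M D)). F (a, y)) = (NN b|B. NN z|(C \<Otimes>\<^sub>M D). F (a, b, z))"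
      by (rule CD.nn_integral_fst[OF Fa, symmetric])
    also have "\<dots> = (NN b|B. NN c|C. NN d|D. F (a, b, c, d))"
      by (intro nn_integral_cong D.nn_integral_fst[symmetric] measurable_compose[OF measurable_Pair1' Fa])
    finally show "(NN y|(B \<Otimes>\<^sub>M (C \<Otimes>\<^sub>M D)). F (a, y)) = (NN b|B. NN c|C. NN d|D. F (a, b, c, d))" .
  qed
  finally show ?thesis .
qed

context stable_pd_triple
begin

abbreviation coag_sample :: "((nat \<Rightarrow> real) \<times> (nat \<Rightarrow> real) \<times> (nat \<Rightarrow> real) \<times> (nat \<Rightarrow> real)) measure" where
  "coag_sample \<equiv> Db \<Otimes>\<^sub>M (Da \<Otimes>\<^sub>M (unifs \<Otimes>\<^sub>M unifs))"

abbreviation coag_seq :: "(nat \<Rightarrow> real) \<times> (nat \<Rightarrow> real) \<times> (nat \<Rightarrow> real) \<times> (nat \<Rightarrow> real) \<Rightarrow> nat \<Rightarrow> real" where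
  "coag_seq x \<equiv> ranked (cell_mass (\<lambda>k. tsum (fst x) powr (1 / \<alpha>) * fst (snd x) k) (normed (fst x)) (fst (snd (snd x))) (snd (snd (snd x))))"

lemma coag_seq_measurable: "coag_seq \<in> coag_sample \<rightarrow>\<^sub>M borel"
proof -
  have "coag_seq \<in> borel \<Otimes>\<^sub>M (borel \<Otimes>\<^sub>M (borel \<Otimes>\<^sub>M borel)) \<rightarrow>\<^sub>M borel"
    by (intro ranked_cell_mass_measurable seq_scale_measurable) measurable
  then show ?thesis by (simp cong: pair_cong)
qed

lemma nn_integral_coag_seq:
  assumes F: "F \<in> borel_measurable seqs"
  shows "(NN v|distr coag_sample borel coag_seq. F v) =
    (NN p'|Db. NN p|Da. NN u|unifs. NN w|unifs. F (ranked (cell_mass (\<lambda>k. tsum p' powr (1 / \<alpha>) * p k) (normed p') u w)))"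
proof -
  have "(NN v|distr coag_sample borel coag_seq. F v) = (NN x|coag_sample. F (coag_seq x))"
    by (rule nn_integral_distr[OF coag_seq_measurable]) (use F in simp)
  also have "\<dots> = (NN p'|Db. NN p|Da. NN u|unifs. NN w|unifs. F (coag_seq (p', p, u, w)))"
    by (rule nn_integral_fst4[OF a.prob_space_axioms prob_space_unifs prob_space_unifs measurable_compose[OF coag_seq_measurable F]])
  finally show ?thesis by simp
qed

text \<open>Conditionally on the \<beta>/\<alpha>-stable points the functional is a product over
  them, by \<open>laplace_coag_cond\<close>. Averaging with \<open>product_functional\<close> gives
  the exponent of \<open>coag_exponent\<close>, which is that of the \<beta>-stable points.\<close>

theorem coag_points: "distr coag_sample borel coag_seq = Dc"
proof (rule ranked_seqs_measure_eqI)
  interpret U: prob_space unifs by (rule prob_space_unifs)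
  interpret UU: pair_prob_space unifs unifs ..
  interpret aUU: pair_prob_space Da "unifs \<Otimes>\<^sub>M unifs" ..
  interpret baUU: pair_prob_space Db "Da \<Otimes>\<^sub>M (unifs \<Otimes>\<^sub>M unifs)" ..
  show "finite_measure (distr coag_sample borel coag_seq)" by (rule baUU.P.finite_measure_distr[OF coag_seq_measurable])
  show "finite_measure Dc" by (rule c.finite_measure_axioms)
  show "sets (distr coag_sample borel coag_seq) = sets borel" "sets Dc = sets borel" by simp_all
  show "AE p in Dc. p \<in> ranked_seqs" by (rule c.AE_ranked_seqs)
  show "AE p in distr coag_sample borel coag_seq. p \<in> ranked_seqs"
  proof (subst AE_distr_iff[OF coag_seq_measurable])
    show "AE x in coag_sample. coag_seq x \<in> ranked_seqs"
      using AE_pair_snd[OF b.prob_space_axioms aUU.prob_space_axioms AE_pair_fst[OF a.prob_space_axioms UU.prob_space_axioms a.AE_tsum]]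
    proof eventually_elim
      case (elim x)
      show ?case
      proof (intro ranked_in_ranked_seqs cell_mass_vanishing)
        show "0 \<le> tsum (fst x) powr (1 / \<alpha>) * fst (snd x) k" for k using elim by (metis less_imp_le mult_nonneg_nonneg powr_ge_zero)
      qed (use elim in \<open>auto intro: summable_mult\<close>)
    qed
  qed simp
  fix g :: "real \<Rightarrow> ennreal" and \<delta>
  assume g[measurable]: "g \<in> borel_measurable borel" and d: "0 < \<delta>" "\<And>x. x \<le> \<delta> \<Longrightarrow> g x = 0"
  then have g0: "g 0 = 0" by simp
  have sm: "(\<lambda>p. nexp (\<Sum>k. g (p k))) \<in> borel_measurable seqs" supply [measurable] = borel_seq_component by measurable
  define \<Psi> where "\<Psi> y = (NN p|Da. nexp (g (y powr (1 / \<alpha>) * tsum p)))" for y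
  have \<Psi>: "\<Psi> \<in> borel_measurable borel" unfolding \<Psi>_def by measurable
  have "\<Psi> y \<le> (NN p|Da. 1)" for y unfolding \<Psi>_def by (intro nn_integral_mono) simp
  then have \<Psi>1: "\<Psi> y \<le> 1" for y using a.emeasure_space_1 by simp
  have "(NN v|distr coag_sample borel coag_seq. nexp (\<Sum>k. g (v k))) = (NN p'|Db. iprod (\<lambda>l. \<Psi> (p' l)))"
    unfolding nn_integral_coag_seq[OF sm] \<Psi>_def
    by (intro nn_integral_cong_AE, use b.AE_tsum in eventually_elim, intro laplace_coag_cond g g0) auto
  also have "\<dots> = nexp (NN y|stable_intensity (\<beta> / \<alpha>). 1 - \<Psi> y)"
    by (rule b.product_functional[OF \<Psi> \<Psi>1])
  also have "\<dots> = (NN v|Dc. nexp (\<Sum>k. g (v k)))"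
    unfolding \<Psi>_def coag_exponent[OF g] c.laplace_functional[OF g] ..
  finally show "(NN v|distr coag_sample borel coag_seq. nexp (\<Sum>k. g (v k))) = (NN v|Dc. nexp (\<Sum>k. g (v k)))" .
qed

text \<open>Collecting masses in cells keeps the total and commutes with scaling. The weight
  \<open>r1\<close>, evaluated at tsum p * tsum p' powr (1 / \<alpha>), is therefore the weight at
  the total mass of the coagulated points, and \<open>coag_points\<close> applies to
  \<open>G\<close>.\<close>

theorem nn_integral_coag_P1:
  assumes F[measurable]: "F \<in> borel_measurable seqs"
  shows "(NN x|joint_PK f K \<alpha> \<beta> (r1 \<beta> z). NN y|(unifs \<Otimes>\<^sub>M unifs). F (ranked (cell_mass (fst x) (snd x) (fst y) (snd y)))) =
    (NN p|P1 f K \<beta> z. F p)"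
proof -
  interpret U: prob_space unifs by (rule prob_space_unifs)
  interpret UU: pair_prob_space unifs unifs ..
  have Fm: "(\<lambda>z. F (ranked (cell_mass (fst (fst z)) (snd (fst z)) (fst (snd z)) (snd (snd z))))) \<in> borel_measurable ((borel \<Otimes>\<^sub>M borel) \<Otimes>\<^sub>M (unifs \<Otimes>\<^sub>M unifs))"
  proof -
    have "(\<lambda>z. ranked (cell_mass (fst (fst z)) (snd (fst z)) (fst (snd z)) (snd (snd z)))) \<in> (borel \<Otimes>\<^sub>M borel) \<Otimes>\<^sub>M (borel \<Otimes>\<^sub>M borel) \<rightarrow>\<^sub>M borel"
      by (intro ranked_cell_mass_measurable) measurable
    from measurable_compose[OF this F] show ?thesis by (simp cong: pair_cong)
  qed
  define H where "H x = (NN y|(unifs \<Otimes>\<^sub>M unifs). F (ranked (cell_mass (fst x) (snd x) (fst y) (snd y))))" for x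
  have Hm: "H \<in> borel_measurable (borel \<Otimes>\<^sub>M borel)"
    unfolding H_def using UU.borel_measurable_nn_integral_fst[OF Fm] by simp
  define G where "G w = ennreal (r1 \<beta> z (tsum w)) * F (normed w)" for w :: "nat \<Rightarrow> real"
  have [measurable]: "G \<in> borel_measurable borel" unfolding G_def by measurable
  have "(NN x|joint_PK f K \<alpha> \<beta> (r1 \<beta> z). H x) =
    (NN p'|Db. NN p|Da. ennreal (r1 \<beta> z (tsum p * tsum p' powr (1 / \<alpha>))) * H (normed p, normed p'))"
    by (rule nn_integral_joint_PK[OF _ Hm]) measurable
  also have "\<dots> = (NN p'|Db. NN p|Da. NN u|unifs. NN w|unifs. G (ranked (cell_mass (\<lambda>k. tsum p' powr (1 / \<alpha>) * p k) (normed p') u w)))"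
  proof (rule nn_integral_cong_on[OF b.AE_tsum], rule nn_integral_cong_on[OF a.AE_tsum], goal_cases elim)
    case (elim p' p)
    let ?t = "tsum p' powr (1 / \<alpha>)" and ?q = "normed p'"
    have t: "0 < ?t" and p: "\<forall>i. 0 < p i" "summable p" "0 < tsum p" using elim by auto
    have v: "0 \<le> ?t * p k" "summable (\<lambda>k. ?t * p k)" for k
      using p by (auto intro: summable_mult) (metis less_imp_le mult_nonneg_nonneg powr_ge_zero)
    have G: "G (ranked (cell_mass (\<lambda>k. ?t * p k) ?q u w)) = ennreal (r1 \<beta> z (tsum p * ?t)) * F (ranked (cell_mass (normed p) ?q u w))" for u w
    proof -
      have ts: "tsum (ranked (cell_mass (\<lambda>k. ?t * p k) ?q u w)) = tsum p * ?t"
        using p by (simp add: tsum_ranked_cell_mass[OF v] tsum_scale mult.commute[of "tsum p"])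
      have e: "normed p = (\<lambda>k. 1 / (tsum p * ?t) * (?t * p k))"
        using t by (simp add: normed_def fun_eq_iff)
      have c: "0 < 1 / (tsum p * ?t)" using p t by simp
      have "ranked (cell_mass (normed p) ?q u w) = (\<lambda>k. 1 / (tsum p * ?t) * ranked (cell_mass (\<lambda>k. ?t * p k) ?q u w) k)"
        unfolding e cell_mass_scale[OF v(2,1)] by (rule ranked_scale[OF cell_mass_vanishing[OF v] c])
      then show ?thesis unfolding G_def ts normed_def[of "ranked _"] by simp
    qed
    have Fw: "(\<lambda>y. F (ranked (cell_mass (normed p) ?q (fst y) (snd y)))) \<in> borel_measurable (unifs \<Otimes>\<^sub>M unifs)"
      using measurable_compose[OF measurable_Pair1' Fm, of "(normed p, ?q)"] by (simp add: space_pair_measure)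
    have "ennreal (r1 \<beta> z (tsum p * ?t)) * H (normed p, ?q) = (NN y|(unifs \<Otimes>\<^sub>M unifs). G (ranked (cell_mass (\<lambda>k. ?t * p k) ?q (fst y) (snd y))))"
      unfolding H_def G using nn_integral_cmult[OF Fw] by simp
    also have "\<dots> = (NN u|unifs. NN w|unifs. G (ranked (cell_mass (\<lambda>k. ?t * p k) ?q u w)))"
    proof -
      have "(\<lambda>y. G (ranked (cell_mass (\<lambda>k. ?t * p k) ?q (fst y) (snd y)))) \<in> borel_measurable (unifs \<Otimes>\<^sub>M unifs)"
        unfolding G using Fw by measurable
      then show ?thesis by (subst U.nn_integral_fst[symmetric]) auto
    qed
    finally show ?case .
  qed
  also have "\<dots> = (NN v|Dc. G v)"
    unfolding coag_points[symmetric] by (rule nn_integral_coag_seq[symmetric]) measurable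
  also have "\<dots> = (NN p|P1 f K \<beta> z. F p)"
    unfolding G_def by (rule c.nn_integral_P1[symmetric]) measurable
  finally show ?thesis unfolding H_def .
qed

end

section \<open>Transfer to the random variables of the coagulation\<close>

lemma distr_indep_elements:
  assumes N: "prob_space N" and ind: "indep_elements N A X B Y" and h: "h \<in> B \<rightarrow>\<^sub>M C"
  shows "distr N (A \<Otimes>\<^sub>M C) (\<lambda>\<omega>. (X \<omega>, h (Y \<omega>))) = distr N A X \<Otimes>\<^sub>M distr N C (\<lambda>\<omega>. h (Y \<omega>))"
proof -
  let ?Z = "\<lambda>\<omega>. h (Y \<omega>)"
  interpret prob_space N by fact
  have X: "X \<in> N \<rightarrow>\<^sub>M A" and Y: "Y \<in> N \<rightarrow>\<^sub>M B"
    and ind: "indep_set {X -` S \<inter> space N | S. S \<in> sets A} {Y -` S \<inter> space N | S. S \<in> sets B}"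
    using ind by (auto simp: indep_elements_def)
  have hY: "?Z \<in> N \<rightarrow>\<^sub>M C" by (rule measurable_compose[OF Y h])
  interpret X: prob_space "distr N A X" by (rule prob_space_distr[OF X])
  interpret Z: prob_space "distr N C ?Z" by (rule prob_space_distr[OF hY])
  show ?thesis
  proof (rule pair_measure_eqI[symmetric])
    show "sigma_finite_measure (distr N A X)" "sigma_finite_measure (distr N C ?Z)" ..
    show "sets (distr N A X \<Otimes>\<^sub>M distr N C ?Z) = sets (distr N (A \<Otimes>\<^sub>M C) (\<lambda>\<omega>. (X \<omega>, h (Y \<omega>))))"
      by (simp cong: sets_pair_measure_cong)
    fix S T assume "S \<in> sets (distr N A X)" "T \<in> sets (distr N C ?Z)"
    then have S: "S \<in> sets A" and T: "T \<in> sets C" by auto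
    have e: "?Z -` T \<inter> space N = Y -` (h -` T \<inter> space B) \<inter> space N"
      using measurable_space[OF Y] by auto
    have "prob ((X -` S \<inter> space N) \<inter> (?Z -` T \<inter> space N)) = prob (X -` S \<inter> space N) * prob (?Z -` T \<inter> space N)"
      unfolding e using S measurable_sets[OF h T] by (intro indep_setD[OF ind]) blast+
    moreover have "(\<lambda>\<omega>. (X \<omega>, h (Y \<omega>))) -` (S \<times> T) \<inter> space N = (X -` S \<inter> space N) \<inter> (?Z -` T \<inter> space N)"
      by auto
    ultimately show "emeasure (distr N A X) S * emeasure (distr N C ?Z) T = emeasure (distr N (A \<Otimes>\<^sub>M C) (\<lambda>\<omega>. (X \<omega>, h (Y \<omega>)))) (S \<times> T)"
      using S T X hY measurable_Pair[OF X hY]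
      by (simp add: emeasure_distr emeasure_eq_measure ennreal_mult'')
  qed
qed

lemma distr_unifs_pair:
  fixes Ut U :: "nat \<Rightarrow> 'w \<Rightarrow> real"
  assumes N: "prob_space N" and ind: "prob_space.indep_vars N (\<lambda>_. borel) (case_sum Ut U) UNIV"
    and d: "\<And>k. distr N borel (Ut k) = unif" "\<And>k. distr N borel (U k) = unif"
  shows "distr N (borel \<Otimes>\<^sub>M borel) (\<lambda>\<omega>. (\<lambda>l. U l \<omega>, \<lambda>k. Ut k \<omega>)) = unifs \<Otimes>\<^sub>M unifs"
proof -
  interpret prob_space N by fact
  interpret U: prob_space unifs by (rule prob_space_unifs)
  interpret UU: pair_prob_space unifs unifs ..
  let ?P = "PiM (UNIV :: (nat + nat) set) (\<lambda>_. borel :: real measure)"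
  let ?S = "PiM (UNIV :: (nat + nat) set) (\<lambda>_. unif)"
  let ?Y = "\<lambda>\<omega> i. case_sum Ut U i \<omega>"
  have rv: "random_variable borel (case_sum Ut U i)" for i using ind by (auto simp: indep_vars_def)
  have Ym: "?Y \<in> N \<rightarrow>\<^sub>M ?P" using rv by (intro measurable_PiM_single') (auto simp: space_PiM)
  have "distr N ?P ?Y = PiM UNIV (\<lambda>i. distr N borel (case_sum Ut U i))"
    using ind rv by (subst (asm) indep_vars_iff_distr_eq_PiM) (auto simp: restrict_UNIV)
  also have "\<dots> = ?S" using d by (intro PiM_cong refl) (auto split: sum.split)
  finally have Y: "distr N ?P ?Y = ?S" .
  have sS: "sets ?S = sets ?P" by (intro sets_PiM_cong) auto
  let ?h = "\<lambda>a :: nat + nat \<Rightarrow> real. (\<lambda>l. a (Inr l), \<lambda>k. a (Inl k))"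
  have hm: "?h \<in> ?P \<rightarrow>\<^sub>M borel \<Otimes>\<^sub>M borel"
    by (intro measurable_Pair measurable_coordinatewise_then_product measurable_component_singleton) auto
  have cm: "(\<lambda>(a, b). case_sum a b) \<in> unifs \<Otimes>\<^sub>M unifs \<rightarrow>\<^sub>M ?P"
  proof (intro measurable_PiM_single')
    fix i :: "nat + nat"
    show "(\<lambda>x. (case x of (a, b) \<Rightarrow> case_sum a b) i) \<in> borel_measurable (unifs \<Otimes>\<^sub>M unifs)"
      using measurable_compose[OF measurable_fst borel_seq_component] measurable_compose[OF measurable_snd borel_seq_component]
      by (cases i) (simp_all add: split_beta cong: pair_cong)
  qed (auto simp: space_PiM)
  have "distr N (borel \<Otimes>\<^sub>M borel) (\<lambda>\<omega>. (\<lambda>l. U l \<omega>, \<lambda>k. Ut k \<omega>)) = distr ?S (borel \<Otimes>\<^sub>M borel) ?h"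
    unfolding Y[symmetric] by (subst distr_distr[OF hm Ym]) (simp add: comp_def)
  also have "\<dots> = distr (distr (unifs \<Otimes>\<^sub>M unifs) ?P (\<lambda>(a, b). case_sum a b)) (borel \<Otimes>\<^sub>M borel) ?h"
  proof -
    have "distr (unifs \<Otimes>\<^sub>M unifs) ?P (\<lambda>(a, b). case_sum a b) = distr (unifs \<Otimes>\<^sub>M unifs) ?S (\<lambda>(a, b). case_sum a b)"
      by (rule distr_cong[OF refl sS[symmetric] refl])
    also have "\<dots> = ?S" by (rule PiM_sum_type[of "\<lambda>_. unif", OF prob_space_unif])
    finally show ?thesis by simp
  qed
  also have "\<dots> = distr (unifs \<Otimes>\<^sub>M unifs) (borel \<Otimes>\<^sub>M borel) (\<lambda>(a, b). (b, a))"
    by (subst distr_distr[OF hm cm]) (simp add: comp_def case_prod_unfold)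
  also have "\<dots> = distr (unifs \<Otimes>\<^sub>M unifs) (unifs \<Otimes>\<^sub>M unifs) (\<lambda>(a, b). (b, a))"
    by (intro distr_cong sets_pair_measure_cong) auto
  also have "\<dots> = unifs \<Otimes>\<^sub>M unifs" by (rule UU.distr_pair_swap[symmetric])
  finally show ?thesis .
qed

text \<open>The configurations to which \<open>coag_eq\<close> applies. Being measurable, this event
  can be moved from the product law to the original probability space.\<close>

definition coag_generic :: "(nat \<Rightarrow> real) \<Rightarrow> (nat \<Rightarrow> real) \<Rightarrow> (nat \<Rightarrow> real) \<Rightarrow> bool" where
  "coag_generic q u w \<longleftrightarrow> inj u \<and> (\<forall>k. \<exists>l. step_cdf q u (u l) - q l < w k \<and> w k < step_cdf q u (u l))"

lemma coag_generic_measurable: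
  "{x \<in> space ((borel \<Otimes>\<^sub>M borel) \<Otimes>\<^sub>M (borel \<Otimes>\<^sub>M borel)). coag_generic (snd (fst x)) (fst (snd x)) (snd (snd x))}
    \<in> sets ((seqs \<Otimes>\<^sub>M borel) \<Otimes>\<^sub>M (borel \<Otimes>\<^sub>M borel))" (is "_ \<in> sets ?N")
proof -
  have [measurable]: "(\<lambda>x. snd (fst x) k) \<in> borel_measurable ?N" "(\<lambda>x. fst (snd x) k) \<in> borel_measurable ?N" "(\<lambda>x. snd (snd x) k) \<in> borel_measurable ?N" for k
    by (rule measurable_compose[OF measurable_compose[OF measurable_fst measurable_snd] borel_seq_component]
      measurable_compose[OF measurable_compose[OF measurable_snd measurable_fst] borel_seq_component]
      measurable_compose[OF measurable_compose[OF measurable_snd measurable_snd] borel_seq_component])+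
  have e: "step_cdf q u (u l) = (\<Sum>k. if u k \<le> u l then q k else 0)" for q u :: "nat \<Rightarrow> real" and l
    unfolding step_cdf_def by (intro arg_cong[where f = suminf] ext) (auto simp: indicator_def)
  have i: "inj u \<longleftrightarrow> (\<forall>i j. u i = u j \<longrightarrow> i = j)" for u :: "nat \<Rightarrow> real" by (auto simp: inj_def)
  show ?thesis unfolding coag_generic_def e i by measurable
qed

context stable_pd_triple
begin

text \<open>By independence the joint law of partitions and locations is a product. Under it almost
  every configuration is generic, so \<open>V\<close> is almost surely the ranking of the cell
  masses and \<open>nn_integral_coag_P1\<close> gives its law.\<close>

theorem distr_coag:
  fixes M :: "'w measure"
  assumes z: "0 < z" and M: "prob_space M"
    and Vt: "Vt \<in> M \<rightarrow>\<^sub>M restrict_space borel mass_partitions"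
    and Q: "Q \<in> M \<rightarrow>\<^sub>M restrict_space borel mass_partitions"
    and law: "distr M (borel \<Otimes>\<^sub>M borel) (\<lambda>\<omega>. (Vt \<omega>, Q \<omega>)) = joint_PK f K \<alpha> \<beta> (r1 \<beta> z)"
    and ind: "prob_space.indep_vars M (\<lambda>_. borel) (case_sum Ut U) UNIV"
    and d: "\<And>k. distr M borel (Ut k) = unif" "\<And>k. distr M borel (U k) = unif"
    and indX: "indep_elements M (borel \<Otimes>\<^sub>M borel) (\<lambda>\<omega>. (Vt \<omega>, Q \<omega>)) (PiM UNIV (\<lambda>_. borel)) (\<lambda>\<omega> i. case_sum Ut U i \<omega>)"
    and V: "V \<in> borel_measurable M" "AE \<omega> in M. V \<omega> = coag (Vt \<omega>) (\<lambda>k. Ut k \<omega>) (Q \<omega>) (\<lambda>l. U l \<omega>)"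
  shows "distr M borel V = P1 f K \<beta> z"
proof (rule measure_eqI_nn_integral)
  interpret M: prob_space M by fact
  interpret U: prob_space unifs by (rule prob_space_unifs)
  interpret UU: pair_prob_space unifs unifs ..
  let ?J = "joint_PK f K \<alpha> \<beta> (r1 \<beta> z)"
  let ?B = "(borel \<Otimes>\<^sub>M borel) \<Otimes>\<^sub>M (borel \<Otimes>\<^sub>M borel) :: (((nat \<Rightarrow> real) \<times> (nat \<Rightarrow> real)) \<times> (nat \<Rightarrow> real) \<times> (nat \<Rightarrow> real)) measure"
  let ?X = "\<lambda>\<omega>. ((Vt \<omega>, Q \<omega>), (\<lambda>l. U l \<omega>, \<lambda>k. Ut k \<omega>))"
  let ?W = "\<lambda>x. ranked (cell_mass (fst (fst x)) (snd (fst x)) (fst (snd x)) (snd (snd x)))"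
  have X: "distr M ?B ?X = ?J \<Otimes>\<^sub>M (unifs \<Otimes>\<^sub>M unifs)"
  proof -
    have hm: "(\<lambda>a :: nat + nat \<Rightarrow> real. (\<lambda>l. a (Inr l), \<lambda>k. a (Inl k))) \<in> PiM UNIV (\<lambda>_. borel) \<rightarrow>\<^sub>M borel \<Otimes>\<^sub>M borel"
      by (intro measurable_Pair measurable_coordinatewise_then_product measurable_component_singleton) auto
    from distr_indep_elements[OF M indX hm] show ?thesis
      unfolding law by (simp add: distr_unifs_pair[OF M ind d])
  qed
  have XY: "(\<lambda>\<omega>. (Vt \<omega>, Q \<omega>)) \<in> M \<rightarrow>\<^sub>M borel \<Otimes>\<^sub>M borel" using indX by (auto simp: indep_elements_def)
  interpret J: prob_space ?J unfolding law[symmetric] by (rule M.prob_space_distr[OF XY])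
  interpret JUU: pair_prob_space ?J "unifs \<Otimes>\<^sub>M unifs" ..
  have rv: "case_sum Ut U i \<in> borel_measurable M" for i using ind by (auto simp: M.indep_vars_def)
  have UM: "Ut k \<in> borel_measurable M" "U k \<in> borel_measurable M" for k
    using rv[of "Inl k"] rv[of "Inr k"] by simp_all
  have Xm: "?X \<in> M \<rightarrow>\<^sub>M ?B"
    using XY UM by (intro measurable_Pair measurable_coordinatewise_then_product) auto
  have mp: "Vt \<omega> \<in> mass_partitions" "Q \<omega> \<in> mass_partitions" if "\<omega> \<in> space M" for \<omega>
    using measurable_space[OF Vt that] measurable_space[OF Q that] by (auto simp: space_restrict_space)
  have sets_eq: "sets (?J \<Otimes>\<^sub>M (unifs \<Otimes>\<^sub>M unifs)) = sets ?B"
    by (intro sets_pair_measure_cong) (auto simp: sets_joint_PK)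
  have gen: "AE \<omega> in M. coag_generic (Q \<omega>) (\<lambda>l. U l \<omega>) (\<lambda>k. Ut k \<omega>)"
  proof -
    \<comment> \<open>Being a mass partition is weakened to conditions with a series in
      \<open>ennreal\<close>, which are evidently measurable and can be carried over to the joint
      law.\<close>
    have "{x \<in> space (borel \<Otimes>\<^sub>M borel). (\<forall>k. 0 \<le> snd x k) \<and> (\<Sum>k. ennreal (snd x k)) = 1} \<in> sets (seqs \<Otimes>\<^sub>M borel)"
      using snd_seq_measurable[of _ borel] by measurable
    moreover have "AE \<omega> in M. (\<forall>k. 0 \<le> Q \<omega> k) \<and> (\<Sum>k. ennreal (Q \<omega> k)) = 1"
      using AE_space
    proof eventually_elim
      case (elim \<omega>)
      from mp(2)[OF elim] have "0 \<le> Q \<omega> k" "Q \<omega> sums 1" for k by (auto simp: mass_partitions_def)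
      from this(1) sums_ennreal_ge[OF this] show ?case by simp
    qed
    ultimately have Jq: "AE x in ?J. (\<forall>k. 0 \<le> snd x k) \<and> (\<Sum>k. ennreal (snd x k)) = 1"
      unfolding law[symmetric] by (subst AE_distr_iff[OF XY]) auto
    have gm: "Measurable.pred ?B (\<lambda>x. coag_generic (snd (fst x)) (fst (snd x)) (snd (snd x)))"
      using coag_generic_measurable by (simp add: pred_def)
    have "AE x in ?J \<Otimes>\<^sub>M (unifs \<Otimes>\<^sub>M unifs). coag_generic (snd (fst x)) (fst (snd x)) (snd (snd x))"
    proof (rule JUU.AE_pair_measure)
      show "{x \<in> space (?J \<Otimes>\<^sub>M (unifs \<Otimes>\<^sub>M unifs)). coag_generic (snd (fst x)) (fst (snd x)) (snd (snd x))} \<in> sets (?J \<Otimes>\<^sub>M (unifs \<Otimes>\<^sub>M unifs))"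
        using coag_generic_measurable sets_eq sets_eq_imp_space_eq[OF sets_eq] by simp
      show "AE x in ?J. AE y in unifs \<Otimes>\<^sub>M unifs. coag_generic (snd (fst (x, y))) (fst (snd (x, y))) (snd (snd (x, y)))"
        using Jq
      proof eventually_elim
        case (elim x)
        have q: "0 \<le> snd x k" "snd x sums 1" for k
          using elim suminf_eq_of_ennreal[of "snd x" 1] by (auto simp: sums_iff)
        have "Measurable.pred (borel \<Otimes>\<^sub>M borel) (\<lambda>y. coag_generic (snd x) (fst y) (snd y))"
          using measurable_compose[OF measurable_Pair1' gm, of x] by (simp add: space_pair_measure)
        then have "{y \<in> space (unifs \<Otimes>\<^sub>M unifs). coag_generic (snd x) (fst y) (snd y)} \<in> sets (unifs \<Otimes>\<^sub>M unifs)"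
          by (simp add: pred_def space_pair_measure space_PiM cong: sets_pair_measure_cong)
        then have "AE y in unifs \<Otimes>\<^sub>M unifs. coag_generic (snd x) (fst y) (snd y)"
        proof (rule UU.AE_pair_measure)
          show "AE u in unifs. AE w in unifs. coag_generic (snd x) (fst (u, w)) (snd (u, w))"
            using AE_unifs_inj by eventually_elim (use AE_unifs_cell[OF q] in \<open>auto simp: coag_generic_def\<close>)
        qed
        then show ?case by simp
      qed
    qed
    then have "AE x in distr M ?B ?X. coag_generic (snd (fst x)) (fst (snd x)) (snd (snd x))" unfolding X .
    then show ?thesis
      by (subst (asm) AE_distr_iff[OF Xm coag_generic_measurable]) simp
  qed
  show "sets (distr M borel V) = sets (P1 f K \<beta> z)" by (simp add: c.sets_P1)
  fix F :: "(nat \<Rightarrow> real) \<Rightarrow> ennreal" assume "F \<in> borel_measurable (P1 f K \<beta> z)"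
  then have F: "F \<in> borel_measurable borel" by (simp cong: measurable_cong_sets add: c.sets_P1)
  have Wm: "(\<lambda>x. F (?W x)) \<in> borel_measurable ?B"
    by (rule measurable_compose[OF _ F]) (intro ranked_cell_mass_measurable; measurable)
  have "(NN v|distr M borel V. F v) = (NN \<omega>|M. F (V \<omega>))"
    by (rule nn_integral_distr[OF V(1)]) (use F in simp)
  also have "\<dots> = (NN \<omega>|M. F (?W (?X \<omega>)))"
  proof (rule nn_integral_cong_AE)
    show "AE \<omega> in M. F (V \<omega>) = F (?W (?X \<omega>))"
      using V(2) gen AE_space
    proof eventually_elim
      case (elim \<omega>)
      have "coag (Vt \<omega>) (\<lambda>k. Ut k \<omega>) (Q \<omega>) (\<lambda>l. U l \<omega>) = ranked (cell_mass (Vt \<omega>) (Q \<omega>) (\<lambda>l. U l \<omega>) (\<lambda>k. Ut k \<omega>))"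
        unfolding cell_mass_def[abs_def] using mp[OF elim(3)] elim(2)
        by (intro coag_eq) (auto simp: mass_partitions_def coag_generic_def sums_iff)
      then show ?case using elim(1) by simp
    qed
  qed
  also have "\<dots> = (NN x|distr M ?B ?X. F (?W x))"
    by (rule nn_integral_distr[OF Xm, symmetric]) (use Wm in simp)
  also have "\<dots> = (NN x|?J. NN y|(unifs \<Otimes>\<^sub>M unifs). F (?W (x, y)))"
    unfolding X using Wm sets_eq by (intro UU.nn_integral_fst[symmetric]) (simp cong: measurable_cong_sets)
  also have "\<dots> = (NN p|P1 f K \<beta> z. F p)" using nn_integral_coag_P1[OF F] by simp
  finally show "(NN v|distr M borel V. F v) = (NN p|P1 f K \<beta> z. F p)" .
qed

end

subsection \<open>Subordinators at independent random times\<close>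

text \<open>A random time is approximated from the right by a discrete one, so that right-continuity of the paths
  reduces its Laplace transform to those of fixed times.\<close>

definition grid :: "nat \<Rightarrow> real \<Rightarrow> nat" where "grid m s = nat \<lfloor>real (Suc m) * s\<rfloor>"

text \<open>The increment of k places the grid time strictly to the right of s, as convergence along
  \<open>at_right s\<close> demands.\<close>

definition grid_time :: "nat \<Rightarrow> nat \<Rightarrow> real" where "grid_time m k = (real k + 1) / real (Suc m)"

lemma grid_time_nonneg: "0 \<le> grid_time m k"
  by (simp add: grid_time_def)

lemma grid_time_bounds:
  assumes "0 \<le> s" shows "s < grid_time m (grid m s)" "grid_time m (grid m s) \<le> s + 1 / real (Suc m)"
proof -
  have k: "real (grid m s) = of_int \<lfloor>real (Suc m) * s\<rfloor>" using assms by (simp add: grid_def)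
  have "real (Suc m) * s < real (grid m s) + 1" "real (grid m s) \<le> real (Suc m) * s" unfolding k by linarith+
  then show "s < grid_time m (grid m s)" "grid_time m (grid m s) \<le> s + 1 / real (Suc m)"
    by (simp_all add: grid_time_def field_simps del: of_nat_Suc)
qed

lemma grid_time_tendsto:
  assumes "0 \<le> s" shows "filterlim (\<lambda>m. grid_time m (grid m s)) (at_right s) sequentially"
proof -
  have "(\<lambda>m. grid_time m (grid m s)) \<longlonglongrightarrow> s"
  proof (rule tendsto_sandwich[OF _ _ tendsto_const])
    show "\<forall>\<^sub>F m in sequentially. s \<le> grid_time m (grid m s)" "\<forall>\<^sub>F m in sequentially. grid_time m (grid m s) \<le> s + 1 / real (Suc m)"
      using grid_time_bounds[OF assms] by (auto intro!: always_eventually less_imp_le)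
    show "(\<lambda>m. s + 1 / real (Suc m)) \<longlonglongrightarrow> s" by real_asymp
  qed
  then show ?thesis
    unfolding filterlim_at using grid_time_bounds(1)[OF assms] by (auto intro!: always_eventually simp: order_less_imp_not_eq2)
qed

lemma grid_measurable [measurable]: "grid m \<in> borel \<rightarrow>\<^sub>M count_space UNIV"
  unfolding grid_def[abs_def] by measurable

text \<open>The time is a function \<open>h\<close> of a random element \<open>X\<close> of
  arbitrary type, so that both a shifted gamma variable and the sum of a pair of variables are
  covered.\<close>

locale subordinator_at_indep_time = prob_space N for N :: "'w measure" +
  fixes \<gamma> :: real and \<tau> :: "real \<Rightarrow> 'w \<Rightarrow> real" and B :: "'b measure" and X :: "'w \<Rightarrow> 'b" and h :: "'b \<Rightarrow> real"
  assumes sub: "gen_gamma_subordinator N \<gamma> \<tau>" and ind: "indep_of_process N \<tau> B X"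
    and h: "h \<in> borel_measurable B" and nonneg: "\<And>\<omega>. \<omega> \<in> space N \<Longrightarrow> 0 \<le> h (X \<omega>)"
begin

abbreviation S :: "'w \<Rightarrow> real" where "S \<omega> \<equiv> h (X \<omega>)"

lemma S_measurable [measurable]: "S \<in> borel_measurable N"
  using ind h by (auto simp: indep_of_process_def indep_elements_def intro: measurable_compose)

lemma path:
  assumes "\<omega> \<in> space N"
  shows "\<tau> 0 \<omega> = 0" "mono_on {0..} (\<lambda>s. \<tau> s \<omega>)" "0 \<le> s \<Longrightarrow> continuous (at_right s) (\<lambda>s. \<tau> s \<omega>)" "0 \<le> s \<Longrightarrow> 0 \<le> \<tau> s \<omega>"
proof -
  show 1: "\<tau> 0 \<omega> = 0" "mono_on {0..} (\<lambda>s. \<tau> s \<omega>)" "0 \<le> s \<Longrightarrow> continuous (at_right s) (\<lambda>s. \<tau> s \<omega>)"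
    using sub assms by (auto simp: gen_gamma_subordinator_def)
  show "0 \<le> s \<Longrightarrow> 0 \<le> \<tau> s \<omega>" using mono_onD[OF 1(2), of 0 s] 1(1) by simp
qed

lemma tau_measurable: "0 \<le> s \<Longrightarrow> \<tau> s \<in> borel_measurable N"
  using sub by (simp add: gen_gamma_subordinator_def)

lemma laplace_tau:
  assumes s: "0 \<le> s" and w: "0 \<le> w"
  shows "(NN \<omega>|N. ennreal (exp (- w * \<tau> s \<omega>))) = ennreal (exp (- s * ((1 + w) powr \<gamma> - 1)))"
proof -
  have [measurable]: "\<tau> s \<in> borel_measurable N" by (rule tau_measurable[OF s])
  have "(\<integral>\<omega>. exp (- w * (\<tau> (0 + s) \<omega> - \<tau> 0 \<omega>)) \<partial>N) = exp (- s * ((1 + w) powr \<gamma> - 1))"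
    by (rule sub[unfolded gen_gamma_subordinator_def, THEN conjunct2, THEN conjunct2, THEN conjunct2, rule_format]) (use s w in auto)
  moreover have "(\<integral>\<omega>. exp (- w * (\<tau> (0 + s) \<omega> - \<tau> 0 \<omega>)) \<partial>N) = (\<integral>\<omega>. exp (- w * \<tau> s \<omega>) \<partial>N)"
    by (intro Bochner_Integration.integral_cong) (simp_all add: path)
  moreover have "integrable N (\<lambda>\<omega>. exp (- w * \<tau> s \<omega>))"
    using s w by (intro integrable_const_bound[where B = 1] AE_I2) (auto simp: path)
  ultimately show ?thesis by (subst nn_integral_eq_integral) auto
qed

lemma tau_grid_tendsto:
  "\<omega> \<in> space N \<Longrightarrow> (\<lambda>m. \<tau> (grid_time m (grid m (S \<omega>))) \<omega>) \<longlonglongrightarrow> \<tau> (S \<omega>) \<omega>"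
  using filterlim_compose[OF _ grid_time_tendsto[OF nonneg], of "\<lambda>s. \<tau> s \<omega>" "nhds (\<tau> (S \<omega>) \<omega>)"] path(3)[OF _ nonneg]
  by (simp add: continuous_within)

lemma tau_grid_measurable: "(\<lambda>\<omega>. \<tau> (grid_time m (grid m (S \<omega>))) \<omega>) \<in> borel_measurable N"
  by (rule measurable_compose_countable[where f = "\<lambda>k \<omega>. \<tau> (grid_time m k) \<omega>"]) (auto intro: tau_measurable grid_time_nonneg)

lemma tau_S_measurable [measurable]: "(\<lambda>\<omega>. \<tau> (S \<omega>) \<omega>) \<in> borel_measurable N"
  by (rule borel_measurable_LIMSEQ_real[OF tau_grid_tendsto tau_grid_measurable])

lemma tau_S_nonneg: "\<omega> \<in> space N \<Longrightarrow> 0 \<le> \<tau> (S \<omega>) \<omega>"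
  by (intro path(4) nonneg)

text \<open>By independence the path and the time have a product law, so the time can be fixed.
  Evaluation of a path at a varying time is jointly measurable here because the grid has only
  countably many values.\<close>

lemma laplace_tau_grid:
  assumes w: "0 \<le> w"
  shows "(NN \<omega>|N. ennreal (exp (- w * \<tau> (grid_time m (grid m (S \<omega>))) \<omega>))) =
    (NN \<omega>|N. ennreal (exp (- grid_time m (grid m (S \<omega>)) * ((1 + w) powr \<gamma> - 1))))"
proof -
  let ?A = "PiM {0..} (\<lambda>_. borel) :: (real \<Rightarrow> real) measure"
  let ?P = "\<lambda>\<omega>. \<lambda>s\<in>{0..}. \<tau> s \<omega>"
  let ?F = "\<lambda>x. ennreal (exp (- w * fst x (grid_time m (grid m (snd x)))))"
  have Pm: "?P \<in> N \<rightarrow>\<^sub>M ?A" by (rule measurable_restrict) (auto intro: tau_measurable)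
  interpret P: prob_space "distr N ?A ?P" by (rule prob_space_distr[OF Pm])
  interpret T: prob_space "distr N borel S" by (rule prob_space_distr) measurable
  interpret PT: pair_prob_space "distr N ?A ?P" "distr N borel S" ..
  have pair: "distr N (?A \<Otimes>\<^sub>M borel) (\<lambda>\<omega>. (?P \<omega>, S \<omega>)) = distr N ?A ?P \<Otimes>\<^sub>M distr N borel S"
    using distr_indep_elements[OF prob_space_axioms _ h] ind unfolding indep_of_process_def by blast
  have "(\<lambda>x. fst x (grid_time m (grid m (snd x)))) \<in> borel_measurable (?A \<Otimes>\<^sub>M borel)"
    by (rule measurable_compose_countable[where f = "\<lambda>k x. fst x (grid_time m k)"])
       (auto intro!: measurable_compose[OF measurable_fst] measurable_component_singleton grid_time_nonneg measurable_compose[OF measurable_snd grid_measurable])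
  then have Fm: "?F \<in> borel_measurable (?A \<Otimes>\<^sub>M borel)" by measurable
  have "(NN \<omega>|N. ennreal (exp (- w * \<tau> (grid_time m (grid m (S \<omega>))) \<omega>))) = (NN \<omega>|N. ?F (?P \<omega>, S \<omega>))"
    by (simp add: grid_time_nonneg)
  also have "\<dots> = (NN x|distr N (?A \<Otimes>\<^sub>M borel) (\<lambda>\<omega>. (?P \<omega>, S \<omega>)). ?F x)"
    by (rule nn_integral_distr[symmetric]) (use Pm Fm in auto)
  also have "\<dots> = (NN s|distr N borel S. NN x|distr N ?A ?P. ?F (x, s))"
    unfolding pair using Fm by (intro PT.nn_integral_snd[symmetric]) (simp add: split_beta' cong: pair_cong)
  also have "\<dots> = (NN s|distr N borel S. ennreal (exp (- grid_time m (grid m s) * ((1 + w) powr \<gamma> - 1))))"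
  proof (intro nn_integral_cong)
    fix s
    have "(\<lambda>x. x (grid_time m k)) \<in> borel_measurable ?A" for k
      by (rule measurable_component_singleton) (simp add: grid_time_nonneg)
    then have "(\<lambda>x. ennreal (exp (- w * x (grid_time m k)))) \<in> borel_measurable ?A" for k by measurable
    from this[of "grid m s"] have "(NN x|distr N ?A ?P. ?F (x, s)) = (NN \<omega>|N. ?F (?P \<omega>, s))"
      by (intro nn_integral_distr[OF Pm]) simp
    also have "\<dots> = ennreal (exp (- grid_time m (grid m s) * ((1 + w) powr \<gamma> - 1)))"
      using laplace_tau[OF grid_time_nonneg w] by (simp add: grid_time_nonneg)
    finally show "(NN x|distr N ?A ?P. ?F (x, s)) = ennreal (exp (- grid_time m (grid m s) * ((1 + w) powr \<gamma> - 1)))" .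
  qed
  also have "\<dots> = (NN \<omega>|N. ennreal (exp (- grid_time m (grid m (S \<omega>)) * ((1 + w) powr \<gamma> - 1))))"
    by (rule nn_integral_distr) auto
  finally show ?thesis .
qed

lemma laplace_tau_S:
  assumes w: "0 \<le> w" and g: "0 < \<gamma>"
  shows "(NN \<omega>|N. ennreal (exp (- w * \<tau> (S \<omega>) \<omega>))) = (NN \<omega>|N. ennreal (exp (- S \<omega> * ((1 + w) powr \<gamma> - 1))))"
proof -
  define \<psi> where "\<psi> = (1 + w) powr \<gamma> - 1"
  have psi: "0 \<le> \<psi>" using ge_one_powr_ge_zero[of "1 + w" \<gamma>] w g by (simp add: \<psi>_def)
  have 1: "(\<lambda>m. NN \<omega>|N. ennreal (exp (- w * \<tau> (grid_time m (grid m (S \<omega>))) \<omega>))) \<longlonglongrightarrow> (NN \<omega>|N. ennreal (exp (- w * \<tau> (S \<omega>) \<omega>)))"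
  proof (rule nn_integral_dominated_convergence[where w = "\<lambda>_. 1"])
    show "AE \<omega> in N. (\<lambda>m. ennreal (exp (- w * \<tau> (grid_time m (grid m (S \<omega>))) \<omega>))) \<longlonglongrightarrow> ennreal (exp (- w * \<tau> (S \<omega>) \<omega>))"
      by (intro AE_I2 tendsto_ennrealI tendsto_exp tendsto_mult tendsto_const tau_grid_tendsto)
    show "AE \<omega> in N. ennreal (exp (- w * \<tau> (grid_time m (grid m (S \<omega>))) \<omega>)) \<le> 1" for m
      using w by (intro AE_I2) (simp add: path(4) grid_time_nonneg)
  qed (use tau_grid_measurable in \<open>auto simp: emeasure_space_1\<close>)
  have 2: "(\<lambda>m. NN \<omega>|N. ennreal (exp (- grid_time m (grid m (S \<omega>)) * \<psi>))) \<longlonglongrightarrow> (NN \<omega>|N. ennreal (exp (- S \<omega> * \<psi>)))"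
  proof (rule nn_integral_dominated_convergence[where w = "\<lambda>_. 1"])
    have "(\<lambda>m. grid_time m (grid m (S \<omega>))) \<longlonglongrightarrow> S \<omega>" if "\<omega> \<in> space N" for \<omega>
      using grid_time_tendsto[OF nonneg[OF that]] by (simp add: filterlim_at)
    then show "AE \<omega> in N. (\<lambda>m. ennreal (exp (- grid_time m (grid m (S \<omega>)) * \<psi>))) \<longlonglongrightarrow> ennreal (exp (- S \<omega> * \<psi>))"
      by (intro AE_I2 tendsto_ennrealI tendsto_exp tendsto_mult tendsto_minus tendsto_const)
    show "AE \<omega> in N. ennreal (exp (- grid_time m (grid m (S \<omega>)) * \<psi>)) \<le> 1" for m
      using psi by (intro AE_I2) (simp add: grid_time_nonneg)
  qed (auto simp: emeasure_space_1)
  show ?thesis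
    using LIMSEQ_unique[OF 1[unfolded laplace_tau_grid[OF w]] 2[unfolded \<psi>_def]] .
qed

end

section \<open>Subordinated gamma times and stable total masses\<close>

lemma laplace_gamma_law:
  assumes a: "0 < a" and u: "0 \<le> u"
  shows "(NN x|gamma_law a. ennreal (exp (- x * u))) = ennreal ((1 + u) powr - a)"
proof -
  have G: "0 < Gamma a" using a by (rule Gamma_real_pos)
  have u1: "0 < 1 + u" using u by simp
  have "(NN x|gamma_law a. ennreal (exp (- x * u))) = (NN x|lborel. ennreal (x powr (a - 1) * exp (- x) / Gamma a) * indicator {0<..} x * ennreal (exp (- x * u)))"
    by (rule nn_integral_gamma_law) measurable
  also have "\<dots> = (NN x|lborel. ennreal (1 / Gamma a) * (ennreal (x powr (a - 1) * exp (- ((1 + u) * x))) * indicator {0<..} x))"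
  proof (intro nn_integral_cong)
    fix x
    have "exp (- ((1 + u) * x)) = exp (- x) * exp (- x * u)" by (simp add: exp_add[symmetric] algebra_simps)
    then show "ennreal (x powr (a - 1) * exp (- x) / Gamma a) * indicator {0<..} x * ennreal (exp (- x * u)) =
      ennreal (1 / Gamma a) * (ennreal (x powr (a - 1) * exp (- ((1 + u) * x))) * indicator {0<..} x)"
      using G by (simp add: indicator_def ennreal_mult'[symmetric])
  qed
  also have "\<dots> = ennreal (1 / Gamma a) * ennreal (Gamma a * (1 + u) powr - a)"
    by (subst nn_integral_cmult, measurable) (simp only: nn_integral_Gamma[OF a u1])
  also have "\<dots> = ennreal ((1 + u) powr - a)" using G by (simp add: ennreal_mult'[symmetric])
  finally show ?thesis .
qed

context stable_points
begin

text \<open>\<open>z\<close> with law \<open>\<mu>\<close> plays the role of the deterministic part of the time, and the hypothesis \<open>laplace\<close> says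
  that the time has the law of \<open>z + \<gamma>\<^bsub>(1-\<gamma>)/\<gamma>\<^esub>\<close>.\<close>

theorem subordinated_law:
  fixes \<mu> :: "real measure"
  assumes sub: "subordinator_at_indep_time N \<gamma> \<tau> B X h"
    and mu: "prob_space \<mu>" "sets \<mu> = sets borel" "AE z in \<mu>. 0 < z"
    and laplace: "\<And>u. 0 \<le> u \<Longrightarrow> (NN \<omega>|N. ennreal (exp (- h (X \<omega>) * u))) =
      (NN z|\<mu>. ennreal (exp (- z * u) * (1 + u) powr - ((1 - \<gamma>) / \<gamma>)))"
    and F: "F \<in> borel_measurable borel"
  shows "(NN \<omega>|N. F (\<tau> (h (X \<omega>)) \<omega>)) =
    (NN z|\<mu>. NN p|D. ennreal (r1 \<gamma> z (tsum p)) * F (z powr (1 / \<gamma>) * tsum p))"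
proof -
  interpret S: subordinator_at_indep_time N \<gamma> \<tau> B X h by fact
  interpret mu: prob_space \<mu> by fact
  let ?L = "distr N borel (\<lambda>\<omega>. \<tau> (h (X \<omega>)) \<omega>)"
  let ?Y = "\<lambda>x :: real \<times> (nat \<Rightarrow> real). fst x powr (1 / \<gamma>) * tsum (snd x)"
  let ?R = "distr (density (\<mu> \<Otimes>\<^sub>M D) (\<lambda>x. ennreal (r1 \<gamma> (fst x) (tsum (snd x))))) borel ?Y"
  have sets: "sets (\<mu> \<Otimes>\<^sub>M D) = sets (borel \<Otimes>\<^sub>M borel)" using mu(2) by (intro sets_pair_measure_cong) auto
  have dm: "(\<lambda>x. ennreal (r1 \<gamma> (fst x) (tsum (snd x)))) \<in> borel_measurable (\<mu> \<Otimes>\<^sub>M D)"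
    unfolding measurable_cong_sets[OF sets refl] r1_def by measurable
  have Ym: "?Y \<in> borel_measurable (\<mu> \<Otimes>\<^sub>M D)" unfolding measurable_cong_sets[OF sets refl] by measurable
  have R: "(NN x|?R. H x) = (NN z|\<mu>. NN p|D. ennreal (r1 \<gamma> z (tsum p)) * H (z powr (1 / \<gamma>) * tsum p))"
    if H: "H \<in> borel_measurable borel" for H
  proof -
    note HY = measurable_compose[OF Ym H]
    have "(NN x|?R. H x) = (NN x|(\<mu> \<Otimes>\<^sub>M D). ennreal (r1 \<gamma> (fst x) (tsum (snd x))) * H (?Y x))"
      using dm Ym H HY by (subst nn_integral_distr) (auto simp: nn_integral_density)
    also have "\<dots> = (NN z|\<mu>. NN p|D. ennreal (r1 \<gamma> z (tsum p)) * H (z powr (1 / \<gamma>) * tsum p))"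
      using borel_measurable_times_ennreal[OF dm HY] by (subst nn_integral_fst[symmetric]) auto
    finally show ?thesis .
  qed
  have Rl: "(NN x|?R. ennreal (exp (- w * x))) = (NN \<omega>|N. ennreal (exp (- w * \<tau> (h (X \<omega>)) \<omega>)))" if w: "0 \<le> w" for w
  proof -
    \<comment> \<open>The Laplace exponent of the subordinator. Since 1 + \<psi> is the \<gamma>-th
      power of 1 + w, the factor (1 + w) powr (\<gamma> - 1) from \<open>nn_integral_r1_exp\<close>
      is the Laplace transform at \<psi> of a gamma variable of index (1 - \<gamma>) /
      \<gamma>.\<close>
    define \<psi> where "\<psi> = (1 + w) powr \<gamma> - 1"
    have psi: "0 \<le> \<psi>" using ge_one_powr_ge_zero[of "1 + w" \<gamma>] w gamma by (simp add: \<psi>_def)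
    have e: "(NN p|D. ennreal (r1 \<gamma> z (tsum p)) * ennreal (exp (- w * (z powr (1 / \<gamma>) * tsum p)))) =
        ennreal (exp (- z * \<psi>) * (1 + \<psi>) powr - ((1 - \<gamma>) / \<gamma>))" if z: "0 < z" for z
    proof -
      let ?c = "w * z powr (1 / \<gamma>)"
      have c: "z powr (1 / \<gamma>) + ?c = z powr (1 / \<gamma>) * (1 + w)" by (simp add: algebra_simps)
      have "(NN p|D. ennreal (r1 \<gamma> z (tsum p)) * ennreal (exp (- w * (z powr (1 / \<gamma>) * tsum p)))) =
          (NN p|D. ennreal (r1 \<gamma> z (tsum p) * exp (- (?c * tsum p))))"
        by (intro nn_integral_cong) (simp add: ennreal_mult'' mult.assoc)
      also have "\<dots> = ennreal (exp z * z powr (1 / \<gamma> - 1) * (z powr (1 / \<gamma>) * (1 + w)) powr (\<gamma> - 1) * exp (- ((z powr (1 / \<gamma>) * (1 + w)) powr \<gamma>)))"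
        unfolding c[symmetric] using w by (intro nn_integral_r1_exp z) simp
      also have "exp z * z powr (1 / \<gamma> - 1) * (z powr (1 / \<gamma>) * (1 + w)) powr (\<gamma> - 1) * exp (- ((z powr (1 / \<gamma>) * (1 + w)) powr \<gamma>)) =
          (exp z * exp (- (z * (1 + w) powr \<gamma>))) * (z powr (1 / \<gamma> - 1) * z powr (1 / \<gamma> * (\<gamma> - 1))) * (1 + w) powr (\<gamma> - 1)"
        using z w gamma by (simp add: powr_mult powr_powr)
      also have "exp z * exp (- (z * (1 + w) powr \<gamma>)) = exp (- z * \<psi>)"
        by (simp add: \<psi>_def exp_add[symmetric] algebra_simps)
      also have "z powr (1 / \<gamma> - 1) * z powr (1 / \<gamma> * (\<gamma> - 1)) = 1"
        using z gamma by (simp add: powr_add[symmetric] field_simps)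
      also have "(1 + w) powr (\<gamma> - 1) = (1 + \<psi>) powr - ((1 - \<gamma>) / \<gamma>)"
        using gamma by (simp add: \<psi>_def powr_powr)
      finally show ?thesis by simp
    qed
    have "(NN x|?R. ennreal (exp (- w * x))) = (NN z|\<mu>. ennreal (exp (- z * \<psi>) * (1 + \<psi>) powr - ((1 - \<gamma>) / \<gamma>)))"
      using mu(3) by (subst R, measurable, intro nn_integral_cong_AE, eventually_elim) (rule e)
    also have "\<dots> = (NN \<omega>|N. ennreal (exp (- w * \<tau> (h (X \<omega>)) \<omega>)))"
      unfolding S.laplace_tau_S[OF w gamma(1)] \<psi>_def[symmetric] by (rule laplace[OF psi, symmetric])
    finally show ?thesis .
  qed
  have "?L = ?R"
  proof (rule laplace_unique)
    show "finite_measure ?L" by (rule S.finite_measure_distr) measurable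
    have "emeasure ?R (space ?R) = 1" using Rl[of 0] S.emeasure_space_1 by simp
    then show "finite_measure ?R" by (intro finite_measureI) simp
    show "sets ?L = sets borel" "sets ?R = sets borel" by simp_all
    show "AE x in ?L. 0 \<le> x" by (subst AE_distr_iff) (auto intro!: AE_I2 S.tau_S_nonneg)
    have "AE x in \<mu> \<Otimes>\<^sub>M D. 0 \<le> ?Y x"
      using AE_pair_snd[OF mu(1) prob_space_axioms AE_tsum] by eventually_elim simp
    then have "AE x in density (\<mu> \<Otimes>\<^sub>M D) (\<lambda>x. ennreal (r1 \<gamma> (fst x) (tsum (snd x)))). 0 \<le> ?Y x"
      by (subst AE_density[OF dm]) (auto elim: eventually_mono)
    then show "AE x in ?R. 0 \<le> x" using Ym by (subst AE_distr_iff) auto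
    fix w :: real assume w: "0 \<le> w"
    have "(NN x|?L. ennreal (exp (- w * x))) = (NN \<omega>|N. ennreal (exp (- w * \<tau> (h (X \<omega>)) \<omega>)))"
      by (rule nn_integral_distr) measurable
    then show "(NN x|?L. ennreal (exp (- w * x))) = (NN x|?R. ennreal (exp (- w * x)))" using Rl[OF w] by simp
  qed
  moreover have "(NN \<omega>|N. F (\<tau> (h (X \<omega>)) \<omega>)) = (NN x|?L. F x)" by (rule nn_integral_distr[symmetric]) (use F in auto)
  ultimately show ?thesis using R[OF F] by simp
qed

end

subsection \<open>The joint law of the fragmented and the coagulating partition\<close>

lemma stable_pd_exists:
  assumes "0 < \<gamma>" "\<gamma> < 1" "stable_density_and_PD_cond \<gamma> (f \<gamma>) (K \<gamma>)"
  shows "\<exists>D. stable_pd D \<gamma> f K"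
  using assms unfolding stable_density_and_PD_cond_def stable_pd_def stable_points_def stable_points_axioms_def stable_pd_axioms_def
  by blast

lemma (in stable_pd) nn_integral_P1_measurable:
  assumes F[measurable]: "F \<in> borel_measurable borel"
  shows "(\<lambda>z. NN p|P1 f K \<gamma> z. F p) \<in> borel_measurable borel"
proof -
  have "(\<lambda>x. ennreal (r1 \<gamma> (fst x) (tsum (snd x))) * F (normed (snd x))) \<in> borel_measurable (borel \<Otimes>\<^sub>M borel)"
    unfolding r1_def by measurable
  then have "(\<lambda>x. ennreal (r1 \<gamma> (fst x) (tsum (snd x))) * F (normed (snd x))) \<in> borel_measurable (borel \<Otimes>\<^sub>M D)"
    by (simp cong: pair_cong)
  from borel_measurable_nn_integral_fst[OF this] show ?thesis
    unfolding nn_integral_P1[OF F] by simp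
qed

context stable_pd_triple
begin

abbreviation joint_law :: "real \<Rightarrow> ((nat \<Rightarrow> real) \<times> (nat \<Rightarrow> real)) measure" where
  "joint_law z \<equiv> joint_PK f K \<alpha> \<beta> (r1 \<beta> z)"

lemma nn_integral_joint_law_snd:
  assumes z: "0 < z" and F[measurable]: "F \<in> borel_measurable borel"
  shows "(NN x|joint_law z. F (snd x)) = (NN q|P1 f K (\<beta> / \<alpha>) z. F q)"
proof -
  have "(NN x|joint_law z. F (snd x)) = (NN p'|Db. ennreal (r1 (\<beta> / \<alpha>) z (tsum p')) *
       (NN v|P1 f K \<alpha> (z powr (\<alpha> / \<beta>) * tsum p'). F (snd (v, normed p'))))"
    by (rule nn_integral_joint_P1[OF z]) measurable
  also have "\<dots> = (NN p'|Db. ennreal (r1 (\<beta> / \<alpha>) z (tsum p')) * F (normed p'))"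
  proof (rule nn_integral_cong_on[OF b.AE_tsum], goal_cases elim)
    case (elim p')
    then interpret P: prob_space "P1 f K \<alpha> (z powr (\<alpha> / \<beta>) * tsum p')" using z by (intro a.prob_space_P1) simp
    show ?case using P.emeasure_space_1 by simp
  qed
  finally show ?thesis by (simp add: b.nn_integral_P1)
qed

text \<open>The inverse local time of the second component is the total mass \<open>tsum p'\<close> of the points it is made of.\<close>

lemma nn_integral_joint_law_local_time:
  assumes z: "0 < z" and F: "(\<lambda>x. F (fst x) (snd x)) \<in> borel_measurable (seqs \<Otimes>\<^sub>M borel)"
  shows "(NN x|joint_law z. F (fst x) (inv_local_time (\<beta> / \<alpha>) (snd x))) =
    (NN p'|Db. ennreal (r1 (\<beta> / \<alpha>) z (tsum p')) * (NN v|P1 f K \<alpha> (z powr (\<alpha> / \<beta>) * tsum p'). F v (tsum p')))"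
proof -
  have "(\<lambda>x. (fst x, inv_local_time (\<beta> / \<alpha>) (snd x))) \<in> seqs \<Otimes>\<^sub>M borel \<rightarrow>\<^sub>M borel \<Otimes>\<^sub>M borel"
    by (intro measurable_Pair measurable_fst measurable_compose[OF measurable_snd inv_local_time_measurable] b.gamma)
  from measurable_compose[OF this F]
  have "(NN x|joint_law z. F (fst x) (inv_local_time (\<beta> / \<alpha>) (snd x))) =
    (NN p'|Db. ennreal (r1 (\<beta> / \<alpha>) z (tsum p')) *
       (NN v|P1 f K \<alpha> (z powr (\<alpha> / \<beta>) * tsum p'). F (fst (v, normed p')) (inv_local_time (\<beta> / \<alpha>) (snd (v, normed p')))))"
    by (intro nn_integral_joint_P1[OF z]) simp
  also have "\<dots> = (NN p'|Db. ennreal (r1 (\<beta> / \<alpha>) z (tsum p')) * (NN v|P1 f K \<alpha> (z powr (\<alpha> / \<beta>) * tsum p'). F v (tsum p')))"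
    using b.AE_inv_local_time by (intro nn_integral_cong_AE) (auto elim!: eventually_mono)
  finally show ?thesis .
qed

lemma nn_integral_joint_law_time:
  assumes z: "0 < z" and H[measurable]: "H \<in> borel_measurable borel"
  shows "(NN x|joint_law z. H (inv_local_time (\<beta> / \<alpha>) (snd x))) = (NN p'|Db. ennreal (r1 (\<beta> / \<alpha>) z (tsum p')) * H (tsum p'))"
proof -
  have "(NN x|joint_law z. H (inv_local_time (\<beta> / \<alpha>) (snd x))) =
    (NN p'|Db. ennreal (r1 (\<beta> / \<alpha>) z (tsum p')) * (NN v|P1 f K \<alpha> (z powr (\<alpha> / \<beta>) * tsum p'). H (tsum p')))"
    by (rule nn_integral_joint_law_local_time[OF z, of "\<lambda>_. H"]) measurable
  also have "\<dots> = (NN p'|Db. ennreal (r1 (\<beta> / \<alpha>) z (tsum p')) * H (tsum p'))"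
  proof (rule nn_integral_cong_on[OF b.AE_tsum], goal_cases elim)
    case (elim p')
    then interpret P: prob_space "P1 f K \<alpha> (z powr (\<alpha> / \<beta>) * tsum p')" using z by (intro a.prob_space_P1) simp
    show ?case using P.emeasure_space_1 by simp
  qed
  finally show ?thesis .
qed

lemma coupled_kernel_measurable:
  "(\<lambda>q. P1 f K \<alpha> (z powr (\<alpha> / \<beta>) * inv_local_time (\<beta> / \<alpha>) q)) \<in> borel \<rightarrow>\<^sub>M subprob_algebra borel"
proof (rule measurable_compose[OF _ a.P1_measurable])
  show "(\<lambda>q. z powr (\<alpha> / \<beta>) * inv_local_time (\<beta> / \<alpha>) q) \<in> borel \<rightarrow>\<^sub>M restrict_space borel {0..}"
    using borel_measurable_times[OF borel_measurable_const inv_local_time_measurable[OF b.gamma(1)]]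
    by (intro measurable_restrict_space2) (simp_all add: inv_local_time_nonneg)
qed

text \<open>Almost surely the inverse local time of \<open>normed p'\<close> is
  \<open>tsum p'\<close>, so the kernel defining \<open>coupled_law\<close> is the conditional law
  found in \<open>nn_integral_joint_P1\<close>.\<close>

lemma coupled_law_eq:
  assumes z: "0 < z" shows "coupled_law f K \<alpha> \<beta> z = joint_law z"
proof -
  let ?k = "\<lambda>q. P1 f K \<alpha> (z powr (\<alpha> / \<beta>) * inv_local_time (\<beta> / \<alpha>) q)"
  let ?d = "\<lambda>q. distr (?k q) (borel \<Otimes>\<^sub>M borel) (\<lambda>v. (v, q))"
  have dm: "?d \<in> borel \<rightarrow>\<^sub>M subprob_algebra (borel \<Otimes>\<^sub>M borel)"
    by (rule measurable_distr2[OF _ coupled_kernel_measurable]) (simp add: split_beta')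
  have dm': "?d \<in> P1 f K (\<beta> / \<alpha>) z \<rightarrow>\<^sub>M subprob_algebra (borel \<Otimes>\<^sub>M borel)"
    using dm by (simp cong: measurable_cong_sets)
  show ?thesis
  proof (rule measure_eqI_nn_integral)
    show "sets (coupled_law f K \<alpha> \<beta> z) = sets (joint_law z)"
      unfolding coupled_law_def by (subst sets_bind[where N = "borel \<Otimes>\<^sub>M borel"]) auto
    fix F :: "(nat \<Rightarrow> real) \<times> (nat \<Rightarrow> real) \<Rightarrow> ennreal" assume "F \<in> borel_measurable (joint_law z)"
    then have F[measurable]: "F \<in> borel_measurable (borel \<Otimes>\<^sub>M borel)" by (simp cong: measurable_cong_sets)
    have "(NN x|coupled_law f K \<alpha> \<beta> z. F x) = (NN q|P1 f K (\<beta> / \<alpha>) z. NN x|?d q. F x)"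
      unfolding coupled_law_def by (rule nn_integral_bind[OF F dm'])
    also have "\<dots> = (NN p'|Db. ennreal (r1 (\<beta> / \<alpha>) z (tsum p')) * (NN x|?d (normed p'). F x))"
      by (rule b.nn_integral_P1) (rule measurable_compose[OF dm nn_integral_measurable_subprob_algebra[OF F]])
    also have "\<dots> = (NN p'|Db. ennreal (r1 (\<beta> / \<alpha>) z (tsum p')) * (NN v|P1 f K \<alpha> (z powr (\<alpha> / \<beta>) * tsum p'). F (v, normed p')))"
    proof (rule nn_integral_cong_AE)
      have "(NN x|?d q. F x) = (NN v|?k q. F (v, q))" for q
        by (rule nn_integral_distr) measurable
      then show "AE p' in Db. ennreal (r1 (\<beta> / \<alpha>) z (tsum p')) * (NN x|?d (normed p'). F x) =
        ennreal (r1 (\<beta> / \<alpha>) z (tsum p')) * (NN v|P1 f K \<alpha> (z powr (\<alpha> / \<beta>) * tsum p'). F (v, normed p'))"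
        using b.AE_inv_local_time by (auto elim!: eventually_mono)
    qed
    also have "\<dots> = (NN x|joint_law z. F x)" by (rule nn_integral_joint_P1[OF z F, symmetric])
    finally show "(NN x|coupled_law f K \<alpha> \<beta> z. F x) = (NN x|joint_law z. F x)" .
  qed
qed

lemma prob_space_joint_law: assumes "0 < z" shows "prob_space (joint_law z)"
proof (rule prob_spaceI)
  have "emeasure (joint_law z) (space (joint_law z)) = (NN x|joint_law z. 1)" by simp
  also have "\<dots> = 1"
    using nn_integral_joint_law_snd[OF assms, of "\<lambda>_. 1"] prob_space.emeasure_space_1[OF b.prob_space_P1[OF assms]] by simp
  finally show "emeasure (joint_law z) (space (joint_law z)) = 1" .
qed

lemma nn_integral_joint_law_measurable:
  assumes F: "F \<in> borel_measurable (borel \<Otimes>\<^sub>M borel)"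
  shows "(\<lambda>z. NN x|joint_law z. F x) \<in> borel_measurable borel"
    and "sets \<mu> = sets borel \<Longrightarrow> sigma_finite_measure \<mu> \<Longrightarrow> (NN z|\<mu>. NN x|joint_law z. F x) =
      (NN p'|Db. NN p|Da. (NN z|\<mu>. ennreal (r1 \<beta> z (tsum p * tsum p' powr (1 / \<alpha>)))) * F (normed p, normed p'))"
proof -
  define H where "H z p' p = ennreal (r1 \<beta> z (tsum p * tsum p' powr (1 / \<alpha>))) * F (normed p, normed p')" for z p' p
  have J: "(NN x|joint_law z. F x) = (NN p'|Db. NN p|Da. H z p' p)" for z
    unfolding H_def by (rule nn_integral_joint_PK[OF _ F]) measurable
  note [measurable] = F
  have H0: "(\<lambda>x. H (fst (fst x)) (snd (fst x)) (snd x)) \<in> borel_measurable ((borel \<Otimes>\<^sub>M borel) \<Otimes>\<^sub>M borel)"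
    unfolding H_def r1_def by measurable
  have Hm: "(\<lambda>x. H (fst (fst x)) (snd (fst x)) (snd x)) \<in> borel_measurable ((\<mu> \<Otimes>\<^sub>M Db) \<Otimes>\<^sub>M Da)" if "sets \<mu> = sets borel" for \<mu>
    using H0 that by (simp cong: pair_cong)
  have Hi: "(\<lambda>x. NN p|Da. H (fst x) (snd x) p) \<in> borel_measurable (\<mu> \<Otimes>\<^sub>M Db)" if "sets \<mu> = sets borel" for \<mu>
    using a.borel_measurable_nn_integral_fst[OF Hm[OF that]] by simp
  show "(\<lambda>z. NN x|joint_law z. F x) \<in> borel_measurable borel"
    unfolding J using b.borel_measurable_nn_integral_fst[OF Hi[OF refl]] by simp
  assume mu: "sets \<mu> = sets borel" "sigma_finite_measure \<mu>"
  interpret mu: sigma_finite_measure \<mu> by fact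
  interpret mb: pair_sigma_finite \<mu> Db ..
  interpret ma: pair_sigma_finite \<mu> Da ..
  have "(NN z|\<mu>. NN x|joint_law z. F x) = (NN p'|Db. NN z|\<mu>. NN p|Da. H z p' p)"
    unfolding J by (rule mb.Fubini'[symmetric]) (use Hi[OF mu(1)] in \<open>simp add: split_beta'\<close>)
  also have "\<dots> = (NN p'|Db. NN p|Da. NN z|\<mu>. H z p' p)"
  proof (intro nn_integral_cong ma.Fubini'[symmetric])
    fix p'
    have "(\<lambda>x. H (fst x) p' (snd x)) \<in> borel_measurable (borel \<Otimes>\<^sub>M borel)" unfolding H_def by measurable
    then show "(\<lambda>(z, p). H z p' p) \<in> borel_measurable (\<mu> \<Otimes>\<^sub>M Da)"
      using mu(1) by (simp add: split_beta' cong: pair_cong)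
  qed
  also have "\<dots> = (NN p'|Db. NN p|Da. (NN z|\<mu>. ennreal (r1 \<beta> z (tsum p * tsum p' powr (1 / \<alpha>)))) * F (normed p, normed p'))"
  proof (intro nn_integral_cong)
    have "(\<lambda>z. ennreal (r1 \<beta> z t)) \<in> borel_measurable borel" for t unfolding r1_def by measurable
    then show "(NN z|\<mu>. H z p' p) = (NN z|\<mu>. ennreal (r1 \<beta> z (tsum p * tsum p' powr (1 / \<alpha>)))) * F (normed p, normed p')" for p' p
      unfolding H_def using mu(1) by (intro nn_integral_multc) (simp cong: measurable_cong_sets)
  qed
  finally show "(NN z|\<mu>. NN x|joint_law z. F x) =
      (NN p'|Db. NN p|Da. (NN z|\<mu>. ennreal (r1 \<beta> z (tsum p * tsum p' powr (1 / \<alpha>)))) * F (normed p, normed p'))" .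
qed

text \<open>Serves both a fixed parameter, with \<mu> a point mass, and a gamma parameter. The
  hypothesis \<open>law\<close> gives the time the form z powr (\<alpha> / \<beta>) * tsum p',
  exactly the parameter of the inner law in \<open>nn_integral_joint_P1\<close>.\<close>

lemma nn_integral_P1_mix_time:
  assumes Z: "Z \<in> borel_measurable N" and mu: "AE z in \<mu>. 0 < z"
    and law: "\<And>H. H \<in> borel_measurable borel \<Longrightarrow> (NN \<omega>|N. H (Z \<omega>)) =
      (NN z|\<mu>. NN p'|Db. ennreal (r1 (\<beta> / \<alpha>) z (tsum p')) * H (z powr (1 / (\<beta> / \<alpha>)) * tsum p'))"
    and F[measurable]: "F \<in> borel_measurable borel"
  shows "(NN v|P1_mix f K \<alpha> (distr N borel Z). F v) = (NN z|\<mu>. NN x|joint_law z. F (fst x))"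
proof -
  define H where "H t = (NN v|P1 f K \<alpha> t. F v) * indicator {0<..} t" for t
  have Hm: "H \<in> borel_measurable borel"
    unfolding H_def by (intro borel_measurable_times_ennreal a.nn_integral_P1_measurable F) measurable
  have "(NN v|P1_mix f K \<alpha> (distr N borel Z). F v) = (NN t|distr N borel Z. H t)"
    unfolding H_def by (rule a.nn_integral_P1_mix) simp_all
  also have "\<dots> = (NN \<omega>|N. H (Z \<omega>))" by (rule nn_integral_distr[OF Z]) (use Hm in simp)
  also have "\<dots> = (NN z|\<mu>. NN p'|Db. ennreal (r1 (\<beta> / \<alpha>) z (tsum p')) * H (z powr (1 / (\<beta> / \<alpha>)) * tsum p'))"
    by (rule law[OF Hm])
  also have "\<dots> = (NN z|\<mu>. NN x|joint_law z. F (fst x))"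
  proof (rule nn_integral_cong_on[OF mu], goal_cases elim)
    case (elim z)
    have "(NN x|joint_law z. F (fst x)) = (NN p'|Db. ennreal (r1 (\<beta> / \<alpha>) z (tsum p')) *
        (NN v|P1 f K \<alpha> (z powr (\<alpha> / \<beta>) * tsum p'). F (fst (v, normed p'))))"
      by (rule nn_integral_joint_P1[OF elim]) measurable
    also have "\<dots> = (NN p'|Db. ennreal (r1 (\<beta> / \<alpha>) z (tsum p')) * H (z powr (1 / (\<beta> / \<alpha>)) * tsum p'))"
      using elim by (intro nn_integral_cong_AE, use b.AE_tsum in eventually_elim) (simp add: H_def)
    finally show ?case ..
  qed
  finally show ?thesis .
qed

text \<open>Both sides of the defining identity are evaluated as integrals over \<open>Db\<close>,
  where the inverse local time is \<open>tsum p'\<close>; its almost sure positivity comes from that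
  of \<open>tsum\<close>.\<close>

lemma has_cond_law_joint:
  fixes M :: "'w measure"
  assumes z: "0 < z" and Vt: "Vt \<in> borel_measurable M" and Q: "Q \<in> borel_measurable M"
    and law: "distr M (borel \<Otimes>\<^sub>M borel) (\<lambda>\<omega>. (Vt \<omega>, Q \<omega>)) = joint_law z"
  shows "has_cond_law M Vt (\<lambda>\<omega>. inv_local_time (\<beta> / \<alpha>) (Q \<omega>)) (\<lambda>y. P1 f K \<alpha> (z powr (\<alpha> / \<beta>) * y))"
  unfolding has_cond_law_def
proof (intro conjI ballI impI)
  let ?T = "\<lambda>\<omega>. inv_local_time (\<beta> / \<alpha>) (Q \<omega>)"
  note ilt = inv_local_time_measurable[OF b.gamma(1)]
  have XY: "(\<lambda>\<omega>. (Vt \<omega>, Q \<omega>)) \<in> M \<rightarrow>\<^sub>M borel \<Otimes>\<^sub>M borel" using Vt Q by measurable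
  show T: "?T \<in> borel_measurable M" by (rule measurable_compose[OF Q ilt])
  have int: "(NN \<omega>|M. F (Vt \<omega>, Q \<omega>)) = (NN x|joint_law z. F x)" if "F \<in> borel_measurable (borel \<Otimes>\<^sub>M borel)" for F
    unfolding law[symmetric] by (rule nn_integral_distr[OF XY, symmetric]) (use that in simp)
  have intT: "(NN \<omega>|M. H (?T \<omega>)) = (NN p'|Db. ennreal (r1 (\<beta> / \<alpha>) z (tsum p')) * H (tsum p'))" if H: "H \<in> borel_measurable borel" for H
    using int[OF measurable_compose[OF measurable_snd measurable_compose[OF ilt H]]] nn_integral_joint_law_time[OF z H] by simp
  show "Vt \<in> borel_measurable M" by fact
  show "AE \<omega> in M. 0 < ?T \<omega>"
  proof -
    have "(NN \<omega>|M. indicator {..0} (?T \<omega>)) = (NN p'|Db. ennreal (r1 (\<beta> / \<alpha>) z (tsum p')) * indicator {..0} (tsum p'))"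
      by (rule intT) measurable
    also have "\<dots> = (NN p'|Db. 0)"
      by (intro nn_integral_cong_AE, use b.AE_tsum in eventually_elim) (simp add: indicator_def)
    finally have "(NN \<omega>|M. indicator {..0} (?T \<omega>)) = 0" by simp
    then have "AE \<omega> in M. indicator {..0} (?T \<omega>) = (0 :: ennreal)"
      using measurable_compose[OF T, of "indicator {..0}" borel] by (subst (asm) nn_integral_0_iff_AE) auto
    then show ?thesis by eventually_elim (simp add: indicator_def not_le split: if_splits)
  qed
  show "(\<lambda>y. P1 f K \<alpha> (z powr (\<alpha> / \<beta>) * y)) \<in> restrict_space borel {0<..} \<rightarrow>\<^sub>M prob_algebra borel"
  proof (rule measurable_compose[OF _ a.P1_measurable_prob])
    show "(\<lambda>y. z powr (\<alpha> / \<beta>) * y) \<in> restrict_space borel {0<..} \<rightarrow>\<^sub>M restrict_space borel {0<..}"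
      using z by (intro measurable_restrict_space2 measurable_restrict_space1) (auto simp: space_restrict_space)
  qed
  fix A :: "(nat \<Rightarrow> real) set" and B :: "real set"
  assume A: "A \<in> sets borel" and B: "B \<in> sets borel" "B \<subseteq> {0<..}"
  let ?F = "\<lambda>v t. indicator A v * indicator B t :: ennreal"
  have Fm: "(\<lambda>x. ?F (fst x) (snd x)) \<in> borel_measurable (borel \<Otimes>\<^sub>M borel)" using A B by measurable
  have Fm': "(\<lambda>x. ?F (fst x) (inv_local_time (\<beta> / \<alpha>) (snd x))) \<in> borel_measurable (borel \<Otimes>\<^sub>M borel)"
    using measurable_compose[OF measurable_Pair[OF measurable_fst measurable_compose[OF measurable_snd ilt]] Fm] by simp
  have Hm: "(\<lambda>t. emeasure (P1 f K \<alpha> (z powr (\<alpha> / \<beta>) * t)) A * indicator B t) \<in> borel_measurable borel"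
    using B measurable_compose[OF borel_measurable_times[OF borel_measurable_const[of "z powr (\<alpha> / \<beta>)"] measurable_ident] a.emeasure_P1_measurable[OF A]]
    by (intro borel_measurable_times_ennreal) simp_all
  have "{\<omega> \<in> space M. Vt \<omega> \<in> A \<and> ?T \<omega> \<in> B} = (Vt -` A \<inter> space M) \<inter> (?T -` B \<inter> space M)" by auto
  then have "{\<omega> \<in> space M. Vt \<omega> \<in> A \<and> ?T \<omega> \<in> B} \<in> sets M"
    using measurable_sets[OF Vt A] measurable_sets[OF T B(1)] by auto
  then have "emeasure M {\<omega> \<in> space M. Vt \<omega> \<in> A \<and> ?T \<omega> \<in> B} = (NN \<omega>|M. indicator {\<omega> \<in> space M. Vt \<omega> \<in> A \<and> ?T \<omega> \<in> B} \<omega>)"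
    by simp
  also have "\<dots> = (NN \<omega>|M. ?F (Vt \<omega>) (?T \<omega>))"
    by (intro nn_integral_cong) (auto simp: indicator_def)
  also have "\<dots> = (NN x|joint_law z. ?F (fst x) (inv_local_time (\<beta> / \<alpha>) (snd x)))"
    using int[OF Fm'] by simp
  also have "\<dots> = (NN p'|Db. ennreal (r1 (\<beta> / \<alpha>) z (tsum p')) * (NN v|P1 f K \<alpha> (z powr (\<alpha> / \<beta>) * tsum p'). ?F v (tsum p')))"
    by (rule nn_integral_joint_law_local_time[OF z Fm])
  also have "\<dots> = (NN p'|Db. ennreal (r1 (\<beta> / \<alpha>) z (tsum p')) * (emeasure (P1 f K \<alpha> (z powr (\<alpha> / \<beta>) * tsum p')) A * indicator B (tsum p')))"
    using A by (intro nn_integral_cong arg_cong2[where f = "(*)"] refl) (simp add: nn_integral_multc)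
  also have "\<dots> = (NN \<omega>|M. emeasure (P1 f K \<alpha> (z powr (\<alpha> / \<beta>) * ?T \<omega>)) A * indicator B (?T \<omega>))"
    by (rule intT[OF Hm, symmetric])
  also have "\<dots> = (NN t|distr M borel ?T. emeasure (P1 f K \<alpha> (z powr (\<alpha> / \<beta>) * t)) A * indicator B t)"
    by (rule nn_integral_distr[OF T, symmetric]) (use Hm in simp)
  finally show "emeasure M {\<omega> \<in> space M. Vt \<omega> \<in> A \<and> ?T \<omega> \<in> B} =
    (NN t|distr M borel ?T. emeasure (P1 f K \<alpha> (z powr (\<alpha> / \<beta>) * t)) A * indicator B t)" .
qed

lemma theta_bounds: assumes "- \<beta> < \<theta>" shows "- \<alpha> < \<theta>" "- (\<beta> / \<alpha>) < \<theta> / \<alpha>"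
  using assms beta a.gamma divide_strict_right_mono[of "- \<beta>" \<theta> \<alpha>] by auto

text \<open>Mixing turns the exponential tilt into the power -\<theta> of s * y powr (1 / \<alpha>),
  which factors into powers of s and y: this is the independence. The constants factor as well,
  since Gamma (\<theta> / \<alpha> + 1) cancels and (\<theta> / \<alpha>) / (\<beta> / \<alpha>) =
  \<theta> / \<beta>.\<close>

lemma gamma_mixture_joint_law:
  assumes th: "- \<beta> < \<theta>" and F: "F \<in> borel_measurable (borel \<Otimes>\<^sub>M borel)"
  shows "(NN z|gamma_law ((\<theta> + \<beta>) / \<beta>). NN x|joint_law z. F x) = (NN x|(PD \<alpha> \<theta> \<Otimes>\<^sub>M PD (\<beta> / \<alpha>) (\<theta> / \<alpha>)). F x)"
proof -
  let ?c = "pd_const \<beta> \<theta>"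
  let ?ca = "pd_const \<alpha> \<theta>"
  let ?cb = "Gamma (\<theta> / \<alpha> + 1) / Gamma (\<theta> / \<alpha> / (\<beta> / \<alpha>) + 1)"
  note tha = theta_bounds(1)[OF th] and thb = theta_bounds(2)[OF th]
  have pos: "0 < (\<theta> + \<beta>) / \<beta>" using th beta by simp
  interpret G: prob_space "gamma_law ((\<theta> + \<beta>) / \<beta>)" by (rule prob_space_gamma_law[OF pos])
  interpret A: prob_space "a.pd_law \<theta>" by (rule a.prob_space_pd_law[OF tha])
  interpret B: prob_space "b.pd_law (\<theta> / \<alpha>)" by (rule b.prob_space_pd_law[OF thb])
  interpret AB: pair_prob_space "a.pd_law \<theta>" "b.pd_law (\<theta> / \<alpha>)" ..
  have Gp: "0 < Gamma (\<theta> / \<alpha> + 1)" "0 < Gamma (\<theta> + 1)" "0 < Gamma (\<theta> / \<beta> + 1)"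
    using th tha beta a.gamma by (auto intro!: Gamma_real_pos simp: field_simps)
  have Fs: "(\<lambda>v. F (v, q)) \<in> borel_measurable borel" for q
    using measurable_compose[OF measurable_Pair2' F, of q] by simp
  have Fp: "(\<lambda>q. NN v|a.pd_law \<theta>. F (v, q)) \<in> borel_measurable borel"
  proof -
    have "(\<lambda>x. F (snd x, fst x)) \<in> borel_measurable (borel \<Otimes>\<^sub>M borel)" using F by measurable
    then have "(\<lambda>x. F (snd x, fst x)) \<in> borel_measurable (borel \<Otimes>\<^sub>M a.pd_law \<theta>)" by (simp cong: pair_cong)
    from A.borel_measurable_nn_integral_fst[OF this] show ?thesis by simp
  qed
  have "(NN z|gamma_law ((\<theta> + \<beta>) / \<beta>). NN x|joint_law z. F x) =
      (NN p'|Db. NN p|Da. (NN z|gamma_law ((\<theta> + \<beta>) / \<beta>). ennreal (r1 \<beta> z (tsum p * tsum p' powr (1 / \<alpha>)))) * F (normed p, normed p'))"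
    by (rule nn_integral_joint_law_measurable(2)[OF F]) (auto simp: G.sigma_finite_measure_axioms)
  also have "\<dots> = (NN p'|Db. ennreal (?cb * tsum p' powr - (\<theta> / \<alpha>)) * (NN p|Da. ennreal (?ca * tsum p powr - \<theta>) * F (normed p, normed p')))"
  proof (rule nn_integral_cong_on[OF b.AE_tsum], goal_cases elim)
    case p': (elim p')
    have "(NN p|Da. (NN z|gamma_law ((\<theta> + \<beta>) / \<beta>). ennreal (r1 \<beta> z (tsum p * tsum p' powr (1 / \<alpha>)))) * F (normed p, normed p')) =
      (NN p|Da. ennreal (?cb * tsum p' powr - (\<theta> / \<alpha>)) * (ennreal (?ca * tsum p powr - \<theta>) * F (normed p, normed p')))"
    proof (rule nn_integral_cong_on[OF a.AE_tsum], goal_cases elim)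
      case p: (elim p)
      have s: "0 < tsum p * tsum p' powr (1 / \<alpha>)" using p p' by simp
      have eq: "?c * (tsum p * tsum p' powr (1 / \<alpha>)) powr - \<theta> = (?cb * tsum p' powr - (\<theta> / \<alpha>)) * (?ca * tsum p powr - \<theta>)"
        using p p' Gp a.gamma beta by (simp add: powr_mult powr_powr)
      have "0 \<le> ?ca * tsum p powr - \<theta>" using Gp by simp
      then have "ennreal (?c * (tsum p * tsum p' powr (1 / \<alpha>)) powr - \<theta>) = ennreal (?cb * tsum p' powr - (\<theta> / \<alpha>)) * ennreal (?ca * tsum p powr - \<theta>)"
        unfolding eq by (rule ennreal_mult'')
      then show ?case
        unfolding gamma_mixture_r1[OF c.gamma(1) th c.gamma(2) s] by (simp only: mult.assoc)
    qed
    also have "\<dots> = ennreal (?cb * tsum p' powr - (\<theta> / \<alpha>)) * (NN p|Da. ennreal (?ca * tsum p powr - \<theta>) * F (normed p, normed p'))"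
      using measurable_compose[OF normed_measurable Fs] by (intro nn_integral_cmult) measurable
    finally show ?case .
  qed
  also have "\<dots> = (NN q|b.pd_law (\<theta> / \<alpha>). NN v|a.pd_law \<theta>. F (v, q))"
    unfolding b.nn_integral_pd_law[OF Fp] unfolding a.nn_integral_pd_law[OF Fs] ..
  also have "\<dots> = (NN x|(a.pd_law \<theta> \<Otimes>\<^sub>M b.pd_law (\<theta> / \<alpha>)). F x)"
    using F by (intro AB.nn_integral_snd) (simp add: split_beta' cong: pair_cong)
  finally show ?thesis using a.PD_eq_pd_law[OF tha] b.PD_eq_pd_law[OF thb] by simp
qed

lemma bind_coupled_law:
  assumes th: "- \<beta> < \<theta>"
  shows "restrict_space (gamma_law ((\<theta> + \<beta>) / \<beta>)) {0<..} \<bind> coupled_law f K \<alpha> \<beta> = PD \<alpha> \<theta> \<Otimes>\<^sub>M PD (\<beta> / \<alpha>) (\<theta> / \<alpha>)"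
    (is "?L = ?P")
proof (rule measure_eqI_nn_integral)
  let ?G = "gamma_law ((\<theta> + \<beta>) / \<beta>)"
  let ?B = "borel \<Otimes>\<^sub>M borel :: ((nat \<Rightarrow> real) \<times> (nat \<Rightarrow> real)) measure"
  note tha = theta_bounds(1)[OF th] and thb = theta_bounds(2)[OF th]
  have sP: "sets ?P = sets ?B"
    by (intro sets_pair_measure_cong) (auto simp: a.PD_eq_pd_law[OF tha] b.PD_eq_pd_law[OF thb])
  have sp: "space (restrict_space ?G {0<..}) = {0<..}"
    using sets_eq_imp_space_eq[OF sets_gamma_law] by (simp add: space_restrict_space)
  have cm: "coupled_law f K \<alpha> \<beta> \<in> restrict_space ?G {0<..} \<rightarrow>\<^sub>M subprob_algebra ?B"
  proof (rule measurable_subprob_algebra)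
    fix z assume "z \<in> space (restrict_space ?G {0<..})"
    then have z: "0 < z" unfolding sp by simp
    show "subprob_space (coupled_law f K \<alpha> \<beta> z)" unfolding coupled_law_eq[OF z]
      by (rule prob_space_imp_subprob_space[OF prob_space_joint_law[OF z]])
    show "sets (coupled_law f K \<alpha> \<beta> z) = sets ?B" unfolding coupled_law_eq[OF z] by simp
  next
    fix A assume A: "A \<in> sets ?B"
    have e: "emeasure (coupled_law f K \<alpha> \<beta> z) A = (NN x|joint_law z. indicator A x)" if "z \<in> space (restrict_space ?G {0<..})" for z
      using that A unfolding sp by (simp add: coupled_law_eq)
    have "(\<lambda>z. NN x|joint_law z. indicator A x) \<in> borel_measurable ?G"
      using nn_integral_joint_law_measurable(1)[OF borel_measurable_indicator[OF A]] by (simp cong: measurable_cong_sets)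
    then show "(\<lambda>z. emeasure (coupled_law f K \<alpha> \<beta> z) A) \<in> borel_measurable (restrict_space ?G {0<..})"
      by (subst measurable_cong[OF e]) (auto intro: measurable_restrict_space1)
  qed
  show "sets (?L) = sets ?P"
    unfolding sP using sp by (subst sets_bind[where N = ?B]) (auto simp: coupled_law_eq)
  fix F :: "(nat \<Rightarrow> real) \<times> (nat \<Rightarrow> real) \<Rightarrow> ennreal" assume "F \<in> borel_measurable ?P"
  then have F: "F \<in> borel_measurable ?B" using sP by (simp cong: measurable_cong_sets)
  have "(NN x|(?L). F x) = (NN z|restrict_space ?G {0<..}. NN x|coupled_law f K \<alpha> \<beta> z. F x)"
    by (rule nn_integral_bind[OF F cm])
  also have "\<dots> = (NN z|restrict_space ?G {0<..}. NN x|joint_law z. F x)"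
    using sp by (intro nn_integral_cong) (simp add: coupled_law_eq)
  also have "\<dots> = (NN z|?G. (NN x|joint_law z. F x) * indicator {0<..} z)"
    using sets_eq_imp_space_eq[OF sets_gamma_law] by (subst nn_integral_restrict_space) auto
  also have "\<dots> = (NN z|?G. NN x|joint_law z. F x)"
    by (intro nn_integral_cong_AE, use AE_gamma_law_pos in eventually_elim) simp
  also have "\<dots> = (NN x|?P. F x)"
    by (rule gamma_mixture_joint_law[OF th F])
  finally show "(NN x|(?L). F x) = (NN x|?P. F x)" .
qed

end

lemma distr_eqI_nn_integral:
  assumes f: "f \<in> M \<rightarrow>\<^sub>M L" and g: "g \<in> N \<rightarrow>\<^sub>M L"
    and eq: "\<And>H. H \<in> borel_measurable L \<Longrightarrow> (NN x|M. H (f x)) = (NN x|N. H (g x))"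
  shows "distr M L f = distr N L g"
  by (rule measure_eqI_nn_integral) (simp_all add: nn_integral_distr[OF f] nn_integral_distr[OF g] eq)

theorem proposition6p1:
  fixes \<alpha> \<beta> \<zeta> :: real
    and f :: "real \<Rightarrow> real \<Rightarrow> real"
    and K :: "real \<Rightarrow> real \<Rightarrow> (nat \<Rightarrow> real) measure"
    and M :: "'a measure" and Vt Q V :: "'a \<Rightarrow> nat \<Rightarrow> real"
    and Ut U :: "nat \<Rightarrow> 'a \<Rightarrow> real" and T1 :: "'a \<Rightarrow> real"
    and N :: "'b measure" and \<tau> :: "real \<Rightarrow> 'b \<Rightarrow> real" and G :: "'b \<Rightarrow> real"
  assumes params: "0 < \<beta>" "\<beta> < \<alpha>" "\<alpha> < 1" "0 < \<zeta>"
    and PD_cond: "\<And>\<gamma>. \<gamma> \<in> {\<alpha>, \<beta>, \<beta> / \<alpha>} \<Longrightarrow> stable_density_and_PD_cond \<gamma> (f \<gamma>) (K \<gamma>)"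
    and M: "prob_space M"
    and Vt: "Vt \<in> M \<rightarrow>\<^sub>M restrict_space borel mass_partitions"
    and Q: "Q \<in> M \<rightarrow>\<^sub>M restrict_space borel mass_partitions"
    and VtQ_law: "distr M (borel \<Otimes>\<^sub>M borel) (\<lambda>\<omega>. (Vt \<omega>, Q \<omega>)) = joint_PK f K \<alpha> \<beta> (r1 \<beta> \<zeta>)"
    and U_indep: "prob_space.indep_vars M (\<lambda>_. borel) (case_sum Ut U) UNIV"
    and Ut_unif: "\<And>k. distr M borel (Ut k) = uniform_measure lborel {0..1}"
    and U_unif: "\<And>l. distr M borel (U l) = uniform_measure lborel {0..1}"
    and U_indep_VtQ: "indep_elements M
           (borel \<Otimes>\<^sub>M borel) (\<lambda>\<omega>. (Vt \<omega>, Q \<omega>))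
           (PiM UNIV (\<lambda>_. borel)) (\<lambda>\<omega> i. case_sum Ut U i \<omega>)"
    and V: "V \<in> borel_measurable M"
    and V_coag: "AE \<omega> in M. V \<omega> = coag (Vt \<omega>) (\<lambda>k. Ut k \<omega>) (Q \<omega>) (\<lambda>l. U l \<omega>)"
    and T1_def: "T1 = (\<lambda>\<omega>. inv_local_time (\<beta> / \<alpha>) (Q \<omega>))"
    and N: "prob_space N"
    and \<tau>: "gen_gamma_subordinator N (\<beta> / \<alpha>) \<tau>"
    and G: "G \<in> N \<rightarrow>\<^sub>M restrict_space borel {0<..}" "distr N borel G = gamma_law ((\<alpha> - \<beta>) / \<beta>)"
    and \<tau>_G_indep: "indep_of_process N \<tau> borel G"
  shows
    "distr M borel V = P1 f K \<beta> \<zeta>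
     \<and>
     (distr M borel Q = P1 f K (\<beta> / \<alpha>) \<zeta> \<and>
      distr M borel T1 = distr N borel (\<lambda>\<omega>. \<tau> (\<zeta> + G \<omega>) \<omega> / \<zeta> powr (1 / (\<beta> / \<alpha>))))
     \<and>
     has_cond_law M Vt T1 (\<lambda>y. P1 f K \<alpha> (\<zeta> powr (\<alpha> / \<beta>) * y))
     \<and>
     distr M borel Vt = P1_mix f K \<alpha> (distr N borel (\<lambda>\<omega>. \<tau> (\<zeta> + G \<omega>) \<omega>))
     \<and>
     (distr M (borel \<Otimes>\<^sub>M borel) (\<lambda>\<omega>. (Vt \<omega>, Q \<omega>)) = coupled_law f K \<alpha> \<beta> \<zeta> \<and>
      distr (coupled_law f K \<alpha> \<beta> \<zeta>) borel (\<lambda>(v, q). \<zeta> powr (\<alpha> / \<beta>) * inv_local_time (\<beta> / \<alpha>) q)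
        = distr N borel (\<lambda>\<omega>. \<tau> (\<zeta> + G \<omega>) \<omega>) \<and>
      distr (coupled_law f K \<alpha> \<beta> \<zeta>) borel fst
        = P1_mix f K \<alpha> (distr N borel (\<lambda>\<omega>. \<tau> (\<zeta> + G \<omega>) \<omega>)) \<and>
      distr (coupled_law f K \<alpha> \<beta> \<zeta>) borel snd = P1 f K (\<beta> / \<alpha>) \<zeta>)
     \<and>
     P1_mix f K \<alpha> (distr N borel (\<lambda>\<omega>. \<tau> (\<zeta> + G \<omega>) \<omega>)) = FRAG \<alpha> (- \<beta>) (P1 f K \<beta> \<zeta>)
     \<and>
     (\<forall>\<theta>>- \<beta>. P1_mix f K \<beta> (gamma_law ((\<theta> + \<beta>) / \<beta>)) = PD \<beta> \<theta>)
     \<and>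
     (\<forall>\<theta>>- \<beta>. \<forall>G' \<in> N \<rightarrow>\<^sub>M restrict_space borel {0<..}.
        distr N borel G' = gamma_law ((\<theta> + \<beta>) / \<beta>) \<and>
        prob_space.indep_var N borel G' borel G \<and>
        indep_of_process N \<tau> (borel \<Otimes>\<^sub>M borel) (\<lambda>\<omega>. (G' \<omega>, G \<omega>)) \<longrightarrow>
        P1_mix f K \<alpha> (distr N borel (\<lambda>\<omega>. \<tau> (G' \<omega> + G \<omega>) \<omega>)) = PD \<alpha> \<theta> \<and>
        P1_mix f K (\<beta> / \<alpha>) (distr N borel G') = PD (\<beta> / \<alpha>) (\<theta> / \<alpha>) \<and>
        restrict_space (distr N borel G') {0<..} \<bind> coupled_law f K \<alpha> \<beta>
          = PD \<alpha> \<theta> \<Otimes>\<^sub>M PD (\<beta> / \<alpha>) (\<theta> / \<alpha>))"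
proof -
  have ab: "0 < \<alpha>" "\<beta> < 1" "0 < \<beta> / \<alpha>" "\<beta> / \<alpha> < 1" using params by auto
  obtain Da Db Dc where D: "stable_pd Da \<alpha> f K" "stable_pd Db (\<beta> / \<alpha>) f K" "stable_pd Dc \<beta> f K"
    using stable_pd_exists[of \<alpha> f K] stable_pd_exists[of "\<beta> / \<alpha>" f K] stable_pd_exists[of \<beta> f K] PD_cond params ab by auto
  interpret t: stable_pd_triple Da Db \<alpha> \<beta> f K Dc
    using D params by (simp add: stable_pd_triple_def stable_pd_pair_def stable_pd_pair_axioms_def)
  interpret M: prob_space M by fact
  interpret N: prob_space N by fact
  note z = \<open>0 < \<zeta>\<close>
  let ?J = "joint_PK f K \<alpha> \<beta> (r1 \<beta> \<zeta>)"
  let ?Z = "\<lambda>\<omega>. \<tau> (\<zeta> + G \<omega>) \<omega>"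
  let ?c = "\<zeta> powr (\<alpha> / \<beta>)" and ?r = "\<lambda>\<xi> p'. ennreal (r1 (\<beta> / \<alpha>) \<xi> (tsum p'))"
  let ?k = "(1 - \<beta> / \<alpha>) / (\<beta> / \<alpha>)" and ?g = "gamma_law ((\<alpha> - \<beta>) / \<beta>)" and ?T = "inv_local_time (\<beta> / \<alpha>)"
  have c: "\<zeta> powr (1 / (\<beta> / \<alpha>)) = ?c" "0 < ?c" using z by simp_all
  \<comment> \<open>The gamma index written as (1 - \<gamma>) / \<gamma> for \<gamma> = \<beta> /
    \<alpha>, the form in which \<open>subordinated_law\<close> expects it.\<close>
  have a: "(\<alpha> - \<beta>) / \<beta> = ?k" "0 < (\<alpha> - \<beta>) / \<beta>" using params ab by (simp_all add: field_simps)
  have Vm: "Vt \<in> borel_measurable M" and Qm: "Q \<in> borel_measurable M"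
    using Vt Q by (simp_all add: measurable_restrict_space2_iff)
  have XY: "(\<lambda>\<omega>. (Vt \<omega>, Q \<omega>)) \<in> M \<rightarrow>\<^sub>M borel \<Otimes>\<^sub>M borel" using Vm Qm by measurable
  note ilt = inv_local_time_measurable[OF t.b.gamma(1)]
  have Tm: "T1 \<in> borel_measurable M" unfolding T1_def by (rule measurable_compose[OF Qm ilt])
  have Jm: "(\<lambda>x. ?c * ?T (snd x)) \<in> borel_measurable (borel \<Otimes>\<^sub>M borel)"
    by (intro borel_measurable_times borel_measurable_const measurable_compose[OF measurable_snd ilt])
  have int: "(NN \<omega>|M. F (Vt \<omega>, Q \<omega>)) = (NN x|?J. F x)" if "F \<in> borel_measurable (borel \<Otimes>\<^sub>M borel)" for F
    unfolding VtQ_law[symmetric] by (rule nn_integral_distr[OF XY, symmetric]) (use that in simp)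
  have Gp: "G \<in> borel_measurable N" "0 < G \<omega>" if "\<omega> \<in> space N" for \<omega>
    using G(1) measurable_space[OF G(1) that] by (auto simp: measurable_restrict_space2_iff space_restrict_space)
  have Gm[measurable]: "G \<in> borel_measurable N" using G(1) by (simp add: measurable_restrict_space2_iff)
  have GL: "(NN \<omega>|N. ennreal (exp (- G \<omega> * u))) = ennreal ((1 + u) powr - ((\<alpha> - \<beta>) / \<beta>))" if "0 \<le> u" for u
  proof -
    have "(NN \<omega>|N. ennreal (exp (- G \<omega> * u))) = (NN x|distr N borel G. ennreal (exp (- x * u)))"
      by (rule nn_integral_distr[OF Gm, symmetric]) simp
    then show ?thesis unfolding G(2) laplace_gamma_law[OF a(2) that] .
  qed

  interpret S: subordinator_at_indep_time N "\<beta> / \<alpha>" \<tau> borel G "\<lambda>g. \<zeta> + g"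
  proof (unfold_locales; (intro \<tau> \<tau>_G_indep)?)
    show "0 \<le> \<zeta> + G \<omega>" if "\<omega> \<in> space N" for \<omega> using Gp(2)[OF that] z by linarith
  qed measurable
  \<comment> \<open>A fixed parameter is treated as a mixture over a point mass, so that
    \<open>subordinated_law\<close> covers it together with the gamma parameter below.\<close>
  have Z: "(NN \<omega>|N. H (?Z \<omega>)) = (NN \<xi>|return borel \<zeta>. NN p'|Db. ?r \<xi> p' * H (\<xi> powr (1 / (\<beta> / \<alpha>)) * tsum p'))"
    if "H \<in> borel_measurable borel" for H
  proof (rule t.b.subordinated_law[OF S.subordinator_at_indep_time_axioms _ _ _ _ that])
    show "prob_space (return borel \<zeta>)" by (rule prob_space_return) simp
    show "AE \<xi> in return borel \<zeta>. 0 < \<xi>" using z by (subst AE_return) auto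
    fix u :: real assume u: "0 \<le> u"
    have "(NN \<omega>|N. ennreal (exp (- (\<zeta> + G \<omega>) * u))) = (NN \<omega>|N. ennreal (exp (- \<zeta> * u)) * ennreal (exp (- G \<omega> * u)))"
      by (intro nn_integral_cong) (simp add: ennreal_mult'[symmetric] exp_add[symmetric] algebra_simps)
    also have "\<dots> = ennreal (exp (- \<zeta> * u)) * (NN \<omega>|N. ennreal (exp (- G \<omega> * u)))"
      by (rule nn_integral_cmult) measurable
    also have "\<dots> = ennreal (exp (- \<zeta> * u) * (1 + u) powr - ?k)"
      unfolding GL[OF u] a(1) by (simp add: ennreal_mult')
    finally show "(NN \<omega>|N. ennreal (exp (- (\<zeta> + G \<omega>) * u))) =
      (NN \<xi>|return borel \<zeta>. ennreal (exp (- \<xi> * u) * (1 + u) powr - ?k))"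
      by (subst nn_integral_return) auto
  qed simp
  \<comment> \<open>This identifies the law of the subordinator at its random time with that of the
    scaled inverse local time of the second component, as the coupling prescribes.\<close>
  have Zc: "(NN \<omega>|N. H (?Z \<omega>)) = (NN x|?J. H (?c * ?T (snd x)))"
    if H[measurable]: "H \<in> borel_measurable borel" for H
  proof -
    have m: "(\<lambda>\<xi>. NN p'|Db. ?r \<xi> p' * H (\<xi> powr (1 / (\<beta> / \<alpha>)) * tsum p')) \<in> borel_measurable borel"
    proof -
      have "(\<lambda>x. ?r (fst x) (snd x) * H (fst x powr (1 / (\<beta> / \<alpha>)) * tsum (snd x))) \<in> borel_measurable (borel \<Otimes>\<^sub>M borel)"
        unfolding r1_def by measurable
      then have "(\<lambda>x. ?r (fst x) (snd x) * H (fst x powr (1 / (\<beta> / \<alpha>)) * tsum (snd x))) \<in> borel_measurable (borel \<Otimes>\<^sub>M Db)"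
        by (simp cong: pair_cong)
      from t.b.borel_measurable_nn_integral_fst[OF this] show ?thesis by simp
    qed
    have "(NN x|?J. H (?c * ?T (snd x))) = (NN p'|Db. ?r \<zeta> p' * H (?c * tsum p'))"
      by (intro t.nn_integral_joint_law_time[OF z, of "\<lambda>y. H (?c * y)"]) measurable
    then show ?thesis unfolding Z[OF H] using m by (subst nn_integral_return) (simp_all only: c space_borel UNIV_I)
  qed
  have Jm': "(\<lambda>x. ?c * ?T (snd x)) \<in> borel_measurable ?J" "fst \<in> ?J \<rightarrow>\<^sub>M borel" "snd \<in> ?J \<rightarrow>\<^sub>M borel"
    unfolding measurable_cong_sets[OF t.sets_joint_PK refl] by (rule Jm, measurable)
  have law_Z: "distr N borel ?Z = distr ?J borel (\<lambda>x. ?c * ?T (snd x))"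
    by (rule distr_eqI_nn_integral[OF S.tau_S_measurable Jm'(1) Zc])
  have int_mix: "(NN v|P1_mix f K \<alpha> (distr N borel ?Z). F v) = (NN x|?J. F (fst x))" if F: "F \<in> borel_measurable borel" for F
  proof -
    have "(NN v|P1_mix f K \<alpha> (distr N borel ?Z). F v) = (NN \<xi>|return borel \<zeta>. NN x|joint_PK f K \<alpha> \<beta> (r1 \<beta> \<xi>). F (fst x))"
      by (rule t.nn_integral_P1_mix_time[OF S.tau_S_measurable _ Z F]) (use z in \<open>simp_all add: AE_return\<close>)
    then show ?thesis
      using t.nn_integral_joint_law_measurable(1)[OF measurable_compose[OF measurable_fst F]] by (subst (asm) nn_integral_return) auto
  qed
  have mix_J: "P1_mix f K \<alpha> (distr N borel ?Z) = distr ?J borel fst"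
    by (rule measure_eqI_nn_integral) (simp, subst nn_integral_distr[OF Jm'(2)], auto simp: int_mix)
  have snd_J: "distr ?J borel snd = P1 f K (\<beta> / \<alpha>) \<zeta>"
  proof (rule measure_eqI_nn_integral)
    fix F :: "(nat \<Rightarrow> real) \<Rightarrow> ennreal" assume "F \<in> borel_measurable (P1 f K (\<beta> / \<alpha>) \<zeta>)"
    then have F: "F \<in> borel_measurable borel" by (simp cong: measurable_cong_sets)
    show "(NN q|distr ?J borel snd. F q) = (NN q|P1 f K (\<beta> / \<alpha>) \<zeta>. F q)"
      using F by (subst nn_integral_distr[OF Jm'(3)]) (auto simp: t.nn_integral_joint_law_snd[OF z])
  qed simp
  have fst_M: "distr M borel Vt = distr ?J borel fst" and snd_M: "distr M borel Q = distr ?J borel snd"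
    unfolding VtQ_law[symmetric] using XY by (simp_all add: distr_distr comp_def)

  have V_law: "distr M borel V = P1 f K \<beta> \<zeta>"
    by (rule t.distr_coag[OF z M Vt Q VtQ_law U_indep Ut_unif U_unif U_indep_VtQ V V_coag])
  have T_law: "distr M borel T1 = distr N borel (\<lambda>\<omega>. ?Z \<omega> / \<zeta> powr (1 / (\<beta> / \<alpha>)))"
  proof -
    have "distr N borel (\<lambda>\<omega>. ?Z \<omega> / \<zeta> powr (1 / (\<beta> / \<alpha>))) = distr (distr N borel ?Z) borel (\<lambda>x. x / ?c)"
      using S.tau_S_measurable by (simp add: distr_distr comp_def c)
    also have "\<dots> = distr ?J borel (\<lambda>x. ?T (snd x))"
      unfolding law_Z using c(2) by (subst distr_distr[OF _ Jm'(1)]) (auto simp: comp_def)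
    also have "\<dots> = distr M borel T1"
      unfolding VtQ_law[symmetric] T1_def using XY measurable_compose[OF measurable_snd ilt] by (subst distr_distr) (auto simp: comp_def)
    finally show ?thesis ..
  qed
  have FRAG: "P1_mix f K \<alpha> (distr N borel ?Z) = FRAG \<alpha> (- \<beta>) (P1 f K \<beta> \<zeta>)"
  proof (rule measure_eqI_nn_integral)
    show "sets (P1_mix f K \<alpha> (distr N borel ?Z)) = sets (FRAG \<alpha> (- \<beta>) (P1 f K \<beta> \<zeta>))" by (simp add: FRAG_def)
    fix F :: "(nat \<Rightarrow> real) \<Rightarrow> ennreal" assume "F \<in> borel_measurable (FRAG \<alpha> (- \<beta>) (P1 f K \<beta> \<zeta>))"
    then have F: "F \<in> borel_measurable borel" by (simp add: FRAG_def)
    show "(NN v|P1_mix f K \<alpha> (distr N borel ?Z). F v) = (NN v|FRAG \<alpha> (- \<beta>) (P1 f K \<beta> \<zeta>). F v)"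
      unfolding int_mix[OF F] t.nn_integral_FRAG_P1[OF F] ..
  qed
  have PD_mix: "P1_mix f K \<beta> (gamma_law ((\<theta> + \<beta>) / \<beta>)) = PD \<beta> \<theta>" if "- \<beta> < \<theta>" for \<theta>
    using t.c.P1_mix_gamma_law[OF that] t.c.PD_eq_pd_law[OF that] by simp
  have vii: "P1_mix f K \<alpha> (distr N borel (\<lambda>\<omega>. \<tau> (G' \<omega> + G \<omega>) \<omega>)) = PD \<alpha> \<theta> \<and>
        P1_mix f K (\<beta> / \<alpha>) (distr N borel G') = PD (\<beta> / \<alpha>) (\<theta> / \<alpha>) \<and>
        restrict_space (distr N borel G') {0<..} \<bind> coupled_law f K \<alpha> \<beta> = PD \<alpha> \<theta> \<Otimes>\<^sub>M PD (\<beta> / \<alpha>) (\<theta> / \<alpha>)"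
    if th: "- \<beta> < \<theta>" and G': "G' \<in> N \<rightarrow>\<^sub>M restrict_space borel {0<..}" "distr N borel G' = gamma_law ((\<theta> + \<beta>) / \<beta>)"
      and ind: "N.indep_var borel G' borel G" "indep_of_process N \<tau> (borel \<Otimes>\<^sub>M borel) (\<lambda>\<omega>. (G' \<omega>, G \<omega>))" for \<theta> G'
  proof (intro conjI)
    let ?Y = "\<lambda>\<omega>. \<tau> (G' \<omega> + G \<omega>) \<omega>"
    let ?G = "gamma_law ((\<theta> + \<beta>) / \<beta>)"
    have pos: "0 < (\<theta> + \<beta>) / \<beta>" using th params by simp
    interpret Ga: prob_space ?G by (rule prob_space_gamma_law[OF pos])
    have G'p: "0 < G' \<omega>" if "\<omega> \<in> space N" for \<omega>
      using measurable_space[OF G'(1) that] by (auto simp: space_restrict_space)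
    have G'm: "G' \<in> borel_measurable N" using G'(1) by (simp add: measurable_restrict_space2_iff)
    \<comment> \<open>The independent element is the pair of gamma variables, and the random time is
      their sum.\<close>
    interpret S': subordinator_at_indep_time N "\<beta> / \<alpha>" \<tau> "borel \<Otimes>\<^sub>M borel" "\<lambda>\<omega>. (G' \<omega>, G \<omega>)" "\<lambda>x. fst x + snd x"
    proof (unfold_locales; (intro \<tau> ind(2))?)
      show "0 \<le> fst (G' \<omega>, G \<omega>) + snd (G' \<omega>, G \<omega>)" if "\<omega> \<in> space N" for \<omega> using Gp(2)[OF that] G'p[OF that] by simp
    qed measurable
    have pair: "distr N (borel \<Otimes>\<^sub>M borel) (\<lambda>\<omega>. (G' \<omega>, G \<omega>)) = ?G \<Otimes>\<^sub>M ?g"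
      using ind(1) G'(2) G(2) by (simp add: N.indep_var_distribution_eq)
    have GGm: "(\<lambda>\<omega>. (G' \<omega>, G \<omega>)) \<in> N \<rightarrow>\<^sub>M borel \<Otimes>\<^sub>M borel" using G'm Gm by measurable
    interpret Gb: prob_space "?g" by (rule prob_space_gamma_law[OF a(2)])
    have Z': "(NN \<omega>|N. H (\<tau> (fst (G' \<omega>, G \<omega>) + snd (G' \<omega>, G \<omega>)) \<omega>)) =
      (NN \<xi>|?G. NN p'|Db. ?r \<xi> p' * H (\<xi> powr (1 / (\<beta> / \<alpha>)) * tsum p'))"
      if "H \<in> borel_measurable borel" for H
    proof (rule t.b.subordinated_law[OF S'.subordinator_at_indep_time_axioms Ga.prob_space_axioms _ AE_gamma_law_pos _ that])
      fix u :: real assume u: "0 \<le> u"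
      let ?e = "\<lambda>x. ennreal (exp (- (fst x + snd x) * u))"
      have em: "?e \<in> borel_measurable (borel \<Otimes>\<^sub>M borel)" by measurable
      have "(NN \<omega>|N. ?e (G' \<omega>, G \<omega>)) = (NN x|(?G \<Otimes>\<^sub>M ?g). ?e x)"
        unfolding pair[symmetric] by (rule nn_integral_distr[OF GGm, symmetric]) (use em in simp)
      also have "\<dots> = (NN x|?G. NN y|?g. ?e (x, y))"
        using em by (intro Gb.nn_integral_fst[symmetric]) (simp cong: pair_cong)
      also have "\<dots> = (NN x|?G. ennreal (exp (- x * u) * (1 + u) powr - ?k))"
      proof (intro nn_integral_cong)
        fix x
        have "(NN y|?g. ?e (x, y)) = (NN y|?g. ennreal (exp (- x * u)) * ennreal (exp (- y * u)))"
          by (intro nn_integral_cong) (simp add: ennreal_mult'[symmetric] exp_add[symmetric] algebra_simps)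
        also have "\<dots> = ennreal (exp (- x * u)) * (NN y|?g. ennreal (exp (- y * u)))"
          by (rule nn_integral_cmult) measurable
        also have "\<dots> = ennreal (exp (- x * u) * (1 + u) powr - ?k)"
          unfolding a(1) laplace_gamma_law[OF a(2) u, unfolded a(1)] by (simp add: ennreal_mult')
        finally show "(NN y|?g. ?e (x, y)) = ennreal (exp (- x * u) * (1 + u) powr - ?k)" .
      qed
      finally show "(NN \<omega>|N. ?e (G' \<omega>, G \<omega>)) = (NN x|?G. ennreal (exp (- x * u) * (1 + u) powr - ?k))" .
    qed simp
    show "P1_mix f K \<alpha> (distr N borel ?Y) = PD \<alpha> \<theta>"
    proof (rule measure_eqI_nn_integral)
      note tha = t.theta_bounds(1)[OF th] and thb = t.theta_bounds(2)[OF th]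
      show "sets (P1_mix f K \<alpha> (distr N borel ?Y)) = sets (PD \<alpha> \<theta>)" by (simp add: t.a.PD_eq_pd_law[OF tha])
      interpret A: prob_space "PD \<alpha> \<theta>" unfolding t.a.PD_eq_pd_law[OF tha] by (rule t.a.prob_space_pd_law[OF tha])
      interpret B: prob_space "PD (\<beta> / \<alpha>) (\<theta> / \<alpha>)" unfolding t.b.PD_eq_pd_law[OF thb] by (rule t.b.prob_space_pd_law[OF thb])
      fix F :: "(nat \<Rightarrow> real) \<Rightarrow> ennreal" assume F': "F \<in> borel_measurable (PD \<alpha> \<theta>)"
      then have F: "F \<in> borel_measurable borel" by (simp add: t.a.PD_eq_pd_law[OF tha] cong: measurable_cong_sets)
      have "(NN v|P1_mix f K \<alpha> (distr N borel ?Y). F v) = (NN \<xi>|?G. NN x|joint_PK f K \<alpha> \<beta> (r1 \<beta> \<xi>). F (fst x))"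
        using t.nn_integral_P1_mix_time[OF S'.tau_S_measurable AE_gamma_law_pos Z' F] by simp
      also have "\<dots> = (NN x|(PD \<alpha> \<theta> \<Otimes>\<^sub>M PD (\<beta> / \<alpha>) (\<theta> / \<alpha>)). F (fst x))"
        by (rule t.gamma_mixture_joint_law[OF th measurable_compose[OF measurable_fst F]])
      also have "\<dots> = (NN v|PD \<alpha> \<theta>. NN q|PD (\<beta> / \<alpha>) (\<theta> / \<alpha>). F (fst (v, q)))"
        by (rule B.nn_integral_fst[OF measurable_compose[OF measurable_fst F'], symmetric])
      also have "\<dots> = (NN v|PD \<alpha> \<theta>. F v)" using B.emeasure_space_1 by simp
      finally show "(NN v|P1_mix f K \<alpha> (distr N borel ?Y). F v) = (NN v|PD \<alpha> \<theta>. F v)" .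
    qed
    have e: "(\<theta> / \<alpha> + \<beta> / \<alpha>) / (\<beta> / \<alpha>) = (\<theta> + \<beta>) / \<beta>" using ab params by (simp add: field_simps)
    show "P1_mix f K (\<beta> / \<alpha>) (distr N borel G') = PD (\<beta> / \<alpha>) (\<theta> / \<alpha>)"
      using t.b.P1_mix_gamma_law[OF t.theta_bounds(2)[OF th]] unfolding e G'(2) t.b.PD_eq_pd_law[OF t.theta_bounds(2)[OF th]] .
    show "restrict_space (distr N borel G') {0<..} \<bind> coupled_law f K \<alpha> \<beta> = PD \<alpha> \<theta> \<Otimes>\<^sub>M PD (\<beta> / \<alpha>) (\<theta> / \<alpha>)"
      unfolding G'(2) by (rule t.bind_coupled_law[OF th])
  qed
  have "has_cond_law M Vt T1 (\<lambda>y. P1 f K \<alpha> (?c * y))"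
    unfolding T1_def by (rule t.has_cond_law_joint[OF z Vm Qm VtQ_law])
  moreover have "distr ?J borel (\<lambda>(v, q). ?c * inv_local_time (\<beta> / \<alpha>) q) = distr N borel ?Z"
    unfolding law_Z case_prod_unfold ..
  ultimately show ?thesis
    using V_law T_law snd_M snd_J fst_M mix_J FRAG PD_mix vii VtQ_law t.coupled_law_eq[OF z] by simp
qed

end
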